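(* Let $N\ge 3$ and let $f\in\mathbb{C}[x_1,\dots,x_N]$ be a quasihomogeneous polynomial with reduced weights $q_1,\dots,q_N$ which defines an isolated singularity and satisfies the Calabi--Yau condition $\sum_{k=1}^N q_k=1$. Let $G$ be a finite group with $J\subseteq G\subseteq \mathrm{SL}_f$. For $a,b\in\mathbb{Q}$ let $V^{a,b}\subseteq \mathcal{B}(f,G)$ be the subspace of bidegree $(q_l,q_r)=(a,b)$ in the B-model state space, and put $D:=N-2$. Then $\mathcal{B}(f,G)$ forms a diamond of size $D$, that is: (1) $\mathcal{B}(f,G)=\bigoplus_{p,q\in\mathbb{Z}}V^{p,q}$; (2) $\dim V^{p,q}=0$ if $p<0$ or $q<0$ or $p>D$ or $q>D$; (3) $\dim V^{0,0}=\dim V^{D,D}=1$; (4) $\dim V^{D,0}=\dim V^{0,D}=1$; (5) there is a vector space isomorphism $V^{p,q}\cong V^{q,p}$ for all $p,q$; (6) there is a vector space isomorphism $V^{p,q}\cong (V^{D-q,D-p})^\vee$ for all $p,q$, where $(-)^\vee$ is the dual vector space.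
   Context: Quasihomogeneous: there are positive integers $d_0,d_1,\dots,d_N$ with $f(\lambda^{d_1}x_1,\dots,\lambda^{d_N}x_N)=\lambda^{d_0}f(x_1,\dots,x_N)$ for all $\lambda\in\mathbb{C}^*$; the reduced weights are $q_k=d_k/d_0$. $f$ defines an isolated singularity if $0\in\mathbb{C}^N$ is the only critical point of $f$. Groups: $\mathrm{GL}_f=\{g\in\mathrm{GL}(N,\mathbb{C}) : f(g\cdot\mathbf{x})=f(\mathbf{x})\}$, $\mathrm{SL}_f=\mathrm{GL}_f\cap\mathrm{SL}(N,\mathbb{C})$, $j_f=\mathrm{diag}(e^{2\pi\sqrt{-1}q_1},\dots,e^{2\pi\sqrt{-1}q_N})\in\mathrm{GL}_f$, $J=\langle j_f\rangle$. Fixed loci: for $g\in\mathrm{GL}_f$, $\mathrm{Fix}(g)=\{x\in\mathbb{C}^N: gx=x\}$, $N_g=\dim\mathrm{Fix}(g)$, $d_g=N-N_g$, $f^g=f|_{\mathrm{Fix}(g)}$. Let $W_w\subseteq\mathbb{C}^N$ be the span of the standard basis vectors $e_k$ with $q_k=w$. Every $g\in\mathrm{GL}_f$ preserves each $W_w$, so $\mathrm{Fix}(g)=\bigoplus_w(\mathrm{Fix}(g)\cap W_w)$. Choose $I_g\subseteq\{1,\dots,N\}$ such that for every $w$ the number of $k\in I_g$ with $q_k=w$ equals $\dim(\mathrm{Fix}(g)\cap W_w)$; put $I_g^c=\{1,\dots,N\}\setminus I_g$ (sums of $q_k$ over $I_g^c$ do not depend on the choice). Jacobian algebra: $\mathrm{Jac}(f^g)$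 is the quotient of the ring $\mathbb{C}[\mathrm{Fix}(g)]$ of polynomial functions on $\mathrm{Fix}(g)$ by the ideal generated by all first partial derivatives of $f^g$; $\mathrm{Jac}(f^g)=\mathbb{C}$ if $\mathrm{Fix}(g)=0$. It is graded by letting linear functions on $\mathrm{Fix}(g)\cap W_w$ (extended by zero on the other weight pieces) have degree $w$. State space: for each $g$ fix a generator $\xi_g$ of the one-dimensional space $\Lambda(g)=\bigwedge^{d_g}(\mathbb{C}^N/\mathrm{Fix}(g))$. For finite $G\subseteq\mathrm{GL}_f$ let $\mathcal{B}_{\mathrm{tot},G}=\bigoplus_{g\in G}\mathrm{Jac}(f^g)\xi_g$ (formal direct sum over $g\in G$). Any $h\in G$ maps $\mathrm{Fix}(g)$ to $\mathrm{Fix}(hgh^{-1})$ and induces $h:\Lambda(g)\to\Lambda(hgh^{-1})$, $h(\xi_g)=\rho_{h,g}\xi_{hgh^{-1}}$ with $\rho_{h,g}\in\mathbb{C}^*$. $G$ acts on $\mathcal{B}_{\mathrm{tot},G}$ by $h^*([p(\mathbf{x})]\xi_g)=\rho_{h,g}[p(h^{-1}\cdot\mathbf{x})]\xi_{hgh^{-1}}$. The B-model state space is the space of invariants $\mathcal{B}(f,G)=(\mathcal{B}_{\mathrm{tot},G})^G$. Bigrading: for $g$ with eigenvalues $e^{2\pi\sqrt{-1}\alpha_k}$, $0\le\alpha_k<1$, $k=1,\dots,N$, set $\mathrm{age}(g)=\sum_k\alpha_k$. For homogeneous $p$, the element $[p]\xi_g$ has bidegree $$(q_l,q_r)=\Big(\deg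 p-\sum_{k\in I_g^c}q_k+\mathrm{age}(g),\ \deg p-\sum_{k\in I_g^c}q_k+\mathrm{age}(g^{-1})\Big).$$ This makes $\mathcal{B}_{\mathrm{tot},G}$ a $\mathbb{Q}$-bigraded vector space; the $G$-action preserves the bidegree, so $\mathcal{B}(f,G)$ is bigraded. *)

theory Defs
  imports
    "HOL-Analysis.Analysis"
    "HOL-Algebra.Generated_Groups"
    "HOL-Algebra.QuotRing"
    "HOL-Algebra.Algebraic_Closure_Type"
    "Jordan_Normal_Form.Missing_VectorSpace"
begin

text \<open>
  Complex vector spaces are \<open>module\<close> records over the field record \<open>CC\<close>.  The \<open>mult\<close> and
  \<open>one\<close> components of such a record are only meaningful for \<open>poly_ring\<close> and its quotients;
  elsewhere they are dummies.
\<close>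

section \<open>Linear algebra\<close>

abbreviation CC :: "complex ring" where
  "CC \<equiv> ring_of_type_algebra"

definition CC_mod :: "(complex, complex) module" where
  "CC_mod = \<lparr>carrier = UNIV, monoid.mult = (*), one = 1, ring.zero = 0, add = (+), smult = (*)\<rparr>"

definition Cvec :: "(complex, complex ^ 'n) module" where
  "Cvec = \<lparr>carrier = UNIV, monoid.mult = (\<lambda>x y. 0), one = 0, ring.zero = 0, add = (+), smult = (*s)\<rparr>"

abbreviation span_in :: "(complex, 'b) module \<Rightarrow> 'b set \<Rightarrow> 'b set" where
  "span_in M S \<equiv> LinearCombinations.module.span CC M S"

text \<open>The quotient of a vector space (or algebra) \<open>M\<close> by a subspace (or ideal) \<open>N\<close>, i.e.
  \<open>M Quot N\<close> equipped with scalar multiplication.\<close>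

definition quot_mod :: "(complex, 'b) module \<Rightarrow> 'b set \<Rightarrow> (complex, 'b set) module" where
  "quot_mod M N =
     \<lparr>carrier = a_rcosets\<^bsub>M\<^esub> N, monoid.mult = rcoset_mult M N, one = N +>\<^bsub>M\<^esub> \<one>\<^bsub>M\<^esub>,
      ring.zero = N, add = set_add M, smult = (\<lambda>c A. \<Union>x\<in>A. N +>\<^bsub>M\<^esub> (c \<odot>\<^bsub>M\<^esub> x))\<rparr>"

definition has_dimension :: "(complex, 'b) module \<Rightarrow> nat \<Rightarrow> bool" where
  "has_dimension M n \<longleftrightarrow> VectorSpace.vectorspace.fin_dim CC M \<and> VectorSpace.vectorspace.dim CC M = n"

definition isomorphic :: "(complex, 'b) module \<Rightarrow> (complex, 'c) module \<Rightarrow> bool" where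
  "isomorphic M N \<longleftrightarrow>
     (\<exists>\<phi>. \<phi> \<in> LinearCombinations.module_hom CC M N \<and> bij_betw \<phi> (carrier M) (carrier N))"

definition dual :: "(complex, 'b) module \<Rightarrow> (complex, 'b \<Rightarrow> complex) module" where
  "dual M =
     \<lparr>carrier = LinearCombinations.module_hom CC M CC_mod \<inter> extensional (carrier M),
      monoid.mult = (\<lambda>\<phi> \<psi>. \<lambda>x\<in>carrier M. 0), one = (\<lambda>x\<in>carrier M. 0), ring.zero = (\<lambda>x\<in>carrier M. 0),
      add = (\<lambda>\<phi> \<psi>. \<lambda>x\<in>carrier M. \<phi> x + \<psi> x), smult = (\<lambda>c \<phi>. \<lambda>x\<in>carrier M. c * \<phi> x)\<rparr>"

definition internal_direct_sum :: "(complex, 'b) module \<Rightarrow> ('i \<Rightarrow> 'b set) \<Rightarrow> bool" where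
  "internal_direct_sum M V \<longleftrightarrow>
     (\<forall>i. VectorSpace.subspace CC (V i) M) \<and>
     (\<forall>u\<in>carrier M. \<exists>!v. (\<forall>i. v i \<in> V i) \<and> finite {i. v i \<noteq> \<zero>\<^bsub>M\<^esub>} \<and>
        u = finsum M v {i. v i \<noteq> \<zero>\<^bsub>M\<^esub>})"

subsection \<open>Exterior powers\<close>

definition free_mod :: "'a set \<Rightarrow> (complex, 'a \<Rightarrow> complex) module" where
  "free_mod S =
     \<lparr>carrier = {c. finite {s. c s \<noteq> 0} \<and> {s. c s \<noteq> 0} \<subseteq> S},
      monoid.mult = (\<lambda>c d s. 0), one = (\<lambda>s. 0), ring.zero = (\<lambda>s. 0),
      add = (\<lambda>c d s. c s + d s), smult = (\<lambda>a c s. a * c s)\<rparr>"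

definition free_gen :: "'a \<Rightarrow> 'a \<Rightarrow> complex" where
  "free_gen s = (\<lambda>t. if t = s then 1 else 0)"

text \<open>The exterior power is the free vector space on \<open>k\<close>-tuples modulo the relations expressing
  additivity and homogeneity in each slot and vanishing on tuples with a repeated entry.\<close>

definition tuples :: "nat \<Rightarrow> (complex, 'b) module \<Rightarrow> 'b list set" where
  "tuples k M = {vs. length vs = k \<and> set vs \<subseteq> carrier M}"

definition ext_relations :: "nat \<Rightarrow> (complex, 'b) module \<Rightarrow> ('b list \<Rightarrow> complex) set" where
  "ext_relations k M =
     {\<lambda>l. free_gen (xs @ (a \<oplus>\<^bsub>M\<^esub> b) # ys) l - free_gen (xs @ a # ys) l - free_gen (xs @ b # ys) l
        | xs a b ys. xs @ a # ys \<in> tuples k M \<and> b \<in> carrier M} \<union>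
     {\<lambda>l. free_gen (xs @ (c \<odot>\<^bsub>M\<^esub> a) # ys) l - c * free_gen (xs @ a # ys) l
        | xs c a ys. xs @ a # ys \<in> tuples k M} \<union>
     {free_gen (xs @ a # ys @ a # zs) | xs a ys zs. xs @ a # ys @ a # zs \<in> tuples k M}"

definition ext_null :: "nat \<Rightarrow> (complex, 'b) module \<Rightarrow> ('b list \<Rightarrow> complex) set" where
  "ext_null k M = span_in (free_mod (tuples k M)) (ext_relations k M)"

definition ext_power :: "nat \<Rightarrow> (complex, 'b) module \<Rightarrow> (complex, ('b list \<Rightarrow> complex) set) module" where
  "ext_power k M = quot_mod (free_mod (tuples k M)) (ext_null k M)"

definition wedge :: "nat \<Rightarrow> (complex, 'b) module \<Rightarrow> 'b list \<Rightarrow> ('b list \<Rightarrow> complex) set" where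
  "wedge k M vs = ext_null k M +>\<^bsub>free_mod (tuples k M)\<^esub> free_gen vs"

text \<open>\<open>H\<close> is the map \<open>\<Lambda>\<^sup>k M \<rightarrow> \<Lambda>\<^sup>k N\<close> induced by the linear map \<open>\<phi> : M \<rightarrow> N\<close>.\<close>

definition induced_ext_map ::
  "nat \<Rightarrow> (complex, 'b) module \<Rightarrow> (complex, 'c) module \<Rightarrow> ('b \<Rightarrow> 'c) \<Rightarrow>
   (('b list \<Rightarrow> complex) set \<Rightarrow> ('c list \<Rightarrow> complex) set) \<Rightarrow> bool" where
  "induced_ext_map k M N \<phi> H \<longleftrightarrow>
     H \<in> LinearCombinations.module_hom CC (ext_power k M) (ext_power k N) \<and>
     (\<forall>vs\<in>tuples k M. H (wedge k M vs) = wedge k N (map \<phi> vs))"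

section \<open>Quasihomogeneous polynomials\<close>

text \<open>Since \<open>\<complex>\<close> is infinite, polynomials in the variables indexed by \<open>'n\<close> are identified with the
  polynomial functions they define.\<close>

definition polynomial_fun :: "(complex ^ 'n \<Rightarrow> complex) \<Rightarrow> bool" where
  "polynomial_fun p \<longleftrightarrow>
     (\<exists>(M :: ('n \<Rightarrow> nat) set) c. finite M \<and> p = (\<lambda>x. \<Sum>m\<in>M. c m * (\<Prod>k\<in>UNIV. (x $ k) ^ m k)))"

definition quasihomogeneous :: "(complex ^ 'n \<Rightarrow> complex) \<Rightarrow> nat \<Rightarrow> ('n \<Rightarrow> nat) \<Rightarrow> bool" where
  "quasihomogeneous f d0 d \<longleftrightarrow> d0 > 0 \<and> (\<forall>k. d k > 0) \<and>
     (\<forall>t x. t \<noteq> 0 \<longrightarrow> f (\<chi> k. t ^ d k * x $ k) = t ^ d0 * f x)"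

definition quasihomogeneous_with_weights :: "(complex ^ 'n \<Rightarrow> complex) \<Rightarrow> ('n \<Rightarrow> real) \<Rightarrow> bool" where
  "quasihomogeneous_with_weights f q \<longleftrightarrow>
     (\<exists>d0 d. quasihomogeneous f d0 d \<and> (\<forall>k. q k = real (d k) / real d0))"

definition dir_deriv :: "(complex ^ 'n \<Rightarrow> complex) \<Rightarrow> complex ^ 'n \<Rightarrow> complex ^ 'n \<Rightarrow> complex" where
  "dir_deriv p v x = deriv (\<lambda>t. p (x + t *s v)) 0"

definition isolated_singularity :: "(complex ^ 'n \<Rightarrow> complex) \<Rightarrow> bool" where
  "isolated_singularity f \<longleftrightarrow> {x. \<forall>k. dir_deriv f (axis k 1) x = 0} = {0}"

section \<open>Symmetry groups and fixed loci\<close>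

definition GL :: "(complex ^ 'n ^ 'n) monoid" where
  "GL = \<lparr>carrier = {g. invertible g}, monoid.mult = (**), one = mat 1\<rparr>"

definition GL_of :: "(complex ^ 'n \<Rightarrow> complex) \<Rightarrow> (complex ^ 'n ^ 'n) set" where
  "GL_of f = {g \<in> carrier GL. \<forall>x. f (g *v x) = f x}"

definition SL_of :: "(complex ^ 'n \<Rightarrow> complex) \<Rightarrow> (complex ^ 'n ^ 'n) set" where
  "SL_of f = {g \<in> GL_of f. det g = 1}"

definition j_elem :: "('n \<Rightarrow> real) \<Rightarrow> complex ^ 'n ^ 'n" where
  "j_elem q = (\<chi> i k. if i = k then cis (2 * pi * q i) else 0)"

definition J_group :: "('n \<Rightarrow> real) \<Rightarrow> (complex ^ 'n ^ 'n) set" where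
  "J_group q = generate GL {j_elem q}"

definition Fix :: "complex ^ 'n ^ 'n \<Rightarrow> (complex ^ 'n) set" where
  "Fix g = {x. g *v x = x}"

definition codim_Fix :: "complex ^ 'n ^ 'n \<Rightarrow> nat" where
  "codim_Fix g = CARD('n) - vec.dim (Fix g)"

definition weight_space :: "('n \<Rightarrow> real) \<Rightarrow> real \<Rightarrow> (complex ^ 'n) set" where
  "weight_space q w = vec.span {axis k 1 | k. q k = w}"

definition fixed_indices :: "('n \<Rightarrow> real) \<Rightarrow> complex ^ 'n ^ 'n \<Rightarrow> 'n set \<Rightarrow> bool" where
  "fixed_indices q g I \<longleftrightarrow> (\<forall>w. card {k\<in>I. q k = w} = vec.dim (Fix g \<inter> weight_space q w))"

text \<open>The exponents list the eigenvalues of \<open>g\<close> with multiplicity; they exist whenever all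
  eigenvalues lie on the unit circle, in particular for \<open>g\<close> of finite order.\<close>

definition eigen_exponents :: "complex ^ 'n ^ 'n \<Rightarrow> ('n \<Rightarrow> real) \<Rightarrow> bool" where
  "eigen_exponents g \<alpha> \<longleftrightarrow> (\<forall>k. 0 \<le> \<alpha> k \<and> \<alpha> k < 1) \<and>
     (\<forall>t. det (mat t - g) = (\<Prod>k\<in>UNIV. t - cis (2 * pi * \<alpha> k)))"

definition age :: "complex ^ 'n ^ 'n \<Rightarrow> real" where
  "age g = (THE a. \<exists>\<alpha>. eigen_exponents g \<alpha> \<and> a = (\<Sum>k\<in>UNIV. \<alpha> k))"

section \<open>Jacobian algebras\<close>

definition poly_ring :: "(complex ^ 'n) set \<Rightarrow> (complex, complex ^ 'n \<Rightarrow> complex) module" where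
  "poly_ring V =
     \<lparr>carrier = {restrict p V | p. polynomial_fun p},
      monoid.mult = (\<lambda>p r. \<lambda>x\<in>V. p x * r x), one = (\<lambda>x\<in>V. 1), ring.zero = (\<lambda>x\<in>V. 0),
      add = (\<lambda>p r. \<lambda>x\<in>V. p x + r x), smult = (\<lambda>c p. \<lambda>x\<in>V. c * p x)\<rparr>"

text \<open>The first partial derivatives of \<open>f\<^sup>g\<close> are taken along all vectors of \<open>Fix g\<close>; these are
  linear combinations of the ones along any basis, so no coordinates need to be chosen.  For
  \<open>Fix g = {0}\<close> the quotient is \<open>\<complex>\<close> modulo the zero ideal.\<close>

definition jac_ideal :: "(complex ^ 'n \<Rightarrow> complex) \<Rightarrow> complex ^ 'n ^ 'n \<Rightarrow> (complex ^ 'n \<Rightarrow> complex) set" where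
  "jac_ideal f g =
     Idl\<^bsub>poly_ring (Fix g)\<^esub> {restrict (dir_deriv (restrict f (Fix g)) v) (Fix g) | v. v \<in> Fix g}"

definition Jac :: "(complex ^ 'n \<Rightarrow> complex) \<Rightarrow> complex ^ 'n ^ 'n \<Rightarrow> (complex, (complex ^ 'n \<Rightarrow> complex) set) module" where
  "Jac f g = quot_mod (poly_ring (Fix g)) (jac_ideal f g)"

definition jac_class ::
  "(complex ^ 'n \<Rightarrow> complex) \<Rightarrow> complex ^ 'n ^ 'n \<Rightarrow> (complex ^ 'n \<Rightarrow> complex) \<Rightarrow> (complex ^ 'n \<Rightarrow> complex) set" where
  "jac_class f g p = jac_ideal f g +>\<^bsub>poly_ring (Fix g)\<^esub> p"

text \<open>The weight grading of \<open>\<complex>[V]\<close> for \<open>V = \<Oplus>\<^sub>w (V \<inter> W\<^sub>w)\<close>: the one generated by giving degree \<open>w\<close>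
  to the linear functions that vanish on all pieces of weight different from \<open>w\<close>.\<close>

inductive homogeneous ::
  "('n \<Rightarrow> real) \<Rightarrow> (complex ^ 'n) set \<Rightarrow> real \<Rightarrow> (complex ^ 'n \<Rightarrow> complex) \<Rightarrow> bool"
  for q :: "'n \<Rightarrow> real" and V :: "(complex ^ 'n) set"
where
  zero: "homogeneous q V w (\<lambda>x\<in>V. 0)"
| const: "homogeneous q V 0 (\<lambda>x\<in>V. c)"
| linear: "\<lbrakk>Vector_Spaces.linear (*s) (*) l; \<forall>w'. w' \<noteq> w \<longrightarrow> (\<forall>x \<in> V \<inter> weight_space q w'. l x = 0)\<rbrakk>
    \<Longrightarrow> homogeneous q V w (restrict l V)"
| mult: "\<lbrakk>homogeneous q V w p; homogeneous q V w' r\<rbrakk> \<Longrightarrow> homogeneous q V (w + w') (\<lambda>x\<in>V. p x * r x)"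
| add: "\<lbrakk>homogeneous q V w p; homogeneous q V w r\<rbrakk> \<Longrightarrow> homogeneous q V w (\<lambda>x\<in>V. p x + r x)"

section \<open>The state space\<close>

type_synonym 'n ext = "((complex ^ 'n) set list \<Rightarrow> complex) set"
type_synonym 'n state = "complex ^ 'n ^ 'n \<Rightarrow> (complex ^ 'n \<Rightarrow> complex) set"

definition normal_space :: "complex ^ 'n ^ 'n \<Rightarrow> (complex, (complex ^ 'n) set) module" where
  "normal_space g = quot_mod Cvec (Fix g)"

definition Lambda :: "complex ^ 'n ^ 'n \<Rightarrow> (complex, 'n ext) module" where
  "Lambda g = ext_power (codim_Fix g) (normal_space g)"

definition is_generator :: "complex ^ 'n ^ 'n \<Rightarrow> 'n ext \<Rightarrow> bool" where
  "is_generator g z \<longleftrightarrow>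
     z \<in> carrier (Lambda g) \<and> z \<noteq> \<zero>\<^bsub>Lambda g\<^esub> \<and> span_in (Lambda g) {z} = carrier (Lambda g)"

text \<open>\<open>h\<close> maps the coset \<open>v + Fix g\<close> to its image \<open>h v + Fix (h g h\<^sup>-\<^sup>1)\<close>.\<close>

definition rho :: "(complex ^ 'n ^ 'n \<Rightarrow> 'n ext) \<Rightarrow> complex ^ 'n ^ 'n \<Rightarrow> complex ^ 'n ^ 'n \<Rightarrow> complex" where
  "rho \<xi> h g = (let g' = h ** g ** matrix_inv h in
     THE r. \<exists>H. induced_ext_map (codim_Fix g) (normal_space g) (normal_space g') (image ((*v) h)) H \<and>
       H (\<xi> g) = r \<odot>\<^bsub>Lambda g'\<^esub> \<xi> g')"

text \<open>A state \<open>u\<close> stands for the formal sum of the \<open>(u g) \<xi>\<^sub>g\<close> over \<open>g \<in> G\<close>, with \<open>u g \<in> Jac(f\<^sup>g)\<close>.\<close>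

definition Btot :: "(complex ^ 'n \<Rightarrow> complex) \<Rightarrow> (complex ^ 'n ^ 'n) set \<Rightarrow> (complex, 'n state) module" where
  "Btot f G =
     \<lparr>carrier = (\<Pi>\<^sub>E g\<in>G. carrier (Jac f g)),
      monoid.mult = (\<lambda>u v. \<lambda>g\<in>G. \<zero>\<^bsub>Jac f g\<^esub>), one = (\<lambda>g\<in>G. \<zero>\<^bsub>Jac f g\<^esub>), ring.zero = (\<lambda>g\<in>G. \<zero>\<^bsub>Jac f g\<^esub>),
      add = (\<lambda>u v. \<lambda>g\<in>G. u g \<oplus>\<^bsub>Jac f g\<^esub> v g), smult = (\<lambda>c u. \<lambda>g\<in>G. c \<odot>\<^bsub>Jac f g\<^esub> u g)\<rparr>"

definition sector_elem ::
  "(complex ^ 'n \<Rightarrow> complex) \<Rightarrow> (complex ^ 'n ^ 'n) set \<Rightarrow> (complex ^ 'n \<Rightarrow> complex) \<Rightarrow> complex ^ 'n ^ 'n \<Rightarrow> 'n state" where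
  "sector_elem f G p g = (\<lambda>g'\<in>G. if g' = g then jac_class f g p else \<zero>\<^bsub>Jac f g'\<^esub>)"

text \<open>The \<open>g'\<close>-component of \<open>h\<^sup>* u\<close> comes from the \<open>g\<close>-component of \<open>u\<close> with \<open>g' = h g h\<^sup>-\<^sup>1\<close>.
  As \<open>f\<close> is \<open>h\<close>-invariant, applying \<open>p \<mapsto> p \<circ> h\<^sup>-\<^sup>1\<close> to all representatives of a class in
  \<open>Jac(f\<^sup>g)\<close> gives precisely a class in \<open>Jac(f\<^sup>g\<^sup>')\<close>.\<close>

definition act ::
  "(complex ^ 'n \<Rightarrow> complex) \<Rightarrow> (complex ^ 'n ^ 'n) set \<Rightarrow> (complex ^ 'n ^ 'n \<Rightarrow> 'n ext) \<Rightarrow>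
   complex ^ 'n ^ 'n \<Rightarrow> 'n state \<Rightarrow> 'n state" where
  "act f G \<xi> h u = (\<lambda>g'\<in>G. let g = matrix_inv h ** g' ** h in
     rho \<xi> h g \<odot>\<^bsub>Jac f g'\<^esub> ((\<lambda>p. \<lambda>x\<in>Fix g'. p (matrix_inv h *v x)) ` u g))"

definition B_model ::
  "(complex ^ 'n \<Rightarrow> complex) \<Rightarrow> (complex ^ 'n ^ 'n) set \<Rightarrow> (complex ^ 'n ^ 'n \<Rightarrow> 'n ext) \<Rightarrow>
   (complex, 'n state) module" where
  "B_model f G \<xi> = (Btot f G)\<lparr>carrier := {u \<in> carrier (Btot f G). \<forall>h\<in>G. act f G \<xi> h u = u}\<rparr>"

definition bideg ::
  "('n \<Rightarrow> real) \<Rightarrow> (complex ^ 'n ^ 'n \<Rightarrow> 'n set) \<Rightarrow> complex ^ 'n ^ 'n \<Rightarrow> real \<Rightarrow> real \<times> real" where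
  "bideg q I g w = (w - (\<Sum>k\<in>- I g. q k) + age g, w - (\<Sum>k\<in>- I g. q k) + age (matrix_inv g))"

definition Btot_piece ::
  "(complex ^ 'n \<Rightarrow> complex) \<Rightarrow> ('n \<Rightarrow> real) \<Rightarrow> (complex ^ 'n ^ 'n) set \<Rightarrow> (complex ^ 'n ^ 'n \<Rightarrow> 'n set) \<Rightarrow>
   rat \<Rightarrow> rat \<Rightarrow> 'n state set" where
  "Btot_piece f q G I a b = span_in (Btot f G)
     {sector_elem f G p g | g w p. g \<in> G \<and> homogeneous q (Fix g) w p \<and>
        bideg q I g w = (of_rat a, of_rat b)}"

definition B_piece ::
  "(complex ^ 'n \<Rightarrow> complex) \<Rightarrow> ('n \<Rightarrow> real) \<Rightarrow> (complex ^ 'n ^ 'n) set \<Rightarrow> (complex ^ 'n ^ 'n \<Rightarrow> 'n ext) \<Rightarrow>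
   (complex ^ 'n ^ 'n \<Rightarrow> 'n set) \<Rightarrow> rat \<Rightarrow> rat \<Rightarrow> 'n state set" where
  "B_piece f q G \<xi> I a b = carrier (B_model f G \<xi>) \<inter> Btot_piece f q G I a b"

section \<open>Diamonds\<close>

text \<open>\<open>V a b\<close> is the subspace of bidegree \<open>(a, b)\<close> of the vector space \<open>B\<close>.\<close>

definition diamond :: "int \<Rightarrow> (complex, 'b) module \<Rightarrow> (rat \<Rightarrow> rat \<Rightarrow> 'b set) \<Rightarrow> bool" where
  "diamond D B V \<longleftrightarrow>
     (let W = (\<lambda>p r :: int. B\<lparr>carrier := V (of_int p) (of_int r)\<rparr>) in
      internal_direct_sum B (\<lambda>(p, r). carrier (W p r)) \<and>
      (\<forall>p r. p < 0 \<or> r < 0 \<or> p > D \<or> r > D \<longrightarrow> has_dimension (W p r) 0) \<and>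
      has_dimension (W 0 0) 1 \<and> has_dimension (W D D) 1 \<and>
      has_dimension (W D 0) 1 \<and> has_dimension (W 0 D) 1 \<and>
      (\<forall>p r. isomorphic (W p r) (W r p)) \<and>
      (\<forall>p r. isomorphic (W p r) (dual (W (D - r) (D - p)))))"

end

theory Submission
  imports Defs
    "HOL-Library.Poly_Mapping"
    "HOL-Library.Function_Algebras"
    "HOL-Computational_Algebra.Fundamental_Theorem_Algebra"
begin

text \<open>In a common eigenbasis of two commuting symmetries \<open>g\<close> and \<open>h\<close>, the algebra \<open>Jac(f\<^sup>g)\<close> is the
  quotient of the full polynomial ring by as many semi-invariant weighted homogeneous polynomials as
  there are variables (the partial derivatives along \<open>Fix g\<close> and the remaining coordinates), whose only
  common zero is 0.  Such a quotient carries a nondegenerate functional that is homogeneous of top degree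
  and semi-invariant.  For powers of the coordinates this is clear; it persists when one entry of a
  regular sequence is exchanged for an element of the ideal; and by the Nullstellensatz and generic
  combinations a chain of exchanges leads from the powers of the coordinates to any such tuple.

  These functionals transform by \<open>\<rho>\<^sup>2\<close> under the centralizer of \<open>g\<close>, so averaging over \<open>G\<close> yields the
  duality (6).  The symmetry (5) comes from \<open>\<Lambda>(g) = \<Lambda>(g\<^sup>-\<^sup>1)\<close>, and invariance under \<open>j\<close> makes the bidegrees
  integral.  Ages are integers, positive away from the identity, which gives the bounds and leaves only
  \<open>g = 1\<close> for the corners \<open>(0, 0)\<close> and \<open>(D, D)\<close>.  For the other two corners, \<open>j\<close> has to be the only
  element with age 1 and without fixed points; this follows by counting the partial derivatives of \<open>f\<close>
  that survive on coordinate subspaces.\<close>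

text \<open>An exchange only works in one direction: \<open>good_exchange\<close> passes from a good
  tuple to one with a new entry when the old entry lies in the ideal of the new tuple. So the chain
  is built from the given tuple but goodness is propagated backwards along it, and every
  intermediate tuple must again have 0 as its only common zero. The generic forms are the meeting
  point of the two halves: they combine high powers of the coordinates, hence lie in the ideal of
  the tuple, and the exponents are multiples of the order of the symmetry, hence the forms are
  invariant. Weight and character travel together as one complex number, 2 to the weight times the
  character; its norm returns the weight and makes graded inductions end. The square of \<rho>
  arises as follows: an eigenvalue b of h in a fixed direction enters the character of the
  functional with exponent -2, in a moved direction with exponent 0, and det h = 1 turns the product
  over fixed directions into the inverse of that over moved ones. Eigenbases compatible with the
  weights exist because no nonzero linear vector field annihilates f, which rests on the Calabi-Yau
  condition and N \<ge> 3.\<close>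

no_notation fps_nth (infixl "$" 75)

section \<open>Polynomials and their homogeneous components\<close>

type_synonym 'n mpoly = "('n \<Rightarrow>\<^sub>0 nat) \<Rightarrow>\<^sub>0 complex"

abbreviation coef :: "'n mpoly => ('n \<Rightarrow>\<^sub>0 nat) => complex" where
 "coef \<equiv> Poly_Mapping.lookup"

abbreviation expo :: "('n \<Rightarrow>\<^sub>0 nat) => 'n => nat" where
 "expo \<equiv> Poly_Mapping.lookup"

abbreviation supp :: "'n mpoly => ('n \<Rightarrow>\<^sub>0 nat) set" where
 "supp \<equiv> Poly_Mapping.keys"

abbreviation term_of :: "('n \<Rightarrow>\<^sub>0 nat) => complex => 'n mpoly" where
 "term_of \<equiv> Poly_Mapping.single"

abbreviation cnst :: "complex => 'n mpoly" where
 "cnst c \<equiv> term_of 0 c"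

definition vpow :: "'n => nat => 'n mpoly" where
 "vpow k e = term_of (Poly_Mapping.single k e) 1"

abbreviation Var :: "'n => 'n mpoly" where
 "Var k \<equiv> vpow k 1"

lemma mpoly_eq_sum: "p = (\<Sum>m\<in>supp p. term_of m (coef p m))" for p :: "'n mpoly"
proof (rule poly_mapping_eqI)
 fix m
 have "(\<Sum>x\<in>supp p. coef (term_of x (coef p x)) m) = (\<Sum>x\<in>supp p. if x = m then coef p x else 0)"
  by (rule sum.cong) (auto simp: lookup_single when_def)
 thus "coef p m = coef (\<Sum>m\<in>supp p. term_of m (coef p m)) m"
  by (simp add: lookup_sum in_keys_iff del: keys_eq_empty)
qed

lemma mpoly_induct [case_names zero single add]:
 fixes p :: "'n mpoly"
 assumes "P 0" and "\<And>m c. P (term_of m c)" and "\<And>p q. P p ==> P q ==> P (p + q)"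
 shows "P p"
proof -
 have "P (\<Sum>m\<in>S. term_of m (coef p m))" if "finite S" for S
  using that
 proof (induction S rule: finite_induct)
  case empty show ?case using assms(1) by simp
 next
  case (insert m S) thus ?case using assms(3)[OF assms(2) insert.IH] by simp
 qed
 hence "P (\<Sum>m\<in>supp p. term_of m (coef p m))" by simp
 thus ?thesis by (rule back_subst[of P]) (rule mpoly_eq_sum[symmetric])
qed

lemma vpow_0 [simp]: "vpow k 0 = 1"
 by (simp add: vpow_def)

lemma vpow_add: "vpow k (a + b) = vpow k a * vpow k b"
 by (simp add: vpow_def mult_single single_add[symmetric])

lemma vpow_power: "vpow k e ^ j = vpow k (e * j)"
 by (induction j) (simp_all add: vpow_add algebra_simps)

lemma term_of_eq: "term_of m c = cnst c * term_of m 1"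
 by (simp add: mult_single)

text \<open>Induction over ring generators, for constructions compatible with sums and products such
  as derivatives and substitutions.\<close>

lemma mpoly_ring_induct [case_names cnst var add mult]:
 fixes p :: "('n::finite) mpoly"
 assumes c: "\<And>c. P (cnst c)" and v: "\<And>k. P (Var k)"
  and a: "\<And>p q. P p ==> P q ==> P (p + q)" and m: "\<And>p q. P p ==> P q ==> P (p * q)"
 shows "P p"
proof (induction p rule: mpoly_induct)
 case zero show ?case using c[of 0] by simp
next
 case (single t c)
 have pw: "P (vpow k e)" for k e
 proof (induction e)
  case 0 show ?case using c[of 1] by simp
 next
  case (Suc e)
  have "vpow k (Suc e) = Var k * vpow k e" using vpow_add[of k 1 e] by simp
  thus ?case using m[OF v Suc] by simp
 qed
 have "P (term_of t 1)"
 proof (induction t rule: update_induct)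
  case const show ?case using c[of 1] by simp
 next
  case (update f a b)
  have "Poly_Mapping.update a b f = Poly_Mapping.single a b + f"
   using update(1) by (intro poly_mapping_eqI) (auto simp: lookup_update lookup_add lookup_single when_def in_keys_iff)
  hence "term_of (Poly_Mapping.update a b f) 1 = vpow a b * term_of f 1"
   by (simp add: vpow_def mult_single)
  thus ?case using m[OF pw update(3)] by simp
 qed
 from m[OF c this, of c] show ?case unfolding term_of_eq[of t c, symmetric] .
next
 case (add p q) thus ?case by (rule a)
qed

definition mon :: "complex ^ 'n => ('n::finite \<Rightarrow>\<^sub>0 nat) => complex" where
 "mon x m = (\<Prod>k\<in>UNIV. x $ k ^ expo m k)"

definition ev :: "('n::finite) mpoly => complex ^ 'n => complex" where
 "ev p x = (\<Sum>m\<in>supp p. coef p m * mon x m)"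

lemma mon_0 [simp]: "mon x 0 = 1"
 by (simp add: mon_def)

lemma mon_add: "mon x (m + m') = mon x m * mon x m'"
 by (simp add: mon_def lookup_add power_add prod.distrib)

lemma mon_single [simp]: "mon x (Poly_Mapping.single k e) = x $ k ^ e"
proof -
 have "(\<Prod>i\<in>UNIV. x $ i ^ (if i = k then e else 0)) = (\<Prod>i\<in>UNIV. if i = k then x $ i ^ e else 1)"
  by (rule prod.cong) auto
 thus ?thesis by (simp add: mon_def lookup_single when_def eq_commute[of k])
qed

lemma ev_superset:
 assumes "finite S" "supp p \<subseteq> S"
 shows "ev p x = (\<Sum>m\<in>S. coef p m * mon x m)"
 unfolding ev_def by (rule sum.mono_neutral_left) (use assms in \<open>auto simp: in_keys_iff\<close>)

lemma ev_0 [simp]: "ev 0 x = 0" by (simp add: ev_def)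

lemma ev_add [simp]: "ev (p + q) x = ev p x + ev q x"
proof -
 let ?S = "supp p \<union> supp q"
 have "supp (p + q) \<subseteq> ?S" by (rule keys_add)
 hence "ev (p + q) x = (\<Sum>m\<in>?S. coef (p + q) m * mon x m)"
  by (intro ev_superset) auto
 moreover have "ev p x = (\<Sum>m\<in>?S. coef p m * mon x m)" "ev q x = (\<Sum>m\<in>?S. coef q m * mon x m)"
  by (intro ev_superset; auto)+
 ultimately show ?thesis by (simp add: lookup_add distrib_right sum.distrib)
qed

lemma ev_term_of [simp]: "ev (term_of m c) x = c * mon x m"
 by (simp add: ev_def)

lemma ev_sum [simp]: "ev (sum f A) x = (\<Sum>a\<in>A. ev (f a) x)"
 by (induction A rule: infinite_finite_induct) auto

lemma ev_mult [simp]: "ev (p * q) x = ev p x * ev q x"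
proof (induction p rule: mpoly_induct)
 case (single m c)
 show ?case
  by (induction q rule: mpoly_induct) (auto simp: mult_single mon_add algebra_simps)
qed (auto simp: algebra_simps)

lemma ev_1 [simp]: "ev 1 x = 1"
 using ev_term_of[of 0 1 x] by simp

lemma ev_minus [simp]: "ev (- p) x = - ev p x"
 using ev_add[of p "- p" x] by (simp add: eq_neg_iff_add_eq_0 add.commute)

lemma ev_diff [simp]: "ev (p - q) x = ev p x - ev q x"
 using ev_add[of p "- q" x] by simp

lemma ev_power [simp]: "ev (p ^ k) x = ev p x ^ k"
 by (induction k) auto

lemma ev_prod [simp]: "ev (prod f A) x = (\<Prod>a\<in>A. ev (f a) x)"
 by (induction A rule: infinite_finite_induct) auto

lemma ev_vpow [simp]: "ev (vpow k e) x = x $ k ^ e"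
 by (simp add: vpow_def)

text \<open>Weight components, character components, bidegree components and the part free of
  certain variables are all instances of this one projection.\<close>

definition filt :: "(('n \<Rightarrow>\<^sub>0 nat) => bool) => 'n mpoly => 'n mpoly" where
 "filt Q p = Poly_Mapping.mapp (%m c. if Q m then c else 0) p"

lemma coef_filt [simp]: "coef (filt Q p) m = (if Q m then coef p m else 0)"
 by (auto simp: filt_def lookup_mapp when_def in_keys_iff)

lemma filt_add [simp]: "filt Q (p + q) = filt Q p + filt Q q"
 by (rule poly_mapping_eqI) (simp add: lookup_add)

lemma filt_0 [simp]: "filt Q 0 = 0"
 by (rule poly_mapping_eqI) simp

lemma filt_minus [simp]: "filt Q (- p) = - filt Q p"
 by (rule poly_mapping_eqI) simp

lemma filt_diff [simp]: "filt Q (p - q) = filt Q p - filt Q q"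
 by (rule poly_mapping_eqI) (simp add: lookup_minus)

lemma filt_sum: "filt Q (sum f A) = (\<Sum>a\<in>A. filt Q (f a))"
 by (induction A rule: infinite_finite_induct) auto

lemma filt_term_of: "filt Q (term_of m c) = (if Q m then term_of m c else 0)"
 by (rule poly_mapping_eqI) (auto simp: lookup_single when_def)

lemma supp_filt [simp]: "supp (filt Q p) = {m \<in> supp p. Q m}"
 by (auto simp: in_keys_iff split: if_splits)

lemma filt_id: "(\<And>m. m \<in> supp p ==> Q m) ==> filt Q p = p"
 by (rule poly_mapping_eqI) (auto simp: in_keys_iff)

lemma filt_eq_0: "(\<And>m. m \<in> supp p ==> \<not> Q m) ==> filt Q p = 0"
 by (rule poly_mapping_eqI) (auto simp: in_keys_iff)

text \<open>Applied with homogeneous \<open>b\<close>: both predicates then fix a degree, and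
  multiplication shifts it by the degree of \<open>b\<close>.\<close>

lemma filt_mult:
 fixes b p :: "'n mpoly"
 assumes "\<And>m0 m. m0 \<in> supp b ==> Q' (m0 + m) \<longleftrightarrow> Q m"
 shows "filt Q' (b * p) = b * filt Q p"
proof (induction p rule: mpoly_induct)
 case (single m c)
 have eq: "b * q = (\<Sum>m0\<in>supp b. term_of m0 (coef b m0) * q)" for q
  by (rule trans[OF arg_cong[OF mpoly_eq_sum, of "%b. b * q"]]) (rule sum_distrib_right)
 have "filt Q' (b * term_of m c) = filt Q' (\<Sum>m0\<in>supp b. term_of (m0 + m) (coef b m0 * c))"
  by (subst eq) (simp add: mult_single)
 also have "\<dots> = (\<Sum>m0\<in>supp b. if Q m then term_of (m0 + m) (coef b m0 * c) else 0)"
  unfolding filt_sum by (rule sum.cong) (auto simp: filt_term_of assms)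
 also have "\<dots> = (\<Sum>m0\<in>supp b. term_of m0 (coef b m0) * filt Q (term_of m c))"
  by (rule sum.cong) (auto simp: filt_term_of mult_single)
 also have "\<dots> = b * filt Q (term_of m c)" by (rule eq[symmetric])
 finally show ?case .
qed (auto simp: algebra_simps)

lemma sum_filt:
 fixes p :: "'n mpoly"
 assumes "finite T" "t ` supp p \<subseteq> T"
 shows "p = (\<Sum>\<beta>\<in>T. filt (%m. t m = \<beta>) p)"
proof (rule poly_mapping_eqI)
 fix m
 have "coef p m = (\<Sum>\<beta>\<in>T. if t m = \<beta> then coef p m else 0)"
 proof (cases "m \<in> supp p")
  case True
  hence "t m \<in> T" using assms(2) by blast
  thus ?thesis using assms(1) by simp
 next
  case False
  hence "coef p m = 0" by (simp add: in_keys_iff)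
  thus ?thesis by (simp cong: if_cong)
 qed
 thus "coef p m = coef (\<Sum>\<beta>\<in>T. filt (%m. t m = \<beta>) p) m"
  by (simp add: lookup_sum)
qed

section \<open>Gradings by characters and by weights\<close>

definition graded :: "(('n \<Rightarrow>\<^sub>0 nat) => 'g) => 'g => 'n mpoly => bool" where
 "graded t \<gamma> p \<longleftrightarrow> (\<forall>m\<in>supp p. t m = \<gamma>)"

lemma graded_filt [simp]: "graded t \<gamma> (filt (%m. t m = \<gamma>) p)"
 by (simp add: graded_def)

lemma graded_0 [simp]: "graded t \<gamma> 0"
 by (simp add: graded_def)

lemma graded_add: "graded t \<gamma> p ==> graded t \<gamma> q ==> graded t \<gamma> (p + q)"
 using keys_add[of p q] unfolding graded_def by blast

lemma graded_sum: "(\<And>a. a \<in> A ==> graded t \<gamma> (f a)) ==> graded t \<gamma> (sum f A)"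
 by (induction A rule: infinite_finite_induct) (auto intro: graded_add)

lemma graded_term_of: "graded t (t m) (term_of m c)"
 by (simp add: graded_def)

lemma graded_mult:
 assumes "graded t \<gamma> p" "graded t \<delta> q" "\<And>m m'. t (m + m') = op (t m) (t m')"
 shows "graded t (op \<gamma> \<delta>) (p * q)"
 unfolding graded_def
proof
 fix m assume "m \<in> supp (p * q)"
 then obtain a b where "m = a + b" "a \<in> supp p" "b \<in> supp q" using keys_mult[of p q] by blast
 thus "t m = op \<gamma> \<delta>" using assms by (simp add: graded_def)
qed

lemma filt_graded: "graded t \<gamma> p ==> filt (%m. t m = \<beta>) p = (if \<beta> = \<gamma> then p else 0)"
 unfolding graded_def by (auto intro!: filt_id filt_eq_0)

text \<open>The eigenvalue of the monomial with exponents \<open>m\<close> under the diagonal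
  substitution that multiplies the k-th variable by \<open>b k\<close>.\<close>

definition chr :: "('n::finite => complex) => ('n \<Rightarrow>\<^sub>0 nat) => complex" where
 "chr b m = (\<Prod>k\<in>UNIV. b k ^ expo m k)"

definition wdeg :: "('n::finite => nat) => ('n \<Rightarrow>\<^sub>0 nat) => nat" where
 "wdeg d m = (\<Sum>k\<in>UNIV. d k * expo m k)"

abbreviation wgraded :: "('n::finite => nat) => nat => 'n mpoly => bool" where
 "wgraded d \<equiv> graded (wdeg d)"

lemma chr_0 [simp]: "chr b 0 = 1" and wdeg_0 [simp]: "wdeg d 0 = 0"
 by (simp_all add: chr_def wdeg_def)

lemma chr_add: "chr b (m + m') = chr b m * chr b m'"
 by (simp add: chr_def lookup_add power_add prod.distrib)

lemma wdeg_add: "wdeg d (m + m') = wdeg d m + wdeg d m'"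
 by (simp add: wdeg_def lookup_add algebra_simps sum.distrib)

lemma chr_single [simp]: "chr b (Poly_Mapping.single k e) = b k ^ e"
 using mon_single[of "\<chi> i. b i" k e] by (simp add: mon_def chr_def)

lemma wdeg_single [simp]: "wdeg d (Poly_Mapping.single k e) = d k * e"
proof -
 have "(\<Sum>i\<in>UNIV. d i * (if i = k then e else 0)) = (\<Sum>i\<in>UNIV. if i = k then d i * e else 0)"
  by (rule sum.cong) auto
 thus ?thesis by (simp add: wdeg_def lookup_single when_def eq_commute[of k])
qed

lemma chr_nonzero: "(\<And>k. b k ~= 0) ==> chr b m ~= 0"
 by (simp add: chr_def)

lemma wdeg_eq_0: "(\<And>k. d k > 0) ==> wdeg d m = 0 \<longleftrightarrow> m = 0"
proof
 assume d: "\<And>k. d k > 0" and "wdeg d m = 0"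
 hence "\<forall>k. d k * expo m k = 0" by (simp add: wdeg_def)
 hence "expo m k = 0" for k using d[of k] by (metis mult_is_0 not_gr_zero)
 thus "m = 0" by (intro poly_mapping_eqI) simp
qed auto

lemma filt_chr_mult:
 assumes "graded (chr b) \<gamma> p" "\<gamma> ~= 0"
 shows "filt (%m. chr b m = \<beta>) (p * q) = p * filt (%m. chr b m = \<beta> / \<gamma>) q"
 using assms by (intro filt_mult) (auto simp: graded_def chr_add field_simps)

lemma filt_wdeg_mult:
 assumes "wgraded d \<gamma> p"
 shows "filt (%m. wdeg d m = \<gamma> + \<beta>) (p * q) = p * filt (%m. wdeg d m = \<beta>) q"
 using assms by (intro filt_mult) (auto simp: graded_def wdeg_add)

text \<open>Complements \<open>filt_wdeg_mult\<close> in the degrees that no multiple of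
  \<open>p\<close> reaches, as weights are natural numbers.\<close>

lemma filt_wdeg_mult_lt:
 assumes "wgraded d \<gamma> p" "\<beta> < \<gamma>"
 shows "filt (%m. wdeg d m = \<beta>) (p * q) = 0"
proof (rule filt_eq_0)
 fix m assume "m \<in> supp (p * q)"
 then obtain a b where "m = a + b" "a \<in> supp p" using keys_mult[of p q] by blast
 thus "wdeg d m ~= \<beta>" using assms by (auto simp: graded_def wdeg_add)
qed

section \<open>Regular tuples\<close>

text \<open>Generators form an indexed family, so that exchanging one of them is the update
  \<open>F(i := a)\<close> and smaller ideals arise by shrinking \<open>S\<close>.\<close>

definition idl :: "('i => 'r::comm_ring_1) => 'i set => 'r set" where
 "idl F S = {\<Sum>k\<in>S. F k * r k | r. True}"

lemma idl_I: "p = (\<Sum>k\<in>S. F k * r k) ==> p \<in> idl F S"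
 by (auto simp: idl_def)

lemma idl_E: "p \<in> idl F S ==> (\<And>r. p = (\<Sum>k\<in>S. F k * r k) ==> thesis) ==> thesis"
 by (auto simp: idl_def)

lemma idl_0 [simp]: "0 \<in> idl F S"
 by (rule idl_I[where r = "%_. 0"]) simp

lemma idl_add: "p \<in> idl F S ==> q \<in> idl F S ==> p + q \<in> idl F S"
 by (elim idl_E) (rule idl_I, simp add: sum.distrib[symmetric] distrib_left[symmetric])

lemma idl_mult: "p \<in> idl F S ==> c * p \<in> idl F S"
proof (elim idl_E)
 fix r assume "p = (\<Sum>k\<in>S. F k * r k)"
 thus ?thesis by (intro idl_I[where r = "%k. c * r k"]) (simp add: sum_distrib_left algebra_simps)
qed

lemma idl_mult2: "p \<in> idl F S ==> p * c \<in> idl F S"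
 using idl_mult[of p F S c] by (simp add: mult.commute)

lemma idl_minus: "p \<in> idl F S ==> - p \<in> idl F S"
 using idl_mult[of p F S "-1"] by simp

lemma idl_diff: "p \<in> idl F S ==> q \<in> idl F S ==> p - q \<in> idl F S"
 using idl_add[of p F S "- q"] idl_minus[of q F S] by simp

lemma idl_sum: "(\<And>a. a \<in> A ==> f a \<in> idl F S) ==> sum f A \<in> idl F S"
 by (induction A rule: infinite_finite_induct) (auto intro: idl_add)

lemma idl_cong: "(\<And>k. k \<in> S ==> F k = G k) ==> idl F S = idl G S"
 by (simp add: idl_def)

lemma idl_insert:
 assumes "finite S" "i \<notin> S"
 shows "idl F (insert i S) = {F i * s + p | s p. p \<in> idl F S}"
proof safe
 fix p assume "p \<in> idl F (insert i S)"
 then obtain r where "p = (\<Sum>k\<in>insert i S. F k * r k)" by (elim idl_E)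
 thus "\<exists>s p'. p = F i * s + p' \<and> p' \<in> idl F S"
  using assms by (intro exI[of _ "r i"] exI[of _ "\<Sum>k\<in>S. F k * r k"]) (auto intro: idl_I)
next
 fix s p assume "p \<in> idl F S"
 then obtain r where r: "p = (\<Sum>k\<in>S. F k * r k)" by (elim idl_E)
 have "(\<Sum>k\<in>S. F k * (if k = i then s else r k)) = (\<Sum>k\<in>S. F k * r k)"
  by (rule sum.cong) (use assms in auto)
 thus "F i * s + p \<in> idl F (insert i S)"
  using assms r by (intro idl_I[where r = "%k. if k = i then s else r k"]) simp
qed

lemma idl_gen: "finite S ==> k \<in> S ==> F k \<in> idl F S"
 by (rule idl_I[where r = "%i. if i = k then 1 else 0"]) (simp add: if_distrib cong: if_cong)

lemma idl_subset:
 assumes "finite S" "finite T" "\<And>k. k \<in> S ==> F k \<in> idl G T"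
 shows "idl F S \<subseteq> idl G T"
 using assms(3) by (auto elim!: idl_E intro!: idl_sum idl_mult2)

lemma idl_mono: "finite T ==> S \<subseteq> T ==> idl F S \<subseteq> idl F T"
 by (rule idl_subset) (auto intro: idl_gen finite_subset)

definition nzd :: "'r => 'r::comm_ring_1 set => bool" where
 "nzd b J \<longleftrightarrow> (\<forall>m. b * m \<in> J --> m \<in> J)"

text \<open>The condition ranges over all subsets, hence over all orders of the entries; the
  exchange of an arbitrary entry relies on this.\<close>

definition regular_tuple :: "('i => 'r::comm_ring_1) => bool" where
 "regular_tuple F \<longleftrightarrow> (\<forall>S i. i \<notin> S --> nzd (F i) (idl F S))"

text \<open>In a relation \<open>F k * m = F i * s + p\<close>, regularity of \<open>F i\<close>
  modulo \<open>F k\<close> makes \<open>s\<close> a multiple of \<open>F k\<close> modulo the rest,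
  and then \<open>F k\<close> can be cancelled.\<close>

lemma nzd_exchange:
 fixes F :: "'i::finite => 'r::comm_ring_1"
 assumes "i \<notin> S" "k \<notin> S" "i ~= k"
  and c: "nzd (F k) (idl F S)" and b: "nzd (F i) (idl F (insert k S))"
 shows "nzd (F k) (idl F (insert i S))"
 unfolding nzd_def
proof (intro allI impI)
 fix m assume "F k * m \<in> idl F (insert i S)"
 then obtain s p where sp: "F k * m = F i * s + p" "p \<in> idl F S"
  using idl_insert[of S i F] assms(1) by auto
 have "F i * s = F k * m + (- p)" using sp(1) by simp
 moreover have "finite S" by simp
 ultimately have "F i * s \<in> idl F (insert k S)"
  using idl_insert[of S k F] assms(2) idl_minus[OF sp(2)] by blast
 hence "s \<in> idl F (insert k S)" using b by (auto simp: nzd_def)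
 then obtain s' p' where s': "s = F k * s' + p'" "p' \<in> idl F S"
  using idl_insert[of S k F] assms(2) by auto
 have "F k * (m - F i * s') = F i * p' + p" using sp(1) s'(1) by (simp add: algebra_simps)
 moreover have "F i * p' + p \<in> idl F S" using s'(2) sp(2) by (intro idl_add idl_mult)
 ultimately have "m - F i * s' \<in> idl F S" using c by (auto simp: nzd_def)
 hence "F i * s' + (m - F i * s') \<in> idl F (insert i S)"
  unfolding idl_insert[OF finite assms(1)] by blast
 thus "m \<in> idl F (insert i S)" by simp
qed

lemma chr_norm_ge_1: "(\<And>k. norm (b k) \<ge> 1) ==> norm (chr b m) \<ge> 1"
 unfolding chr_def prod_norm[symmetric] norm_power
 by (rule prod_ge_1) (simp add: one_le_power)

lemma filt_chr_idl:
 fixes F :: "'n::finite => 'n mpoly"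
 assumes "\<And>k. k \<in> S ==> graded (chr b) (\<gamma> k) (F k)" "\<And>k. \<gamma> k ~= 0" "p \<in> idl F S"
 shows "filt (%m. chr b m = \<beta>) p \<in> idl F S"
proof -
 obtain r where "p = (\<Sum>k\<in>S. F k * r k)" using assms(3) by (elim idl_E)
 hence "filt (%m. chr b m = \<beta>) p = (\<Sum>k\<in>S. F k * filt (%m. chr b m = \<beta> / \<gamma> k) (r k))"
  by (auto simp: filt_sum intro!: sum.cong filt_chr_mult assms(1,2))
 thus ?thesis by (rule idl_I)
qed

text \<open>Graded Nakayama: a homogeneous \<open>m\<close> with \<open>a * m\<close> in the smaller
  ideal is \<open>F k * s'\<close> modulo that ideal, and \<open>s'\<close> has the same property
  with a character smaller in norm by at least the factor \<open>\<rho>\<close>. Monomials have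
  characters of norm at least 1, so the descent ends in 0.\<close>

lemma nzd_descend:
 fixes F :: "'n::finite => 'n mpoly"
 assumes "k \<notin> S" and gr: "\<And>k. graded (chr b) (\<gamma> k) (F k)" and g0: "\<And>k. \<gamma> k ~= 0"
  and \<rho>: "\<rho> > 1" "norm (\<gamma> k) \<ge> \<rho>" and b1: "\<And>k. norm (b k) \<ge> 1"
  and gra: "graded (chr b) \<delta> a" "\<delta> ~= 0"
  and c: "nzd (F k) (idl F S)" and a: "nzd a (idl F (insert k S))"
 shows "nzd a (idl F S)"
proof -
 \<comment> \<open>\<open>N\<close> bounds the number of divisions by \<open>F k\<close>: below norm
   1 no monomial is left.\<close>
 have main: "m \<in> idl F S" if "norm \<beta> < \<rho> ^ N" "graded (chr b) \<beta> m" "a * m \<in> idl F S" for N \<beta> m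
  using that
 proof (induction N arbitrary: \<beta> m)
  case 0
  have "m' \<notin> supp m" for m'
  proof
   assume "m' \<in> supp m"
   hence "norm (chr b m') < 1" using 0(1,2) by (simp add: graded_def)
   moreover have "1 \<le> norm (chr b m')" by (rule chr_norm_ge_1) (rule b1)
   ultimately show False by simp
  qed
  hence "supp m = {}" by blast
  thus ?case by simp
 next
  case (Suc N)
  have "idl F S \<subseteq> idl F (insert k S)" by (rule idl_mono) auto
  hence "m \<in> idl F (insert k S)" using a Suc(4) by (auto simp: nzd_def)
  then obtain s p where sp: "m = F k * s + p" "p \<in> idl F S"
   using idl_insert[of S k F] assms(1) by auto
  define s' p' where "s' = filt (%m. chr b m = \<beta> / \<gamma> k) s" and "p' = filt (%m. chr b m = \<beta>) p"
  have m: "m = F k * s' + p'"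
   using arg_cong[OF sp(1), of "filt (%m. chr b m = \<beta>)"] Suc(3)
   by (simp add: s'_def p'_def filt_graded filt_chr_mult[OF gr g0])
  have p': "p' \<in> idl F S" unfolding p'_def using filt_chr_idl gr g0 sp(2) by blast
  have "F k * (a * s') = a * m - a * p'" using m by (simp add: algebra_simps)
  also have "\<dots> \<in> idl F S" by (rule idl_diff[OF Suc(4) idl_mult[OF p']])
  finally have "a * s' \<in> idl F S" using c by (auto simp: nzd_def)
  moreover have "norm (\<beta> / \<gamma> k) < \<rho> ^ N"
  proof -
   have "norm \<beta> / norm (\<gamma> k) \<le> norm \<beta> / \<rho>" using \<rho> by (intro divide_left_mono mult_pos_pos) auto
   also have "\<dots> < \<rho> ^ N" using Suc(2) \<rho> by (simp add: field_simps)
   finally show ?thesis by (simp add: norm_divide)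
  qed
  ultimately have "s' \<in> idl F S" using Suc.IH[of "\<beta> / \<gamma> k" s'] by (simp add: s'_def)
  hence "F k * s' + p' \<in> idl F S" using p' by (intro idl_add idl_mult)
  thus ?case by (subst m)
 qed
 show ?thesis unfolding nzd_def
 proof (intro allI impI)
  fix m assume am: "a * m \<in> idl F S"
  \<comment> \<open>The ideal is homogeneous, so each character component of \<open>m\<close> can be
    treated separately.\<close>
  have "filt (%m. chr b m = \<beta>) m \<in> idl F S" for \<beta>
  proof -
   obtain N where "norm \<beta> < \<rho> ^ N" using real_arch_pow[OF \<rho>(1)] by blast
   moreover have "filt (%m. chr b m = \<delta> * \<beta>) (a * m) \<in> idl F S"
    by (rule filt_chr_idl[OF gr g0 am])
   ultimately show ?thesis
    using main[of \<beta> N] gra by (simp add: filt_chr_mult)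
  qed
  hence "(\<Sum>\<beta>\<in>chr b ` supp m. filt (%m. chr b m = \<beta>) m) \<in> idl F S" by (intro idl_sum)
  thus "m \<in> idl F S" using sum_filt[of "chr b ` supp m" "chr b" m] by simp
 qed
qed

section \<open>Dual generators and the exchange of one entry\<close>

definition linear_form :: "('n mpoly => complex) => bool" where
 "linear_form \<phi> \<longleftrightarrow> (\<forall>p q. \<phi> (p + q) = \<phi> p + \<phi> q) \<and> (\<forall>c p. \<phi> (cnst c * p) = c * \<phi> p)"

lemma linear_form_0 [simp]: "linear_form \<phi> ==> \<phi> 0 = 0"
 unfolding linear_form_def by (metis add_cancel_right_right)

lemma linear_form_sum: "linear_form \<phi> ==> \<phi> (sum f A) = (\<Sum>a\<in>A. \<phi> (f a))"
 by (induction A rule: infinite_finite_induct) (auto simp: linear_form_def linear_form_0[unfolded linear_form_def])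

lemma linear_form_diff: "linear_form \<phi> ==> \<phi> (p - q) = \<phi> p - \<phi> q"
 unfolding linear_form_def by (metis add_diff_cancel_right' diff_add_cancel)

text \<open>The bilinear form given by \<open>\<phi> (p * r)\<close> has radical exactly
  \<open>K\<close>, so it induces a nondegenerate pairing on the quotient by
  \<open>K\<close>.\<close>

definition dual_generator :: "('n::finite mpoly => complex) => 'n mpoly set => bool" where
 "dual_generator \<phi> K \<longleftrightarrow> linear_form \<phi> \<and> (\<forall>p. p \<in> K \<longleftrightarrow> (\<forall>r. \<phi> (p * r) = 0))"

text \<open>The functional sees monomials of a single character only, the product of the
  \<open>\<gamma> k\<close> divided by that of the \<open>b k\<close>: the character of the
  socle.\<close>

definition good :: "('n::finite => complex) => ('n => complex) => ('n => 'n mpoly) => bool" where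
 "good b \<gamma> F \<longleftrightarrow> regular_tuple F \<and> (\<exists>\<phi>. dual_generator \<phi> (idl F UNIV) \<and>
  (\<forall>m. \<phi> (term_of m 1) ~= 0 --> chr b m * (\<Prod>k\<in>UNIV. b k) = (\<Prod>k\<in>UNIV. \<gamma> k)))"

lemma nzdD: "nzd b J ==> b * m \<in> J ==> m \<in> J"
 by (simp add: nzd_def)

text \<open>Write \<open>F i = a * u\<close> modulo the other entries. Multiplication by
  \<open>u\<close> embeds the quotient by the new tuple into the quotient by the old one, so
  \<open>\<phi> (u * p)\<close> is the new functional, and its character changes by that of
  \<open>u\<close>.\<close>

lemma good_exchange:
 fixes F :: "'n::finite => 'n mpoly"
 assumes gr: "\<And>k. graded (chr b) (\<gamma> k) (F k)" and g0: "\<And>k. \<gamma> k ~= 0"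
  and \<rho>: "\<rho> > 1" "\<And>k. norm (\<gamma> k) \<ge> \<rho>" and b1: "\<And>k. norm (b k) \<ge> 1"
  and gra: "graded (chr b) \<delta> a" "\<delta> ~= 0"
  and mem: "F i \<in> idl (F(i := a)) UNIV" and good: "good b \<gamma> F"
 shows "good b (\<gamma>(i := \<delta>)) (F(i := a))"
proof -
 let ?F = "F(i := a)"
 have reg: "regular_tuple F" using good by (simp add: good_def)
 have U: "UNIV = insert i (- {i})" by auto
 have cong: "idl ?F S = idl F S" if "i \<notin> S" for S
  using that by (intro idl_cong) auto
 obtain u0 p where F: "F i = a * u0 + p" "p \<in> idl F (- {i})"
  using mem cong[of "- {i}"] idl_insert[of "- {i}" i ?F] U by auto
 \<comment> \<open>Passing to components makes \<open>u\<close> homogeneous, of exactly the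
   character by which that of the socle has to change.\<close>
 define u where "u = filt (%m. chr b m = \<gamma> i / \<delta>) u0"
 define p1 where "p1 = filt (%m. chr b m = \<gamma> i) p"
 have p1: "p1 \<in> idl F (- {i})"
  unfolding p1_def by (rule filt_chr_idl[OF gr g0 F(2)])
 have Fi: "F i = a * u + p1"
  using arg_cong[OF F(1), of "filt (%m. chr b m = \<gamma> i)"]
  by (simp add: u_def p1_def filt_graded[OF gr] filt_chr_mult[OF gra])
 have au: "F i * m \<in> idl F (- {i})" if "a * u * m \<in> idl F (- {i})" for m
  using idl_add[OF that idl_mult2[OF p1, of m]] by (simp add: Fi distrib_right)
 have nF: "nzd (F i) (idl F (- {i}))" using reg by (simp add: regular_tuple_def)
 \<comment> \<open>\<open>a\<close> and \<open>u\<close> divide \<open>F i\<close> modulo the other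
   entries, so both inherit its regularity.\<close>
 have na: "nzd a (idl F (- {i}))"
  unfolding nzd_def
 proof (intro allI impI)
  fix m assume "a * m \<in> idl F (- {i})"
  from idl_mult[OF this, of u] have "a * u * m \<in> idl F (- {i})" by (simp add: algebra_simps)
  from nzdD[OF nF au[OF this]] show "m \<in> idl F (- {i})" .
 qed
 have nu: "nzd u (idl F (- {i}))"
  unfolding nzd_def
 proof (intro allI impI)
  fix m assume "u * m \<in> idl F (- {i})"
  from idl_mult[OF this, of a] have "a * u * m \<in> idl F (- {i})" by (simp add: algebra_simps)
  from nzdD[OF nF au[OF this]] show "m \<in> idl F (- {i})" .
 qed
 \<comment> \<open>Regularity modulo all other entries is passed down to smaller sets by removing
   one entry at a time with \<open>nzd_descend\<close>.\<close>
 have naS: "nzd a (idl F S)" if "i \<notin> S" for S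
  using that
 proof (induction "card (- {i} - S)" arbitrary: S)
  case 0
  hence "S = - {i}" by auto
  thus ?case using na by simp
 next
  case (Suc n)
  hence "- {i} - S ~= {}" by (metis card.empty nat.distinct(1))
  then obtain k where k: "k ~= i" "k \<notin> S" by auto
  have "- {i} - S = insert k (- {i} - insert k S)" using k by auto
  hence "n = card (- {i} - insert k S)" using Suc(2) by (simp add: card_insert_if)
  hence "nzd a (idl F (insert k S))" using Suc(1)[of "insert k S"] Suc(3) k by auto
  moreover have "nzd (F k) (idl F S)" using reg k by (simp add: regular_tuple_def)
  ultimately show ?case using nzd_descend[of k S b \<gamma> F \<rho> \<delta> a] k gr g0 \<rho> b1 gra by blast
 qed
 have reg': "regular_tuple ?F" unfolding regular_tuple_def
 proof (intro allI impI)
  fix S :: "'n set" and j assume j: "j \<notin> S"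
  show "nzd (?F j) (idl ?F S)"
  proof (cases "i \<in> S")
   case False
   thus ?thesis using naS j reg by (cases "j = i") (auto simp: cong regular_tuple_def)
  next
   case True
   \<comment> \<open>The new entry is treated as the last generator and swapped with
     \<open>?F j\<close>.\<close>
   have "nzd (?F j) (idl ?F (insert i (S - {i})))"
   proof (rule nzd_exchange)
    show "nzd (?F j) (idl ?F (S - {i}))"
     using reg j True by (auto simp: cong regular_tuple_def)
    have "i \<notin> insert j (S - {i})" using True j by auto
    thus "nzd (?F i) (idl ?F (insert j (S - {i})))"
     using naS by (simp add: cong)
   qed (use True j in auto)
   thus ?thesis using True by (simp add: insert_absorb)
  qed
 qed
 obtain \<phi> where \<phi>: "dual_generator \<phi> (idl F UNIV)"
  and \<phi>d: "\<And>m. \<phi> (term_of m 1) ~= 0 ==> chr b m * (\<Prod>k\<in>UNIV. b k) = (\<Prod>k\<in>UNIV. \<gamma> k)"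
  using good by (auto simp: good_def)
 have lin: "linear_form \<phi>" and ker: "\<And>p. p \<in> idl F UNIV \<longleftrightarrow> (\<forall>r. \<phi> (p * r) = 0)"
  using \<phi> by (auto simp: dual_generator_def)
 have sub: "idl F (- {i}) \<subseteq> idl F UNIV" by (rule idl_mono) auto
 have Fi_in: "F i \<in> idl F UNIV" by (rule idl_gen) auto
 have "u * a \<in> idl F UNIV"
  using idl_diff[OF Fi_in subsetD[OF sub p1]] by (simp add: Fi mult.commute)
 hence uF: "u * ?F k \<in> idl F UNIV" for k using idl_mult[OF idl_gen[of UNIV k F], of u] by auto
 have ker': "p \<in> idl ?F UNIV \<longleftrightarrow> (\<forall>r. \<phi> (u * (p * r)) = 0)" for p
 proof
  assume "p \<in> idl ?F UNIV"
  then obtain s where "p = (\<Sum>k\<in>UNIV. ?F k * s k)" by (elim idl_E)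
  hence "u * p = (\<Sum>k\<in>UNIV. (u * ?F k) * s k)" by (simp add: sum_distrib_left mult.assoc del: fun_upd_apply)
  also have "\<dots> \<in> idl F UNIV" by (intro idl_sum idl_mult2 uF)
  finally show "\<forall>r. \<phi> (u * (p * r)) = 0" using ker by (simp add: mult.assoc)
 next
  assume "\<forall>r. \<phi> (u * (p * r)) = 0"
  hence "u * p \<in> idl F UNIV" using ker by (simp add: mult.assoc)
  then obtain s q where sq: "u * p = F i * s + q" "q \<in> idl F (- {i})"
   using idl_insert[of "- {i}" i F] U by auto
  hence "u * (p - a * s) = p1 * s + q" by (simp add: Fi algebra_simps)
  also have "\<dots> \<in> idl F (- {i})" using p1 sq(2) by (intro idl_add idl_mult2)
  finally have "p - a * s \<in> idl F (- {i})" using nu nzdD by blast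
  hence "p - a * s \<in> idl ?F (- {i})" by (simp add: cong)
  moreover have "idl ?F (insert i (- {i})) = {a * s + p | s p. p \<in> idl ?F (- {i})}"
   using idl_insert[of "- {i}" i ?F] by simp
  ultimately have "a * s + (p - a * s) \<in> idl ?F (insert i (- {i}))" by blast
  thus "p \<in> idl ?F UNIV" using U by simp
 qed
 have "dual_generator (%p. \<phi> (u * p)) (idl ?F UNIV)"
  unfolding dual_generator_def
 proof (intro conjI allI ker')
  show "linear_form (%p. \<phi> (u * p))"
   unfolding linear_form_def
  proof (intro conjI allI)
   show "\<phi> (u * (p + q)) = \<phi> (u * p) + \<phi> (u * q)" for p q
    using lin by (simp add: linear_form_def distrib_left)
   fix c p
   have "u * (cnst c * p) = cnst c * (u * p)" by (rule mult.left_commute)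
   thus "\<phi> (u * (cnst c * p)) = c * \<phi> (u * p)" using lin unfolding linear_form_def by metis
  qed
 qed
 moreover have "chr b m * (\<Prod>k\<in>UNIV. b k) = (\<Prod>k\<in>UNIV. (\<gamma>(i := \<delta>)) k)"
  if "\<phi> (u * term_of m 1) ~= 0" for m
 proof -
  have "u * term_of m 1 = (\<Sum>m'\<in>supp u. term_of m' (coef u m') * term_of m 1)"
   by (rule trans[OF arg_cong[OF mpoly_eq_sum, of "%b. b * term_of m 1"]]) (rule sum_distrib_right)
  also have "\<dots> = (\<Sum>m'\<in>supp u. cnst (coef u m') * term_of (m' + m) 1)"
   by (simp add: mult_single)
  finally have "\<phi> (u * term_of m 1) = (\<Sum>m'\<in>supp u. coef u m' * \<phi> (term_of (m' + m) 1))"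
   using lin by (simp add: linear_form_sum) (simp add: linear_form_def)
  hence "(\<Sum>m'\<in>supp u. coef u m' * \<phi> (term_of (m' + m) 1)) ~= 0" using that by simp
  then obtain m' where "m' \<in> supp u" "coef u m' * \<phi> (term_of (m' + m) 1) ~= 0"
   by (rule sum.not_neutral_contains_not_neutral)
  hence m': "m' \<in> supp u" "\<phi> (term_of (m' + m) 1) ~= 0" by auto
  have "chr b m' = \<gamma> i / \<delta>" using m'(1) by (simp add: u_def)
  hence "\<gamma> i / \<delta> * chr b m * (\<Prod>k\<in>UNIV. b k) = (\<Prod>k\<in>UNIV. \<gamma> k)"
   using \<phi>d[OF m'(2)] by (simp add: chr_add)
  moreover have "(\<Prod>k\<in>UNIV. \<gamma> k) = \<gamma> i * (\<Prod>k\<in>- {i}. \<gamma> k)" by (subst U) simp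
  moreover have "(\<Prod>k\<in>UNIV. (\<gamma>(i := \<delta>)) k) = \<delta> * (\<Prod>k\<in>- {i}. \<gamma> k)"
  proof -
   have "(\<Prod>k\<in>- {i}. (\<gamma>(i := \<delta>)) k) = (\<Prod>k\<in>- {i}. \<gamma> k)" by (rule prod.cong) auto
   thus ?thesis by (subst U) (simp del: prod.cong)
  qed
  ultimately show ?thesis using g0[of i] gra(2) by (simp add: field_simps del: fun_upd_apply)
 qed
 ultimately show ?thesis using reg' unfolding good_def by blast
qed

lemma coef_term_mult: "coef (term_of t c * p) (t + m) = c * coef p m"
proof (induction p rule: mpoly_induct)
 case (single m' c')
 show ?case by (auto simp: mult_single lookup_single when_def)
qed (auto simp: algebra_simps lookup_add)

lemma expo_sub:
 assumes "e \<le> expo m k"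
 shows "m = Poly_Mapping.single k e + (m - Poly_Mapping.single k e)"
 by (rule poly_mapping_eqI) (use assms in \<open>auto simp: lookup_add lookup_minus lookup_single when_def\<close>)

lemma idl_vpow:
 fixes L :: "'n::finite => nat"
 shows "p \<in> idl (%k. vpow k (L k)) S \<longleftrightarrow> (\<forall>m\<in>supp p. \<exists>k\<in>S. L k \<le> expo m k)"
proof
 assume "p \<in> idl (%k. vpow k (L k)) S"
 then obtain r where p: "p = (\<Sum>k\<in>S. vpow k (L k) * r k)" by (elim idl_E)
 show "\<forall>m\<in>supp p. \<exists>k\<in>S. L k \<le> expo m k"
 proof
  fix m assume "m \<in> supp p"
  hence "\<exists>k\<in>S. m \<in> supp (vpow k (L k) * r k)"
   unfolding p in_keys_iff lookup_sum using sum.not_neutral_contains_not_neutral by blast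
  then obtain k where k: "k \<in> S" "m \<in> supp (vpow k (L k) * r k)" by blast
  then obtain m' where "m = Poly_Mapping.single k (L k) + m'"
   using keys_mult[of "vpow k (L k)" "r k"] by (auto simp: vpow_def)
  hence "L k \<le> expo m k" by (simp add: lookup_add)
  thus "\<exists>k\<in>S. L k \<le> expo m k" using k(1) by blast
 qed
next
 assume *: "\<forall>m\<in>supp p. \<exists>k\<in>S. L k \<le> expo m k"
 have "(\<Sum>m\<in>supp p. term_of m (coef p m)) \<in> idl (%k. vpow k (L k)) S"
 proof (rule idl_sum)
  fix m assume "m \<in> supp p"
  then obtain k where k: "k \<in> S" "L k \<le> expo m k" using * by blast
  have "term_of m (coef p m) = vpow k (L k) * term_of (m - Poly_Mapping.single k (L k)) (coef p m)"
   using expo_sub[OF k(2)] by (simp add: vpow_def mult_single)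
  also have "\<dots> \<in> idl (%k. vpow k (L k)) S"
   using k(1) idl_gen[of S k "%k. vpow k (L k)"] by (intro idl_mult2) auto
  finally show "term_of m (coef p m) \<in> idl (%k. vpow k (L k)) S" .
 qed
 thus "p \<in> idl (%k. vpow k (L k)) S" using mpoly_eq_sum[of p] by simp
qed

text \<open>The functional reads off the coefficient of the socle monomial, whose exponents are
  \<open>L k - 1\<close>; every monomial outside the ideal divides it.\<close>

lemma good_vpow:
 fixes L :: "'n::finite => nat"
 assumes L: "\<And>k. L k > 0"
 shows "good b (%k. b k ^ L k) (%k. vpow k (L k))"
proof -
 let ?F = "%k. vpow k (L k) :: 'n mpoly"
 have reg: "regular_tuple ?F"
  unfolding regular_tuple_def nzd_def
 proof (intro allI impI)
  fix S i m assume i: "i \<notin> S" and m: "?F i * m \<in> idl ?F S"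
  show "m \<in> idl ?F S"
   unfolding idl_vpow
  proof
   fix t assume "t \<in> supp m"
   hence "Poly_Mapping.single i (L i) + t \<in> supp (?F i * m)"
    by (simp add: in_keys_iff vpow_def coef_term_mult)
   then obtain k where "k \<in> S" "L k \<le> expo (Poly_Mapping.single i (L i) + t) k"
    using m unfolding idl_vpow by blast
   moreover from this have "k ~= i" using i by auto
   ultimately show "\<exists>k\<in>S. L k \<le> expo t k" by (auto simp: lookup_add lookup_single)
  qed
 qed
 define top where "top = (\<Sum>k\<in>UNIV. Poly_Mapping.single k (L k - 1))"
 have top: "expo top k = L k - 1" for k
  by (simp add: top_def lookup_sum lookup_single when_def)
 have ker: "p \<in> idl ?F UNIV \<longleftrightarrow> (\<forall>r. coef (p * r) top = 0)" for p
 proof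
  assume "p \<in> idl ?F UNIV"
  show "\<forall>r. coef (p * r) top = 0"
  proof (rule allI, rule ccontr)
   fix r assume "coef (p * r) top ~= 0"
   hence "top \<in> supp (p * r)" by (simp add: in_keys_iff)
   moreover have "p * r \<in> idl ?F UNIV" using \<open>p \<in> _\<close> by (rule idl_mult2)
   ultimately obtain k where "L k \<le> expo top k" unfolding idl_vpow by blast
   thus False using L[of k] by (simp add: top)
  qed
 next
  assume *: "\<forall>r. coef (p * r) top = 0"
  show "p \<in> idl ?F UNIV"
   unfolding idl_vpow
  proof (rule ballI, rule ccontr)
   fix m assume m: "m \<in> supp p" and "\<not> (\<exists>k\<in>UNIV. L k \<le> expo m k)"
   hence le: "expo m k \<le> L k - 1" for k using L[of k] by (metis One_nat_def Suc_pred UNIV_I less_Suc_eq_le not_le)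
   have "top = (top - m) + m"
   proof (rule poly_mapping_eqI)
    fix k
    show "expo top k = expo (top - m + m) k"
     unfolding lookup_add lookup_minus top using le[of k] by arith
   qed
   hence "coef (term_of (top - m) 1 * p) top = coef p m"
    using coef_term_mult[of "top - m" 1 p m] by simp
   thus False using * m by (simp add: mult.commute in_keys_iff)
  qed
 qed
 have "dual_generator (%p. coef p top) (idl ?F UNIV)"
  unfolding dual_generator_def
 proof (intro conjI allI ker)
  have "coef (cnst c * p) top = c * coef p top" for c p
   using coef_term_mult[of 0 c p top] by simp
  thus "linear_form (%p. coef p top)" by (simp add: linear_form_def lookup_add)
 qed
 moreover have "chr b m * (\<Prod>k\<in>UNIV. b k) = (\<Prod>k\<in>UNIV. b k ^ L k)" if "coef (term_of m 1) top ~= 0" for m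
 proof -
  have "m = top" using that by (auto simp: lookup_single when_def split: if_splits)
  hence "chr b m * (\<Prod>k\<in>UNIV. b k) = (\<Prod>k\<in>UNIV. b k ^ (L k - 1) * b k)"
   by (simp add: chr_def top prod.distrib)
  also have "\<dots> = (\<Prod>k\<in>UNIV. b k ^ L k)"
  proof (rule prod.cong)
   fix k show "b k ^ (L k - 1) * b k = b k ^ L k" using L[of k] by (cases "L k") auto
  qed simp
  finally show ?thesis .
 qed
 ultimately show ?thesis using reg unfolding good_def by blast
qed

section \<open>Hilbert's Nullstellensatz\<close>

text \<open>Gaussian elimination of the coordinate \<open>b\<close> with pivot \<open>a0\<close>;
  \<open>l0\<close> is solved from that equation. Both the Nullstellensatz and
  \<open>finite_fibre\<close> use this in place of a dimension argument.\<close>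

lemma linear_dependence:
 fixes r :: "'a => 'b => 'c::field"
 assumes "finite B" "finite A" "card B < card A"
 shows "\<exists>l. (\<exists>a\<in>A. l a ~= 0) \<and> (\<forall>b\<in>B. (\<Sum>a\<in>A. l a * r a b) = 0)"
 using assms
proof (induction B arbitrary: A r rule: finite_induct)
 case empty
 then obtain a where "a \<in> A" by fastforce
 thus ?case by (intro exI[of _ "%_. 1"]) auto
next
 case (insert b B)
 show ?case
 proof (cases "\<forall>a\<in>A. r a b = 0")
  case True
  have "card B < card A" using insert by simp
  from insert.IH[OF insert.prems(1) this, of r] obtain l
   where l: "\<exists>a\<in>A. l a ~= 0" "\<forall>b\<in>B. (\<Sum>a\<in>A. l a * r a b) = 0" by blast
  have "(\<Sum>a\<in>A. l a * r a b) = 0" by (rule sum.neutral) (use True in simp)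
  thus ?thesis using l by (intro exI[of _ l]) simp
 next
  case False
  then obtain a0 where a0: "a0 \<in> A" "r a0 b ~= 0" by blast
  define A' where "A' = A - {a0}"
  have A: "A = insert a0 A'" "a0 \<notin> A'" "finite A'" using a0 insert.prems by (auto simp: A'_def)
  have "card B < card A'" using insert.prems insert.hyps A by simp
  from insert.IH[OF A(3) this, of "%a c. r a c - r a b / r a0 b * r a0 c"] obtain l
   where l: "\<exists>a\<in>A'. l a ~= 0"
    "\<And>c. c \<in> B ==> (\<Sum>a\<in>A'. l a * (r a c - r a b / r a0 b * r a0 c)) = 0" by blast
  define l0 where "l0 = - (\<Sum>a\<in>A'. l a * r a b) / r a0 b"
  define l' where "l' = (%a. if a = a0 then l0 else l a)"
  have s: "(\<Sum>a\<in>A. l' a * r a c) = l0 * r a0 c + (\<Sum>a\<in>A'. l a * r a c)" for c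
  proof -
   have "(\<Sum>a\<in>A'. l' a * r a c) = (\<Sum>a\<in>A'. l a * r a c)"
    by (rule sum.cong) (use A in \<open>auto simp: l'_def\<close>)
   thus ?thesis using A by (simp add: l'_def)
  qed
  have "(\<Sum>a\<in>A. l' a * r a c) = 0" if "c \<in> B" for c
  proof -
   have "(\<Sum>a\<in>A'. l a * (r a c - r a b / r a0 b * r a0 c)) =
      (\<Sum>a\<in>A'. l a * r a c) - (\<Sum>a\<in>A'. l a * r a b) / r a0 b * r a0 c"
    by (simp add: right_diff_distrib sum_subtractf sum_distrib_right sum_divide_distrib mult.assoc)
   thus ?thesis using l(2)[OF that] s[of c] by (simp add: l0_def)
  qed
  moreover have "(\<Sum>a\<in>A. l' a * r a b) = 0" using s[of b] a0 by (simp add: l0_def)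
  moreover have "\<exists>a\<in>A. l' a ~= 0" using l(1) A by (auto simp: l'_def)
  ultimately show ?thesis by (intro exI[of _ l']) simp
 qed
qed

text \<open>Arbitrary ideals, because the Nullstellensatz enlarges an ideal step by step without
  tracking generators.\<close>

definition ideal_set :: "'r::comm_ring_1 set => bool" where
 "ideal_set J \<longleftrightarrow> 0 \<in> J \<and> (\<forall>p\<in>J. \<forall>q\<in>J. p + q \<in> J) \<and> (\<forall>p\<in>J. \<forall>c. c * p \<in> J)"

lemma ideal_setD:
 assumes "ideal_set J"
 shows "0 \<in> J" "p \<in> J ==> q \<in> J ==> p + q \<in> J" "p \<in> J ==> c * p \<in> J"
  "p \<in> J ==> p * c \<in> J" "p \<in> J ==> q \<in> J ==> p - q \<in> J"
proof -
 show "0 \<in> J" "p \<in> J ==> q \<in> J ==> p + q \<in> J" and m: "p \<in> J ==> c * p \<in> J"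
  using assms by (auto simp: ideal_set_def)
 show "p \<in> J ==> p * c \<in> J" using m by (simp add: mult.commute)
 have "p \<in> J ==> q \<in> J ==> p + (-1) * q \<in> J" using assms unfolding ideal_set_def by blast
 thus "p \<in> J ==> q \<in> J ==> p - q \<in> J" by simp
qed

lemma ideal_set_sum: "ideal_set J ==> (\<And>a. a \<in> A ==> f a \<in> J) ==> sum f A \<in> J"
 by (induction A rule: infinite_finite_induct) (auto intro: ideal_setD)

definition eval_at :: "'n mpoly => complex poly => 'n mpoly" where
 "eval_at Y q = poly (map_poly cnst q) Y"

lemma eval_at_0 [simp]: "eval_at Y 0 = 0"
 by (simp add: eval_at_def)

lemma eval_at_pCons [simp]: "eval_at Y (pCons a q) = cnst a + Y * eval_at Y q"
 by (simp add: eval_at_def map_poly_pCons)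

lemma eval_at_add [simp]: "eval_at Y (p + q) = eval_at Y p + eval_at Y q"
 by (induction p q rule: poly_induct2) (simp_all add: single_add algebra_simps)

lemma eval_at_smult [simp]: "eval_at Y (Polynomial.smult c p) = cnst c * eval_at Y p"
 by (induction p) (simp_all add: mult_single algebra_simps)

lemma eval_at_mult [simp]: "eval_at Y (p * q) = eval_at Y p * eval_at Y q"
 by (induction p) (simp_all add: algebra_simps)

lemma eval_at_1 [simp]: "eval_at Y 1 = 1"
 by (simp add: one_pCons)

lemma eval_at_sum [simp]: "eval_at Y (sum f A) = (\<Sum>a\<in>A. eval_at Y (f a))"
 by (induction A rule: infinite_finite_induct) auto

lemma eval_at_prod [simp]: "eval_at Y (prod f A) = (\<Prod>a\<in>A. eval_at Y (f a))"
 by (induction A rule: infinite_finite_induct) auto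

lemma finite_bounded_expo: "finite {m :: 'n::finite \<Rightarrow>\<^sub>0 nat. \<forall>k. expo m k \<le> D}"
proof -
 have "finite (expo ` {m :: 'n \<Rightarrow>\<^sub>0 nat. \<forall>k. expo m k \<le> D})"
  by (rule finite_subset[of _ "PiE UNIV (%_. {..D})"]) (auto intro: finite_PiE)
 thus ?thesis by (rule finite_imageD) (auto intro: inj_onI poly_mapping_eqI)
qed

lemma supp_bounded_expo:
 fixes p :: "'n::finite mpoly"
 shows "\<exists>D. \<forall>m\<in>supp p. \<forall>k. expo m k \<le> D"
proof (intro exI ballI allI)
 fix m k assume "m \<in> supp p"
 hence "expo m k \<le> (\<Sum>k\<in>UNIV. expo m k)" by (intro member_le_sum) auto
 also have "\<dots> \<le> (\<Sum>m\<in>supp p. \<Sum>k\<in>UNIV. expo m k)" using \<open>m \<in> supp p\<close>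
  by (intro member_le_sum) auto
 finally show "expo m k \<le> (\<Sum>m\<in>supp p. \<Sum>k\<in>UNIV. expo m k)" .
qed

text \<open>Otherwise every \<open>x\<^sub>k - c\<close> has an inverse \<open>s c\<close> modulo \<open>J\<close>; as \<open>\<complex>\<close> is uncountable, these inverses
 satisfy a linear relation, and clearing denominators puts a nonzero polynomial in \<open>x\<^sub>k\<close> into \<open>J\<close>.\<close>

lemma nullstellensatz_step:
 fixes J :: "'n::finite mpoly set"
 assumes J: "ideal_set J" and "1 \<notin> J"
 shows "\<exists>c. \<forall>q\<in>J. \<forall>s. q + (Var k - cnst c) * s ~= 1"
proof (rule ccontr)
 assume "\<not> ?thesis"
 hence "\<forall>c. \<exists>s. \<exists>q\<in>J. q + (Var k - cnst c) * s = 1" by blast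
 then obtain s where "\<forall>c. \<exists>q\<in>J. q + (Var k - cnst c) * s c = 1" by metis
 hence s: "1 - (Var k - cnst c) * s c \<in> J" for c by (metis add_diff_cancel_right')
 define Mon where "Mon = (%D. {m :: 'n \<Rightarrow>\<^sub>0 nat. \<forall>k. expo m k \<le> D})"
 \<comment> \<open>Uncountably many \<open>c\<close> are distributed over countably many finite sets
   of monomials, so one of these sets serves infinitely many \<open>c\<close>, in particular more
   than it has monomials.\<close>
 have "\<exists>D. infinite {c. supp (s c) \<subseteq> Mon D}"
 proof (rule ccontr)
  assume "\<not> ?thesis"
  hence "countable (\<Union>D. {c. supp (s c) \<subseteq> Mon D})" by (auto intro: countable_finite)
  moreover have "\<exists>D. supp (s c) \<subseteq> Mon D" for c
   using supp_bounded_expo[of "s c"] unfolding Mon_def by blast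
  hence "(\<Union>D. {c. supp (s c) \<subseteq> Mon D}) = UNIV" by blast
  ultimately have "countable (UNIV :: complex set)" by simp
  hence "countable (of_real ` UNIV :: complex set)" by (rule countable_subset[rotated]) auto
  hence "countable (UNIV :: real set)"
   by (rule countable_image_inj_on) (auto intro: inj_onI)
  thus False using uncountable_UNIV_real by blast
 qed
 then obtain D where "infinite {c. supp (s c) \<subseteq> Mon D}" by blast
 from infinite_arbitrarily_large[OF this, of "Suc (card (Mon D))"]
 obtain A where A: "finite A" "card A = Suc (card (Mon D))" "A \<subseteq> {c. supp (s c) \<subseteq> Mon D}" by blast
 have "finite (Mon D)" unfolding Mon_def by (rule finite_bounded_expo)
 from linear_dependence[OF this A(1), of "%c m. coef (s c) m"] A(2)
 obtain l where l: "\<exists>c\<in>A. l c ~= 0" "\<And>m. m \<in> Mon D ==> (\<Sum>c\<in>A. l c * coef (s c) m) = 0" by auto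
 have ls: "(\<Sum>c\<in>A. cnst (l c) * s c) = 0"
 proof (rule poly_mapping_eqI)
  fix m
  have "coef (cnst (l c) * s c) m = l c * coef (s c) m" for c
   using coef_term_mult[of 0 "l c" "s c" m] by simp
  hence "coef (\<Sum>c\<in>A. cnst (l c) * s c) m = (\<Sum>c\<in>A. l c * coef (s c) m)"
   by (simp add: lookup_sum)
  also have "\<dots> = 0"
  proof (cases "m \<in> Mon D")
   case False
   hence "m \<notin> supp (s c)" if "c \<in> A" for c using A(3) that by blast
   hence "coef (s c) m = 0" if "c \<in> A" for c using that by (simp add: in_keys_iff)
   thus ?thesis by simp
  qed (rule l(2))
  finally show "coef (\<Sum>c\<in>A. cnst (l c) * s c) m = coef 0 m" by simp
 qed
 define q where "q = (\<Sum>c\<in>A. Polynomial.smult (l c) (\<Prod>c'\<in>A - {c}. [:- c', 1:]))"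
 define Y :: "'n mpoly" where "Y = Var k"
 have lin: "eval_at Y [:- c, 1:] = Y - cnst c" for c by (simp add: single_uminus)
 have "q ~= 0"
 proof
  obtain c where c: "c \<in> A" "l c ~= 0" using l(1) by blast
  have "poly q c = (\<Sum>a\<in>A. l a * (\<Prod>c'\<in>A - {a}. c - c'))" by (simp add: q_def poly_sum poly_prod)
  also have "\<dots> = (\<Sum>a\<in>A. if a = c then l c * (\<Prod>c'\<in>A - {c}. c - c') else 0)"
   by (rule sum.cong) (use A(1) c(1) in \<open>auto simp: prod_zero_iff\<close>)
  also have "\<dots> = l c * (\<Prod>c'\<in>A - {c}. c - c')" using A(1) c(1) by simp
  also have "\<dots> ~= 0" using A(1) c by auto
  moreover assume "q = 0"
  ultimately show False by simp
 qed
 have "eval_at Y q \<in> J"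
 proof -
  have "eval_at Y q = eval_at Y q - (\<Sum>c\<in>A. cnst (l c) * s c) * (\<Prod>c'\<in>A. Y - cnst c')"
   by (simp add: ls)
  also have "\<dots> = (\<Sum>c\<in>A. cnst (l c) * (1 - (Y - cnst c) * s c) * (\<Prod>c'\<in>A - {c}. Y - cnst c'))"
   unfolding q_def eval_at_sum eval_at_smult eval_at_prod lin sum_distrib_right sum_subtractf[symmetric]
  proof (rule sum.cong)
   fix c assume "c \<in> A"
   hence "(\<Prod>c'\<in>A. Y - cnst c') = (Y - cnst c) * (\<Prod>c'\<in>A - {c}. Y - cnst c')"
    using A(1) by (simp add: prod.remove)
   thus "cnst (l c) * (\<Prod>c'\<in>A - {c}. Y - cnst c') - cnst (l c) * s c * (\<Prod>c'\<in>A. Y - cnst c') =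
    cnst (l c) * (1 - (Y - cnst c) * s c) * (\<Prod>c'\<in>A - {c}. Y - cnst c')"
    by (simp only:) (simp add: algebra_simps)
  qed auto
  also have "\<dots> \<in> J"
   using s by (intro ideal_set_sum J ideal_setD(4)[OF J] ideal_setD(3)[OF J]) (simp add: Y_def)
  finally show ?thesis .
 qed
 \<comment> \<open>A nonzero polynomial in one variable splits into linear factors. Each factor is
   invertible modulo \<open>J\<close> by assumption, so membership would bring 1 into
   \<open>J\<close>.\<close>
 moreover have "eval_at Y p \<notin> J" if "p ~= 0" for p
  using that
 proof (induction "Polynomial.degree p" arbitrary: p)
  case 0
  then obtain a where a: "p = [:a:]" "a ~= 0" by (metis degree_eq_zeroE pCons_0_0)
  show ?case
  proof
   assume "eval_at Y p \<in> J"
   hence "cnst (inverse a) * cnst a \<in> J" using a ideal_setD(3)[OF J] by simp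
   thus False using \<open>1 \<notin> J\<close> a by (simp add: mult_single)
  qed
 next
  case (Suc n)
  then obtain z where "poly p z = 0" using alg_closed_imp_poly_has_root[of p] by auto
  then obtain p' where p': "p = [:- z, 1:] * p'" using poly_eq_0_iff_dvd by blast
  hence "p' ~= 0" using Suc(3) by auto
  moreover have "Polynomial.degree p = Polynomial.degree [:- z, 1:] + Polynomial.degree p'"
   unfolding p' by (rule degree_mult_eq) (use \<open>p' ~= 0\<close> in auto)
  hence "n = Polynomial.degree p'" using Suc(2) by simp
  ultimately have "eval_at Y p' \<notin> J" using Suc(1) by blast
  show ?case
  proof
   assume "eval_at Y p \<in> J"
   hence h: "(Y - cnst z) * eval_at Y p' \<in> J" unfolding p' eval_at_mult lin .
   have "s z * ((Y - cnst z) * eval_at Y p') + (1 - (Y - cnst z) * s z) * eval_at Y p' \<in> J"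
    by (rule ideal_setD(2)[OF J ideal_setD(3)[OF J h] ideal_setD(4)[OF J s[of z, folded Y_def]]])
   thus False using \<open>eval_at Y p' \<notin> J\<close> by (simp add: algebra_simps)
  qed
 qed
 ultimately show False using \<open>q ~= 0\<close> by blast
qed

text \<open>Adjoining \<open>Var k - cnst (c k)\<close> for one variable after another keeps 1
  outside the ideal. In the end every polynomial is congruent to its value at \<open>c\<close>, and
  a nonzero constant in the ideal would be a unit.\<close>

theorem weak_nullstellensatz:
 fixes J :: "'n::finite mpoly set"
 assumes "ideal_set J" "1 \<notin> J"
 shows "\<exists>c. \<forall>p\<in>J. ev p c = 0"
proof -
 have "\<exists>c :: 'n => complex. \<exists>J'. ideal_set J' \<and> J \<subseteq> J' \<and> 1 \<notin> J' \<and> (\<forall>k\<in>T. Var k - cnst (c k) \<in> J')"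
  if "finite T" for T
  using that
 proof (induction T rule: finite_induct)
  case empty thus ?case using assms by auto
 next
  case (insert k T)
  then obtain c J' where J': "ideal_set J'" "J \<subseteq> J'" "1 \<notin> J'" "\<forall>k\<in>T. Var k - cnst (c k) \<in> J'" by blast
  obtain z where z: "\<And>q s. q \<in> J' ==> q + (Var k - cnst z) * s ~= 1"
   using nullstellensatz_step[OF J'(1,3), of k] by blast
  define K where "K = {q + (Var k - cnst z) * s | q s. q \<in> J'}"
  have "ideal_set K"
   unfolding ideal_set_def
  proof (intro conjI ballI allI)
   have "0 + (Var k - cnst z) * 0 \<in> K" unfolding K_def using ideal_setD(1)[OF J'(1)] by blast
   thus "0 \<in> K" by simp
   fix p assume "p \<in> K"
   then obtain q s where p: "p = q + (Var k - cnst z) * s" "q \<in> J'" by (auto simp: K_def)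
   { fix p' assume "p' \<in> K"
    then obtain q' s' where p': "p' = q' + (Var k - cnst z) * s'" "q' \<in> J'" by (auto simp: K_def)
    have "p + p' = (q + q') + (Var k - cnst z) * (s + s')" by (simp add: p p' algebra_simps)
    thus "p + p' \<in> K" using ideal_setD(2)[OF J'(1) p(2) p'(2)] unfolding K_def by blast }
   fix c have "c * p = c * q + (Var k - cnst z) * (c * s)" by (simp add: p algebra_simps)
   thus "c * p \<in> K" using ideal_setD(3)[OF J'(1) p(2)] unfolding K_def by blast
  qed
  moreover have sub: "J' \<subseteq> K"
  proof
   fix q assume "q \<in> J'"
   hence "q + (Var k - cnst z) * 0 \<in> K" unfolding K_def by blast
   thus "q \<in> K" by simp
  qed
  moreover have "1 \<notin> K" using z by (auto simp: K_def)
  moreover have "Var i - cnst ((c(k := z)) i) \<in> K" if "i \<in> insert k T" for i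
  proof (cases "i = k")
   case True
   have "0 + (Var k - cnst z) * 1 \<in> K" unfolding K_def using ideal_setD(1)[OF J'(1)] by blast
   thus ?thesis using True by simp
  qed (use that J'(4) sub in auto)
  ultimately show ?case using J'(2) by blast
 qed
 from this[of UNIV] obtain c :: "'n => complex" and J'
  where J': "ideal_set J'" "J \<subseteq> J'" "1 \<notin> J'" "\<And>k. Var k - cnst (c k) \<in> J'" by auto
 have cong: "p - cnst (ev p (\<chi> k. c k)) \<in> J'" for p
 proof (induction p rule: mpoly_ring_induct)
  case (cnst c) show ?case using ideal_setD(1)[OF J'(1)] by simp
 next
  case (var k) show ?case using J'(4) by simp
 next
  case (add p q)
  from ideal_setD(2)[OF J'(1) this] show ?case by (simp add: single_add algebra_simps)
 next
  case (mult p q)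
  have "p * q - cnst (ev (p * q) (\<chi> k. c k)) =
   (p - cnst (ev p (\<chi> k. c k))) * q + cnst (ev p (\<chi> k. c k)) * (q - cnst (ev q (\<chi> k. c k)))"
   by (simp add: algebra_simps mult_single)
  thus ?case using mult ideal_setD(2-4)[OF J'(1)] by simp
 qed
 have "ev p (\<chi> k. c k) = 0" if "p \<in> J" for p
 proof (rule ccontr)
  assume n: "ev p (\<chi> k. c k) ~= 0"
  have "p - (p - cnst (ev p (\<chi> k. c k))) \<in> J'"
   by (rule ideal_setD(5)[OF J'(1)]) (use that J'(2) cong in blast)+
  hence "cnst (inverse (ev p (\<chi> k. c k))) * cnst (ev p (\<chi> k. c k)) \<in> J'"
   using ideal_setD(3)[OF J'(1)] by simp
  thus False using n J'(3) by (simp add: mult_single)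
 qed
 thus ?thesis by blast
qed

text \<open>The degrees of the coefficients are recorded for later descents;
  \<open>wdeg d m + \<delta> k = w\<close> avoids a truncating subtraction.\<close>

lemma filt_wdeg_idl:
 fixes F :: "'n::finite => 'n mpoly"
 assumes "\<And>k. k \<in> S ==> wgraded d (\<delta> k) (F k)" "p \<in> idl F S"
 shows "\<exists>r. (\<forall>k. supp (r k) \<subseteq> {m. wdeg d m + \<delta> k = w}) \<and> filt (%m. wdeg d m = w) p = (\<Sum>k\<in>S. F k * r k)"
proof -
 obtain r where r: "p = (\<Sum>k\<in>S. F k * r k)" using assms(2) by (elim idl_E)
 define r' where "r' = (%k. filt (%m. wdeg d m + \<delta> k = w) (r k))"
 have "filt (%m. wdeg d m = w) (F k * r k) = F k * r' k" if "k \<in> S" for k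
  unfolding r'_def
  by (rule filt_mult) (use assms(1)[OF that] in \<open>auto simp: graded_def wdeg_add\<close>)
 hence "filt (%m. wdeg d m = w) p = (\<Sum>k\<in>S. F k * r' k)" by (simp add: r filt_sum)
 thus ?thesis by (intro exI[of _ r']) (auto simp: r'_def)
qed

lemma filt_wdeg_idl':
 fixes F :: "'n::finite => 'n mpoly"
 assumes "\<And>k. k \<in> S ==> wgraded d (\<delta> k) (F k)" "p \<in> idl F S"
 shows "filt (%m. wdeg d m = w) p \<in> idl F S"
 using filt_wdeg_idl[OF assms, where w = w] by (auto intro: idl_I)

definition only_zero :: "('i => 'n::finite mpoly) => bool" where
 "only_zero F \<longleftrightarrow> (\<forall>x. (\<forall>k. ev (F k) x = 0) --> x = 0)"

text \<open>On the hyperplane where the k-th coordinate is 1 the entries have no common zero, so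
  \<open>1 = q + (Var k - 1) * s\<close> with \<open>q\<close> in the ideal. Comparing weight
  components telescopes: \<open>vpow k j\<close> is congruent to minus the component of
  \<open>s\<close> of weight \<open>j * d k\<close>, which vanishes for large
  \<open>j\<close>.\<close>

theorem homogeneous_nullstellensatz:
 fixes F :: "'n::finite => 'n mpoly"
 assumes gr: "\<And>k. wgraded d (\<delta> k) (F k)" and d: "\<And>k. d k > 0" and z: "only_zero F"
 shows "\<exists>M. \<forall>e\<ge>M. vpow k e \<in> idl F UNIV"
proof -
 define J where "J = {q + (Var k - 1) * s | q s. q \<in> idl F UNIV}"
 have "ideal_set J"
  unfolding ideal_set_def
 proof (intro conjI ballI allI)
  have "0 + (Var k - 1) * 0 \<in> J" unfolding J_def using idl_0 by blast
  thus "0 \<in> J" by simp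
  fix p assume "p \<in> J"
  then obtain q s where p: "p = q + (Var k - 1) * s" "q \<in> idl F UNIV" by (auto simp: J_def)
  { fix p' assume "p' \<in> J"
   then obtain q' s' where p': "p' = q' + (Var k - 1) * s'" "q' \<in> idl F UNIV" by (auto simp: J_def)
   have "p + p' = (q + q') + (Var k - 1) * (s + s')" by (simp add: p p' algebra_simps)
   thus "p + p' \<in> J" using idl_add[OF p(2) p'(2)] unfolding J_def by blast }
  fix c have "c * p = c * q + (Var k - 1) * (c * s)" by (simp add: p algebra_simps)
  thus "c * p \<in> J" using idl_mult[OF p(2)] unfolding J_def by blast
 qed
 moreover have "\<not> (\<forall>p\<in>J. ev p c = 0)" for c
 proof
  assume *: "\<forall>p\<in>J. ev p c = 0"
  have "ev (F i) c = 0" for i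
  proof -
   have "F i \<in> idl F UNIV" by (rule idl_gen) auto
   hence "F i + (Var k - 1) * 0 \<in> J" unfolding J_def by blast
   thus ?thesis using * by fastforce
  qed
  hence "c = 0" using z by (simp add: only_zero_def)
  moreover have "0 + (Var k - 1) * 1 \<in> J" unfolding J_def using idl_0 by blast
  ultimately show False using * by fastforce
 qed
 ultimately have "1 \<in> J" using weak_nullstellensatz by blast
 then obtain q s where qs: "1 = q + (Var k - 1) * s" "q \<in> idl F UNIV" by (auto simp: J_def)
 define f where "f = (%w p. filt (%m. wdeg d m = w) p :: 'n mpoly)"
 have fq: "f w q \<in> idl F UNIV" for w unfolding f_def by (rule filt_wdeg_idl'[OF gr qs(2)])
 have q_eq: "q = 1 + s - Var k * s" using qs(1) by (simp add: algebra_simps)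
 have gk: "wgraded d (d k) (Var k)" by (simp add: graded_def vpow_def)
 have f1: "f w 1 = (if w = 0 then 1 else 0)" for w
  unfolding f_def by (rule poly_mapping_eqI) (auto simp: lookup_one when_def)
 have main: "vpow k j + f (j * d k) s \<in> idl F UNIV" for j
 proof (induction j)
  case 0
  have "f 0 (Var k * s) = 0" unfolding f_def by (rule filt_wdeg_mult_lt[OF gk]) (rule d)
  hence "f 0 q = 1 + f 0 s" using f1[of 0] by (simp add: q_eq) (simp add: f_def)
  thus ?case using fq[of 0] by simp
 next
  case (Suc j)
  have "f (Suc j * d k) (Var k * s) = Var k * f (j * d k) s"
   using filt_wdeg_mult[OF gk, of "j * d k" s] by (simp add: f_def)
  hence "f (Suc j * d k) q = f (Suc j * d k) s - Var k * f (j * d k) s"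
   using f1[of "Suc j * d k"] d[of k] by (simp add: q_eq) (simp add: f_def)
  moreover have "vpow k (Suc j) = Var k * vpow k j" using vpow_add[of k 1 j] by simp
  ultimately have "vpow k (Suc j) + f (Suc j * d k) s =
    f (Suc j * d k) q + Var k * (vpow k j + f (j * d k) s)"
   by (simp add: algebra_simps)
  thus ?case using fq idl_add idl_mult[OF Suc] by metis
 qed
 define M where "M = Suc (\<Sum>m\<in>supp s. wdeg d m)"
 have "vpow k e \<in> idl F UNIV" if "e \<ge> M" for e
 proof -
  have "f (e * d k) s = 0"
   unfolding f_def
  proof (rule filt_eq_0)
   fix m assume "m \<in> supp s"
   hence "wdeg d m \<le> (\<Sum>m\<in>supp s. wdeg d m)" by (intro member_le_sum) auto
   also have "\<dots> < e" using that by (simp add: M_def)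
   also have "e \<le> e * d k" using d[of k] by simp
   finally show "wdeg d m ~= e * d k" by simp
  qed
  thus ?thesis using main[of e] by simp
 qed
 thus ?thesis by blast
qed

section \<open>Homogeneous systems of parameters\<close>

text \<open>The coefficient at an index where the new vector is nonzero is moved by
  \<open>\<epsilon>\<close>; each vector excludes at most one value of
  \<open>\<epsilon>\<close>.\<close>

lemma exists_generic_form:
 fixes P :: "('n::finite => complex) set"
 assumes "finite P" "\<And>v. v \<in> P ==> \<exists>k. v k ~= 0"
 shows "\<exists>c. \<forall>v\<in>P. (\<Sum>k\<in>UNIV. c k * v k) ~= 0"
 using assms
proof (induction P rule: finite_induct)
 case (insert v P)
 then obtain c where c: "\<And>u. u \<in> P ==> (\<Sum>k\<in>UNIV. c k * u k) ~= 0" by auto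
 obtain k0 where k0: "v k0 ~= 0" using insert.prems by auto
 define B where "B = (%u. - (\<Sum>k\<in>UNIV. c k * u k) / u k0) ` insert v P \<union> {0}"
 have "finite B" using insert.hyps by (simp add: B_def)
 from ex_new_if_finite[OF infinite_UNIV_char_0 this] obtain \<epsilon> where \<epsilon>: "\<epsilon> \<notin> B" by blast
 have s: "(\<Sum>k\<in>UNIV. (c(k0 := c k0 + \<epsilon>)) k * u k) = (\<Sum>k\<in>UNIV. c k * u k) + \<epsilon> * u k0" for u :: "'n => complex"
 proof -
  have "(\<Sum>k\<in>UNIV. (c(k0 := c k0 + \<epsilon>)) k * u k) = (\<Sum>k\<in>UNIV. c k * u k + (if k = k0 then \<epsilon> * u k0 else 0))"
   by (rule sum.cong) (auto simp: algebra_simps)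
  thus ?thesis by (simp add: sum.distrib)
 qed
 have "(\<Sum>k\<in>UNIV. (c(k0 := c k0 + \<epsilon>)) k * u k) ~= 0" if "u \<in> insert v P" for u
 proof
  assume "(\<Sum>k\<in>UNIV. (c(k0 := c k0 + \<epsilon>)) k * u k) = 0"
  hence eq: "(\<Sum>k\<in>UNIV. c k * u k) + \<epsilon> * u k0 = 0" using s[of u] by metis
  show False
  proof (cases "u k0 = 0")
   case True
   hence "u \<in> P" using that k0 by auto
   thus False using c[of u] eq True by simp
  next
   case False
   hence "\<epsilon> = - (\<Sum>k\<in>UNIV. c k * u k) / u k0" using eq by (simp add: field_simps add_eq_0_iff)
   thus False using \<epsilon> that by (auto simp: B_def)
  qed
 qed
 thus ?case by blast
qed simp

lemma graded_vpow: "wgraded d (d k * e) (vpow k e)" "graded (chr a) (a k ^ e) (vpow k e)"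
 by (simp_all add: graded_def vpow_def)

lemma graded_cnst: "wgraded d 0 (cnst c)" "graded (chr a) 1 (cnst c)"
 by (auto simp: graded_def)

lemma ev_scale:
 fixes p :: "'n::finite mpoly"
 assumes "wgraded d \<delta> p"
 shows "ev p (\<chi> k. t ^ d k * x $ k) = t ^ \<delta> * ev p x"
proof -
 have "mon (\<chi> k. t ^ d k * x $ k) m = t ^ wdeg d m * mon x m" for m
  by (simp add: mon_def wdeg_def power_mult_distrib prod.distrib power_sum power_mult)
 thus ?thesis using assms by (auto simp: ev_def sum_distrib_left graded_def intro!: sum.cong)
qed

lemma graded_ev_0:
 fixes p :: "'n::finite mpoly"
 assumes "wgraded d \<delta> p" "\<delta> > 0"
 shows "ev p 0 = 0"
 using ev_scale[OF assms(1), of 0 0] assms(2) by (auto simp: zero_vec_def power_0_left)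

text \<open>A monomial with a large exponent lies in the ideal, and on this set only its coefficient
  at \<open>F i\<close> survives, which has smaller weight. So every monomial is a combination of
  those with bounded exponents, the powers of each coordinate become linearly dependent, and the
  coordinate takes finitely many values.\<close>

lemma finite_fibre:
 fixes F :: "'n::finite => 'n mpoly"
 assumes gr: "\<And>k. wgraded d (\<delta> k) (F k)" and d: "\<And>k. d k > 0" and \<delta>: "\<And>k. \<delta> k > 0"
  and z: "only_zero F"
 shows "finite {x. (\<forall>k. k ~= i --> ev (F k) x = 0) \<and> ev (F i) x = 1}" 
proof -
 define Z where "Z = {x. (\<forall>k. k ~= i --> ev (F k) x = 0) \<and> ev (F i) x = 1}"
 have "\<exists>M. \<forall>e\<ge>M. vpow k e \<in> idl F UNIV" for k by (rule homogeneous_nullstellensatz[OF gr d z])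
 then obtain M0 where M0: "\<And>k e. e \<ge> M0 k ==> vpow k e \<in> idl F UNIV" by metis
 define M where "M = (\<Sum>k\<in>UNIV. M0 k)"
 have "M0 k \<le> M" for k unfolding M_def by (rule member_le_sum) auto
 hence M: "vpow k e \<in> idl F UNIV" if "e \<ge> M" for k e using M0 that order_trans by blast
 define Mon where "Mon = {m :: 'n \<Rightarrow>\<^sub>0 nat. \<forall>k. expo m k \<le> M}"
 have fM: "finite Mon" unfolding Mon_def by (rule finite_bounded_expo)
 define Q where "Q = (%f. \<exists>c. \<forall>x\<in>Z. f x = (\<Sum>m\<in>Mon. c m * mon x m))"
 have Q_sum: "Q (%x. \<Sum>a\<in>A. h a * f a x)" if A: "finite A" "\<And>a. a \<in> A ==> Q (f a)" for A h and f :: "'b => _"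
 proof -
  have "\<forall>a\<in>A. \<exists>c. \<forall>x\<in>Z. f a x = (\<Sum>m\<in>Mon. c m * mon x m)" using A(2) by (simp add: Q_def)
  from bchoice[OF this] obtain c
   where c: "\<And>a x. a \<in> A ==> x \<in> Z ==> f a x = (\<Sum>m\<in>Mon. c a m * mon x m)" by blast
  have "(\<Sum>a\<in>A. h a * f a x) = (\<Sum>m\<in>Mon. (\<Sum>a\<in>A. h a * c a m) * mon x m)" if "x \<in> Z" for x
  proof -
   have "(\<Sum>a\<in>A. h a * f a x) = (\<Sum>a\<in>A. \<Sum>m\<in>Mon. h a * c a m * mon x m)"
    by (rule sum.cong) (use c that in \<open>auto simp: sum_distrib_left mult.assoc\<close>)
   also have "\<dots> = (\<Sum>m\<in>Mon. \<Sum>a\<in>A. h a * c a m * mon x m)" by (rule sum.swap)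
   finally show ?thesis by (simp add: sum_distrib_right)
  qed
  thus ?thesis unfolding Q_def by (intro exI[of _ "%m. \<Sum>a\<in>A. h a * c a m"]) blast
 qed
 have Q_mon: "Q (%x. mon x m)" for m
 proof (induction "wdeg d m" arbitrary: m rule: less_induct)
  case less
  show ?case
  proof (cases "m \<in> Mon")
   case True
   have "mon x m = (\<Sum>m'\<in>Mon. (if m' = m then 1 else 0) * mon x m')" for x
   proof -
    have "(\<Sum>m'\<in>Mon. (if m' = m then 1 else 0) * mon x m') = (\<Sum>m'\<in>Mon. if m' = m then mon x m else 0)"
     by (rule sum.cong) auto
    thus ?thesis using True fM by simp
   qed
   thus ?thesis unfolding Q_def by (intro exI[of _ "%m'. if m' = m then 1 else 0"] ballI)
  next
   case False
   then obtain k where k: "\<not> expo m k \<le> M" by (auto simp: Mon_def)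
   hence "vpow k (expo m k) * term_of (m - Poly_Mapping.single k (expo m k)) 1 \<in> idl F UNIV"
    using M by (intro idl_mult2) auto
   moreover have "vpow k (expo m k) * term_of (m - Poly_Mapping.single k (expo m k)) 1 = term_of m 1"
    using expo_sub[of "expo m k" m k] by (simp add: vpow_def mult_single)
   ultimately have "term_of m 1 \<in> idl F UNIV" by simp
   from filt_wdeg_idl[OF gr this, where w = "wdeg d m"] obtain r
    where r: "\<And>k. supp (r k) \<subseteq> {m'. wdeg d m' + \<delta> k = wdeg d m}"
     "term_of m 1 = (\<Sum>k\<in>UNIV. F k * r k)" by (auto simp: filt_term_of)
   have "mon x m = (\<Sum>m'\<in>supp (r i). coef (r i) m' * mon x m')" if "x \<in> Z" for x
   proof -
    have "mon x m = ev (\<Sum>k\<in>UNIV. F k * r k) x" by (simp add: r(2)[symmetric])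
    also have "\<dots> = (\<Sum>k\<in>UNIV. if k = i then ev (r i) x else 0)"
     unfolding ev_sum by (rule sum.cong) (use that in \<open>auto simp: Z_def\<close>)
    also have "\<dots> = ev (r i) x" by simp
    finally show ?thesis by (simp add: ev_def)
   qed
   moreover have "Q (%x. \<Sum>m'\<in>supp (r i). coef (r i) m' * mon x m')"
   proof (rule Q_sum)
    fix m' assume "m' \<in> supp (r i)"
    hence "wdeg d m' + \<delta> i = wdeg d m" using r(1) by blast
    thus "Q (%x. mon x m')" using less \<delta>[of i] by simp
   qed simp
   ultimately show ?thesis by (simp add: Q_def)
  qed
 qed
 have fin_k: "finite {x $ k | x. x \<in> Z}" for k
 proof -
  have "\<exists>c. \<forall>x\<in>Z. x $ k ^ j = (\<Sum>m\<in>Mon. c m * mon x m)" for j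
   using Q_mon[of "Poly_Mapping.single k j"] by (simp add: Q_def)
  hence "\<forall>j. \<exists>c. \<forall>x\<in>Z. x $ k ^ j = (\<Sum>m\<in>Mon. c m * mon x m)" by blast
  from choice[OF this] obtain c
   where c: "\<And>j x. x \<in> Z ==> x $ k ^ j = (\<Sum>m\<in>Mon. c j m * mon x m)" by blast
  \<comment> \<open>The exponents from 0 to \<open>card Mon\<close> give one more power than there
    are monomials in \<open>Mon\<close>.\<close>
  from linear_dependence[OF fM, of "{..card Mon}" c] obtain l
   where l: "\<exists>j\<in>{..card Mon}. l j ~= 0" "\<And>m. m \<in> Mon ==> (\<Sum>j\<in>{..card Mon}. l j * c j m) = 0" by auto
  define q where "q = (\<Sum>j\<in>{..card Mon}. Polynomial.monom (l j) j)"
  obtain j where j: "j \<le> card Mon" "l j ~= 0" using l(1) by auto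
  have "Polynomial.coeff q j = l j" using j(1) by (simp add: q_def coeff_sum)
  hence "q ~= 0" using j(2) by auto
  have "poly q (x $ k) = 0" if "x \<in> Z" for x
  proof -
   have "poly q (x $ k) = (\<Sum>j\<in>{..card Mon}. \<Sum>m\<in>Mon. l j * c j m * mon x m)"
    using that by (simp add: q_def poly_sum poly_monom c sum_distrib_left mult.assoc)
   also have "\<dots> = (\<Sum>m\<in>Mon. \<Sum>j\<in>{..card Mon}. l j * c j m * mon x m)" by (rule sum.swap)
   also have "\<dots> = 0" using l(2) by (simp add: sum_distrib_right[symmetric])
   finally show ?thesis .
  qed
  hence "{x $ k | x. x \<in> Z} \<subseteq> {z. poly q z = 0}" by blast
  thus ?thesis using poly_roots_finite[OF \<open>q ~= 0\<close>] finite_subset by blast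
 qed
 have "Z \<subseteq> vec_lambda ` PiE UNIV (%k. {x $ k | x. x \<in> Z})"
 proof
  fix x assume "x \<in> Z"
  hence "vec_nth x \<in> PiE UNIV (%k. {x $ k | x. x \<in> Z})" by blast
  thus "x \<in> vec_lambda ` PiE UNIV (%k. {x $ k | x. x \<in> Z})"
   by (rule rev_image_eqI) simp
 qed
 moreover have "finite (PiE UNIV (%k. {x $ k | x. x \<in> Z}))" using fin_k by (intro finite_PiE) auto
 ultimately have "finite Z" using finite_surj by blast
 thus ?thesis by (simp add: Z_def)
qed

text \<open>Weighted scaling carries a common zero of the other entries at which
  \<open>F j i\<close> is nonzero to one where its value is 1. Hence only the finitely many points
  of \<open>finite_fibre\<close> have to be avoided, for all tuples at once. The common weight
  \<open>E\<close> of the terms makes vanishing of the new form stable under scaling.\<close>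

lemma generic_replacement:
 fixes F :: "'a => 'n::finite => 'n mpoly"
 assumes A: "finite A" and gr: "\<And>j k. j \<in> A ==> wgraded d (\<delta> j k) (F j k)" and d: "\<And>k. d k > 0"
  and \<delta>: "\<And>j k. j \<in> A ==> \<delta> j k > 0" and z: "\<And>j. j \<in> A ==> only_zero (F j)"
  and e: "\<And>k. e k > 0" "\<And>k. d k * e k = E"
 shows "\<exists>c. \<forall>j\<in>A. only_zero ((F j)(i := \<Sum>k\<in>UNIV. cnst (c k) * vpow k (e k)))"
proof -
 define Z where "Z = (%j. {x. (\<forall>k. k ~= i --> ev (F j k) x = 0) \<and> ev (F j i) x = 1})"
 define P where "P = (%x k. x $ k ^ e k) ` (\<Union>j\<in>A. Z j)"
 have "finite (Z j)" if "j \<in> A" for j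
  unfolding Z_def using finite_fibre[of d "\<delta> j" "F j" i] gr d \<delta> z that by blast
 hence "finite P" using A by (auto simp: P_def)
 moreover have "\<exists>k. v k ~= 0" if "v \<in> P" for v
 proof -
  from that obtain j x where x: "j \<in> A" "x \<in> Z j" "v = (%k. x $ k ^ e k)" unfolding P_def by blast
  have "ev (F j i) 0 = 0" by (rule graded_ev_0[OF gr[OF x(1)] \<delta>[OF x(1)]])
  hence "x ~= 0" using x(2) by (auto simp: Z_def)
  then obtain k where "x $ k ~= 0" by (auto simp: vec_eq_iff)
  thus ?thesis using x(3) by auto
 qed
 ultimately obtain c where c: "\<And>v. v \<in> P ==> (\<Sum>k\<in>UNIV. c k * v k) ~= 0"
  using exists_generic_form[of P] by blast
 define y where "y = (\<Sum>k\<in>UNIV. cnst (c k) * vpow k (e k))"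
 have gy: "wgraded d E y"
  unfolding y_def
 proof (rule graded_sum)
  fix k
  have "wgraded d (0 + d k * e k) (cnst (c k) * vpow k (e k))"
   by (rule graded_mult[OF graded_cnst(1) graded_vpow(1) wdeg_add])
  thus "wgraded d E (cnst (c k) * vpow k (e k))" by (simp add: e(2))
 qed
 have "only_zero ((F j)(i := y))" if j: "j \<in> A" for j
  unfolding only_zero_def
 proof (intro allI impI, rule ccontr)
  fix x assume x: "\<forall>k. ev (((F j)(i := y)) k) x = 0" and "x ~= 0"
  have xk: "ev (F j k) x = 0" if "k ~= i" for k using spec[OF x, of k] that by simp
  have xy: "ev y x = 0" using spec[OF x, of i] by simp
  have "ev (F j i) x ~= 0" using z[OF j] \<open>x ~= 0\<close> xk unfolding only_zero_def by metis
  moreover obtain t where t: "t ^ \<delta> j i = 1 / ev (F j i) x" using nth_root_exists[OF \<delta>[OF j]] by blast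
  ultimately have "(\<chi> k. t ^ d k * x $ k) \<in> Z j"
   using xk by (simp add: Z_def ev_scale[OF gr[OF j]])
  hence "(%k. (\<chi> k. t ^ d k * x $ k) $ k ^ e k) \<in> P" using j unfolding P_def by blast
  from c[OF this] have "ev y (\<chi> k. t ^ d k * x $ k) ~= 0" by (simp add: y_def)
  thus False using ev_scale[OF gy, of t x] xy by simp
 qed
 thus ?thesis unfolding y_def by blast
qed

lemma only_zero_powers:
 assumes "only_zero (%k. if k \<in> U then Var k else F k)" "\<And>k. L k > 0"
 shows "only_zero (%k. if k \<in> U then vpow k (L k) else F k)"
 unfolding only_zero_def
proof (intro allI impI)
 fix x assume x: "\<forall>k. ev (if k \<in> U then vpow k (L k) else F k) x = 0"
 have "ev (if k \<in> U then Var k else F k) x = 0" for k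
  using spec[OF x, of k] assms(2)[of k] by (auto split: if_splits)
 thus "x = 0" using assms(1) unfolding only_zero_def by blast
qed

locale semi_invariants =
 fixes d :: "'n::finite => nat" and a :: "'n => complex" and h :: nat
 assumes d: "\<And>k. d k > 0" and h: "h > 0" "\<And>k. a k ^ h = 1"
begin

lemma norm_a [simp]: "norm (a k) = 1"
proof -
 have "norm (a k) ^ h = 1" using h(2)[of k] by (metis norm_one norm_power)
 thus ?thesis using h(1) power_eq_imp_eq_base[of "norm (a k)" h 1] by simp
qed

definition semi :: "nat => complex => 'n mpoly => bool" where
 "semi \<delta> \<psi> p \<longleftrightarrow> wgraded d \<delta> p \<and> graded (chr a) \<psi> p \<and> \<delta> > 0 \<and> norm \<psi> = 1"

text \<open>Weight and character in one number: the norm of \<open>chr b m\<close> is 2 to the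
  weight, and the remaining factor \<open>chr a m\<close> has norm 1. Norms above 1 drive the
  descent in \<open>nzd_descend\<close>.\<close>

definition b :: "'n => complex" where
 "b k = 2 ^ d k * a k"

lemma chr_b: "chr b m = 2 ^ wdeg d m * chr a m"
 by (simp add: chr_def wdeg_def b_def power_mult_distrib prod.distrib power_sum power_mult)

lemma norm_b: "norm (b k) \<ge> 1"
 by (simp add: b_def norm_mult norm_power)

lemma semi_graded: "semi \<delta> \<psi> p ==> graded (chr b) (2 ^ \<delta> * \<psi>) p"
 by (auto simp: semi_def graded_def chr_b)

lemma semi_norm: "semi \<delta> \<psi> p ==> norm (2 ^ \<delta> * \<psi>) \<ge> 2"
 using self_le_power[of "2::real" \<delta>] by (auto simp: semi_def norm_mult norm_power)

lemma semi_nonzero: "semi \<delta> \<psi> p ==> 2 ^ \<delta> * \<psi> ~= 0"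
 by (auto simp: semi_def)

lemma exchange:
 fixes F :: "'n => 'n mpoly"
 assumes F: "\<And>k. semi (\<delta> k) (\<psi> k) (F k)" and p: "semi \<delta>' \<psi>' p"
  and mem: "F i \<in> idl (F(i := p)) UNIV" and "good b (%k. 2 ^ \<delta> k * \<psi> k) F"
 shows "good b (%k. 2 ^ (\<delta>(i := \<delta>')) k * (\<psi>(i := \<psi>')) k) (F(i := p))"
proof -
 have "good b ((%k. 2 ^ \<delta> k * \<psi> k)(i := 2 ^ \<delta>' * \<psi>')) (F(i := p))"
 proof (rule good_exchange[where \<rho> = 2])
  show "graded (chr b) (2 ^ \<delta> k * \<psi> k) (F k)" "2 ^ \<delta> k * \<psi> k ~= 0" "2 \<le> norm (2 ^ \<delta> k * \<psi> k)" for k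
   using semi_graded[OF F] semi_nonzero[OF F] semi_norm[OF F] by blast+
  show "graded (chr b) (2 ^ \<delta>' * \<psi>') p" "2 ^ \<delta>' * \<psi>' ~= 0"
   using semi_graded[OF p] semi_nonzero[OF p] by blast+
 qed (use assms norm_b in auto)
 moreover have "(%k. 2 ^ \<delta> k * \<psi> k)(i := 2 ^ \<delta>' * \<psi>') = (%k. 2 ^ (\<delta>(i := \<delta>')) k * (\<psi>(i := \<psi>')) k)"
  by auto
 ultimately show ?thesis by metis
qed

text \<open>The last claim is an implication since an exchange leads from the replaced tuple back to
  \<open>F\<close>. The mixed tuples of forms and variables are carried along because
  \<open>power_chain\<close>, which trades the forms for powers of coordinates, passes through them
  with the variables raised to powers.\<close>

lemma generic_chain:
 fixes F :: "'n => 'n mpoly"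
 assumes F: "\<And>k. semi (\<delta> k) (\<psi> k) (F k)" and z: "only_zero F" and "finite S"
 shows "\<exists>y \<epsilon>. (\<forall>k. semi (\<epsilon> k) 1 (y k)) \<and> only_zero (%k. if k \<in> S then y k else F k) \<and>
  (\<forall>T\<subseteq>S. only_zero (%k. if k \<in> T then y k else Var k)) \<and>
  (good b (%k. if k \<in> S then 2 ^ \<epsilon> k else 2 ^ \<delta> k * \<psi> k) (%k. if k \<in> S then y k else F k) -->
  good b (%k. 2 ^ \<delta> k * \<psi> k) F)"
 using \<open>finite S\<close>
proof (induction S rule: finite_induct)
 case empty
 have "only_zero (%k :: 'n. Var k)" by (auto simp: only_zero_def vec_eq_iff)
 moreover have "semi 1 1 (0 :: 'n mpoly)" by (simp add: semi_def)
 ultimately show ?case using z by (intro exI[of _ "%_. 0"] exI[of _ "%_. 1"]) simp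
next
 case (insert i S)
 then obtain y \<epsilon> where y: "\<And>k. semi (\<epsilon> k) 1 (y k)"
  and zS: "only_zero (%k. if k \<in> S then y k else F k)"
  and zT: "\<And>T. T \<subseteq> S ==> only_zero (%k. if k \<in> T then y k else Var k)"
  and g: "good b (%k. if k \<in> S then 2 ^ \<epsilon> k else 2 ^ \<delta> k * \<psi> k) (%k. if k \<in> S then y k else F k) ==>
   good b (%k. 2 ^ \<delta> k * \<psi> k) F" by blast
 define H where "H = (%k. if k \<in> S then y k else F k)"
 define HT where "HT = (%T k. if k \<in> T then y k else Var k)"
 define \<eta> where "\<eta> = (%k. if k \<in> S then \<epsilon> k else \<delta> k)"
 have H: "semi (\<eta> k) (if k \<in> S then 1 else \<psi> k) (H k)" for k using F y by (simp add: H_def \<eta>_def)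
 have grH: "wgraded d (\<eta> k) (H k)" for k using H by (simp add: semi_def)
 have "\<exists>M. \<forall>e\<ge>M. vpow k e \<in> idl H UNIV" for k
  by (rule homogeneous_nullstellensatz[OF grH d]) (use zS in \<open>simp add: H_def\<close>)
 then obtain M0 where M0: "\<And>k e. e \<ge> M0 k ==> vpow k e \<in> idl H UNIV" by metis
 define M where "M = Suc (\<Sum>k\<in>UNIV. M0 k)"
 have M: "M0 k \<le> M" for k
  using member_le_sum[of k UNIV M0] by (simp add: M_def)
 \<comment> \<open>These exponents give all terms the common weight \<open>E\<close>, are multiples
   of \<open>h\<close> so that the characters become trivial, and are at least \<open>M\<close> so
   that the powers lie in the ideal of \<open>H\<close>.\<close>
 define e where "e = (%k. h * (\<Prod>j\<in>- {k}. d j) * M)"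
 define E where "E = h * (\<Prod>j\<in>UNIV. d j) * M"
 have "d j \<ge> 1" for j using d[of j] by simp
 hence dp: "(\<Prod>j\<in>A. d j) \<ge> 1" for A by (intro prod_ge_1)
 have eE: "d k * e k = E" for k
 proof -
  have "(\<Prod>j\<in>insert k (- {k}). d j) = d k * (\<Prod>j\<in>- {k}. d j)" by (subst prod.insert) auto
  moreover have "insert k (- {k}) = UNIV" by auto
  ultimately show ?thesis by (simp add: e_def E_def)
 qed
 have Me: "M \<le> e k" for k
 proof -
  have "1 \<le> h" using h(1) by simp
  hence "1 * 1 * M \<le> e k" unfolding e_def by (intro mult_le_mono dp) auto
  thus ?thesis by simp
 qed
 have eM: "M0 k \<le> e k" for k using M[of k] Me[of k] by simp
 have e0: "e k > 0" for k using Me[of k] by (simp add: M_def)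
 have E0: "E > 0" using d[of i] e0[of i] eE[of i] by (metis nat_0_less_mult_iff)
 have ae: "a k ^ e k = 1" for k by (simp add: e_def power_mult h(2))
 \<comment> \<open>\<open>None\<close> stands for the tuple \<open>H\<close>, \<open>Some T\<close>
   for a mixed tuple; one generic form has to suit all of them.\<close>
 define A where "A = insert None (Some ` Pow S)"
 define \<F> where "\<F> = (%j. case j of None => H | Some T => HT T)"
 define \<Delta> where "\<Delta> = (%j. case j of None => \<eta> | Some T => (%k. if k \<in> T then \<epsilon> k else d k))"
 have "\<exists>c. \<forall>j\<in>A. only_zero ((\<F> j)(i := \<Sum>k\<in>UNIV. cnst (c k) * vpow k (e k)))"
 proof (rule generic_replacement[OF _ _ d _ _ e0 eE])
  show "finite A" using insert.hyps by (simp add: A_def)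
  fix j k assume j: "j \<in> A"
  have gV: "wgraded d (d k) (Var k)" for k using graded_vpow(1)[of d k 1] by simp
  show "wgraded d (\<Delta> j k) (\<F> j k)"
   using y gV grH by (auto simp: \<F>_def \<Delta>_def HT_def semi_def split: option.split)
  show "\<Delta> j k > 0" using H[of k] y d by (auto simp: \<Delta>_def semi_def split: option.split)
  show "only_zero (\<F> j)" using j zS zT by (auto simp: A_def \<F>_def H_def HT_def)
 qed
 then obtain c where c: "\<And>j. j \<in> A ==> only_zero ((\<F> j)(i := \<Sum>k\<in>UNIV. cnst (c k) * vpow k (e k)))" by blast
 define yi where "yi = (\<Sum>k\<in>UNIV. cnst (c k) * vpow k (e k))"
 have yi: "semi E 1 yi"
 proof -
  have "wgraded d (0 + d k * e k) (cnst (c k) * vpow k (e k))" for k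
   by (rule graded_mult[OF graded_cnst(1) graded_vpow(1) wdeg_add])
  moreover have "graded (chr a) (1 * a k ^ e k) (cnst (c k) * vpow k (e k))" for k
   by (rule graded_mult[OF graded_cnst(2) graded_vpow(2) chr_add])
  ultimately show ?thesis using E0 unfolding semi_def yi_def by (auto intro!: graded_sum simp: eE ae)
 qed
 have yi_mem: "yi \<in> idl H UNIV"
  unfolding yi_def using M0 eM by (intro idl_sum idl_mult) auto
 define y' where "y' = y(i := yi)"
 define \<epsilon>' where "\<epsilon>' = \<epsilon>(i := E)"
 have H': "(%k. if k \<in> insert i S then y' k else F k) = H(i := yi)"
  using insert.hyps by (auto simp: y'_def H_def)
 have HT': "(%k. if k \<in> T then y' k else Var k) = (if i \<in> T then (HT (T - {i}))(i := yi) else HT T)" for T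
  by (auto simp: y'_def HT_def)
 have "only_zero (H(i := yi))" using c[of None] by (simp add: A_def \<F>_def yi_def)
 moreover have "only_zero (%k. if k \<in> T then y' k else Var k)" if "T \<subseteq> insert i S" for T
 proof (cases "i \<in> T")
  case True
  have "Some (T - {i}) \<in> A" using that by (auto simp: A_def)
  from c[OF this] show ?thesis unfolding HT' using True by (simp add: \<F>_def yi_def)
 next
  case False
  hence "T \<subseteq> S" using that by blast
  thus ?thesis unfolding HT' using False zT by (simp add: HT_def)
 qed
 moreover have "semi (\<epsilon>' k) 1 (y' k)" for k using y yi by (simp add: y'_def \<epsilon>'_def)
 moreover have "good b (%k. 2 ^ \<delta> k * \<psi> k) F"
  if "good b (%k. if k \<in> insert i S then 2 ^ \<epsilon>' k else 2 ^ \<delta> k * \<psi> k) (H(i := yi))"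
 proof (rule g)
  let ?\<eta> = "\<eta>(i := E)" and ?\<psi> = "(%k. if k \<in> S then 1 else \<psi> k)(i := 1)"
  have "(%k. if k \<in> insert i S then 2 ^ \<epsilon>' k else 2 ^ \<delta> k * \<psi> k) = (%k. 2 ^ ?\<eta> k * ?\<psi> k)"
   using insert.hyps by (auto simp: \<epsilon>'_def \<eta>_def)
  hence gd: "good b (%k. 2 ^ ?\<eta> k * ?\<psi> k) (H(i := yi))" using that by metis
  have Hi: "(H(i := yi))(i := H i) = H" by auto
  \<comment> \<open>The exchange undoes the replacement, which is possible as \<open>yi\<close> lies
    in the ideal of \<open>H\<close>.\<close>
  have "good b (%k. 2 ^ (?\<eta>(i := \<delta> i)) k * (?\<psi>(i := \<psi> i)) k) ((H(i := yi))(i := H i))"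
  proof (rule exchange[OF _ _ _ gd])
   show "semi (?\<eta> k) (?\<psi> k) ((H(i := yi)) k)" for k using H[of k] yi by auto
   show "semi (\<delta> i) (\<psi> i) (H i)" using H[of i] insert.hyps by (simp add: \<eta>_def)
   show "(H(i := yi)) i \<in> idl ((H(i := yi))(i := H i)) UNIV" unfolding Hi using yi_mem by simp
  qed
  moreover have "(%k. 2 ^ (?\<eta>(i := \<delta> i)) k * (?\<psi>(i := \<psi> i)) k) =
    (%k. if k \<in> S then 2 ^ \<epsilon> k else 2 ^ \<delta> k * \<psi> k)"
   using insert.hyps by (auto simp: \<eta>_def)
  ultimately show "good b (%k. if k \<in> S then 2 ^ \<epsilon> k else 2 ^ \<delta> k * \<psi> k) (%k. if k \<in> S then y k else F k)"
   unfolding Hi by (simp add: H_def)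
 qed
 ultimately show ?case unfolding H'[symmetric] by blast
qed

text \<open>The hypothesis on mixed tuples, used for the complement of \<open>U\<close>, keeps 0 the
  only common zero. So a high power of the next coordinate lies in the ideal of the current tuple
  and can be exchanged back for the form.\<close>

lemma power_chain:
 fixes y :: "'n => 'n mpoly"
 assumes y: "\<And>k. semi (\<epsilon> k) 1 (y k)"
  and z: "\<And>T. only_zero (%k. if k \<in> T then y k else Var k)" and "finite U"
 shows "\<exists>L. (\<forall>k. L k > 0) \<and>
  (good b (%k. if k \<in> U then b k ^ L k else 2 ^ \<epsilon> k) (%k. if k \<in> U then vpow k (L k) else y k) -->
  good b (%k. 2 ^ \<epsilon> k) y)"
 using \<open>finite U\<close>
proof (induction U rule: finite_induct)
 case empty
 show ?case by (intro exI[of _ "%_. 1"]) simp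
next
 case (insert i U)
 then obtain L where L: "\<And>k. L k > 0"
  and g: "good b (%k. if k \<in> U then b k ^ L k else 2 ^ \<epsilon> k) (%k. if k \<in> U then vpow k (L k) else y k) ==>
  good b (%k. 2 ^ \<epsilon> k) y" by blast
 define H where "H = (%k. if k \<in> U then vpow k (L k) else y k)"
 have sv: "semi (d k * e) (a k ^ e) (vpow k e)" if "e > 0" for k e
  using that d by (simp add: semi_def graded_vpow norm_power)
 have H: "semi (if k \<in> U then d k * L k else \<epsilon> k) (if k \<in> U then a k ^ L k else 1) (H k)" for k
  using y sv L by (simp add: H_def)
 have grH: "wgraded d (if k \<in> U then d k * L k else \<epsilon> k) (H k)" for k
  using H[of k] unfolding semi_def by blast
 have "only_zero (%k. if k \<in> U then Var k else y k)"
 proof -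
  have "(%k. if k \<in> - U then y k else Var k) = (%k. if k \<in> U then Var k else y k)" by auto
  thus ?thesis using z[of "- U"] by metis
 qed
 from only_zero_powers[OF this L] have "only_zero H" by (simp add: H_def)
 from homogeneous_nullstellensatz[OF grH d this, of i] obtain M
  where M: "\<And>e. e \<ge> M ==> vpow i e \<in> idl H UNIV" by blast
 define e where "e = Suc M"
 define L' where "L' = L(i := e)"
 define \<eta> where "\<eta> = (%k. if k \<in> U then d k * L k else \<epsilon> k)(i := d i * e)"
 define \<psi> where "\<psi> = (%k. if k \<in> U then a k ^ L k else 1)(i := a i ^ e)"
 have bpow: "b k ^ e = 2 ^ (d k * e) * a k ^ e" for k e
  by (simp add: b_def power_mult_distrib power_mult)
 have "good b (%k. 2 ^ \<epsilon> k) y"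
  if gd: "good b (%k. if k \<in> insert i U then b k ^ L' k else 2 ^ \<epsilon> k)
   (%k. if k \<in> insert i U then vpow k (L' k) else y k)"
 proof (rule g)
  have "(%k. if k \<in> insert i U then b k ^ L' k else 2 ^ \<epsilon> k) = (%k. 2 ^ \<eta> k * \<psi> k)"
   using insert.hyps by (auto simp: L'_def \<eta>_def \<psi>_def bpow)
  moreover have "(%k. if k \<in> insert i U then vpow k (L' k) else y k) = H(i := vpow i e)"
   using insert.hyps by (auto simp: L'_def H_def)
  ultimately have gd': "good b (%k. 2 ^ \<eta> k * \<psi> k) (H(i := vpow i e))" using gd by metis
  have Hi: "(H(i := vpow i e))(i := H i) = H" by auto
  have "good b (%k. 2 ^ (\<eta>(i := \<epsilon> i)) k * (\<psi>(i := 1)) k) ((H(i := vpow i e))(i := H i))"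
  proof (rule exchange[OF _ _ _ gd'])
   show "semi (\<eta> k) (\<psi> k) ((H(i := vpow i e)) k)" for k
    using H[of k] sv[of e i] by (auto simp: \<eta>_def \<psi>_def e_def)
   show "semi (\<epsilon> i) 1 (H i)" using H[of i] insert.hyps by simp
   show "(H(i := vpow i e)) i \<in> idl ((H(i := vpow i e))(i := H i)) UNIV"
    unfolding Hi using M[of e] by (simp add: e_def)
  qed
  moreover have "(%k. 2 ^ (\<eta>(i := \<epsilon> i)) k * (\<psi>(i := 1)) k) =
    (%k. if k \<in> U then b k ^ L k else 2 ^ \<epsilon> k)"
   using insert.hyps by (auto simp: \<eta>_def \<psi>_def bpow)
  ultimately show "good b (%k. if k \<in> U then b k ^ L k else 2 ^ \<epsilon> k)
    (%k. if k \<in> U then vpow k (L k) else y k)"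
   unfolding Hi by (simp add: H_def)
 qed
 moreover have "L' k > 0" for k using L by (simp add: L'_def e_def)
 ultimately show ?case by blast
qed

text \<open>Both chains together end in powers of the coordinates, where \<open>good_vpow\<close>
  applies. Taking norms splits the single identity for \<open>b\<close> into one for weights and one
  for characters.\<close>

theorem parameters_good:
 fixes F :: "'n => 'n mpoly"
 assumes F: "\<And>k. semi (\<delta> k) (\<psi> k) (F k)" and z: "only_zero F"
 shows "regular_tuple F \<and> (\<exists>\<phi>. dual_generator \<phi> (idl F UNIV) \<and>
  (\<forall>m. \<phi> (term_of m 1) ~= 0 --> wdeg d m + (\<Sum>k\<in>UNIV. d k) = (\<Sum>k\<in>UNIV. \<delta> k) \<and>
   chr a m * (\<Prod>k\<in>UNIV. a k) = (\<Prod>k\<in>UNIV. \<psi> k)))"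
proof -
 obtain y \<epsilon> where y: "\<And>k. semi (\<epsilon> k) 1 (y k)"
  and zT: "\<And>T. only_zero (%k. if k \<in> T then y k else Var k)"
  and g: "good b (%k. 2 ^ \<epsilon> k) y ==> good b (%k. 2 ^ \<delta> k * \<psi> k) F"
  using generic_chain[OF F z finite[of UNIV]] by auto
 obtain L where L: "\<And>k. L k > 0"
  and g': "good b (%k. b k ^ L k) (%k. vpow k (L k)) ==> good b (%k. 2 ^ \<epsilon> k) y"
  using power_chain[OF y zT finite[of UNIV]] by auto
 have "good b (%k. 2 ^ \<delta> k * \<psi> k) F" by (rule g, rule g', rule good_vpow, rule L)
 then obtain \<phi> where reg: "regular_tuple F" and \<phi>: "dual_generator \<phi> (idl F UNIV)"
  and top: "\<And>m. \<phi> (term_of m 1) ~= 0 ==> chr b m * (\<Prod>k\<in>UNIV. b k) = (\<Prod>k\<in>UNIV. 2 ^ \<delta> k * \<psi> k)"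
  unfolding good_def by blast
 have "wdeg d m + (\<Sum>k\<in>UNIV. d k) = (\<Sum>k\<in>UNIV. \<delta> k) \<and>
   chr a m * (\<Prod>k\<in>UNIV. a k) = (\<Prod>k\<in>UNIV. \<psi> k)" if "\<phi> (term_of m 1) ~= 0" for m
 proof -
  have eq: "2 ^ (wdeg d m + (\<Sum>k\<in>UNIV. d k)) * (chr a m * (\<Prod>k\<in>UNIV. a k)) =
    2 ^ (\<Sum>k\<in>UNIV. \<delta> k) * (\<Prod>k\<in>UNIV. \<psi> k)"
   using top[OF that] by (simp add: chr_b b_def prod.distrib power_add power_sum algebra_simps)
  have "norm (\<psi> k) = 1" for k using F[of k] by (simp add: semi_def)
  moreover have "norm (chr a m) = 1" by (simp add: chr_def prod_norm[symmetric] norm_power)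
  ultimately have "(2::real) ^ (wdeg d m + (\<Sum>k\<in>UNIV. d k)) = 2 ^ (\<Sum>k\<in>UNIV. \<delta> k)"
   using arg_cong[OF eq, of norm] by (simp add: norm_mult norm_power prod_norm[symmetric])
  hence "wdeg d m + (\<Sum>k\<in>UNIV. d k) = (\<Sum>k\<in>UNIV. \<delta> k)"
   by (rule power_inject_exp[THEN iffD1, rotated]) simp
  thus ?thesis using eq by simp
 qed
 thus ?thesis using reg \<phi> by blast
qed

end

text \<open>If \<open>n - 1\<close> forms had no common zero, then adding the form 0 would give a regular tuple.\<close>

lemma exists_common_zero:
 fixes F :: "'n::finite => 'n mpoly"
 assumes d: "\<And>k. d k > 0" and F: "\<And>k. wgraded d (\<delta> k) (F k)" "\<And>k. \<delta> k > 0" and "F i = 0"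
 shows "\<not> only_zero F"
proof
 assume z: "only_zero F"
 interpret semi_invariants d "%_. 1" 1 by standard (use d in auto)
 have chr1: "chr (%_. 1) m = 1" for m :: "'n \<Rightarrow>\<^sub>0 nat" by (simp add: chr_def)
 have "semi (\<delta> k) 1 (F k)" for k using F chr1 by (simp add: semi_def) (simp add: graded_def)
 from parameters_good[OF this z] have "nzd (F i) (idl F (- {i}))" by (simp add: regular_tuple_def)
 hence "1 \<in> idl F (- {i})" using \<open>F i = 0\<close> by (simp add: nzd_def)
 then obtain r where "1 = (\<Sum>k\<in>- {i}. F k * r k)" by (elim idl_E)
 from arg_cong[OF this, of "%p. ev p 0"] show False using graded_ev_0[OF F(1) F(2)] by simp
qed

section \<open>Polynomial functions and their derivatives\<close>

lemma coef_mapp: "coef (Poly_Mapping.mapp (%m c. c * s m) p) m = coef p m * s m"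
 by (simp add: lookup_mapp when_def in_keys_iff)

lemma ev_mapp:
 fixes p :: "'n::finite mpoly"
 shows "ev (Poly_Mapping.mapp (%m c. c * s m) p) x = (\<Sum>m\<in>supp p. coef p m * s m * mon x m)"
 by (subst ev_superset[of "supp p"]) (auto simp: coef_mapp keys_mapp_subset)

lemma mon_scale: "mon (\<chi> k. c k * x $ k) m = chr c m * mon x m"
 by (simp add: mon_def chr_def power_mult_distrib prod.distrib)

text \<open>Induction on the number of monomials: doubling a coordinate in which two of them differ,
  and subtracting a multiple of \<open>p\<close>, removes one monomial but keeps the other.\<close>

lemma ev_eq_0_imp:
 fixes p :: "'n::finite mpoly"
 assumes "\<And>x. ev p x = 0"
 shows "p = 0"
 using assms
proof (induction "card (supp p)" arbitrary: p rule: less_induct)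
 case less
 show ?case
 proof (rule ccontr)
  assume "p ~= 0"
  then obtain m1 where m1: "m1 \<in> supp p" by (metis all_not_in_conv keys_eq_empty)
  show False
  proof (cases "supp p = {m1}")
   case True
   have "mon (\<chi> k. 1) m1 = 1" by (simp add: mon_def)
   hence "ev p (\<chi> k. 1) = coef p m1" by (simp add: ev_def True)
   thus False using less.prems m1 by (simp add: in_keys_iff)
  next
   case False
   then obtain m2 where m2: "m2 \<in> supp p" "m2 ~= m1" using m1 by blast
   then obtain k where k: "expo m2 k ~= expo m1 k" by (metis poly_mapping_eqI)
   define c :: "'n => complex" where "c = (%i. if i = k then 2 else 1)"
   have c: "chr c m = 2 ^ expo m k" for m
   proof -
    have "chr c m = (\<Prod>i\<in>UNIV. if i = k then 2 ^ expo m k else 1)"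
     unfolding chr_def by (rule prod.cong) (auto simp: c_def)
    thus ?thesis by simp
   qed
   define p' where "p' = Poly_Mapping.mapp (%m z. z * (chr c m - chr c m1)) p"
   have "ev p' x = ev p (\<chi> k. c k * x $ k) - chr c m1 * ev p x" for x
    unfolding p'_def ev_mapp
    by (simp add: ev_def mon_scale algebra_simps sum_subtractf sum_distrib_left)
   hence "ev p' x = 0" for x using less.prems by simp
   moreover have "m1 \<notin> supp p'" by (simp add: in_keys_iff p'_def coef_mapp)
   hence "supp p' \<subset> supp p" using m1 keys_mapp_subset[of "%m z. z * (chr c m - chr c m1)" p]
    unfolding p'_def by blast
   hence "card (supp p') < card (supp p)" by (intro psubset_card_mono) auto
   ultimately have "p' = 0" using less.hyps by blast
   hence "coef p m2 * (chr c m2 - chr c m1) = 0" using coef_mapp[of "%m. chr c m - chr c m1" p m2]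
    by (simp add: p'_def)
   hence "(2::complex) ^ expo m2 k = 2 ^ expo m1 k" using m2(1) by (simp add: in_keys_iff c)
   hence "norm ((2::complex) ^ expo m2 k) = norm ((2::complex) ^ expo m1 k)" by simp
   hence "(2::real) ^ expo m2 k = 2 ^ expo m1 k" by (simp add: norm_power)
   thus False using k by simp
  qed
 qed
qed

lemma ev_inject:
 fixes p r :: "'n::finite mpoly"
 assumes "\<And>x. ev p x = ev r x"
 shows "p = r"
 using ev_eq_0_imp[of "p - r"] assms by simp

lemma graded_chrI:
 fixes p :: "'n::finite mpoly"
 assumes "\<And>x. ev p (\<chi> k. c k * x $ k) = \<gamma> * ev p x"
 shows "graded (chr c) \<gamma> p"
proof -
 define p' where "p' = Poly_Mapping.mapp (%m z. z * (chr c m - \<gamma>)) p"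
 have "ev p' x = ev p (\<chi> k. c k * x $ k) - \<gamma> * ev p x" for x
  unfolding p'_def ev_mapp
  by (simp add: ev_def mon_scale algebra_simps sum_subtractf sum_distrib_left)
 hence "p' = 0" using assms by (intro ev_eq_0_imp) simp
 hence "coef p m * (chr c m - \<gamma>) = 0" for m
  using coef_mapp[of "%m. chr c m - \<gamma>" p m] by (simp add: p'_def)
 thus ?thesis by (auto simp: graded_def in_keys_iff)
qed

text \<open>The single scaling factor 2 detects the weight, since its powers are distinct.\<close>

lemma graded_wdegI:
 fixes p :: "'n::finite mpoly"
 assumes "\<And>x. ev p (\<chi> k. 2 ^ d k * x $ k) = 2 ^ w * ev p x"
 shows "wgraded d w p"
proof -
 have *: "chr (%k. 2 ^ d k) m = 2 ^ wdeg d m" for m :: "'n \<Rightarrow>\<^sub>0 nat"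
  by (simp add: chr_def wdeg_def power_sum power_mult)
 have "wdeg d m = w" if "(2::complex) ^ wdeg d m = 2 ^ w" for m
 proof -
  have "norm ((2::complex) ^ wdeg d m) = norm ((2::complex) ^ w)" using that by simp
  hence "(2::real) ^ wdeg d m = 2 ^ w" by (simp add: norm_power)
  thus ?thesis by simp
 qed
 thus ?thesis using graded_chrI[OF assms] unfolding graded_def * by blast
qed

lemma polynomial_fun_ev: "polynomial_fun (ev p)"
proof -
 have inj: "inj_on expo (supp p)" by (auto intro: inj_onI poly_mapping_eqI)
 define c where "c = (%m. coef p (Abs_poly_mapping m))"
 have "ev p = (%x. \<Sum>m\<in>expo ` supp p. c m * (\<Prod>k\<in>UNIV. x $ k ^ m k))"
  by (subst sum.reindex[OF inj]) (auto simp: ev_def mon_def c_def lookup_inverse fun_eq_iff)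
 thus ?thesis unfolding polynomial_fun_def
  by (intro exI[of _ "expo ` supp p"] exI[of _ c] conjI finite_imageI finite_keys)
qed

lemma polynomial_funE:
 fixes p :: "complex ^ 'n::finite => complex"
 assumes "polynomial_fun p"
 obtains P where "p = ev P"
proof -
 obtain M c where M: "finite M" "p = (%x. \<Sum>m\<in>M. c m * (\<Prod>k\<in>UNIV. x $ k ^ m k))"
  using assms by (auto simp: polynomial_fun_def)
 have "p = ev (\<Sum>m\<in>M. term_of (Abs_poly_mapping m) (c m))"
  by (simp add: M(2) mon_def fun_eq_iff)
 thus ?thesis by (rule that)
qed

text \<open>The chain rule is proved along arbitrary curves: lines give directional derivatives, and
  the curve with coordinates \<open>t ^ d k * x $ k\<close> gives Euler's identity.\<close>

lemma exists_partials:
 fixes p :: "'n::finite mpoly"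
 shows "\<exists>D. \<forall>(c :: complex => complex ^ 'n) v t. (\<forall>k. ((%t. c t $ k) has_field_derivative v $ k) (at t)) -->
  ((%t. ev p (c t)) has_field_derivative (\<Sum>k\<in>UNIV. v $ k * ev (D k) (c t))) (at t)"
proof (induction p rule: mpoly_ring_induct)
 case (cnst z)
 show ?case by (intro exI[of _ "%_. 0"]) simp
next
 case (var i)
 have s: "(\<Sum>k\<in>UNIV. v $ k * ev (if k = i then 1 else 0) x) = v $ i" for v :: "complex ^ 'n" and x
 proof -
  have "(\<Sum>k\<in>UNIV. v $ k * ev (if k = i then 1 else 0) x) = (\<Sum>k\<in>UNIV. if k = i then v $ i else 0)"
   by (rule sum.cong) auto
  thus ?thesis by simp
 qed
 show ?case
  by (intro exI[of _ "%k. if k = i then 1 else 0"] allI impI) (unfold s ev_vpow power_one_right, blast)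
next
 case (add p r)
 then obtain D E where "\<forall>(c :: complex => complex ^ 'n) v t. (\<forall>k. ((%t. c t $ k) has_field_derivative v $ k) (at t)) -->
  ((%t. ev p (c t)) has_field_derivative (\<Sum>k\<in>UNIV. v $ k * ev (D k) (c t))) (at t)"
  "\<forall>(c :: complex => complex ^ 'n) v t. (\<forall>k. ((%t. c t $ k) has_field_derivative v $ k) (at t)) -->
  ((%t. ev r (c t)) has_field_derivative (\<Sum>k\<in>UNIV. v $ k * ev (E k) (c t))) (at t)" by blast
 thus ?case
  by (intro exI[of _ "%k. D k + E k"] allI impI)
   (auto simp: distrib_left sum.distrib intro!: DERIV_add)
next
 case (mult p r)
 then obtain D E where D: "\<And>(c :: complex => complex ^ 'n) v t. (\<forall>k. ((%t. c t $ k) has_field_derivative v $ k) (at t)) ==>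
  ((%t. ev p (c t)) has_field_derivative (\<Sum>k\<in>UNIV. v $ k * ev (D k) (c t))) (at t)"
  and E: "\<And>(c :: complex => complex ^ 'n) v t. (\<forall>k. ((%t. c t $ k) has_field_derivative v $ k) (at t)) ==>
  ((%t. ev r (c t)) has_field_derivative (\<Sum>k\<in>UNIV. v $ k * ev (E k) (c t))) (at t)" by blast
 show ?case
 proof (intro exI[of _ "%k. D k * r + E k * p"] allI impI)
  fix c :: "complex => complex ^ 'n" and v :: "complex ^ 'n" and t :: complex
  assume *: "\<forall>k. ((%t. c t $ k) has_field_derivative v $ k) (at t)"
  have "(\<Sum>k\<in>UNIV. v $ k * ev (D k) (c t)) * ev r (c t) + (\<Sum>k\<in>UNIV. v $ k * ev (E k) (c t)) * ev p (c t) =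
   (\<Sum>k\<in>UNIV. v $ k * ev (D k * r + E k * p) (c t))"
   by (simp add: distrib_left sum.distrib sum_distrib_right mult.assoc)
  with DERIV_mult[OF D[OF *] E[OF *]]
  show "((%t. ev (p * r) (c t)) has_field_derivative (\<Sum>k\<in>UNIV. v $ k * ev (D k * r + E k * p) (c t))) (at t)"
   by simp
 qed
qed

text \<open>The choice has no effect on values: \<open>ev_pd_unique\<close> determines
  \<open>pd p k\<close> from the derivative along the k-th coordinate direction.\<close>

definition pd :: "'n::finite mpoly => 'n => 'n mpoly" where
 "pd p = (SOME D. \<forall>c v t. (\<forall>k. ((%t. c t $ k) has_field_derivative v $ k) (at t)) -->
  ((%t. ev p (c t)) has_field_derivative (\<Sum>k\<in>UNIV. v $ k * ev (D k) (c t))) (at t))"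

lemma has_derivative_ev:
 assumes "\<And>k. ((%t. c t $ k) has_field_derivative v $ k) (at t)"
 shows "((%t. ev p (c t)) has_field_derivative (\<Sum>k\<in>UNIV. v $ k * ev (pd p k) (c t))) (at t)"
 using someI_ex[OF exists_partials[of p]] assms unfolding pd_def by blast

lemma has_derivative_line:
 "((%t. ev p (x + t *s v)) has_field_derivative (\<Sum>k\<in>UNIV. v $ k * ev (pd p k) x)) (at 0)"
proof -
 have "((%t. (x + t *s v) $ k) has_field_derivative v $ k) (at 0)" for k
  by (auto intro!: derivative_eq_intros)
 from has_derivative_ev[of "%t. x + t *s v", OF this] show ?thesis by simp
qed

lemma dir_deriv_ev: "dir_deriv (ev p) v x = (\<Sum>k\<in>UNIV. v $ k * ev (pd p k) x)"
 unfolding dir_deriv_def by (rule DERIV_imp_deriv[OF has_derivative_line])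

lemma sum_axis: "(\<Sum>k\<in>UNIV. axis i (1::complex) $ k * h k) = h i"
proof -
 have "(\<Sum>k\<in>UNIV. axis i (1::complex) $ k * h k) = (\<Sum>k\<in>UNIV. if k = i then h i else 0)"
  by (rule sum.cong) (auto simp: axis_def)
 thus ?thesis by simp
qed

lemma mult_axis: "((A :: complex ^ 'n ^ 'm) *v axis i 1) $ k = A $ k $ i"
proof -
 have "(\<Sum>j\<in>UNIV. axis i 1 $ j * A $ k $ j) = (A *v axis i 1) $ k"
  unfolding matrix_vector_mult_def by (simp add: mult.commute)
 thus ?thesis unfolding sum_axis by simp
qed

lemma dir_deriv_axis: "dir_deriv (ev p) (axis i 1) x = ev (pd p i) x"
 by (simp add: dir_deriv_ev sum_axis)

lemma ev_pd_unique:
 assumes "((%t. ev p (x + t *s axis k 1)) has_field_derivative D) (at 0)"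
 shows "ev (pd p k) x = D"
 using DERIV_unique[OF has_derivative_line[of p x "axis k 1"] assms] by (simp add: sum_axis)

lemma has_derivative_axis:
 "((%t. ev p (x + t *s axis k 1)) has_field_derivative ev (pd p k) x) (at 0)"
 using has_derivative_line[of p x "axis k 1"] by (simp add: sum_axis)

lemma ev_pd_mult: "ev (pd (p * r) k) x = ev (pd p k) x * ev r x + ev p x * ev (pd r k) x"
proof (rule ev_pd_unique)
 show "((%t. ev (p * r) (x + t *s axis k 1)) has_field_derivative
  ev (pd p k) x * ev r x + ev p x * ev (pd r k) x) (at 0)"
  using DERIV_mult[OF has_derivative_axis[of p x k] has_derivative_axis[of r x k]]
  by (simp add: mult.commute)
qed

lemma ev_pd_sum: "ev (pd (\<Sum>a\<in>A. h a) k) x = (\<Sum>a\<in>A. ev (pd (h a) k) x)"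
proof (rule ev_pd_unique)
 show "((%t. ev (\<Sum>a\<in>A. h a) (x + t *s axis k 1)) has_field_derivative (\<Sum>a\<in>A. ev (pd (h a) k) x)) (at 0)"
  unfolding ev_sum by (intro DERIV_sum has_derivative_axis)
qed

lemma ev_pd_scale:
 assumes "\<And>x. ev p (\<chi> k. c k * x $ k) = \<gamma> * ev p x"
 shows "c k * ev (pd p k) (\<chi> k. c k * x $ k) = \<gamma> * ev (pd p k) x"
proof -
 have "(\<chi> i. c i * (x + t *s axis k 1) $ i) = (\<chi> i. c i * x $ i) + t *s (c k *s axis k 1)" for t
  by (auto simp: vec_eq_iff axis_def algebra_simps)
 hence "((%t. ev p (\<chi> i. c i * (x + t *s axis k 1) $ i)) has_field_derivative
   (\<Sum>i\<in>UNIV. (c k *s axis k 1) $ i * ev (pd p i) (\<chi> k. c k * x $ k))) (at 0)"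
  using has_derivative_line[of p "\<chi> k. c k * x $ k" "c k *s axis k 1"] by simp
 moreover have "(\<Sum>i\<in>UNIV. (c k *s axis k 1) $ i * ev (pd p i) (\<chi> k. c k * x $ k)) =
   c k * ev (pd p k) (\<chi> k. c k * x $ k)"
  using sum_axis[of k "%i. ev (pd p i) (\<chi> k. c k * x $ k)"]
  by (simp add: sum_distrib_left[symmetric] mult.assoc)
 ultimately have "((%t. \<gamma> * ev p (x + t *s axis k 1)) has_field_derivative
   c k * ev (pd p k) (\<chi> k. c k * x $ k)) (at 0)" unfolding assms by metis
 moreover have "((%t. \<gamma> * ev p (x + t *s axis k 1)) has_field_derivative \<gamma> * ev (pd p k) x) (at 0)"
  by (intro DERIV_cmult has_derivative_axis)
 ultimately show ?thesis by (rule DERIV_unique)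
qed

section \<open>Symmetries preserve the weights\<close>

lemma two_power_eq: "(2::complex) ^ m = 2 ^ n \<longleftrightarrow> m = n"
proof
 assume "(2::complex) ^ m = 2 ^ n"
 hence "norm ((2::complex) ^ m) = norm ((2::complex) ^ n)" by simp
 hence "(2::real) ^ m = 2 ^ n" by (simp add: norm_power)
 thus "m = n" by simp
qed simp

locale calabi_yau =
 fixes fp :: "'n::finite mpoly" and d :: "'n => nat" and d0 :: nat
 assumes N3: "CARD('n) \<ge> 3" and qh: "quasihomogeneous (ev fp) d0 d"
  and isolated: "isolated_singularity (ev fp)" and cy: "(\<Sum>k\<in>UNIV. d k) = d0"
begin

lemma d_pos: "d k > 0" and d0_pos: "d0 > 0"
 using qh by (auto simp: quasihomogeneous_def)

lemma f_scale: "t ~= 0 ==> ev fp (\<chi> k. t ^ d k * x $ k) = t ^ d0 * ev fp x"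
 using qh by (auto simp: quasihomogeneous_def)

lemma d_sum_lt: "A ~= UNIV ==> (\<Sum>k\<in>A. d k) < d0"
proof -
 assume "A ~= UNIV"
 then obtain k where "k \<notin> A" by blast
 have "(\<Sum>k\<in>A. d k) < (\<Sum>k\<in>insert k A. d k)" using \<open>k \<notin> A\<close> d_pos[of k] by simp
 also have "\<dots> \<le> (\<Sum>k\<in>UNIV. d k)" by (rule sum_mono2) auto
 finally show ?thesis by (simp add: cy)
qed

lemma small_neq_UNIV: "card A < 3 ==> A ~= (UNIV :: 'n set)"
 using N3 by force

lemma d_lt: "d k < d0"
 using d_sum_lt[OF small_neq_UNIV, of "{k}"] by simp

text \<open>With at least three variables, another one of positive weight is left over.\<close>

lemma d_add_lt: "i ~= j ==> d i + d j < d0"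
 using d_sum_lt[OF small_neq_UNIV, of "{i, j}"] by simp

abbreviation F :: "'n => 'n mpoly" where "F \<equiv> pd fp"

lemma F_scale: "t ~= 0 ==> ev (F k) (\<chi> k. t ^ d k * x $ k) = t ^ (d0 - d k) * ev (F k) x"
proof -
 assume t: "t ~= 0"
 have "t ^ d k * ev (F k) (\<chi> k. t ^ d k * x $ k) = t ^ d0 * ev (F k) x"
  by (rule ev_pd_scale) (rule f_scale[OF t])
 also have "t ^ d0 = t ^ d k * t ^ (d0 - d k)" using d_lt[of k] by (simp add: power_add[symmetric])
 finally show ?thesis using t by simp
qed

lemma graded_F: "wgraded d (d0 - d k) (F k)"
 by (rule graded_wdegI) (rule F_scale, simp)

lemma F_0: "ev (F k) 0 = 0"
 by (rule graded_ev_0[OF graded_F]) (use d_lt in simp)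

lemma only_zero_F: "only_zero F"
 using isolated by (auto simp: only_zero_def isolated_singularity_def dir_deriv_axis)

lemma regular_F: "regular_tuple F"
proof -
 interpret semi_invariants d "%_. 1" 1 by standard (use d_pos in auto)
 have chr1: "chr (%_. 1) m = 1" for m :: "'n \<Rightarrow>\<^sub>0 nat" by (simp add: chr_def)
 have "semi (d0 - d k) 1 (F k)" for k
  using graded_F d_lt chr1 by (simp add: semi_def) (simp add: graded_def)
 from parameters_good[OF this only_zero_F] show ?thesis by blast
qed

text \<open>A second derivative at 0 picks a quadratic monomial, so the two weights add up to
  \<open>d0\<close>; two different variables are excluded by \<open>d_add_lt\<close>.\<close>

lemma hessian_0:
 assumes "ev (pd (F j) i) 0 ~= 0"
 shows "i = j" "d i + d i = d0"
proof -
 have "2 ^ d i * ev (pd (F j) i) (\<chi> k. 2 ^ d k * 0 $ k) = 2 ^ (d0 - d j) * ev (pd (F j) i) 0"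
  by (rule ev_pd_scale) (rule F_scale, simp)
 moreover have "(\<chi> k. 2 ^ d k * 0 $ k) = (0 :: complex ^ 'n)" by (simp add: vec_eq_iff)
 ultimately have "d i = d0 - d j" using assms by (simp add: two_power_eq)
 hence "d i + d j = d0" using d_lt[of j] by simp
 thus "i = j" "d i + d i = d0" using d_add_lt[of i j] by (cases "i = j"; simp; fail)+
qed

text \<open>Regularity puts each linear coefficient \<open>l k\<close> into the ideal of the other
  partial derivatives. These vanish at 0, and their linear parts come from the Hessian, which
  confines \<open>B\<close> to one column \<open>i\<close> with \<open>d i + d i = d0\<close>.
  Cancelling \<open>Var i\<close> leaves a constant syzygy, which regularity excludes.\<close>

lemma linear_syzygy:
 assumes syz: "\<And>y. (\<Sum>k\<in>UNIV. (B *v y) $ k * ev (F k) y) = 0"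
 shows "B = 0"
proof -
 define l where "l = (%k. \<Sum>i\<in>UNIV. cnst (B $ k $ i) * Var i)"
 have evl: "ev (l k) y = (B *v y) $ k" for k y
  by (simp add: l_def matrix_vector_mult_def)
 have sum0: "(\<Sum>k\<in>UNIV. F k * l k) = 0"
  by (rule ev_eq_0_imp) (use syz in \<open>simp add: evl mult.commute\<close>)
 have nz: "nzd (F k) (idl F (- {k}))" for k using regular_F by (simp add: regular_tuple_def)
 have split: "F k * m k = - (\<Sum>j\<in>- {k}. F j * m j)" if "(\<Sum>k\<in>UNIV. F k * m k) = 0" for m k
 proof -
  have U: "UNIV = insert k (- {k})" by auto
  have "(\<Sum>k\<in>UNIV. F k * m k) = F k * m k + (\<Sum>j\<in>- {k}. F j * m j)"
   by (subst U, subst sum.insert) auto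
  thus ?thesis using that by (simp add: eq_neg_iff_add_eq_0)
 qed
 have "\<exists>r. l k = (\<Sum>j\<in>- {k}. F j * r j)" for k
 proof -
  have "- (\<Sum>j\<in>- {k}. F j * l j) \<in> idl F (- {k})" by (rule idl_minus, rule idl_I, rule refl)
  hence "F k * l k \<in> idl F (- {k})" by (subst split[OF sum0])
  from nzdD[OF nz this] show ?thesis by (rule idl_E) blast
 qed
 then obtain r where r: "\<And>k. l k = (\<Sum>j\<in>- {k}. F j * r k j)" by metis
 have pdl: "ev (pd (l k) i) 0 = B $ k $ i" for k i
 proof (rule ev_pd_unique)
  have "ev (l k) (0 + t *s axis i 1) = B $ k $ i * t" for t
   unfolding evl by (simp add: vector_scalar_commute mult_axis)
  thus "((%t. ev (l k) (0 + t *s axis i 1)) has_field_derivative B $ k $ i) (at 0)"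
   by (auto intro!: derivative_eq_intros)
 qed
 \<comment> \<open>As \<open>F j\<close> vanishes at 0, the linear term of a product with
   \<open>F j\<close> involves only the linear term of \<open>F j\<close>.\<close>
 have B: "B $ k $ i = (\<Sum>j\<in>- {k}. ev (pd (F j) i) 0 * ev (r k j) 0)" for k i
  unfolding pdl[symmetric] r[of k] ev_pd_sum ev_pd_mult F_0 by simp
 have B_nz: "k ~= i \<and> d i + d i = d0" if "B $ k $ i ~= 0" for k i
 proof -
  from that have "(\<Sum>j\<in>- {k}. ev (pd (F j) i) 0 * ev (r k j) 0) ~= 0" unfolding B .
  then obtain j where j: "j \<in> - {k}" "ev (pd (F j) i) 0 * ev (r k j) 0 ~= 0"
   by (rule sum.not_neutral_contains_not_neutral)
  thus ?thesis using hessian_0[of j i] by auto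
 qed
 have "B $ k $ i = 0" for k i
 proof (rule ccontr)
  assume nz': "B $ k $ i ~= 0"
  have uniq: "B $ k' $ i' = 0" if "i' ~= i" for k' i'
  proof (rule ccontr)
   assume "B $ k' $ i' ~= 0"
   hence "d i' + d i' = d0" "d i + d i = d0" using B_nz nz' by blast+
   hence "d i + d i' = d0" by simp
   thus False using d_add_lt[of i i'] that by simp
  qed
  have l: "l k' = cnst (B $ k' $ i) * Var i" for k'
  proof -
   have "l k' = (\<Sum>j\<in>UNIV. if j = i then cnst (B $ k' $ i) * Var i else 0)"
    unfolding l_def by (rule sum.cong) (auto simp: uniq)
   thus ?thesis by simp
  qed
  define p where "p = (\<Sum>k\<in>UNIV. F k * cnst (B $ k $ i))"
  have "(\<Sum>k\<in>UNIV. F k * l k) = Var i * p"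
   by (simp add: l p_def sum_distrib_left mult_ac)
  hence "Var i * p = 0" using sum0 by simp
  hence "p = 0"
   using coef_term_mult[of "Poly_Mapping.single i 1" 1 p] by (intro poly_mapping_eqI) (simp add: vpow_def)
  hence p0: "(\<Sum>k\<in>UNIV. F k * cnst (B $ k $ i)) = 0" unfolding p_def .
  have "- (\<Sum>j\<in>- {k}. F j * cnst (B $ j $ i)) \<in> idl F (- {k})" by (rule idl_minus, rule idl_I, rule refl)
  hence "F k * cnst (B $ k $ i) \<in> idl F (- {k})" by (subst split[OF p0])
  from nzdD[OF nz this] obtain s where "cnst (B $ k $ i) = (\<Sum>j\<in>- {k}. F j * s j)" by (elim idl_E)
  from arg_cong[OF this, of "%p. ev p 0"] show False using nz' F_0 by simp
 qed
 thus ?thesis by (simp add: vec_eq_iff)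
qed

text \<open>The Euler field \<open>E\<close> and its conjugate under \<open>g\<close> both multiply
  f by \<open>d0\<close>. Their difference is a linear syzygy of the partial derivatives, hence
  zero, so \<open>g\<close> commutes with \<open>E\<close> and is block diagonal for the
  weights.\<close>

theorem symmetry_preserves_weights:
 assumes g: "invertible g" "\<And>x. ev fp (g *v x) = ev fp x" and "g $ i $ k ~= 0"
 shows "d i = d k"
proof -
 define E :: "complex ^ 'n ^ 'n" where "E = (\<chi> i k. if i = k then of_nat (d i) else 0)"
 have Ev: "E *v x = (\<chi> k. of_nat (d k) * x $ k)" for x
  by (simp add: E_def matrix_vector_mult_def vec_eq_iff if_distrib [of "%z. z * _"] cong: if_cong)
 have euler: "(\<Sum>k\<in>UNIV. (E *v x) $ k * ev (F k) x) = of_nat d0 * ev fp x" for x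
 proof -
  have "((%t. (\<chi> k. t ^ d k * x $ k) $ k) has_field_derivative (E *v x) $ k) (at 1)" for k
   unfolding Ev by (auto intro!: derivative_eq_intros)
  from has_derivative_ev[of "%t. \<chi> k. t ^ d k * x $ k", OF this, of fp]
  have "((%t. ev fp (\<chi> k. t ^ d k * x $ k)) has_field_derivative (\<Sum>k\<in>UNIV. (E *v x) $ k * ev (F k) x)) (at 1)"
   by simp
  \<comment> \<open>Quasihomogeneity speaks of nonzero \<open>t\<close> only; these form an open set
    containing 1.\<close>
  moreover have "((%t. ev fp (\<chi> k. t ^ d k * x $ k)) has_field_derivative of_nat d0 * ev fp x) (at 1)"
  proof (rule has_field_derivative_transform_within_open[where S = "- {0}"])
   show "((%t. t ^ d0 * ev fp x) has_field_derivative of_nat d0 * ev fp x) (at 1)"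
    by (auto intro!: derivative_eq_intros)
   show "t ^ d0 * ev fp x = ev fp (\<chi> k. t ^ d k * x $ k)" if "t \<in> - {0}" for t
    using f_scale[of t x] that by simp
  qed auto
  ultimately show ?thesis by (rule DERIV_unique)
 qed
 obtain g' where g': "g' ** g = mat 1" "g ** g' = mat 1" using g(1) by (auto simp: invertible_def)
 define B where "B = E - g' ** E ** g"
 have dd: "(\<Sum>k\<in>UNIV. (g *v v) $ k * ev (F k) (g *v y)) = (\<Sum>k\<in>UNIV. v $ k * ev (F k) y)" for v y
 proof -
  have "g *v y + t *s (g *v v) = g *v (y + t *s v)" for t
   by (simp add: matrix_vector_right_distrib vector_scalar_commute)
  hence "dir_deriv (ev fp) (g *v v) (g *v y) = dir_deriv (ev fp) v y"
   by (simp add: dir_deriv_def g(2))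
  thus ?thesis by (simp add: dir_deriv_ev)
 qed
 have "(\<Sum>k\<in>UNIV. (B *v y) $ k * ev (F k) y) = 0" for y
 proof -
  have "g *v ((g' ** E ** g) *v y) = E *v (g *v y)"
   by (simp add: matrix_vector_mul_assoc matrix_mul_assoc g')
  hence "(\<Sum>k\<in>UNIV. ((g' ** E ** g) *v y) $ k * ev (F k) y) = of_nat d0 * ev fp y"
   using dd[of "(g' ** E ** g) *v y" y] euler[of "g *v y"] g(2) by simp
  thus ?thesis using euler[of y]
   by (simp add: B_def matrix_vector_mult_diff_rdistrib left_diff_distrib sum_subtractf)
 qed
 hence "E = g' ** E ** g" using linear_syzygy[of B] by (simp add: B_def)
 hence "g ** E = E ** g" by (metis g'(2) matrix_mul_assoc matrix_mul_lid)
 hence "(g ** E) $ i $ k = (E ** g) $ i $ k" by simp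
 hence "g $ i $ k * of_nat (d k) = of_nat (d i) * g $ i $ k"
  by (simp add: matrix_matrix_mult_def E_def if_distrib[of "%z. z * _"] if_distrib[of "%z. _ * z"] cong: if_cong)
 thus ?thesis using assms(3) by simp
qed

end

section \<open>Simultaneous diagonalization\<close>

definition dg :: "('n => complex) => complex ^ 'n ^ 'n" where
 "dg a = (\<chi> i k. if i = k then a i else 0)"

lemma dg_mult_vec: "dg a *v x = (\<chi> k. a k * x $ k)"
 by (simp add: dg_def matrix_vector_mult_def vec_eq_iff if_distrib[of "%z. z * _"] cong: if_cong)

lemma dg_mult: "dg a ** A = (\<chi> i k. a i * A $ i $ k)"
 by (simp add: dg_def matrix_matrix_mult_def vec_eq_iff if_distrib[of "%z. z * _"] cong: if_cong)

lemma mult_dg: "A ** dg a = (\<chi> i k. A $ i $ k * a k)"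
 by (simp add: dg_def matrix_matrix_mult_def vec_eq_iff if_distrib[of "%z. _ * z"] cong: if_cong)

lemma det_dg: "det (dg a) = (\<Prod>k\<in>UNIV. a k)"
 by (subst det_diagonal) (auto simp: dg_def)

definition root_exp :: "nat => complex" where
 "root_exp M = exp (2 * of_real pi * \<i> * of_nat 1 / of_nat M)"

lemma root_exp_power: "root_exp M ^ i = exp (2 * of_real pi * \<i> * of_nat i / of_nat M)"
 by (simp add: root_exp_def exp_of_nat_mult[symmetric] algebra_simps)

lemma root_exp_eq_1: "M > 0 ==> root_exp M ^ i = 1 \<longleftrightarrow> M dvd i"
 unfolding root_exp_power using complex_root_unity_eq_1[of M i] by simp

lemma sum_root_exp:
 assumes "M > 0" "i < M"
 shows "(\<Sum>j<M. root_exp M ^ (j * i)) = (if i = 0 then of_nat M else 0)"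
proof (cases "i = 0")
 case False
 hence ne: "root_exp M ^ i ~= 1" using assms by (auto simp: root_exp_eq_1 dest: dvd_imp_le)
 have "(\<Sum>j<M. root_exp M ^ (j * i)) = (\<Sum>j<M. (root_exp M ^ i) ^ j)"
  by (simp add: power_mult[symmetric] mult.commute)
 also have "\<dots> = ((root_exp M ^ i) ^ M - 1) / (root_exp M ^ i - 1)"
  by (rule geometric_sum[OF ne])
 also have "(root_exp M ^ i) ^ M = (root_exp M ^ M) ^ i" by (simp add: power_mult[symmetric] mult.commute)
 also have "root_exp M ^ M = 1" using root_exp_eq_1[OF assms(1)] by simp
 finally show ?thesis using False by simp
qed simp

text \<open>Discrete Fourier transform: the \<open>y j\<close> are eigenvectors of \<open>A\<close>
  and their mean is \<open>x\<close>. As combinations of iterates of \<open>x\<close> they keep the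
  eigenvalues of \<open>x\<close> for matrices commuting with \<open>A\<close>, which permits
  iteration over several matrices.\<close>

lemma eigenvectors_span:
 fixes A :: "complex ^ 'n::finite ^ 'n" and x :: "complex ^ 'n"
 assumes M: "M > 0" and per: "\<And>x. ((*v) A ^^ M) x = x"
 shows "x \<in> vec.span {y. \<exists>c. c ^ M = 1 \<and> A *v y = c *s y \<and>
  (\<forall>B b. B ** A = A ** B --> B *v x = b *s x --> B *v y = b *s y)}" (is "x \<in> vec.span ?S")
proof -
 let ?T = "%i. ((*v) A ^^ i) x"
 define y where "y = (%j. \<Sum>i<M. root_exp M ^ (j * i) *s ?T i)"
 have rM: "root_exp M ^ M = 1" using root_exp_eq_1[OF M] by simp
 have r0: "root_exp M ~= 0" by (simp add: root_exp_def)
 have A_sum: "B *v (\<Sum>i<M. h i *s ?T i) = (\<Sum>i<M. h i *s (B *v ?T i))" for h and B :: "complex ^ 'n ^ 'n"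
 proof -
  have "B *v (\<Sum>i<m. h i *s ?T i) = (\<Sum>i<m. h i *s (B *v ?T i))" for m
   by (induction m) (auto simp: matrix_vector_right_distrib vector_scalar_commute)
  thus ?thesis .
 qed
 have "y j \<in> ?S" for j
 proof -
  define c where "c = inverse (root_exp M ^ j)"
  define u where "u = (%i. root_exp M ^ (j * i) *s ?T i)"
  have "A *v y j = (\<Sum>i<M. root_exp M ^ (j * i) *s ?T (Suc i))"
   unfolding y_def A_sum by simp
  also have "\<dots> = (\<Sum>i<M. c *s u (Suc i))"
   by (rule sum.cong) (use r0 in \<open>auto simp: u_def c_def vector_smult_assoc power_add field_simps\<close>)
  also have "\<dots> = c *s (\<Sum>i<M. u (Suc i))" by (rule vec.scale_sum_right[symmetric])
  finally have Ay0: "A *v y j = c *s (\<Sum>i<M. u (Suc i))" .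
  have rj: "(root_exp M ^ j) ^ M = 1" by (metis rM power_mult mult.commute power_one)
  have "u M = u 0" using rj per[of x] by (simp add: u_def power_mult)
  hence shift: "(\<Sum>i<M. u (Suc i)) = (\<Sum>i<M. u i)"
   using sum.lessThan_Suc_shift[of u M] by simp
  have Ay: "A *v y j = c *s y j" unfolding Ay0 shift by (simp add: y_def u_def)
  have "c ^ M = 1" by (simp add: c_def power_inverse power_mult[symmetric] mult.commute[of j M] power_mult rM)
  moreover have "B *v y j = b *s y j" if B: "B ** A = A ** B" "B *v x = b *s x" for B b
  proof -
   have "B *v ?T i = b *s ?T i" for i
   proof (induction i)
    case (Suc i)
    have "B *v ?T (Suc i) = (A ** B) *v ?T i" by (simp add: matrix_vector_mul_assoc B(1))
    also have "\<dots> = A *v (b *s ?T i)" using Suc by (simp add: matrix_vector_mul_assoc[symmetric])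
    finally show ?case by (simp add: vector_scalar_commute)
   qed (use B in simp)
   thus ?thesis unfolding y_def A_sum by (simp add: vec.scale_sum_right vector_smult_assoc mult.commute)
  qed
  ultimately show ?thesis using Ay by blast
 qed
 hence "(1 / of_nat M) *s (\<Sum>j<M. y j) \<in> vec.span ?S"
  by (intro vec.span_scale vec.span_sum vec.span_base)
 also have "(\<Sum>j<M. y j) = (\<Sum>i<M. \<Sum>j<M. root_exp M ^ (j * i) *s ?T i)"
  unfolding y_def by (rule sum.swap)
 also have "\<dots> = (\<Sum>i<M. (\<Sum>j<M. root_exp M ^ (j * i)) *s ?T i)"
  by (simp add: vec.scale_sum_left)
 also have "\<dots> = (\<Sum>i<M. if i = 0 then of_nat M *s x else 0)"
  by (rule sum.cong) (auto simp: sum_root_exp[OF M])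
 also have "\<dots> = of_nat M *s x" using M by simp
 finally show ?thesis using M by (simp add: vector_smult_assoc)
qed

text \<open>The standard basis vectors, eigenvectors of \<open>E\<close>, are split first under
  \<open>g\<close> and then under \<open>h\<close>. This gives a spanning set of common
  eigenvectors, from which the columns of \<open>P\<close> are chosen.\<close>

lemma common_eigenbasis:
 fixes g h E :: "complex ^ 'n::finite ^ 'n"
 assumes E: "\<And>k. E *v axis k 1 = e k *s axis k 1"
  and gE: "E ** g = g ** E" and hE: "E ** h = h ** E" and gh: "g ** h = h ** g"
  and M: "M > 0" "\<And>x. ((*v) g ^^ M) x = x" "\<And>x. ((*v) h ^^ M) x = x"
 shows "\<exists>(P :: complex ^ 'n ^ 'n) e' a b. invertible P \<and> E ** P = P ** dg e' \<and> g ** P = P ** dg a \<and> h ** P = P ** dg b \<and>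
  (\<forall>k. a k ^ M = 1 \<and> b k ^ M = 1)"
proof -
 define S where "S = {y. (\<exists>c. E *v y = c *s y) \<and> (\<exists>c. c ^ M = 1 \<and> g *v y = c *s y) \<and> (\<exists>c. c ^ M = 1 \<and> h *v y = c *s y)}"
 define S1 where "S1 = {y. (\<exists>c. E *v y = c *s y) \<and> (\<exists>c. c ^ M = 1 \<and> g *v y = c *s y)}"
 have 1: "y \<in> vec.span S" if "y \<in> S1" for y
  by (rule subsetD[OF vec.span_mono eigenvectors_span[OF M(1,3), of y]])
   (use that hE gh in \<open>fastforce simp: S_def S1_def\<close>)
 have 2: "axis k 1 \<in> vec.span S1" for k
  by (rule subsetD[OF vec.span_mono eigenvectors_span[OF M(1,2), of "axis k 1"]])
   (use E gE in \<open>fastforce simp: S1_def\<close>)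
 have "vec.span S1 \<subseteq> vec.span S" by (rule vec.span_minimal) (use 1 in auto)
 hence 3: "axis k 1 \<in> vec.span S" for k using 2 by blast
 have spanS: "x \<in> vec.span S" for x
 proof -
  have "x = (\<Sum>k\<in>UNIV. x $ k *s axis k 1)"
   by (simp add: vec_eq_iff axis_def if_distrib[of "%z. _ * z"] cong: if_cong)
  also have "\<dots> \<in> vec.span S" by (intro vec.span_sum vec.span_scale 3)
  finally show ?thesis .
 qed
 obtain B where B: "B \<subseteq> S" "vec.independent B" "S \<subseteq> vec.span B"
  using vec.maximal_independent_subset[of S] by blast
 have "vec.span S \<subseteq> vec.span B" using B(3) by (rule vec.span_minimal) (rule vec.subspace_span)
 hence spanB: "x \<in> vec.span B" for x using spanS by blast
 have "card B = vec.dim (UNIV :: (complex ^ 'n) set)"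
  by (rule vec.basis_card_eq_dim) (use spanB B(2) in auto)
 hence "card B = CARD('n)" unfolding vec_dim_card .
 moreover have "finite B" using B(2) by (rule vec.finiteI_independent)
 ultimately obtain s where s: "bij_betw s (UNIV :: 'n set) B"
  using finite_same_card_bij[of "UNIV :: 'n set" B] by auto
 have sS: "s k \<in> S" for k using s B(1) by (auto simp: bij_betw_def)
 define P :: "complex ^ 'n ^ 'n" where "P = (\<chi> i k. s k $ i)"
 have Pk: "P *v axis k 1 = s k" for k by (simp add: vec_eq_iff mult_axis P_def)
 have "vec.subspace (range ((*v) P))"
  by (auto simp: vec.subspace_def image_iff)
   (metis matrix_vector_mult_0_right, metis matrix_vector_right_distrib, metis vector_scalar_commute)
 moreover have "B \<subseteq> range ((*v) P)" using s Pk by (auto simp: bij_betw_def) (metis rangeI)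
 ultimately have "vec.span B \<subseteq> range ((*v) P)" by (intro vec.span_minimal)
 hence "surj ((*v) P)" using spanB by blast
 hence "invertible P" using matrix_right_invertible_surjective[of P] invertible_right_inverse by blast
 moreover have diag: "A ** P = P ** dg a" if "\<And>k. A *v s k = a k *s s k" for A a
 proof -
  have "(A ** P) $ i $ k = (P ** dg a) $ i $ k" for i k
  proof -
   have "(A ** P) $ i $ k = (A *v s k) $ i"
    by (simp add: matrix_matrix_mult_def matrix_vector_mult_def P_def)
   also have "\<dots> = (P ** dg a) $ i $ k" unfolding that by (simp add: mult_dg P_def)
   finally show ?thesis .
  qed
  thus ?thesis by (simp add: vec_eq_iff)
 qed
 have "\<forall>k. \<exists>c. E *v s k = c *s s k" "\<forall>k. \<exists>c. c ^ M = 1 \<and> g *v s k = c *s s k"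
  "\<forall>k. \<exists>c. c ^ M = 1 \<and> h *v s k = c *s s k"
  using sS by (auto simp: S_def)
 then obtain e' a b where ab: "\<And>k. E *v s k = e' k *s s k" "\<And>k. a k ^ M = 1 \<and> g *v s k = a k *s s k"
  "\<And>k. b k ^ M = 1 \<and> h *v s k = b k *s s k" by metis
 have "\<forall>k. a k ^ M = 1 \<and> b k ^ M = 1" using ab by blast
 moreover have "E ** P = P ** dg e'" "g ** P = P ** dg a" "h ** P = P ** dg b"
  by (rule diag, use ab in blast)+
 ultimately show ?thesis by blast
qed

lemma diag_power:
 fixes g P :: "complex ^ 'n::finite ^ 'n"
 assumes "invertible P" "g ** P = P ** dg a"
 shows "g *v (P *v y) = P *v (\<chi> k. a k * y $ k)"
 using assms by (simp add: matrix_vector_mul_assoc) (simp add: matrix_vector_mul_assoc[symmetric] dg_mult_vec)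

lemma det_diag:
 fixes P :: "complex ^ 'n::finite ^ 'n"
 assumes P: "invertible P" "g ** P = P ** dg a"
 shows "det (mat t - g) = (\<Prod>k\<in>UNIV. t - a k)" "det g = (\<Prod>k\<in>UNIV. a k)"
proof -
 have dP: "det P ~= 0" using P(1) by (simp add: invertible_det_nz)
 have "(mat t - g) ** P = mat t ** P - P ** dg a"
  unfolding P(2)[symmetric]
  by (simp add: vec_eq_iff matrix_matrix_mult_def left_diff_distrib sum_subtractf)
 also have "\<dots> = P ** dg (%k. t - a k)"
 proof -
  have mt: "mat t = dg (%_. t)" by (simp add: dg_def mat_def)
  show ?thesis unfolding mt mult_dg dg_mult by (simp add: vec_eq_iff algebra_simps)
 qed
 finally have "det (mat t - g) * det P = det P * (\<Prod>k\<in>UNIV. t - a k)"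
  using det_mul det_dg by metis
 thus "det (mat t - g) = (\<Prod>k\<in>UNIV. t - a k)" using dP by simp
 have "det g * det P = det P * (\<Prod>k\<in>UNIV. a k)" using P(2) det_mul det_dg by metis
 thus "det g = (\<Prod>k\<in>UNIV. a k)" using dP by simp
qed

section \<open>Ages computed from diagonalizations\<close>

definition frac_arg :: "complex => real" where
 "frac_arg z = Arg2pi z / (2 * pi)"

lemma frac_arg_range: "0 \<le> frac_arg z" "frac_arg z < 1"
 using Arg2pi[of z] by (auto simp: frac_arg_def)

lemma cis_frac_arg: "norm z = 1 ==> cis (2 * pi * frac_arg z) = z"
 using Arg2pi_eq[of z] by (simp add: frac_arg_def cis_conv_exp)

lemma frac_arg_cis:
 assumes "0 \<le> x" "x < 1"
 shows "frac_arg (cis (2 * pi * x)) = x"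
proof -
 have "Arg2pi (cis (2 * pi * x)) = 2 * pi * x"
  by (rule Arg2pi_unique[of 1]) (use assms in \<open>auto simp: cis_conv_exp\<close>)
 thus ?thesis by (simp add: frac_arg_def)
qed

lemma frac_arg_eq_0: "norm z = 1 ==> frac_arg z = 0 \<longleftrightarrow> z = 1"
 using cis_frac_arg[of z] frac_arg_cis[of 0] by auto

lemma frac_arg_inverse:
 assumes "norm z = 1" "z ~= 1"
 shows "frac_arg (inverse z) = 1 - frac_arg z"
proof -
 have "frac_arg z > 0" using frac_arg_eq_0[OF assms(1)] assms(2) frac_arg_range(1)[of z] by linarith
 have "2 * pi * (1 - frac_arg z) = 2 * pi - 2 * pi * frac_arg z" by (simp add: algebra_simps)
 hence "cis (2 * pi * (1 - frac_arg z)) = inverse (cis (2 * pi * frac_arg z))"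
  by (simp add: cis_divide[symmetric] cis_2pi divide_inverse)
 hence "cis (2 * pi * (1 - frac_arg z)) = inverse z" by (simp add: cis_frac_arg[OF assms(1)])
 thus ?thesis using frac_arg_cis[of "1 - frac_arg z"] \<open>frac_arg z > 0\<close> frac_arg_range(2)[of z] by simp
qed

text \<open>Equal characteristic polynomials have equal multisets of roots, so any sum over
  eigenvalues agrees. This makes \<open>age\<close> independent of the chosen exponents.\<close>

lemma prod_linear_unique:
 fixes u v :: "'n::finite => complex"
 assumes "\<And>t. (\<Prod>k\<in>UNIV. t - u k) = (\<Prod>k\<in>UNIV. t - v k)"
 shows "(\<Sum>k\<in>UNIV. \<phi> (u k) :: real) = (\<Sum>k\<in>UNIV. \<phi> (v k))"
proof -
 have "poly (\<Prod>k\<in>UNIV. [:- u k, 1:]) = poly (\<Prod>k\<in>UNIV. [:- v k, 1:])"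
  using assms by (auto simp: poly_prod fun_eq_iff)
 hence "proots (\<Prod>k\<in>UNIV. [:- u k, 1:]) = proots (\<Prod>k\<in>UNIV. [:- v k, 1:])"
  by (simp only: poly_eq_poly_eq_iff)
 hence "(\<Sum>k\<in>UNIV. {#u k#}) = (\<Sum>k\<in>UNIV. {#v k#})"
  by (subst (asm) (1 2) proots_prod) auto
 hence "sum_mset (image_mset \<phi> (\<Sum>k\<in>UNIV. {#u k#})) = sum_mset (image_mset \<phi> (\<Sum>k\<in>UNIV. {#v k#}))"
  by simp
 moreover have "sum_mset (image_mset \<phi> (\<Sum>k\<in>A. {#w k#})) = (\<Sum>k\<in>A. \<phi> (w k))" if "finite A" for A and w :: "'n => complex"
  using that by (induction A rule: finite_induct) auto
 ultimately show ?thesis by simp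
qed

lemma age_diag:
 fixes g P :: "complex ^ 'n::finite ^ 'n"
 assumes P: "invertible P" "g ** P = P ** dg a" and n: "\<And>k. norm (a k) = 1"
 shows "age g = (\<Sum>k\<in>UNIV. frac_arg (a k))"
 unfolding age_def
proof (rule the_equality)
 show "\<exists>\<alpha>. eigen_exponents g \<alpha> \<and> (\<Sum>k\<in>UNIV. frac_arg (a k)) = sum \<alpha> UNIV"
  by (intro exI[of _ "%k. frac_arg (a k)"])
   (simp add: eigen_exponents_def frac_arg_range cis_frac_arg n det_diag[OF P])
 fix s assume "\<exists>\<alpha>. eigen_exponents g \<alpha> \<and> s = sum \<alpha> UNIV"
 then obtain \<alpha> where \<alpha>: "eigen_exponents g \<alpha>" "s = sum \<alpha> UNIV" by blast
 have "(\<Sum>k\<in>UNIV. frac_arg (cis (2 * pi * \<alpha> k))) = (\<Sum>k\<in>UNIV. frac_arg (a k))"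
  by (rule prod_linear_unique) (use \<alpha>(1) in \<open>simp add: eigen_exponents_def det_diag[OF P, symmetric]\<close>)
 moreover have "frac_arg (cis (2 * pi * \<alpha> k)) = \<alpha> k" for k
  using \<alpha>(1) by (intro frac_arg_cis) (auto simp: eigen_exponents_def)
 ultimately show "s = (\<Sum>k\<in>UNIV. frac_arg (a k))" using \<alpha>(2) by simp
qed

lemma dim_coordinate_image:
 fixes P :: "complex ^ 'n::finite ^ 'n"
 assumes "invertible P"
 shows "vec.dim {P *v y | y. \<forall>k. k \<notin> A --> y $ k = 0} = card A"
proof -
 obtain P' where P': "P' ** P = mat 1" using assms by (auto simp: invertible_def)
 have inj: "inj ((*v) P)"
  by (rule inj_on_inverseI[of _ "(*v) P'"]) (simp add: matrix_vector_mul_assoc P')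
 have "vec.dim ((*v) P ` {y. \<forall>k. k \<notin> A --> y $ k = 0}) = vec.dim {y :: complex ^ 'n. \<forall>k. k \<notin> A --> y $ k = 0}"
  by (rule vec.dim_image_eq) (auto intro: inj_on_subset[OF inj])
 moreover have "(*v) P ` {y. \<forall>k. k \<notin> A --> y $ k = 0} = {P *v y | y. \<forall>k. k \<notin> A --> y $ k = 0}" by blast
 ultimately show ?thesis by (simp add: dim_substandard_cart)
qed

lemma weight_space_eq: "weight_space q w = {x. \<forall>k. q k ~= w --> x $ k = 0}"
proof
 have "vec.subspace {x :: complex ^ 'a. \<forall>k. q k ~= w --> x $ k = 0}"
  by (auto simp: vec.subspace_def)
 thus "weight_space q w \<subseteq> {x. \<forall>k. q k ~= w --> x $ k = 0}"
  unfolding weight_space_def by (intro vec.span_minimal) (auto simp: axis_def)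
 show "{x. \<forall>k. q k ~= w --> x $ k = 0} \<subseteq> weight_space q w"
 proof
  fix x :: "complex ^ 'a"
  assume "x \<in> {x. \<forall>k. q k ~= w --> x $ k = 0}"
  hence x: "\<And>k. q k ~= w ==> x $ k = 0" by simp
  have "x = (\<Sum>k\<in>UNIV. x $ k *s axis k 1)"
   by (simp add: vec_eq_iff axis_def if_distrib[of "%z. _ * z"] cong: if_cong)
  also have "\<dots> \<in> weight_space q w"
   unfolding weight_space_def
  proof (rule vec.span_sum)
   fix k
   show "x $ k *s axis k 1 \<in> vec.span {axis k 1 | k. q k = w}"
   proof (cases "q k = w")
    case True
    hence "axis k 1 \<in> vec.span {axis k 1 | k. q k = w}" by (intro vec.span_base) blast
    thus ?thesis by (rule vec.span_scale)
   qed (simp add: x vec.span_zero)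
  qed
  finally show "x \<in> weight_space q w" .
 qed
qed

text \<open>\<open>fixed_indices\<close> only prescribes how often each weight occurs; such counts
  are turned into sums of weights here.\<close>

lemma sum_level_sets:
 fixes u :: "'a => real" and v :: "'b => real"
 assumes "finite A" "finite B" "\<And>w. card {k \<in> A. u k = w} = card {k \<in> B. v k = w}"
 shows "(\<Sum>k\<in>A. u k) = (\<Sum>k\<in>B. v k)"
proof -
 have *: "(\<Sum>k\<in>C. f k) = (\<Sum>w\<in>W. of_nat (card {k \<in> C. f k = w}) * w)"
  if "finite C" "finite W" "f ` C \<subseteq> W" for C :: "'c set" and f :: "'c => real" and W
 proof -
  have "(\<Sum>k\<in>C. f k) = (\<Sum>w\<in>W. \<Sum>k\<in>{k \<in> C. f k = w}. f k)"
   using that by (rule sum.group[symmetric])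
  thus ?thesis by simp
 qed
 have W: "finite (u ` A \<union> v ` B)" using assms by simp
 show ?thesis
  using *[OF assms(1) W, of u] *[OF assms(2) W, of v] assms(3) by simp
qed

section \<open>Linear substitutions\<close>

lemma exists_substitution:
 fixes p :: "'n::finite mpoly" and A :: "complex ^ 'm::finite ^ 'n"
 shows "\<exists>r. \<forall>x. ev r x = ev p (A *v x)"
proof (induction p rule: mpoly_ring_induct)
 case (cnst c) show ?case by (intro exI[of _ "cnst c"]) simp
next
 case (var k)
 show ?case by (intro exI[of _ "\<Sum>j\<in>UNIV. cnst (A $ k $ j) * Var j"]) (simp add: matrix_vector_mult_def)
next
 case (add p q)
 then obtain r s where "\<forall>x. ev r x = ev p (A *v x)" "\<forall>x. ev s x = ev q (A *v x)" by blast
 thus ?case by (intro exI[of _ "r + s"]) simp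
next
 case (mult p q)
 then obtain r s where "\<forall>x. ev r x = ev p (A *v x)" "\<forall>x. ev s x = ev q (A *v x)" by blast
 thus ?case by (intro exI[of _ "r * s"]) simp
qed

text \<open>Pullback of polynomials along the linear map \<open>A\<close>, hence contravariant in
  \<open>A\<close>.\<close>

definition sub :: "complex ^ 'm::finite ^ 'n::finite => 'n mpoly => 'm mpoly" where
 "sub A p = (SOME r. \<forall>x. ev r x = ev p (A *v x))"

lemma ev_sub [simp]: "ev (sub A p) x = ev p (A *v x)"
 using someI_ex[OF exists_substitution[of p A]] unfolding sub_def by blast

lemma sub_simps:
 "sub A (p + r) = sub A p + sub A r" "sub A (p * r) = sub A p * sub A r"
 "sub A (cnst c) = cnst c" "sub A (p - r) = sub A p - sub A r" "sub A 0 = 0"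
 by (rule ev_inject, simp)+

lemma sub_sub: "sub A (sub B p) = sub (B ** A) p"
 by (rule ev_inject) (simp add: matrix_vector_mul_assoc)

lemma sub_id [simp]: "sub (mat 1) p = p"
 by (rule ev_inject) simp

lemma ev_pd_sub: "ev (pd (sub P p) k) y = (\<Sum>i\<in>UNIV. P $ i $ k * ev (pd p i) (P *v y))"
proof (rule ev_pd_unique)
 have "P *v (y + t *s axis k 1) = P *v y + t *s (P *v axis k 1)" for t
  by (simp add: matrix_vector_right_distrib vector_scalar_commute)
 thus "((%t. ev (sub P p) (y + t *s axis k 1)) has_field_derivative
   (\<Sum>i\<in>UNIV. P $ i $ k * ev (pd p i) (P *v y))) (at 0)"
  using has_derivative_line[of p "P *v y" "P *v axis k 1"] by (simp add: mult_axis)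
qed

text \<open>Setting the variables in \<open>U\<close> to 0 keeps exactly the monomials free of them,
  and by hypothesis these sum to the zero function.\<close>

lemma vanishing_on_coordinate_space:
 fixes p :: "'n::finite mpoly"
 assumes "\<And>y. (\<And>k. k \<in> U ==> y $ k = 0) ==> ev p y = 0"
 shows "p \<in> idl Var U"
proof -
 define Q where "Q = (%m :: 'n \<Rightarrow>\<^sub>0 nat. \<forall>k\<in>U. expo m k = 0)"
 have "filt Q p = 0"
 proof (rule ev_eq_0_imp)
  fix x
  define y :: "complex ^ 'n" where "y = (\<chi> k. if k \<in> U then 0 else x $ k)"
  have mon: "mon y m = (if Q m then mon x m else 0)" for m
  proof (cases "Q m")
   case True
   have "y $ k ^ expo m k = x $ k ^ expo m k" for k
    using True by (auto simp: Q_def y_def)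
   thus ?thesis using True by (simp add: mon_def)
  next
   case False
   then obtain k where k: "k \<in> U" "expo m k ~= 0" by (auto simp: Q_def)
   have "(\<Prod>k\<in>UNIV. y $ k ^ expo m k) = 0"
    by (rule prod_zero) (use k in \<open>auto simp: y_def intro!: bexI[of _ k]\<close>)
   thus ?thesis using False by (simp add: mon_def)
  qed
  have "ev (filt Q p) x = (\<Sum>m\<in>supp p. coef (filt Q p) m * mon x m)"
   by (rule ev_superset) auto
  also have "\<dots> = ev p y" unfolding ev_def by (rule sum.cong) (auto simp: mon)
  also have "\<dots> = 0" by (rule assms) (simp add: y_def)
  finally show "ev (filt Q p) x = 0" .
 qed
 hence *: "coef p m = 0" if "Q m" for m
  using coef_filt[of Q p m] that by simp
 have "\<exists>k\<in>U. 1 \<le> expo m k" if "m \<in> supp p" for m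
 proof -
  have "\<not> Q m" using that * by (auto simp: in_keys_iff)
  thus ?thesis by (auto simp: Q_def Suc_le_eq)
 qed
 thus ?thesis using idl_vpow[of p "%_. 1" U] by simp
qed

section \<open>The ring of polynomial functions on a subspace\<close>

definition rs :: "(complex ^ 'n::finite) set => 'n mpoly => (complex ^ 'n => complex)" where
 "rs V p = restrict (ev p) V"

lemma carrier_poly_ring: "carrier (poly_ring V) = range (rs V)"
 unfolding poly_ring_def by (auto simp: rs_def elim!: polynomial_funE intro: polynomial_fun_ev)

lemma poly_ring_ops:
 "rs V p \<oplus>\<^bsub>poly_ring V\<^esub> rs V r = rs V (p + r)" "rs V p \<otimes>\<^bsub>poly_ring V\<^esub> rs V r = rs V (p * r)"
 "c \<odot>\<^bsub>poly_ring V\<^esub> rs V p = rs V (cnst c * p)" "\<zero>\<^bsub>poly_ring V\<^esub> = rs V 0" "\<one>\<^bsub>poly_ring V\<^esub> = rs V 1"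
 by (auto simp: poly_ring_def rs_def fun_eq_iff)

lemma rs_eq_iff: "rs V p = rs V r \<longleftrightarrow> (\<forall>x\<in>V. ev p x = ev r x)"
 by (auto simp: rs_def fun_eq_iff restrict_def)

lemma cring_poly_ring: "cring (poly_ring V)"
proof (rule cringI)
 show "abelian_group (poly_ring V)"
 proof (rule abelian_groupI)
  fix x assume "x \<in> carrier (poly_ring V)"
  then obtain p where p: "x = rs V p" by (auto simp: carrier_poly_ring)
  show "\<exists>y\<in>carrier (poly_ring V). y \<oplus>\<^bsub>poly_ring V\<^esub> x = \<zero>\<^bsub>poly_ring V\<^esub>"
   by (intro bexI[of _ "rs V (- p)"]) (auto simp: p poly_ring_ops carrier_poly_ring)
 qed (auto simp: carrier_poly_ring poly_ring_ops algebra_simps)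
 show "Group.comm_monoid (poly_ring V)"
  by (rule comm_monoidI) (auto simp: carrier_poly_ring poly_ring_ops algebra_simps)
qed (auto simp: carrier_poly_ring poly_ring_ops algebra_simps)

text \<open>The generators are all constant combinations because \<open>jac_ideal\<close> uses the
  derivatives along all vectors of the fixed space, not only along a basis.\<close>

lemma genideal_poly_ring:
 assumes "finite A"
 shows "Idl\<^bsub>poly_ring V\<^esub> {rs V (\<Sum>k\<in>A. cnst (c k) * h k) | c. True} = {rs V (\<Sum>k\<in>A. r k * h k) | r. True}"
  (is "Idl\<^bsub>?R\<^esub> ?S = ?J")
proof -
 interpret cring ?R by (rule cring_poly_ring)
 have memb: "rs V (\<Sum>k\<in>A. r k * h k) \<in> ?J" for r by blast
 have ideal: "ideal ?J ?R"
 proof (rule idealI)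
  show "ring ?R" by (rule ring_axioms)
  show "subgroup ?J (add_monoid ?R)"
  proof (rule add.subgroupI)
   show "?J \<subseteq> carrier ?R" by (auto simp: carrier_poly_ring)
   show "?J ~= {}" by blast
   fix x assume "x \<in> ?J"
   then obtain r where r: "x = rs V (\<Sum>k\<in>A. r k * h k)" by blast
   have "\<ominus>\<^bsub>?R\<^esub> x = rs V (- (\<Sum>k\<in>A. r k * h k))"
    by (rule minus_equality) (auto simp: r carrier_poly_ring poly_ring_ops)
   also have "- (\<Sum>k\<in>A. r k * h k) = (\<Sum>k\<in>A. (- r k) * h k)" by (simp add: sum_negf)
   finally show "\<ominus>\<^bsub>?R\<^esub> x \<in> ?J" by (simp only: memb)
   fix y assume "y \<in> ?J"
   then obtain s where s: "y = rs V (\<Sum>k\<in>A. s k * h k)" by blast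
   have "x \<oplus>\<^bsub>?R\<^esub> y = rs V (\<Sum>k\<in>A. (r k + s k) * h k)"
    by (simp add: r s poly_ring_ops distrib_right sum.distrib)
   thus "x \<oplus>\<^bsub>?R\<^esub> y \<in> ?J" by (simp only: memb)
  qed
  fix a x assume "a \<in> ?J" "x \<in> carrier ?R"
  then obtain r p where r: "a = rs V (\<Sum>k\<in>A. r k * h k)" "x = rs V p" by (auto simp: carrier_poly_ring)
  have "x \<otimes>\<^bsub>?R\<^esub> a = rs V (\<Sum>k\<in>A. (p * r k) * h k)"
   by (simp add: r poly_ring_ops sum_distrib_left mult.assoc)
  thus "x \<otimes>\<^bsub>?R\<^esub> a \<in> ?J" by (simp only: memb)
  have "a \<otimes>\<^bsub>?R\<^esub> x = rs V (\<Sum>k\<in>A. (r k * p) * h k)"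
   unfolding r poly_ring_ops sum_distrib_right
   by (intro arg_cong[where f = "rs V"] sum.cong refl) (simp add: mult_ac)
  thus "a \<otimes>\<^bsub>?R\<^esub> x \<in> ?J" by (simp only: memb)
 qed
 have "?S \<subseteq> ?J"
 proof
  fix x assume "x \<in> ?S"
  then obtain c where "x = rs V (\<Sum>k\<in>A. cnst (c k) * h k)" by blast
  thus "x \<in> ?J" by (simp only: memb)
 qed
 hence "Idl\<^bsub>?R\<^esub> ?S \<subseteq> ?J" unfolding genideal_def using ideal by blast
 moreover have "?J \<subseteq> Idl\<^bsub>?R\<^esub> ?S"
 proof
  fix x assume "x \<in> ?J"
  then obtain r where r: "x = rs V (\<Sum>k\<in>A. r k * h k)" by blast
  have "?S \<subseteq> carrier ?R" by (auto simp: carrier_poly_ring)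
  from genideal_ideal[OF this] have idl: "ideal (Idl\<^bsub>?R\<^esub> ?S) ?R" .
  have gen: "rs V (h k) \<in> Idl\<^bsub>?R\<^esub> ?S" if "k \<in> A" for k
  proof -
   have "(\<Sum>j\<in>A. cnst (if j = k then 1 else 0) * h j) = (\<Sum>j\<in>A. if j = k then h k else 0)"
    by (rule sum.cong) auto
   hence eq: "rs V (h k) = rs V (\<Sum>j\<in>A. cnst (if j = k then 1 else 0) * h j)" using that assms by simp
   have "rs V (h k) \<in> ?S" unfolding eq by (intro CollectI exI[of _ "%j. if j = k then 1 else 0"] conjI refl TrueI)
   thus ?thesis using genideal_self[OF \<open>?S \<subseteq> carrier ?R\<close>] by blast
  qed
  have "rs V (\<Sum>k\<in>B. r k * h k) \<in> Idl\<^bsub>?R\<^esub> ?S" if "B \<subseteq> A" for B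
   using finite_subset[OF that assms] that
  proof (induction B rule: finite_induct)
   case empty
   have "\<zero>\<^bsub>?R\<^esub> \<in> Idl\<^bsub>?R\<^esub> ?S" using additive_subgroup.zero_closed[OF ideal.axioms(1)[OF idl]] .
   thus ?case by (simp add: poly_ring_ops)
  next
   case (insert k B)
   have "rs V (r k) \<otimes>\<^bsub>?R\<^esub> rs V (h k) \<in> Idl\<^bsub>?R\<^esub> ?S"
    by (rule ideal.I_l_closed[OF idl gen]) (use insert in \<open>auto simp: carrier_poly_ring\<close>)
   moreover have "rs V (\<Sum>k\<in>B. r k * h k) \<in> Idl\<^bsub>?R\<^esub> ?S" using insert by blast
   ultimately have "(rs V (r k) \<otimes>\<^bsub>?R\<^esub> rs V (h k)) \<oplus>\<^bsub>?R\<^esub> rs V (\<Sum>k\<in>B. r k * h k) \<in> Idl\<^bsub>?R\<^esub> ?S"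
    by (rule additive_subgroup.a_closed[OF ideal.axioms(1)[OF idl]])
   thus ?case using insert.hyps by (simp add: poly_ring_ops)
  qed
  thus "x \<in> Idl\<^bsub>?R\<^esub> ?S" unfolding r by blast
 qed
 ultimately show ?thesis by blast
qed

section \<open>Finite symmetry groups\<close>

lemma matrix_inv_cancel:
 fixes A :: "complex ^ 'n::finite ^ 'n"
 assumes "invertible A"
 shows "A ** matrix_inv A = mat 1" "matrix_inv A ** A = mat 1"
 using someI_ex[OF assms[unfolded invertible_def]] by (auto simp: matrix_inv_def)

lemma invertible_matrix_inv: "invertible (A :: complex ^ 'n::finite ^ 'n) ==> invertible (matrix_inv A)"
 unfolding invertible_def using matrix_inv_cancel[of A] by (auto simp: invertible_def)

lemma invertible_mat_1: "invertible (mat 1 :: complex ^ 'n::finite ^ 'n)"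
 unfolding invertible_def by (intro exI[of _ "mat 1"]) simp

lemma group_GL: "group (GL :: (complex ^ 'n::finite ^ 'n) monoid)"
proof (rule groupI)
 show "\<exists>y\<in>carrier GL. y \<otimes>\<^bsub>GL\<^esub> x = \<one>\<^bsub>GL\<^esub>" if "x \<in> carrier GL" for x :: "complex ^ 'n ^ 'n"
  using that matrix_inv_cancel(2)[of x] invertible_matrix_inv[of x] by (auto simp: GL_def)
qed (auto simp: GL_def matrix_mul_assoc invertible_mat_1 intro: invertible_mult)

text \<open>A frame \<open>P\<close> of common eigenvectors of \<open>g\<close> and
  \<open>h\<close>, each lying in a single weight space; \<open>d'\<close> lists the weights of the
  frame, \<open>a\<close> and \<open>b\<close> the eigenvalues.\<close>

definition adapted :: "('n::finite => nat) => complex ^ 'n ^ 'n => complex ^ 'n ^ 'n => complex ^ 'n ^ 'n =>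
  ('n => nat) => ('n => complex) => ('n => complex) => nat => bool" where
 "adapted d g h P d' a b M \<longleftrightarrow> invertible P \<and> (\<forall>i k. P $ i $ k ~= 0 --> d i = d' k) \<and>
  g ** P = P ** dg a \<and> h ** P = P ** dg b \<and> M > 0 \<and> (\<forall>k. a k ^ M = 1 \<and> b k ^ M = 1)"

lemma adapted_norm:
 assumes "adapted d g h P d' a b M"
 shows "norm (a k) = 1" "norm (b k) = 1"
proof -
 have M: "M > 0" "a k ^ M = 1" "b k ^ M = 1" using assms by (auto simp: adapted_def)
 hence "norm (a k) ^ M = 1 ^ M" "norm (b k) ^ M = 1 ^ M" by (metis norm_one norm_power power_one)+
 thus "norm (a k) = 1" "norm (b k) = 1" using M(1) by (auto intro: power_eq_imp_eq_base)
qed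

text \<open>\<open>P\<close> intertwines the diagonal matrices of \<open>d'\<close> and
  \<open>d\<close>, so its inverse does so in the opposite direction.\<close>

lemma adapted_inverse_weights:
 fixes P :: "complex ^ 'n::finite ^ 'n" and d d' :: "'n => nat"
 assumes P: "invertible P" "\<And>i k. P $ i $ k ~= 0 ==> d i = d' k" and nz: "matrix_inv P $ k $ i ~= 0"
 shows "d i = d' k"
proof -
 let ?E = "dg (%k. of_nat (d k))" and ?E' = "dg (%k. of_nat (d' k))"
 have "?E ** P = P ** ?E'"
  unfolding dg_mult mult_dg vec_eq_iff
 proof (intro allI)
  fix i k show "(\<chi> i k. of_nat (d i) * P $ i $ k) $ i $ k = (\<chi> i k. P $ i $ k * of_nat (d' k)) $ i $ k"
   using P(2)[of i k] by (cases "P $ i $ k = 0") auto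
 qed
 hence "matrix_inv P ** (?E ** P) ** matrix_inv P = matrix_inv P ** (P ** ?E') ** matrix_inv P" by simp
 hence "(matrix_inv P ** ?E) ** (P ** matrix_inv P) = (matrix_inv P ** P) ** (?E' ** matrix_inv P)"
  by (simp only: matrix_mul_assoc)
 hence "matrix_inv P ** ?E = ?E' ** matrix_inv P" by (simp add: matrix_inv_cancel[OF P(1)])
 hence "(matrix_inv P ** ?E) $ k $ i = (?E' ** matrix_inv P) $ k $ i" by simp
 thus ?thesis using nz by (simp add: dg_mult mult_dg)
qed

lemma adapted_weight_space:
 fixes P :: "complex ^ 'n::finite ^ 'n" and d d' :: "'n => nat"
 assumes P: "invertible P" "\<And>i k. P $ i $ k ~= 0 ==> d i = d' k" and d0: "d0 > 0"
 shows "P *v y \<in> weight_space (%k. real (d k) / real d0) w \<longleftrightarrow> (\<forall>k. real (d' k) / real d0 ~= w --> y $ k = 0)"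
proof
 assume x: "P *v y \<in> weight_space (%k. real (d k) / real d0) w"
 show "\<forall>k. real (d' k) / real d0 ~= w --> y $ k = 0"
 proof (intro allI impI)
  fix k assume k: "real (d' k) / real d0 ~= w"
  have "y = matrix_inv P *v (P *v y)" by (simp add: matrix_vector_mul_assoc matrix_inv_cancel[OF P(1)])
  from arg_cong[OF this, of "%v. v $ k"]
  have "y $ k = (\<Sum>i\<in>UNIV. matrix_inv P $ k $ i * (P *v y) $ i)"
   unfolding matrix_vector_mult_def[of "matrix_inv P"] vec_lambda_beta .
  also have "\<dots> = 0"
  proof (rule sum.neutral, rule ballI)
   fix i
   show "matrix_inv P $ k $ i * (P *v y) $ i = 0"
   proof (cases "matrix_inv P $ k $ i = 0")
    case False
    from adapted_inverse_weights[OF P False] have "d i = d' k" .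
    thus ?thesis using x k by (simp add: weight_space_eq)
   qed simp
  qed
  finally show "y $ k = 0" .
 qed
next
 assume y: "\<forall>k. real (d' k) / real d0 ~= w --> y $ k = 0"
 have "(P *v y) $ i = 0" if i: "real (d i) / real d0 ~= w" for i
  unfolding matrix_vector_mult_def vec_lambda_beta
 proof (rule sum.neutral, rule ballI)
  fix k show "P $ i $ k * y $ k = 0" using P(2)[of i k] y i by (cases "P $ i $ k = 0") auto
 qed
 thus "P *v y \<in> weight_space (%k. real (d k) / real d0) w" by (simp add: weight_space_eq)
qed

locale orbifold = calabi_yau fp d d0 for fp :: "'n::finite mpoly" and d d0 +
 fixes G :: "(complex ^ 'n ^ 'n) set" and Ix :: "complex ^ 'n ^ 'n => 'n set"
 assumes subgroup_G: "subgroup G GL" and finite_G: "finite G" and G_SL: "G \<subseteq> SL_of (ev fp)"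
  and J_G: "J_group (%k. real (d k) / real d0) \<subseteq> G"
  and fixed: "\<And>g. g \<in> G ==> fixed_indices (%k. real (d k) / real d0) g (Ix g)"
begin

abbreviation q :: "'n => real" where "q \<equiv> %k. real (d k) / real d0"

lemma G_facts:
 assumes "g \<in> G"
 shows "invertible g" "ev fp (g *v x) = ev fp x" "det g = 1"
 using assms G_SL by (auto simp: SL_of_def GL_of_def GL_def)

lemma G_one: "mat 1 \<in> G" and G_mult: "g \<in> G ==> h \<in> G ==> g ** h \<in> G"
 using subgroup.one_closed[OF subgroup_G] subgroup.m_closed[OF subgroup_G] by (auto simp: GL_def)

lemma G_inv: "g \<in> G ==> matrix_inv g \<in> G"
proof -
 assume g: "g \<in> G"
 have "inv\<^bsub>GL\<^esub> g = matrix_inv g"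
  using matrix_inv_cancel[OF G_facts(1)[OF g]] G_facts(1)[OF g] invertible_matrix_inv
  by (intro group.inv_equality[OF group_GL]) (auto simp: GL_def)
 thus ?thesis using subgroup.m_inv_closed[OF subgroup_G g] by simp
qed

text \<open>The order of the group is a common period; it is expressed by iterates because
  \<open>eigenvectors_span\<close> works with them.\<close>

lemma G_period: "\<exists>M>0. \<forall>g\<in>G. \<forall>x. ((*v) g ^^ M) x = x"
proof -
 interpret Gr: group "GL\<lparr>carrier := G\<rparr>"
  by (rule subgroup.subgroup_is_group[OF subgroup_G group_GL])
 have pow: "(g [^]\<^bsub>GL\<lparr>carrier := G\<rparr>\<^esub> n) *v x = ((*v) g ^^ n) x" for g :: "complex ^ 'n ^ 'n" and n :: nat and x
 proof (induction n arbitrary: x)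
  case 0 show ?case by (simp add: GL_def)
 next
  case (Suc n)
  have "(g [^]\<^bsub>GL\<lparr>carrier := G\<rparr>\<^esub> Suc n) = (g [^]\<^bsub>GL\<lparr>carrier := G\<rparr>\<^esub> n) ** g"
   by (simp add: GL_def)
  thus ?case using Suc[of "g *v x"] by (simp add: matrix_vector_mul_assoc[symmetric] funpow_swap1)
 qed
 have carrier: "carrier (GL\<lparr>carrier := G\<rparr>) = G" and one: "\<one>\<^bsub>GL\<lparr>carrier := G\<rparr>\<^esub> = mat 1"
  by (simp_all add: GL_def)
 have "((*v) g ^^ order (GL\<lparr>carrier := G\<rparr>)) x = x" if "g \<in> G" for g x
  unfolding pow[symmetric] Gr.pow_order_eq_1[of g, unfolded carrier, OF that] one
  by (rule matrix_vector_mul_lid)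
 moreover have "order (GL\<lparr>carrier := G\<rparr>) > 0"
  using finite_G G_one by (auto simp: order_def card_gt_0_iff)
 ultimately show ?thesis by blast
qed

lemma G_weights: "g \<in> G ==> g $ i $ k ~= 0 ==> d i = d k"
 by (rule symmetry_preserves_weights[OF G_facts(1,2)])

text \<open>By \<open>G_weights\<close> the diagonal matrix of the weights commutes with
  \<open>g\<close> and \<open>h\<close>, so all three can be diagonalized together.\<close>

lemma adapted_exists:
 assumes g: "g \<in> G" and h: "h \<in> G" and gh: "g ** h = h ** g"
 shows "\<exists>P d' a b M. adapted d g h P d' a b M"
proof -
 define E where "E = dg (%k. of_nat (d k))"
 have comm: "E ** u = u ** E" if "u \<in> G" for u
  unfolding E_def dg_mult mult_dg vec_eq_iff
 proof (intro allI)
  fix i k show "(\<chi> i k. of_nat (d i) * u $ i $ k) $ i $ k = (\<chi> i k. u $ i $ k * of_nat (d k)) $ i $ k"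
   using G_weights[OF that, of i k] by (cases "u $ i $ k = 0") auto
 qed
 have Ek: "E *v axis k 1 = of_nat (d k) *s axis k 1" for k
  by (auto simp: E_def dg_mult_vec vec_eq_iff axis_def)
 obtain M where M: "M > 0" "\<And>g x. g \<in> G ==> ((*v) g ^^ M) x = x" using G_period by blast
 from common_eigenbasis[OF Ek comm[OF g] comm[OF h] gh M(1) M(2)[OF g] M(2)[OF h]]
 obtain P :: "complex ^ 'n ^ 'n" and e' a b where P: "invertible P" "E ** P = P ** dg e'" "g ** P = P ** dg a"
   "h ** P = P ** dg b" "\<And>k. a k ^ M = 1 \<and> b k ^ M = 1" by blast
 have eq: "of_nat (d i) = e' k" if "P $ i $ k ~= 0" for i k
 proof -
  have "(E ** P) $ i $ k = (P ** dg e') $ i $ k" by (simp add: P(2))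
  thus ?thesis using that by (simp add: E_def dg_mult mult_dg)
 qed
 have "\<exists>w. \<forall>i. P $ i $ k ~= 0 --> d i = w" for k
 proof (cases "\<exists>i. P $ i $ k ~= 0")
  case True
  then obtain j where "P $ j $ k ~= 0" by blast
  have "d i = d j" if "P $ i $ k ~= 0" for i
   using eq[OF that] eq[OF \<open>P $ j $ k ~= 0\<close>] by (metis of_nat_eq_iff)
  thus ?thesis by blast
 qed auto
 then obtain d' where "\<And>k i. P $ i $ k ~= 0 --> d i = d' k" by metis
 hence "adapted d g h P d' a b M" using P M(1) by (auto simp: adapted_def)
 thus ?thesis by blast
qed

lemma adapted_Fix:
 assumes "adapted d g h P d' a b M"
 shows "P *v y \<in> Fix g \<longleftrightarrow> (\<forall>k. a k ~= 1 --> y $ k = 0)"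
proof -
 have P: "invertible P" "g ** P = P ** dg a" using assms by (auto simp: adapted_def)
 have inj: "P *v u = P *v v ==> u = v" for u v
  using matrix_inv_cancel(2)[OF P(1)] by (metis matrix_vector_mul_assoc matrix_vector_mul_lid)
 have "P *v y \<in> Fix g \<longleftrightarrow> P *v (\<chi> k. a k * y $ k) = P *v y"
  by (simp add: Fix_def diag_power[OF P])
 also have "\<dots> \<longleftrightarrow> (\<chi> k. a k * y $ k) = y" by (rule iffI, erule inj, simp)
 also have "\<dots> \<longleftrightarrow> (\<forall>k. a k ~= 1 --> y $ k = 0)"
  by (auto simp: vec_eq_iff)
 finally show ?thesis .
qed

lemma adapted_vec:
 assumes "adapted d g h P d' a b M"
 obtains y where "x = P *v y"
proof
 have "invertible P" using assms by (simp add: adapted_def)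
 thus "x = P *v (matrix_inv P *v x)" by (simp add: matrix_vector_mul_assoc matrix_inv_cancel)
qed

lemma adapted_levels:
 assumes "adapted d g h P d' a b M"
 shows "card {k. a k = 1 \<and> real (d' k) / real d0 = w} = vec.dim (Fix g \<inter> weight_space q w)"
  "card {k. real (d' k) / real d0 = w} = vec.dim (weight_space q w)"
proof -
 have P: "invertible P" "\<And>i k. P $ i $ k ~= 0 ==> d i = d' k" using assms by (auto simp: adapted_def)
 have "Fix g \<inter> weight_space q w = {P *v y | y. \<forall>k. k \<notin> {k. a k = 1 \<and> real (d' k) / real d0 = w} --> y $ k = 0}"
 proof (intro equalityI subsetI)
  fix x assume x: "x \<in> Fix g \<inter> weight_space q w"
  obtain y where y: "x = P *v y" using adapted_vec[OF assms] .
  thus "x \<in> {P *v y | y. \<forall>k. k \<notin> {k. a k = 1 \<and> real (d' k) / real d0 = w} --> y $ k = 0}"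
   using x adapted_Fix[OF assms, of y] adapted_weight_space[OF P d0_pos, where y = y and w = w] by auto
 next
  fix x assume "x \<in> {P *v y | y. \<forall>k. k \<notin> {k. a k = 1 \<and> real (d' k) / real d0 = w} --> y $ k = 0}"
  thus "x \<in> Fix g \<inter> weight_space q w"
   using adapted_Fix[OF assms] adapted_weight_space[OF P d0_pos] by auto
 qed
 thus "card {k. a k = 1 \<and> real (d' k) / real d0 = w} = vec.dim (Fix g \<inter> weight_space q w)"
  by (simp only: dim_coordinate_image[OF P(1)])
 have "weight_space q w = {P *v y | y. \<forall>k. k \<notin> {k. real (d' k) / real d0 = w} --> y $ k = 0}"
 proof (intro equalityI subsetI)
  fix x assume x: "x \<in> weight_space q w"
  obtain y where y: "x = P *v y" using adapted_vec[OF assms] .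
  thus "x \<in> {P *v y | y. \<forall>k. k \<notin> {k. real (d' k) / real d0 = w} --> y $ k = 0}"
   using x adapted_weight_space[OF P d0_pos, where y = y and w = w] by auto
 next
  fix x assume "x \<in> {P *v y | y. \<forall>k. k \<notin> {k. real (d' k) / real d0 = w} --> y $ k = 0}"
  thus "x \<in> weight_space q w" using adapted_weight_space[OF P d0_pos] by auto
 qed
 thus "card {k. real (d' k) / real d0 = w} = vec.dim (weight_space q w)"
  by (simp only: dim_coordinate_image[OF P(1)])
qed

lemma sum_div_d0: "(\<Sum>k\<in>A. real (c k) / real d0) = real (\<Sum>k\<in>A. c k) / real d0"
 by (simp add: sum_divide_distrib)

lemma adapted_sums:
 assumes ad: "adapted d g h P d' a b M" and g: "g \<in> G"
 shows "(\<Sum>k | a k = 1. d' k) = (\<Sum>k\<in>Ix g. d k)" "card {k. a k = 1} = card (Ix g)"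
  "(\<Sum>k\<in>UNIV. d' k) = d0"
proof -
 have lev: "card {k \<in> {k. a k = 1}. real (d' k) / real d0 = w} = card {k \<in> Ix g. q k = w}" for w
  using adapted_levels(1)[OF ad, of w] fixed[OF g] by (simp add: fixed_indices_def)
 have "(\<Sum>k | a k = 1. real (d' k) / real d0) = (\<Sum>k\<in>Ix g. q k)"
  by (rule sum_level_sets) (use lev in auto)
 hence "real (\<Sum>k | a k = 1. d' k) = real (\<Sum>k\<in>Ix g. d k)" using d0_pos by (simp only: sum_div_d0) simp
 thus "(\<Sum>k | a k = 1. d' k) = (\<Sum>k\<in>Ix g. d k)" by (simp only: of_nat_eq_iff)
 \<comment> \<open>Raising every weight by 1 adds the number of indices to the sum, so this equation
   and the previous one together compare cardinalities.\<close>
 have "(\<Sum>k | a k = 1. real (d' k) / real d0 + 1) = (\<Sum>k\<in>Ix g. q k + 1)"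
 proof (rule sum_level_sets)
  fix w show "card {k \<in> {k. a k = 1}. real (d' k) / real d0 + 1 = w} = card {k \<in> Ix g. q k + 1 = w}"
   using lev[of "w - 1"] by (simp add: eq_diff_eq)
 qed auto
 thus "card {k. a k = 1} = card (Ix g)"
  using \<open>(\<Sum>k | a k = 1. real (d' k) / real d0) = _\<close> by (simp add: sum.distrib)
 have id: "adapted d (mat 1) (mat 1) (mat 1) d (%_. 1) (%_. 1) 1"
 proof -
  have "dg (%_. 1) = (mat 1 :: complex ^ 'n ^ 'n)" by (simp add: dg_def mat_def)
  moreover have "(mat 1 :: complex ^ 'n ^ 'n) $ i $ k ~= 0 ==> d i = d k" for i k
   by (cases "i = k") (auto simp: mat_def)
  ultimately show ?thesis using invertible_mat_1 by (auto simp: adapted_def)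
 qed
 \<comment> \<open>The comparison is with the frame of the identity matrix, whose weights are
   \<open>d\<close>.\<close>
 have "(\<Sum>k\<in>UNIV. real (d' k) / real d0) = (\<Sum>k\<in>UNIV. q k)"
  by (rule sum_level_sets) (use adapted_levels(2)[OF ad] adapted_levels(2)[OF id] in auto)
 hence "real (\<Sum>k\<in>UNIV. d' k) = real (\<Sum>k\<in>UNIV. d k)" using d0_pos by (simp only: sum_div_d0) simp
 thus "(\<Sum>k\<in>UNIV. d' k) = d0" using cy by (simp only: of_nat_eq_iff)
qed

text \<open>The preimage of the Jacobian ideal in the full polynomial ring; it contains all
  polynomials vanishing on \<open>Fix g\<close>. All sectors thereby become quotients of one
  ring.\<close>

definition K :: "complex ^ 'n ^ 'n => 'n mpoly set" where
 "K g = {p. rs (Fix g) p \<in> jac_ideal (ev fp) g}"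

lemma jac_ideal_eq:
 assumes ad: "adapted d g h P d' a b M"
 shows "jac_ideal (ev fp) g = {rs (Fix g) (\<Sum>k | a k = 1. r k * sub (matrix_inv P) (pd (sub P fp) k)) | r. True}"
proof -
 have P: "invertible P" using ad by (simp add: adapted_def)
 define H where "H = (%k. sub (matrix_inv P) (pd (sub P fp) k))"
 have H: "ev (H k) (P *v y) = (\<Sum>i\<in>UNIV. P $ i $ k * ev (F i) (P *v y))" for k y
  by (simp add: H_def ev_pd_sub matrix_vector_mul_assoc matrix_inv_cancel[OF P])
 have dd: "restrict (dir_deriv (restrict (ev fp) (Fix g)) (P *v v)) (Fix g) =
   rs (Fix g) (\<Sum>k | a k = 1. cnst (v $ k) * H k)" if v: "P *v v \<in> Fix g" for v
  unfolding rs_def restrict_def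
 proof (rule ext, intro if_cong refl)
  fix x assume x: "x \<in> Fix g"
  obtain y where y: "x = P *v y" using adapted_vec[OF ad] .
  \<comment> \<open>The whole line stays in \<open>Fix g\<close>, so the default value of
    \<open>restrict\<close> outside is never met and the derivative is that of f itself.\<close>
  have "x + t *s (P *v v) \<in> Fix g" for t
   using x v by (simp add: Fix_def matrix_vector_right_distrib vector_scalar_commute)
  hence "dir_deriv (%x. if x \<in> Fix g then ev fp x else undefined) (P *v v) x = dir_deriv (ev fp) (P *v v) x"
   by (simp add: dir_deriv_def)
  also have "\<dots> = (\<Sum>i\<in>UNIV. (\<Sum>k\<in>UNIV. P $ i $ k * v $ k) * ev (F i) x)"
   by (simp add: dir_deriv_ev matrix_vector_mult_def)
  also have "\<dots> = (\<Sum>i\<in>UNIV. \<Sum>k\<in>UNIV. v $ k * (P $ i $ k * ev (F i) x))"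
   unfolding sum_distrib_right by (intro sum.cong refl) (simp add: mult_ac)
  also have "\<dots> = (\<Sum>k\<in>UNIV. \<Sum>i\<in>UNIV. v $ k * (P $ i $ k * ev (F i) x))" by (rule sum.swap)
  also have "\<dots> = (\<Sum>k\<in>UNIV. v $ k * ev (H k) x)" unfolding y H by (simp add: sum_distrib_left)
  also have "\<dots> = (\<Sum>k | a k = 1. v $ k * ev (H k) x)"
   by (rule sum.mono_neutral_right) (use v adapted_Fix[OF ad] in auto)
  finally show "dir_deriv (%x. if x \<in> Fix g then ev fp x else undefined) (P *v v) x =
    ev (\<Sum>k | a k = 1. cnst (v $ k) * H k) x" by simp
 qed
 have "{restrict (dir_deriv (restrict (ev fp) (Fix g)) v) (Fix g) | v. v \<in> Fix g} =
   {rs (Fix g) (\<Sum>k | a k = 1. cnst (c k) * H k) | c. True}" (is "?A = ?B")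
 proof (intro equalityI subsetI)
  fix u assume "u \<in> ?A"
  then obtain v where v: "v \<in> Fix g" "u = restrict (dir_deriv (restrict (ev fp) (Fix g)) v) (Fix g)" by blast
  obtain y where y: "v = P *v y" using adapted_vec[OF ad] .
  from dd[of y] v y have "u = rs (Fix g) (\<Sum>k | a k = 1. cnst (y $ k) * H k)" by simp
  thus "u \<in> ?B" by blast
 next
  fix u assume "u \<in> ?B"
  then obtain c where c: "u = rs (Fix g) (\<Sum>k | a k = 1. cnst (c k) * H k)" by blast
  define v :: "complex ^ 'n" where "v = (\<chi> k. if a k = 1 then c k else 0)"
  have "P *v v \<in> Fix g" using adapted_Fix[OF ad] by (simp add: v_def)
  moreover have "(\<Sum>k | a k = 1. cnst (v $ k) * H k) = (\<Sum>k | a k = 1. cnst (c k) * H k)"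
   by (rule sum.cong) (auto simp: v_def)
  ultimately show "u \<in> ?A" using dd[of v] c by (intro CollectI exI[of _ "P *v v"] conjI) simp_all
 qed
 hence "jac_ideal (ev fp) g = {rs (Fix g) (\<Sum>k | a k = 1. r k * H k) | r. True}"
  unfolding jac_ideal_def using genideal_poly_ring[of "{k. a k = 1}" "Fix g" H] by simp
 thus ?thesis by (simp only: H_def)
qed

end

section \<open>Duality in the twisted sectors\<close>

lemma linear_form_expand: "linear_form \<phi> ==> \<phi> p = (\<Sum>m\<in>supp p. coef p m * \<phi> (term_of m 1))"
proof -
 assume l: "linear_form \<phi>"
 have "\<phi> p = \<phi> (\<Sum>m\<in>supp p. term_of m (coef p m))" using mpoly_eq_sum[of p] by simp
 also have "\<dots> = (\<Sum>m\<in>supp p. \<phi> (term_of m (coef p m)))" by (rule linear_form_sum[OF l])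
 also have "\<dots> = (\<Sum>m\<in>supp p. coef p m * \<phi> (term_of m 1))"
 proof (rule sum.cong)
  fix m
  have "\<phi> (cnst (coef p m) * term_of m 1) = coef p m * \<phi> (term_of m 1)"
   using l unfolding linear_form_def by blast
  thus "\<phi> (term_of m (coef p m)) = coef p m * \<phi> (term_of m 1)" by (simp add: mult_single)
 qed simp
 finally show ?thesis .
qed

abbreviation wpart :: "('n::finite => nat) => nat => 'n mpoly => 'n mpoly" where
 "wpart d w p \<equiv> filt (%m. wdeg d m = w) p"

lemma sum_wpart: "p = (\<Sum>w\<in>wdeg d ` supp p. wpart d w p)"
 by (rule sum_filt) auto

lemma graded_wdeg_mult:
 "wgraded d v p ==> wgraded d w r ==> wgraded d (v + w) (p * r)"
 by (rule graded_mult) (auto simp: wdeg_add)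

text \<open>Homogeneity of \<open>\<tau>\<close>: it is supported in the single weight t - s,
  written without subtraction.\<close>

definition top_degree :: "('n::finite => nat) => ('n mpoly => complex) => nat => nat => bool" where
 "top_degree d \<tau> s t \<longleftrightarrow> (\<forall>w p. wgraded d w p --> \<tau> p ~= 0 --> w + s = t)"

text \<open>In the top weight, subtract from \<open>p\<close> the multiple of \<open>e\<close> with
  the same value under \<open>\<sigma>\<close>. The difference pairs to 0 with every polynomial, by
  degree and because only constants have weight 0. So it lies in \<open>K\<close>, and
  \<open>\<tau>\<close> kills it as well.\<close>

lemma dual_generator_unique:
 fixes \<tau> \<sigma> :: "'n::finite mpoly => complex"
 assumes d: "\<And>k. d k > 0" and \<tau>: "dual_generator \<tau> K" "top_degree d \<tau> s t"
  and \<sigma>: "dual_generator \<sigma> K" "top_degree d \<sigma> s t"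
 shows "\<exists>c. \<forall>p. \<tau> p = c * \<sigma> p"
proof (cases "\<forall>p. \<sigma> p = 0")
 case True
 hence "\<forall>p. p \<in> K" using \<sigma> by (simp add: dual_generator_def)
 hence "\<tau> (p * 1) = 0" for p using \<tau> unfolding dual_generator_def by blast
 thus ?thesis by (intro exI[of _ 0]) simp
next
 case False
 have lt: "linear_form \<tau>" and ls: "linear_form \<sigma>" using \<tau> \<sigma> by (auto simp: dual_generator_def)
 obtain p0 where "\<sigma> p0 ~= 0" using False by blast
 hence "(\<Sum>w\<in>wdeg d ` supp p0. \<sigma> (wpart d w p0)) ~= 0"
  using linear_form_sum[OF ls, of "%w. wpart d w p0" "wdeg d ` supp p0"] sum_wpart[of p0 d] by simp
 then obtain w where w: "\<sigma> (wpart d w p0) ~= 0" by (rule sum.not_neutral_contains_not_neutral)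
 define e where "e = wpart d w p0"
 have e: "wgraded d w e" "\<sigma> e ~= 0" using w by (auto simp: e_def)
 hence wt: "w + s = t" using \<sigma>(2) unfolding top_degree_def by blast
 have hom: "\<tau> p = \<tau> e / \<sigma> e * \<sigma> p" if p: "wgraded d v p" for v p
 proof (cases "v = w")
  case False
  hence "\<tau> p = 0" "\<sigma> p = 0" using p \<tau>(2) \<sigma>(2) wt unfolding top_degree_def by (metis add_right_cancel)+
  thus ?thesis by simp
 next
  case True
  define u where "u = p - cnst (\<sigma> p / \<sigma> e) * e"
  have gu: "wgraded d w u"
  proof -
   have "wgraded d (0 + w) (cnst (- (\<sigma> p / \<sigma> e)) * e)"
    by (rule graded_wdeg_mult[OF graded_cnst(1) e(1)])
   hence "wgraded d w (p + cnst (- (\<sigma> p / \<sigma> e)) * e)" using p True by (intro graded_add) auto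
   thus ?thesis by (simp add: u_def single_uminus)
  qed
  have \<sigma>c: "\<sigma> (cnst c * r) = c * \<sigma> r" and \<tau>c: "\<tau> (cnst c * r) = c * \<tau> r" for c r
   using lt ls by (auto simp: linear_form_def)
  have \<sigma>u: "\<sigma> u = 0" using e(2) by (simp add: u_def linear_form_diff[OF ls] \<sigma>c)
  have part: "\<sigma> (u * wpart d v r) = 0" for v r
  proof (cases "v = 0")
   case True
   have "wpart d 0 r = cnst (coef r 0)"
    by (rule poly_mapping_eqI) (auto simp: wdeg_eq_0[OF d] lookup_single when_def)
   thus ?thesis using True \<sigma>u \<sigma>c[of "coef r 0" u] by (simp add: mult.commute)
  next
   case False
   have "wgraded d (w + v) (u * wpart d v r)" by (rule graded_wdeg_mult[OF gu]) simp
   thus ?thesis using \<sigma>(2) wt False unfolding top_degree_def by fastforce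
  qed
  have "\<sigma> (u * r) = 0" for r
  proof -
   have "u * r = (\<Sum>v\<in>wdeg d ` supp r. u * wpart d v r)"
    using arg_cong[OF sum_wpart[of r d], of "%r. u * r"] by (simp add: sum_distrib_left)
   thus ?thesis by (simp add: linear_form_sum[OF ls] part)
  qed
  hence "u \<in> K" using \<sigma>(1) by (simp add: dual_generator_def)
  hence "\<tau> (u * 1) = 0" using \<tau>(1) unfolding dual_generator_def by blast
  thus ?thesis by (simp add: u_def linear_form_diff[OF lt] \<tau>c)
 qed
 have "\<tau> p = \<tau> e / \<sigma> e * \<sigma> p" for p
 proof -
  have "\<tau> p = (\<Sum>v\<in>wdeg d ` supp p. \<tau> (wpart d v p))"
   using linear_form_sum[OF lt, of "%w. wpart d w p" "wdeg d ` supp p"] sum_wpart[of p d] by simp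
  also have "\<dots> = (\<Sum>v\<in>wdeg d ` supp p. \<tau> e / \<sigma> e * \<sigma> (wpart d v p))"
   by (intro sum.cong refl hom[OF graded_filt])
  also have "\<dots> = \<tau> e / \<sigma> e * \<sigma> p"
   using linear_form_sum[OF ls, of "%w. wpart d w p" "wdeg d ` supp p"] sum_wpart[of p d]
   by (simp add: sum_distrib_left)
  finally show ?thesis .
 qed
 thus ?thesis by blast
qed

text \<open>Splitting the second factor into weight components leaves only the complementary weight;
  all the claims come from this.\<close>

lemma dual_generator_graded:
 fixes \<tau> :: "'n::finite mpoly => complex"
 assumes \<tau>: "dual_generator \<tau> K" "top_degree d \<tau> s t"
 shows "p \<in> K ==> wpart d w p \<in> K" "wgraded d w p ==> w + s > t ==> p \<in> K"
  "p \<in> K ==> r \<in> K ==> p + r \<in> K" "p \<in> K ==> p * r \<in> K" "0 \<in> K"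
  "wgraded d w p ==> p \<notin> K ==> \<exists>v r. wgraded d v r \<and> v + w + s = t \<and> \<tau> (p * r) ~= 0"
proof -
 have lt: "linear_form \<tau>" and K: "\<And>p. p \<in> K \<longleftrightarrow> (\<forall>r. \<tau> (p * r) = 0)" using \<tau>(1) by (auto simp: dual_generator_def)
 have expand: "\<tau> (p * r) = (\<Sum>v\<in>wdeg d ` supp r. \<tau> (p * wpart d v r))" for p r
 proof -
  have "p * r = (\<Sum>v\<in>wdeg d ` supp r. p * wpart d v r)"
   using arg_cong[OF sum_wpart[of r d], of "%r. p * r"] by (simp add: sum_distrib_left)
  thus ?thesis by (simp add: linear_form_sum[OF lt])
 qed
 have deg: "\<tau> p = 0" if "wgraded d w p" "w + s ~= t" for p w
  using \<tau>(2) that unfolding top_degree_def by blast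
 show 0: "0 \<in> K" using K linear_form_0[OF lt] by simp
 show "p \<in> K ==> r \<in> K ==> p + r \<in> K"
  using K lt by (simp add: distrib_right linear_form_def)
 show "p \<in> K ==> p * r \<in> K" using K by (simp add: mult.assoc)
 show "p \<in> K" if "wgraded d w p" "w + s > t"
  unfolding K
 proof
  fix r
  have "\<tau> (p * wpart d v r) = 0" for v
   by (rule deg[OF graded_wdeg_mult[OF that(1) graded_filt]]) (use that(2) in simp)
  hence "(\<Sum>v\<in>wdeg d ` supp r. \<tau> (p * wpart d v r)) = 0" by simp
  thus "\<tau> (p * r) = 0" by (rule trans[OF expand])
 qed
 show "wpart d w p \<in> K" if p: "p \<in> K"
  unfolding K
 proof
  fix r
  have "\<tau> (wpart d w p * wpart d v r) = 0" for v
  proof (cases "w + v + s = t")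
   case False
   show ?thesis by (rule deg[OF graded_wdeg_mult[OF graded_filt graded_filt] False])
  next
   case True
   have "\<tau> (wpart d v r * p) = (\<Sum>u\<in>wdeg d ` supp p. \<tau> (wpart d v r * wpart d u p))" by (rule expand)
   also have "\<dots> = (\<Sum>u\<in>wdeg d ` supp p. if u = w then \<tau> (wpart d v r * wpart d w p) else 0)"
   proof (rule sum.cong)
    fix u
    show "\<tau> (wpart d v r * wpart d u p) = (if u = w then \<tau> (wpart d v r * wpart d w p) else 0)"
    proof (cases "u = w")
     case False
     have "\<tau> (wpart d v r * wpart d u p) = 0"
      by (rule deg[OF graded_wdeg_mult[OF graded_filt graded_filt]]) (use True False in simp)
     thus ?thesis using False by simp
    qed simp
   qed simp
   also have "\<dots> = \<tau> (wpart d v r * wpart d w p)"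
   proof (cases "w \<in> wdeg d ` supp p")
    case False
    hence "wpart d w p = 0" by (intro filt_eq_0) blast
    thus ?thesis using linear_form_0[OF lt] by simp
   qed simp
   finally have "\<tau> (wpart d w p * wpart d v r) = \<tau> (p * wpart d v r)" by (simp only: mult.commute)
   moreover have "\<tau> (p * wpart d v r) = 0" using p K by blast
   ultimately show ?thesis by simp
  qed
  hence "(\<Sum>v\<in>wdeg d ` supp r. \<tau> (wpart d w p * wpart d v r)) = 0" by simp
  thus "\<tau> (wpart d w p * r) = 0" by (rule trans[OF expand])
 qed
 assume p: "wgraded d w p" "p \<notin> K"
 then obtain r where "\<tau> (p * r) ~= 0" using K by blast
 hence "(\<Sum>v\<in>wdeg d ` supp r. \<tau> (p * wpart d v r)) ~= 0" using expand[of p r] by simp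
 then obtain v where v: "\<tau> (p * wpart d v r) ~= 0" by (rule sum.not_neutral_contains_not_neutral)
 hence "w + v + s = t" using deg[OF graded_wdeg_mult[OF p(1) graded_filt]] by blast
 thus "\<exists>v r. wgraded d v r \<and> v + w + s = t \<and> \<tau> (p * r) ~= 0"
  using v graded_filt by (metis add.commute)
qed

lemma scale_commute:
 fixes P :: "complex ^ 'n::finite ^ 'n" and d d' :: "'n => nat"
 assumes "\<And>i k. P $ i $ k ~= 0 ==> d i = d' k"
 shows "P *v (\<chi> k. t ^ d' k * y $ k) = (\<chi> i. t ^ d i * (P *v y) $ i)"
proof -
 have "P $ i $ k * (t ^ d' k * y $ k) = t ^ d i * (P $ i $ k * y $ k)" for i k
  using assms[of i k] by (cases "P $ i $ k = 0") auto
 thus ?thesis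
  unfolding matrix_vector_mult_def vec_eq_iff vec_lambda_beta sum_distrib_left
  by (intro allI sum.cong refl)
qed

lemma graded_sub:
 fixes P :: "complex ^ 'n::finite ^ 'n" and d d' :: "'n => nat"
 assumes "\<And>i k. P $ i $ k ~= 0 ==> d i = d' k" "wgraded d w p"
 shows "wgraded d' w (sub P p)"
proof (rule graded_wdegI)
 fix x
 show "ev (sub P p) (\<chi> k. 2 ^ d' k * x $ k) = 2 ^ w * ev (sub P p) x"
 proof -
  have "P *v (\<chi> k. 2 ^ d' k * x $ k) = (\<chi> i. 2 ^ d i * (P *v x) $ i)"
   by (rule scale_commute) (rule assms(1))
  thus ?thesis by (simp only: ev_sub ev_scale[OF assms(2)])
 qed
qed

context orbifold
begin

definition stuple :: "complex ^ 'n ^ 'n => ('n => complex) => 'n => 'n mpoly" where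
 "stuple P a k = (if a k = 1 then pd (sub P fp) k else Var k)"

text \<open>The moved coordinates vanish on \<open>Fix g\<close>, and any polynomial vanishing there
  lies in the ideal they generate. So working modulo them is the same as restricting to
  \<open>Fix g\<close>.\<close>

lemma K_iff:
 assumes ad: "adapted d g h P d' a b M"
 shows "p \<in> K g \<longleftrightarrow> sub P p \<in> idl (stuple P a) UNIV"
proof
 have P: "invertible P" using ad by (simp add: adapted_def)
 have inv: "matrix_inv P *v (P *v y) = y" for y
  by (simp add: matrix_vector_mul_assoc matrix_inv_cancel[OF P])
 assume "p \<in> K g"
 then obtain r where "rs (Fix g) p = rs (Fix g) (\<Sum>k | a k = 1. r k * sub (matrix_inv P) (pd (sub P fp) k))"
  unfolding K_def jac_ideal_eq[OF ad] by blast
 hence r: "ev p x = (\<Sum>k | a k = 1. ev (r k) x * ev (pd (sub P fp) k) (matrix_inv P *v x))" if "x \<in> Fix g" for x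
  using that by (simp add: rs_eq_iff)
 define A where "A = (\<Sum>k | a k = 1. stuple P a k * sub P (r k))"
 have "sub P p - A \<in> idl Var {k. a k ~= 1}"
 proof (rule vanishing_on_coordinate_space)
  fix y :: "complex ^ 'n" assume "\<And>k. k \<in> {k. a k ~= 1} ==> y $ k = 0"
  hence "P *v y \<in> Fix g" using adapted_Fix[OF ad] by simp
  from r[OF this] show "ev (sub P p - A) y = 0"
   by (simp add: A_def stuple_def inv mult.commute)
 qed
 also have "idl Var {k. a k ~= 1} = idl (stuple P a) {k. a k ~= 1}"
  by (rule idl_cong) (simp add: stuple_def)
 also have "\<dots> \<subseteq> idl (stuple P a) UNIV" by (rule idl_mono) auto
 finally have 1: "sub P p - A \<in> idl (stuple P a) UNIV" .
 have "A \<in> idl (stuple P a) {k. a k = 1}" unfolding A_def by (rule idl_I) simp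
 also have "\<dots> \<subseteq> idl (stuple P a) UNIV" by (rule idl_mono) auto
 finally have "A \<in> idl (stuple P a) UNIV" .
 from idl_add[OF 1 this] show "sub P p \<in> idl (stuple P a) UNIV" by simp
next
 have P: "invertible P" using ad by (simp add: adapted_def)
 have inv: "matrix_inv P *v (P *v y) = y" for y
  by (simp add: matrix_vector_mul_assoc matrix_inv_cancel[OF P])
 assume "sub P p \<in> idl (stuple P a) UNIV"
 then obtain s where s: "sub P p = (\<Sum>k\<in>UNIV. stuple P a k * s k)" by (elim idl_E)
 have "ev p x = ev (\<Sum>k | a k = 1. sub (matrix_inv P) (s k) * sub (matrix_inv P) (pd (sub P fp) k)) x"
  if x: "x \<in> Fix g" for x
 proof -
  obtain y where y: "x = P *v y" using adapted_vec[OF ad] .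
  have y0: "y $ k = 0" if "a k ~= 1" for k using adapted_Fix[OF ad, of y] x that y by simp
  have "ev p x = ev (sub P p) y" by (simp add: y)
  also have "\<dots> = (\<Sum>k\<in>UNIV. ev (stuple P a k) y * ev (s k) y)" by (simp add: s)
  also have "\<dots> = (\<Sum>k | a k = 1. ev (stuple P a k) y * ev (s k) y)"
   by (rule sum.mono_neutral_right) (auto simp: stuple_def y0)
  also have "\<dots> = (\<Sum>k | a k = 1. ev (s k) y * ev (pd (sub P fp) k) y)"
   by (rule sum.cong) (auto simp: stuple_def)
  finally show ?thesis by (simp add: y inv)
 qed
 hence "rs (Fix g) p = rs (Fix g) (\<Sum>k | a k = 1. sub (matrix_inv P) (s k) * sub (matrix_inv P) (pd (sub P fp) k))"
  by (simp only: rs_eq_iff) blast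
 hence "\<exists>r. rs (Fix g) p = rs (Fix g) (\<Sum>k | a k = 1. r k * sub (matrix_inv P) (pd (sub P fp) k))"
  by (intro exI[of _ "%k. sub (matrix_inv P) (s k)"])
 thus "p \<in> K g" unfolding K_def jac_ideal_eq[OF ad] by blast
qed

lemma K_vanish_0:
 assumes g: "g \<in> G" and p: "p \<in> K g"
 shows "ev p 0 = 0"
proof -
 obtain P d' a b M where ad: "adapted d g g P d' a b M" using adapted_exists[OF g g] by blast
 obtain s where s: "sub P p = (\<Sum>k\<in>UNIV. stuple P a k * s k)" using p K_iff[OF ad] by (auto elim: idl_E)
 have "ev (stuple P a k) 0 = 0" for k by (simp add: stuple_def ev_pd_sub F_0)
 hence "ev (sub P p) 0 = 0" by (simp add: s)
 thus ?thesis by simp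
qed

text \<open>At a fixed point the derivative of f is a \<open>g\<close>-invariant functional, so it
  vanishes on eigenvectors with eigenvalue other than 1. A critical point of f restricted to
  \<open>Fix g\<close> is therefore critical for f.\<close>

lemma only_zero_stuple:
 assumes ad: "adapted d g h P d' a b M" and g: "g \<in> G"
 shows "only_zero (stuple P a)"
 unfolding only_zero_def
proof (intro allI impI)
 fix y assume y: "\<forall>k. ev (stuple P a k) y = 0"
 have P: "invertible P" "g ** P = P ** dg a" using ad by (auto simp: adapted_def)
 have y0: "y $ k = 0" if "a k ~= 1" for k using spec[OF y, of k] that by (simp add: stuple_def)
 hence fix_x: "g *v (P *v y) = P *v y" using adapted_Fix[OF ad, of y] by (simp add: Fix_def)
 define D where "D = (%v. \<Sum>i\<in>UNIV. v $ i * ev (F i) (P *v y))"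
 have D: "D v = dir_deriv (ev fp) v (P *v y)" for v by (simp add: D_def dir_deriv_ev)
 have Dg: "D (g *v v) = D v" for v
 proof -
  have "P *v y + t *s (g *v v) = g *v (P *v y + t *s v)" for t
   by (simp add: matrix_vector_right_distrib vector_scalar_commute fix_x)
  thus ?thesis unfolding D dir_deriv_def by (simp add: G_facts(2)[OF g])
 qed
 have Dc: "D (c *s v) = c * D v" for c v by (simp add: D_def sum_distrib_left mult.assoc)
 have "D (P *v axis k 1) = 0" for k
 proof (cases "a k = 1")
  case True
  have "ev (pd (sub P fp) k) y = D (P *v axis k 1)" by (simp add: ev_pd_sub D_def mult_axis)
  thus ?thesis using spec[OF y, of k] True by (simp add: stuple_def)
 next
  case False
  have "g *v (P *v axis k 1) = P *v (\<chi> i. a i * axis k 1 $ i)" by (rule diag_power[OF P])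
  also have "(\<chi> i. a i * axis k 1 $ i) = a k *s axis k 1" by (auto simp: vec_eq_iff axis_def)
  finally have "D (P *v axis k 1) = a k * D (P *v axis k 1)"
   using Dg[of "P *v axis k 1"] by (simp add: vector_scalar_commute Dc)
  thus ?thesis using False by simp
 qed
 hence DP: "(\<Sum>i\<in>UNIV. P $ i $ k * ev (F i) (P *v y)) = 0" for k by (simp add: D_def mult_axis)
 have "ev (F j) (P *v y) = 0" for j
 proof -
  have "(\<Sum>k\<in>UNIV. matrix_inv P $ k $ j * (\<Sum>i\<in>UNIV. P $ i $ k * ev (F i) (P *v y))) =
    (\<Sum>k\<in>UNIV. \<Sum>i\<in>UNIV. P $ i $ k * matrix_inv P $ k $ j * ev (F i) (P *v y))"
   unfolding sum_distrib_left by (intro sum.cong refl) (simp add: mult_ac)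
  also have "\<dots> = (\<Sum>i\<in>UNIV. \<Sum>k\<in>UNIV. P $ i $ k * matrix_inv P $ k $ j * ev (F i) (P *v y))"
   by (rule sum.swap)
  also have "\<dots> = (\<Sum>i\<in>UNIV. (P ** matrix_inv P) $ i $ j * ev (F i) (P *v y))"
   by (simp add: matrix_matrix_mult_def sum_distrib_right)
  also have "\<dots> = (\<Sum>i\<in>UNIV. if i = j then ev (F j) (P *v y) else 0)"
   by (rule sum.cong) (auto simp: matrix_inv_cancel[OF P(1)] mat_def)
  finally show ?thesis by (simp add: DP)
 qed
 hence "P *v y = 0" using only_zero_F by (simp add: only_zero_def)
 hence "matrix_inv P *v (P *v y) = 0" by simp
 thus "y = 0" by (simp add: matrix_vector_mul_assoc matrix_inv_cancel[OF P(1)])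
qed

text \<open>A fixed direction contributes to the top weight the weight \<open>d0 - d' k\<close> of
  its derivative minus the weight \<open>d' k\<close> of its coordinate; the contribution of a moved
  direction is \<open>d' k - d' k\<close>.\<close>

theorem sector_functional:
 assumes ad: "adapted d g h P d' a b M" and g: "g \<in> G" and h: "h \<in> G"
 shows "\<exists>\<tau>. dual_generator \<tau> (K g) \<and> top_degree d \<tau> (2 * (\<Sum>k\<in>Ix g. d k)) (d0 * card (Ix g)) \<and>
  (\<forall>p. \<tau> (sub h p) = (\<Prod>k | a k ~= 1. b k)\<^sup>2 * \<tau> p)"
proof -
 have P: "invertible P" "\<And>i k. P $ i $ k ~= 0 ==> d i = d' k" "h ** P = P ** dg b" "M > 0" "\<And>k. b k ^ M = 1"
  using ad by (auto simp: adapted_def)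
 have d': "d' k > 0" "d' k < d0" for k
 proof -
  have "\<exists>i. P $ i $ k ~= 0"
  proof (rule ccontr)
   assume "\<not> ?thesis"
   hence "P *v axis k 1 = 0" by (simp add: vec_eq_iff mult_axis)
   hence "matrix_inv P *v (P *v axis k 1) = 0" by simp
   hence "axis k 1 = (0 :: complex ^ 'n)" by (simp add: matrix_vector_mul_assoc matrix_inv_cancel[OF P(1)])
   thus False by (simp add: axis_eq_0_iff)
  qed
  then obtain i where "d i = d' k" using P(2) by blast
  thus "d' k > 0" "d' k < d0" using d_pos[of i] d_lt[of i] by auto
 qed
 interpret si: semi_invariants d' b M by standard (use d' P in auto)
 define \<delta> where "\<delta> = (%k. if a k = 1 then d0 - d' k else d' k)"
 define \<psi> where "\<psi> = (%k. if a k = 1 then inverse (b k) else b k)"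
 have bnz: "b k ~= 0" for k by (metis si.norm_a norm_zero zero_neq_one)
 have semi: "si.semi (\<delta> k) (\<psi> k) (stuple P a k)" for k
 proof (cases "a k = 1")
  case False
  thus ?thesis using d' graded_vpow(1)[of d' k 1] graded_vpow(2)[of b k 1]
   by (simp add: si.semi_def stuple_def \<delta>_def \<psi>_def)
 next
  case True
  have "ev (sub P fp) (\<chi> k. 2 ^ d' k * y $ k) = 2 ^ d0 * ev (sub P fp) y" for y
  proof -
   have "P *v (\<chi> k. 2 ^ d' k * y $ k) = (\<chi> i. 2 ^ d i * (P *v y) $ i)"
    by (rule scale_commute) (rule P(2))
   moreover have "ev fp (\<chi> i. 2 ^ d i * (P *v y) $ i) = 2 ^ d0 * ev fp (P *v y)"
    by (rule f_scale) simp
   ultimately show ?thesis by (simp only: ev_sub)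
  qed
  from ev_pd_scale[OF this, of k]
  have *: "2 ^ d' k * ev (pd (sub P fp) k) (\<chi> k. 2 ^ d' k * y $ k) = 2 ^ d0 * ev (pd (sub P fp) k) y" for y .
  have "(2::complex) ^ d0 = 2 ^ d' k * 2 ^ (d0 - d' k)" using d'(2)[of k] by (simp add: power_add[symmetric])
  hence "ev (pd (sub P fp) k) (\<chi> k. 2 ^ d' k * y $ k) = 2 ^ (d0 - d' k) * ev (pd (sub P fp) k) y" for y
   using *[of y] by simp
  hence g1: "wgraded d' (d0 - d' k) (pd (sub P fp) k)" by (rule graded_wdegI)
  have "ev (sub P fp) (\<chi> k. b k * y $ k) = 1 * ev (sub P fp) y" for y
   unfolding ev_sub diag_power[OF P(1,3), symmetric] by (simp add: G_facts(2)[OF h])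
  from ev_pd_scale[OF this, of k]
  have "b k * ev (pd (sub P fp) k) (\<chi> k. b k * y $ k) = 1 * ev (pd (sub P fp) k) y" for y .
  hence "ev (pd (sub P fp) k) (\<chi> k. b k * y $ k) = inverse (b k) * ev (pd (sub P fp) k) y" for y
   using bnz[of k] by (simp add: field_simps)
  hence g2: "graded (chr b) (inverse (b k)) (pd (sub P fp) k)" by (rule graded_chrI)
  show ?thesis using g1 g2 d' True by (simp add: si.semi_def stuple_def \<delta>_def \<psi>_def norm_inverse)
 qed
 from si.parameters_good[OF semi only_zero_stuple[OF ad g]] obtain \<phi>
  where \<phi>: "dual_generator \<phi> (idl (stuple P a) UNIV)"
   and top: "\<And>m. \<phi> (term_of m 1) ~= 0 ==> wdeg d' m + (\<Sum>k\<in>UNIV. d' k) = (\<Sum>k\<in>UNIV. \<delta> k) \<and>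
    chr b m * (\<Prod>k\<in>UNIV. b k) = (\<Prod>k\<in>UNIV. \<psi> k)" by blast
 have lin: "linear_form \<phi>" and ker: "\<And>p. p \<in> idl (stuple P a) UNIV \<longleftrightarrow> (\<forall>r. \<phi> (p * r) = 0)"
  using \<phi> by (auto simp: dual_generator_def)
 define \<tau> where "\<tau> = (%p. \<phi> (sub P p))"
 have "dual_generator \<tau> (K g)"
  unfolding dual_generator_def
 proof (intro conjI allI)
  show "linear_form \<tau>" using lin by (simp add: linear_form_def \<tau>_def sub_simps)
  fix p
  have "(\<forall>r. \<phi> (sub P p * r) = 0) \<longleftrightarrow> (\<forall>r. \<phi> (sub P (p * r)) = 0)"
  proof
   assume *: "\<forall>r. \<phi> (sub P (p * r)) = 0"
   show "\<forall>r. \<phi> (sub P p * r) = 0"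
   proof
    fix r
    have "sub P (p * sub (matrix_inv P) r) = sub P p * r"
     by (simp add: sub_simps sub_sub matrix_inv_cancel[OF P(1)])
    thus "\<phi> (sub P p * r) = 0" using spec[OF *, of "sub (matrix_inv P) r"] by simp
   qed
  qed (simp add: sub_simps)
  thus "p \<in> K g \<longleftrightarrow> (\<forall>r. \<tau> (p * r) = 0)" unfolding K_iff[OF ad] ker \<tau>_def .
 qed
 moreover have "top_degree d \<tau> (2 * (\<Sum>k\<in>Ix g. d k)) (d0 * card (Ix g))"
  unfolding top_degree_def
 proof (intro allI impI)
  fix w p assume w: "wgraded d w p" and "\<tau> p ~= 0"
  hence "(\<Sum>m\<in>supp (sub P p). coef (sub P p) m * \<phi> (term_of m 1)) ~= 0"
   unfolding \<tau>_def linear_form_expand[OF lin, of "sub P p"] by blast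
  then obtain m where m: "m \<in> supp (sub P p)" "coef (sub P p) m * \<phi> (term_of m 1) ~= 0"
   by (rule sum.not_neutral_contains_not_neutral)
  have "wdeg d' m = w" using m(1) graded_sub[of P d d' w p, OF P(2) w] by (simp add: graded_def)
  moreover have "\<phi> (term_of m 1) ~= 0" using m(2) by simp
  ultimately have eq: "w + (\<Sum>k\<in>UNIV. d' k) = (\<Sum>k\<in>UNIV. \<delta> k)" using top by blast
  have split: "(\<Sum>k\<in>UNIV. u k) = (\<Sum>k | a k = 1. u k) + (\<Sum>k | a k ~= 1. u k)" for u :: "'n => nat"
   by (subst sum.union_disjoint[symmetric]) (auto intro: sum.cong)
  have "(\<Sum>k | a k ~= 1. \<delta> k) = (\<Sum>k | a k ~= 1. d' k)" by (rule sum.cong) (auto simp: \<delta>_def)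
  moreover have "(\<Sum>k | a k = 1. \<delta> k) + (\<Sum>k | a k = 1. d' k) = d0 * card {k. a k = 1}"
  proof -
   have "(\<Sum>k | a k = 1. \<delta> k) + (\<Sum>k | a k = 1. d' k) = (\<Sum>k | a k = 1. d0)"
    unfolding sum.distrib[symmetric] by (rule sum.cong) (auto simp: \<delta>_def d'(2) less_imp_le)
   thus ?thesis by simp
  qed
  ultimately have "w + 2 * (\<Sum>k | a k = 1. d' k) = d0 * card {k. a k = 1}"
   using eq split[of \<delta>] split[of d'] by simp
  thus "w + 2 * (\<Sum>k\<in>Ix g. d k) = d0 * card (Ix g)" by (simp add: adapted_sums[OF ad g])
 qed
 moreover have "\<tau> (sub h p) = (\<Prod>k | a k ~= 1. b k)\<^sup>2 * \<tau> p" for p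
 proof -
  define B where "B = (\<Prod>k | a k = 1. b k)"
  define R where "R = (\<Prod>k | a k ~= 1. b k)"
  have splitP: "(\<Prod>k\<in>UNIV. u k) = (\<Prod>k | a k = 1. u k) * (\<Prod>k | a k ~= 1. u k)" for u :: "'n => complex"
   by (subst prod.union_disjoint[symmetric]) (auto intro: prod.cong)
  have BR: "B * R = 1"
   using splitP[of b] det_diag(2)[OF P(1,3)] G_facts(3)[OF h] by (simp add: B_def R_def)
  have chr: "chr b m = R\<^sup>2" if "\<phi> (term_of m 1) ~= 0" for m
  proof -
   have "(\<Prod>k | a k = 1. \<psi> k) = inverse B"
    unfolding B_def prod_inversef[symmetric] by (rule prod.cong) (auto simp: \<psi>_def)
   moreover have "(\<Prod>k | a k ~= 1. \<psi> k) = R"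
    unfolding R_def by (rule prod.cong) (auto simp: \<psi>_def)
   moreover have "(\<Prod>k\<in>UNIV. b k) = 1" using splitP[of b] BR by (simp add: B_def R_def)
   ultimately have "chr b m = inverse B * R" using top[OF that] splitP[of \<psi>] by simp
   moreover have "inverse B = R" using BR by (simp add: inverse_unique)
   ultimately show ?thesis by (simp add: power2_eq_square)
  qed
  define r where "r = sub P p"
  \<comment> \<open>In the frame \<open>P\<close> the pullback by \<open>h\<close> scales each
    monomial by its character.\<close>
  have "sub P (sub h p) = Poly_Mapping.mapp (%m c. c * chr b m) r"
  proof (rule ev_inject)
   fix y
   have "ev (sub P (sub h p)) y = ev r (\<chi> k. b k * y $ k)"
    by (simp add: r_def diag_power[OF P(1,3)])
   thus "ev (sub P (sub h p)) y = ev (Poly_Mapping.mapp (%m c. c * chr b m) r) y"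
    unfolding ev_mapp by (simp add: ev_def mon_scale mult.assoc)
  qed
  hence "\<tau> (sub h p) = \<phi> (Poly_Mapping.mapp (%m c. c * chr b m) r)" by (simp add: \<tau>_def)
  also have "\<dots> = (\<Sum>m\<in>supp (Poly_Mapping.mapp (%m c. c * chr b m) r). coef r m * chr b m * \<phi> (term_of m 1))"
   by (subst linear_form_expand[OF lin]) (simp add: coef_mapp)
  also have "\<dots> = (\<Sum>m\<in>supp r. coef r m * chr b m * \<phi> (term_of m 1))"
   by (rule sum.mono_neutral_left) (use keys_mapp_subset coef_mapp[of "chr b" r] in \<open>auto simp: in_keys_iff\<close>)
  also have "\<dots> = (\<Sum>m\<in>supp r. R\<^sup>2 * (coef r m * \<phi> (term_of m 1)))"
  proof (rule sum.cong)
   fix m show "coef r m * chr b m * \<phi> (term_of m 1) = R\<^sup>2 * (coef r m * \<phi> (term_of m 1))"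
    using chr[of m] by (cases "\<phi> (term_of m 1) = 0") auto
  qed simp
  also have "\<dots> = R\<^sup>2 * \<tau> p" unfolding sum_distrib_left[symmetric] linear_form_expand[OF lin, symmetric]
   by (simp add: \<tau>_def r_def)
  finally show ?thesis by (simp add: R_def)
 qed
 ultimately show ?thesis by blast
qed

text \<open>Frames, and with them the functionals of \<open>sector_functional\<close>, vary with
  \<open>h\<close>. By \<open>dual_generator_unique\<close> they are proportional, so one functional
  has the right character for every \<open>h\<close>.\<close>

theorem sector_duality:
 assumes g: "g \<in> G"
 shows "\<exists>\<tau>. dual_generator \<tau> (K g) \<and> top_degree d \<tau> (2 * (\<Sum>k\<in>Ix g. d k)) (d0 * card (Ix g)) \<and>
  (\<forall>h P d' a b M p. h \<in> G --> adapted d g h P d' a b M --> \<tau> (sub h p) = (\<Prod>k | a k ~= 1. b k)\<^sup>2 * \<tau> p)"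
proof -
 obtain P d' a b M where "adapted d g g P d' a b M" using adapted_exists[OF g g] by blast
 from sector_functional[OF this g g] obtain \<tau> where \<tau>: "dual_generator \<tau> (K g)"
  "top_degree d \<tau> (2 * (\<Sum>k\<in>Ix g. d k)) (d0 * card (Ix g))" by blast
 have "\<tau> (sub h p) = (\<Prod>k | a k ~= 1. b k)\<^sup>2 * \<tau> p" if h: "h \<in> G" and ad: "adapted d g h P d' a b M" for h P d' a b M p
 proof -
  from sector_functional[OF ad g h] obtain \<sigma> where \<sigma>: "dual_generator \<sigma> (K g)"
   "top_degree d \<sigma> (2 * (\<Sum>k\<in>Ix g. d k)) (d0 * card (Ix g))"
   "\<And>p. \<sigma> (sub h p) = (\<Prod>k | a k ~= 1. b k)\<^sup>2 * \<sigma> p" by blast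
  obtain c where "\<And>p. \<tau> p = c * \<sigma> p"
   using dual_generator_unique[OF d_pos \<tau> \<sigma>(1,2)] by blast
  thus ?thesis using \<sigma>(3) by simp
 qed
 thus ?thesis using \<tau> by blast
qed

lemma adapted_conjugate:
 assumes ad: "adapted d g h P d' a b M" and u: "u \<in> G"
 shows "adapted d (u ** g ** matrix_inv u) (u ** h ** matrix_inv u) (u ** P) d' a b M"
proof -
 have P: "invertible P" "\<And>i k. P $ i $ k ~= 0 ==> d i = d' k" "g ** P = P ** dg a" "h ** P = P ** dg b"
  using ad by (auto simp: adapted_def)
 have iu: "invertible u" by (rule G_facts(1)[OF u])
 have cancel: "u ** x ** matrix_inv u ** (u ** P) = u ** (x ** P)" for x
 proof -
  have "u ** x ** matrix_inv u ** (u ** P) = u ** x ** (matrix_inv u ** u) ** P"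
   by (simp only: matrix_mul_assoc)
  thus ?thesis by (simp add: matrix_inv_cancel[OF iu] matrix_mul_assoc)
 qed
 have "d i = d' k" if "(u ** P) $ i $ k ~= 0" for i k
 proof -
  from that have "(\<Sum>j\<in>UNIV. u $ i $ j * P $ j $ k) ~= 0" by (simp add: matrix_matrix_mult_def)
  then obtain j where "u $ i $ j * P $ j $ k ~= 0" by (rule sum.not_neutral_contains_not_neutral)
  thus ?thesis using G_weights[OF u, of i j] P(2)[of j k] by simp
 qed
 moreover have "invertible (u ** P)" by (rule invertible_mult[OF iu P(1)])
 moreover have "u ** x ** matrix_inv u ** (u ** P) = u ** P ** dg c" if "x ** P = P ** dg c" for x c
  unfolding cancel that by (rule matrix_mul_assoc)
 ultimately show ?thesis using ad P(3,4) by (simp add: adapted_def)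
qed

text \<open>As \<open>u\<close> preserves f, the two ideals are described by the same tuple in the
  frames \<open>P\<close> and \<open>u ** P\<close>.\<close>

lemma K_conjugate:
 assumes g: "g \<in> G" and u: "u \<in> G"
 shows "sub (matrix_inv u) p \<in> K (u ** g ** matrix_inv u) \<longleftrightarrow> p \<in> K g"
proof -
 obtain P d' a b M where ad: "adapted d g g P d' a b M" using adapted_exists[OF g g] by blast
 have iu: "invertible u" by (rule G_facts(1)[OF u])
 have "sub u fp = fp" by (rule ev_inject) (simp add: G_facts(2)[OF u])
 hence "sub (u ** P) fp = sub P fp" by (simp add: sub_sub[symmetric])
 hence "stuple (u ** P) a = stuple P a" by (simp add: stuple_def fun_eq_iff)
 moreover have "sub (u ** P) (sub (matrix_inv u) p) = sub P p"
  by (simp add: sub_sub matrix_mul_assoc matrix_inv_cancel[OF iu])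
 ultimately show ?thesis by (simp add: K_iff[OF ad] K_iff[OF adapted_conjugate[OF ad u]])
qed

end

section \<open>Presented vector spaces\<close>

lemma CC_simps [simp]:
 "carrier CC = UNIV" "(\<otimes>\<^bsub>CC\<^esub>) = (*)" "\<one>\<^bsub>CC\<^esub> = 1" "\<zero>\<^bsub>CC\<^esub> = 0" "(\<oplus>\<^bsub>CC\<^esub>) = (+)"
 by (simp_all add: ring_of_type_algebra_def)

text \<open>\<open>pr\<close> presents \<open>M\<close> as the quotient of the space \<open>Dm\<close>, with scalar multiplication \<open>sc\<close>, by \<open>Z\<close>.\<close>

locale presented =
 fixes M :: "(complex, 'b) module" and pr :: "'x::ab_group_add => 'b"
  and sc :: "complex => 'x => 'x" and Dm Z :: "'x set"
 assumes carrier: "carrier M = pr ` Dm"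
  and add: "x \<in> Dm ==> y \<in> Dm ==> pr x \<oplus>\<^bsub>M\<^esub> pr y = pr (x + y)"
  and zero: "\<zero>\<^bsub>M\<^esub> = pr 0"
  and smult: "x \<in> Dm ==> c \<odot>\<^bsub>M\<^esub> pr x = pr (sc c x)"
  and X0: "0 \<in> Dm" and Xadd: "x \<in> Dm ==> y \<in> Dm ==> x + y \<in> Dm" and Xsc: "x \<in> Dm ==> sc c x \<in> Dm"
  and sc_add: "sc (a + b) x = sc a x + sc b x" and sc_distrib: "sc a (x + y) = sc a x + sc a y"
  and sc_mult: "sc (a * b) x = sc a (sc b x)" and sc_1: "sc 1 x = x"
  and ker: "x \<in> Dm ==> y \<in> Dm ==> pr x = pr y \<longleftrightarrow> x - y \<in> Z"
begin

lemma sc_0 [simp]: "sc 0 x = 0" and sc_zero [simp]: "sc c 0 = 0"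
 using sc_add[of 0 0 x] sc_distrib[of c 0 0] by simp_all

lemma sc_neg: "sc (- c) x = - sc c x"
 using sc_add[of "- c" c x] by (simp add: eq_neg_iff_add_eq_0)

lemma Xneg: "x \<in> Dm ==> - x \<in> Dm"
 using Xsc[of x "-1"] sc_neg[of 1 x] sc_1 by simp

lemma Xdiff: "x \<in> Dm ==> y \<in> Dm ==> x - y \<in> Dm"
 using Xadd[OF _ Xneg] by simp

lemma Xsum: "(\<And>a. a \<in> A ==> u a \<in> Dm) ==> sum u A \<in> Dm"
 by (induction A rule: infinite_finite_induct) (auto intro: X0 Xadd)

lemma pr_eq_0: "x \<in> Dm ==> pr x = \<zero>\<^bsub>M\<^esub> \<longleftrightarrow> x \<in> Z"
 using ker[OF _ X0, of x] by (simp add: zero)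

lemma module: "module CC M"
proof (rule module_criteria)
 show "cring CC" by (rule cring_from_type_algebra)
 show "\<forall>v\<in>carrier M. \<exists>n\<in>carrier M. v \<oplus>\<^bsub>M\<^esub> n = \<zero>\<^bsub>M\<^esub>"
 proof
  fix v assume "v \<in> carrier M"
  then obtain x where "x \<in> Dm" "v = pr x" by (auto simp: carrier)
  thus "\<exists>n\<in>carrier M. v \<oplus>\<^bsub>M\<^esub> n = \<zero>\<^bsub>M\<^esub>"
   by (intro bexI[of _ "pr (- x)"]) (auto simp: add Xneg zero carrier)
 qed
qed (auto simp: carrier add zero smult X0 Xadd Xsc sc_add sc_distrib sc_mult sc_1 add_ac)

lemma vectorspace: "vectorspace CC M"
proof -
 interpret module CC M by (rule module)
 show ?thesis by (rule vectorspace.intro[OF module field_from_type_algebra])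
qed

lemma finsum_pr:
 assumes "finite A" "\<And>a. a \<in> A ==> u a \<in> Dm" "\<And>a. a \<in> A ==> v a = pr (u a)"
 shows "finsum M v A = pr (sum u A)"
proof -
 interpret md: module CC M by (rule module)
 show ?thesis using assms
 proof (induction A rule: finite_induct)
  case empty show ?case using zero by simp
 next
  case (insert a A)
  have "v \<in> A \<rightarrow> carrier M" "v a \<in> carrier M" using insert.prems by (auto simp: carrier)
  hence "finsum M v (insert a A) = v a \<oplus>\<^bsub>M\<^esub> finsum M v A" using insert.hyps by (intro md.M.finsum_insert)
  also have "finsum M v A = pr (sum u A)" using insert by simp
  finally show ?case using insert by (simp add: add Xsum)
 qed
qed

definition subsp :: "'x set => bool" where
 "subsp Y \<longleftrightarrow> Y \<subseteq> Dm \<and> 0 \<in> Y \<and> (\<forall>x\<in>Y. \<forall>y\<in>Y. x + y \<in> Y) \<and> (\<forall>x\<in>Y. \<forall>c. sc c x \<in> Y)"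

lemma presented_subsp: "subsp Y ==> presented (M\<lparr>carrier := pr ` Y\<rparr>) pr sc Y Z"
 by unfold_locales (auto simp: subsp_def subset_eq add smult zero sc_add sc_distrib sc_mult sc_1 ker)

lemma subspace_subsp: "subsp Y ==> VectorSpace.subspace CC (pr ` Y) M"
 by (intro subspace.intro vectorspace submodule.intro module)
  (auto simp: subsp_def subset_eq carrier add smult zero)

text \<open>\<open>quot_mod\<close> forms cosets of classes; on representatives this merely enlarges
  the kernel from \<open>Z\<close> to \<open>Y\<close>.\<close>

lemma quotient:
 assumes Y: "subsp Y" and ZY: "Z \<subseteq> Y"
 shows "presented (quot_mod M (pr ` Y)) (%x. pr ` Y +>\<^bsub>M\<^esub> pr x) sc Dm Y"
proof -
 have YX: "y \<in> Dm" if "y \<in> Y" for y using Y that by (auto simp: subsp_def)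
 have Yadd: "x + y \<in> Y" and Ysc: "sc c x \<in> Y" if "x \<in> Y" "y \<in> Y" for x y c using Y that by (auto simp: subsp_def)
 have Yneg: "- x \<in> Y" if "x \<in> Y" for x using Ysc[OF that that, of "-1"] sc_neg[of 1 x] sc_1 by simp
 have coset: "pr ` Y +>\<^bsub>M\<^esub> pr x = {pr (n + x) | n. n \<in> Y}" if "x \<in> Dm" for x
  unfolding a_r_coset_def' using add[OF YX that] by force
 have ker': "pr ` Y +>\<^bsub>M\<^esub> pr x = pr ` Y +>\<^bsub>M\<^esub> pr y \<longleftrightarrow> x - y \<in> Y" if x: "x \<in> Dm" and y: "y \<in> Dm" for x y
 proof
  assume eq: "pr ` Y +>\<^bsub>M\<^esub> pr x = pr ` Y +>\<^bsub>M\<^esub> pr y"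
  have "0 \<in> Y" using Y by (simp add: subsp_def)
  hence "pr (0 + x) \<in> pr ` Y +>\<^bsub>M\<^esub> pr x" unfolding coset[OF x] by blast
  then obtain n where n: "n \<in> Y" "pr x = pr (n + y)" unfolding eq coset[OF y] by auto
  hence "x - (n + y) \<in> Y" using ker[OF x Xadd[OF YX y]] ZY by blast
  from Yadd[OF n(1) this] show "x - y \<in> Y" by simp
 next
  have sub: "{pr (n + x) | n. n \<in> Y} \<subseteq> {pr (n + y) | n. n \<in> Y}" if "x - y \<in> Y" for x y
  proof
   fix z assume "z \<in> {pr (n + x) | n. n \<in> Y}"
   then obtain n where n: "n \<in> Y" "z = pr (n + x)" by blast
   have "z = pr ((n + (x - y)) + y)" by (simp add: n)
   thus "z \<in> {pr (n + y) | n. n \<in> Y}" using Yadd[OF n(1) that] by blast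
  qed
  assume xy: "x - y \<in> Y"
  have "y - x \<in> Y" using Yneg[OF xy] by simp
  thus "pr ` Y +>\<^bsub>M\<^esub> pr x = pr ` Y +>\<^bsub>M\<^esub> pr y"
   unfolding coset[OF x] coset[OF y] using sub[OF xy] sub[of y x] by blast
 qed
 show ?thesis
 proof
  show "carrier (quot_mod M (pr ` Y)) = (%x. pr ` Y +>\<^bsub>M\<^esub> pr x) ` Dm"
   by (auto simp: quot_mod_def A_RCOSETS_def' carrier)
  show "\<zero>\<^bsub>quot_mod M (pr ` Y)\<^esub> = pr ` Y +>\<^bsub>M\<^esub> pr 0"
   unfolding coset[OF X0] by (auto simp: quot_mod_def)
  fix x y assume x: "x \<in> Dm" and y: "y \<in> Dm"
  show "(pr ` Y +>\<^bsub>M\<^esub> pr x) \<oplus>\<^bsub>quot_mod M (pr ` Y)\<^esub> (pr ` Y +>\<^bsub>M\<^esub> pr y) = pr ` Y +>\<^bsub>M\<^esub> pr (x + y)"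
  proof -
   have "{pr (n + x) | n. n \<in> Y} <+>\<^bsub>M\<^esub> {pr (n + y) | n. n \<in> Y} = {pr (n + (x + y)) | n. n \<in> Y}"
   proof (intro equalityI subsetI)
    fix z assume "z \<in> {pr (n + x) | n. n \<in> Y} <+>\<^bsub>M\<^esub> {pr (n + y) | n. n \<in> Y}"
    then obtain n m where nm: "n \<in> Y" "m \<in> Y" "z = pr (n + x) \<oplus>\<^bsub>M\<^esub> pr (m + y)"
     unfolding set_add_def' by blast
    hence "z = pr ((n + m) + (x + y))"
     using add[OF Xadd[OF YX x] Xadd[OF YX y]] by (simp add: algebra_simps)
    thus "z \<in> {pr (n + (x + y)) | n. n \<in> Y}" using Yadd nm by blast
   next
    fix z assume "z \<in> {pr (n + (x + y)) | n. n \<in> Y}"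
    then obtain n where n: "n \<in> Y" "z = pr (n + (x + y))" by blast
    have "0 \<in> Y" using Y by (simp add: subsp_def)
    have "z = pr (n + x) \<oplus>\<^bsub>M\<^esub> pr (0 + y)"
     using add[OF Xadd[OF YX[OF n(1)] x] Xadd[OF X0 y]] n by (simp add: algebra_simps)
    thus "z \<in> {pr (n + x) | n. n \<in> Y} <+>\<^bsub>M\<^esub> {pr (n + y) | n. n \<in> Y}"
     unfolding set_add_def' using n(1) \<open>0 \<in> Y\<close> by blast
   qed
   thus ?thesis unfolding coset[OF x] coset[OF y] coset[OF Xadd[OF x y]] by (simp add: quot_mod_def)
  qed
  show "c \<odot>\<^bsub>quot_mod M (pr ` Y)\<^esub> (pr ` Y +>\<^bsub>M\<^esub> pr x) = pr ` Y +>\<^bsub>M\<^esub> pr (sc c x)" for c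
  proof -
   have "pr ` Y +>\<^bsub>M\<^esub> (c \<odot>\<^bsub>M\<^esub> pr (n + x)) = pr ` Y +>\<^bsub>M\<^esub> pr (sc c x)" if n: "n \<in> Y" for n
   proof -
    have "sc c (n + x) - sc c x \<in> Y" using Ysc[OF n n] by (simp add: sc_distrib)
    thus ?thesis unfolding smult[OF Xadd[OF YX[OF n] x]]
     using ker'[OF Xsc[OF Xadd[OF YX[OF n] x]] Xsc[OF x]] by blast
   qed
   moreover have "0 \<in> Y" using Y by (simp add: subsp_def)
   ultimately have "(\<Union>z\<in>{pr (n + x) | n. n \<in> Y}. pr ` Y +>\<^bsub>M\<^esub> (c \<odot>\<^bsub>M\<^esub> z)) = pr ` Y +>\<^bsub>M\<^esub> pr (sc c x)"
    by blast
   thus ?thesis unfolding coset[OF x] by (simp add: quot_mod_def)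
  qed
  show "pr ` Y +>\<^bsub>M\<^esub> pr x = pr ` Y +>\<^bsub>M\<^esub> pr y \<longleftrightarrow> x - y \<in> Y" by (rule ker'[OF x y])
 qed (auto intro: X0 Xadd Xsc simp: sc_add sc_distrib sc_mult sc_1)
qed

lemma span_subset:
 assumes "subsp Y" "S \<subseteq> pr ` Y"
 shows "span_in M S \<subseteq> pr ` Y"
 using module.span_is_subset[OF module assms(2)] subspace_subsp[OF assms(1)] subspace.submod by blast

lemma span_base: "S \<subseteq> carrier M ==> S \<subseteq> span_in M S"
 by (rule module.in_own_span[OF module])

lemma subsp_span:
 assumes "S \<subseteq> carrier M"
 shows "subsp {x \<in> Dm. pr x \<in> span_in M S}"
proof -
 have s: "LinearCombinations.submodule CC (span_in M S) M"
  by (rule module.span_is_submodule[OF module assms])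
 show ?thesis unfolding subsp_def
  using LinearCombinations.submodule.m_closed[OF s] LinearCombinations.submodule.zero_closed[OF s]
   LinearCombinations.submodule.smult_closed[OF s]
  by (auto simp: X0 Xadd Xsc zero add[symmetric] smult[symmetric])
qed

lemma span_singleton:
 assumes "e \<in> Dm"
 shows "span_in M {pr e} = {pr (sc c e) | c. True}"
proof
 have "subsp {sc c e | c. True}"
  unfolding subsp_def
 proof (intro conjI ballI allI)
  show "{sc c e | c. True} \<subseteq> Dm" using Xsc[OF assms] by blast
  show "0 \<in> {sc c e | c. True}" using sc_0[of e] by (metis (mono_tags, lifting) mem_Collect_eq)
  fix x y assume "x \<in> {sc c e | c. True}" "y \<in> {sc c e | c. True}"
  then obtain a b where ab: "x = sc a e" "y = sc b e" by blast
  have "x + y = sc (a + b) e" by (simp add: ab sc_add)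
  thus "x + y \<in> {sc c e | c. True}" by blast
  fix c have "sc c x = sc (c * a) e" by (simp add: ab sc_mult)
  thus "sc c x \<in> {sc c e | c. True}" by blast
 qed
 moreover have "{pr e} \<subseteq> pr ` {sc c e | c. True}" using sc_1[of e] by (metis (mono_tags, lifting) empty_subsetI image_eqI insert_subset mem_Collect_eq)
 ultimately have "span_in M {pr e} \<subseteq> pr ` {sc c e | c. True}" by (rule span_subset)
 thus "span_in M {pr e} \<subseteq> {pr (sc c e) | c. True}" by blast
 have "pr e \<in> span_in M {pr e}" using span_base[of "{pr e}"] assms by (auto simp: carrier)
 hence "e \<in> {x \<in> Dm. pr x \<in> span_in M {pr e}}" using assms by simp
 hence "sc c e \<in> {x \<in> Dm. pr x \<in> span_in M {pr e}}" for c
  using subsp_span[of "{pr e}"] assms by (auto simp: subsp_def carrier)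
 thus "{pr (sc c e) | c. True} \<subseteq> span_in M {pr e}" by blast
qed

lemma has_dimension_0:
 assumes "Dm \<subseteq> Z"
 shows "has_dimension M 0"
proof -
 interpret V: vectorspace CC M by (rule vectorspace)
 have car: "carrier M = {\<zero>\<^bsub>M\<^esub>}" using assms pr_eq_0 X0 by (auto simp: carrier zero)
 have "V.gen_set {}" using car V.span_is_submodule[of "{}"] submodule.zero_closed V.span_is_subset2[of "{}"] by fastforce
 moreover from this have "V.basis {}" by (simp add: V.basis_def V.lin_dep_def)
 ultimately show ?thesis using V.dim_basis[of "{}"] by (auto simp: has_dimension_def V.fin_dim_def)
qed

lemma has_dimension_1:
 assumes e: "e \<in> Dm" "e \<notin> Z" and span: "\<And>x. x \<in> Dm ==> \<exists>c. x - sc c e \<in> Z"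
 shows "has_dimension M 1"
proof -
 interpret V: vectorspace CC M by (rule vectorspace)
 have ec: "pr e \<in> carrier M" using e by (simp add: carrier)
 have "carrier M \<subseteq> {pr (sc c e) | c. True}"
 proof
  fix m assume "m \<in> carrier M"
  then obtain x where x: "x \<in> Dm" "m = pr x" by (auto simp: carrier)
  obtain c where "x - sc c e \<in> Z" using span x by blast
  hence "pr x = pr (sc c e)" using ker[OF x(1) Xsc[OF e(1)]] by simp
  thus "m \<in> {pr (sc c e) | c. True}" using x by blast
 qed
 moreover have "{pr (sc c e) | c. True} \<subseteq> carrier M" using Xsc[OF e(1)] by (auto simp: carrier)
 ultimately have gen: "V.gen_set {pr e}" using span_singleton[OF e(1)] by blast
 have "V.lin_indpt {pr e}"
 proof
  assume "V.lin_dep {pr e}"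
  then obtain A a v where A: "finite A" "A \<subseteq> {pr e}" "a \<in> A \<rightarrow> carrier CC"
   "V.lincomb a A = \<zero>\<^bsub>M\<^esub>" "v \<in> A" "a v ~= \<zero>\<^bsub>CC\<^esub>" unfolding V.lin_dep_def by blast
  have Ae: "A = {pr e}" "v = pr e" using A by auto
  have "V.lincomb a A = finsum M (%v. a v \<odot>\<^bsub>M\<^esub> v) {pr e}" by (simp add: V.lincomb_def Ae)
  also have "\<dots> = pr (sum (%v. sc (a v) e) {pr e})"
   by (rule finsum_pr) (auto simp: smult e Xsc)
  finally have "pr (sc (a v) e) = \<zero>\<^bsub>M\<^esub>" using A(4) Ae by simp
  hence "a v \<odot>\<^bsub>M\<^esub> pr e = \<zero>\<^bsub>M\<^esub>" by (simp add: smult e)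
  hence "inverse (a v) \<odot>\<^bsub>M\<^esub> (a v \<odot>\<^bsub>M\<^esub> pr e) = \<zero>\<^bsub>M\<^esub>" by (simp add: zero smult X0)
  hence "pr e = \<zero>\<^bsub>M\<^esub>" using A(6) by (simp add: smult e Xsc sc_mult[symmetric] sc_1)
  thus False using pr_eq_0 e by blast
 qed
 hence "V.basis {pr e}" using gen ec by (simp add: V.basis_def)
 hence "V.dim = card {pr e}" by (intro V.dim_basis) simp
 moreover have "V.fin_dim"
  unfolding V.fin_dim_def by (intro exI[of _ "{pr e}"] conjI gen) (use ec in simp_all)
 ultimately show ?thesis by (simp add: has_dimension_def)
qed

end

text \<open>\<open>\<Phi>\<close> acts on representatives and induces the isomorphism; linearity,
  injectivity and surjectivity are only checked modulo the kernels.\<close>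

lemma presented_isomorphic:
 assumes "presented M pr sc Dm Z" and "presented N qr tc Y W"
  and \<Phi>: "\<And>x. x \<in> Dm ==> \<Phi> x \<in> Y" "\<And>x y. x \<in> Dm ==> y \<in> Dm ==> \<Phi> (x + y) = \<Phi> x + \<Phi> y"
   "\<And>c x. x \<in> Dm ==> \<Phi> (sc c x) = tc c (\<Phi> x)" "\<And>x. x \<in> Dm ==> \<Phi> x \<in> W \<longleftrightarrow> x \<in> Z"
  and surj: "\<And>y. y \<in> Y ==> \<exists>x\<in>Dm. y - \<Phi> x \<in> W"
 shows "isomorphic M N"
proof -
 interpret M: presented M pr sc Dm Z by fact
 interpret N: presented N qr tc Y W by fact
 define \<phi> where "\<phi> = (%m. qr (\<Phi> (SOME x. x \<in> Dm \<and> pr x = m)))"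
 have \<Phi>diff: "\<Phi> (x - y) = \<Phi> x - \<Phi> y" if "x \<in> Dm" "y \<in> Dm" for x y
  using \<Phi>(2)[OF M.Xdiff[OF that] that(2)] by simp
 have \<phi>: "\<phi> (pr x) = qr (\<Phi> x)" if x: "x \<in> Dm" for x
 proof -
  define x' where "x' = (SOME x'. x' \<in> Dm \<and> pr x' = pr x)"
  have x': "x' \<in> Dm \<and> pr x' = pr x" unfolding x'_def by (rule someI) (use x in simp)
  hence "x' - x \<in> Z" using M.ker x by blast
  hence "\<Phi> x' - \<Phi> x \<in> W" using \<Phi>(4)[of "x' - x"] \<Phi>diff x x' M.Xdiff by auto
  hence "qr (\<Phi> x') = qr (\<Phi> x)" using N.ker \<Phi>(1) x x' by blast
  thus ?thesis by (simp add: \<phi>_def x'_def)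
 qed
 have "\<phi> \<in> LinearCombinations.module_hom CC M N"
  unfolding module_hom_def
  by (auto simp: M.carrier N.carrier M.add M.smult \<phi> \<Phi> M.Xadd M.Xsc N.add N.smult)
 moreover have "inj_on \<phi> (carrier M)"
 proof (rule inj_onI)
  fix m m' assume "m \<in> carrier M" "m' \<in> carrier M" and eq: "\<phi> m = \<phi> m'"
  then obtain x x' where x: "x \<in> Dm" "m = pr x" "x' \<in> Dm" "m' = pr x'" by (auto simp: M.carrier)
  hence "\<Phi> x - \<Phi> x' \<in> W" using eq \<phi> N.ker \<Phi>(1) by simp
  hence "x - x' \<in> Z" using \<Phi>(4)[OF M.Xdiff] \<Phi>diff x by simp
  thus "m = m'" using M.ker x by simp
 qed
 moreover have "\<phi> ` carrier M = carrier N"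
 proof (intro equalityI subsetI)
  fix n assume "n \<in> carrier N"
  then obtain y where y: "y \<in> Y" "n = qr y" by (auto simp: N.carrier)
  obtain x where x: "x \<in> Dm" "y - \<Phi> x \<in> W" using surj y by blast
  hence "n = \<phi> (pr x)" using \<phi> N.ker y \<Phi>(1) by simp
  thus "n \<in> \<phi> ` carrier M" using x by (simp add: M.carrier)
 qed (auto simp: M.carrier N.carrier \<phi> \<Phi>)
 ultimately show ?thesis unfolding isomorphic_def bij_betw_def by blast
qed

text \<open>Induction over the functionals: on the kernel of one of them the others express
  \<open>f\<close>, and the coefficient of that one is then fixed by a single vector
  \<open>x1\<close> off its kernel.\<close>

lemma common_kernel:
 fixes b :: "'x::ab_group_add => 'i => complex"
 assumes "finite S"
  and sc: "\<And>x y. x \<in> Dm ==> y \<in> Dm ==> x + y \<in> Dm" "\<And>c x. x \<in> Dm ==> sc c x \<in> Dm"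
  and b: "\<And>x y s. x \<in> Dm ==> y \<in> Dm ==> b (x + y) s = b x s + b y s" "\<And>c x s. x \<in> Dm ==> b (sc c x) s = c * b x s"
  and f: "\<And>x y. x \<in> Dm ==> y \<in> Dm ==> f (x + y) = f x + f y" "\<And>c x. x \<in> Dm ==> f (sc c x) = c * f x"
  and k: "\<And>x. x \<in> Dm ==> (\<forall>s\<in>S. b x s = 0) ==> f x = 0"
 shows "\<exists>l. \<forall>x\<in>Dm. f x = (\<Sum>s\<in>S. l s * b x s)"
 using assms
proof (induction S arbitrary: Dm rule: finite_induct)
 case (insert s S)
 define X' where "X' = {x \<in> Dm. b x s = 0}"
 have "\<exists>l. \<forall>x\<in>X'. f x = (\<Sum>s\<in>S. l s * b x s)"
  by (rule insert.IH) (use insert.prems in \<open>auto simp: X'_def\<close>)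
 then obtain l where l: "\<And>x. x \<in> X' ==> f x = (\<Sum>s\<in>S. l s * b x s)" by blast
 have sumb: "(\<Sum>s'\<in>insert s S. (l(s := c)) s' * b x s') = c * b x s + (\<Sum>s\<in>S. l s * b x s)" for c x
 proof -
  have "(\<Sum>s'\<in>S. (l(s := c)) s' * b x s') = (\<Sum>s\<in>S. l s * b x s)"
   by (rule sum.cong) (use insert.hyps in auto)
  thus ?thesis using insert.hyps by simp
 qed
 show ?case
 proof (cases "\<exists>x1\<in>Dm. b x1 s ~= 0")
  case False
  hence "X' = Dm" by (auto simp: X'_def)
  hence "\<forall>x\<in>Dm. f x = (\<Sum>s'\<in>insert s S. (l(s := 0)) s' * b x s')" using l sumb[of 0] by simp
  thus ?thesis by blast
 next
  case True
  then obtain x1 where x1: "x1 \<in> Dm" "b x1 s ~= 0" by blast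
  define f' where "f' = (%x. f x - (\<Sum>s\<in>S. l s * b x s))"
  define c where "c = f' x1 / b x1 s"
  have "f x = (\<Sum>s'\<in>insert s S. (l(s := c)) s' * b x s')" if x: "x \<in> Dm" for x
  proof -
   define t where "t = - (b x s / b x1 s)"
   have tx: "sc t x1 \<in> Dm" using insert.prems(2) x1 by blast
   have "x + sc t x1 \<in> X'"
    using x x1 tx insert.prems(1,3,4) by (auto simp: X'_def t_def)
   hence "f (x + sc t x1) = (\<Sum>s\<in>S. l s * b (x + sc t x1) s)" by (rule l)
   hence "f x + t * f x1 = (\<Sum>s\<in>S. l s * (b x s + t * b x1 s))"
    using x x1 tx insert.prems(3-6) by simp
   hence "f' x + t * f' x1 = 0"
    by (simp add: f'_def algebra_simps sum.distrib sum_distrib_left)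
   hence "f' x = c * b x s" using x1(2) by (simp add: t_def c_def field_simps)
   thus ?thesis unfolding sumb by (simp add: f'_def diff_eq_eq)
  qed
  thus ?thesis by blast
 qed
qed auto

text \<open>Nondegeneracy makes the functionals \<open>B x\<close> separate points, so every functional on the finitely
 generated space \<open>N\<close> agrees with some \<open>B x\<close> on a finite generating set.\<close>

lemma presented_dual:
 fixes B :: "'x::ab_group_add => 'y::ab_group_add => complex"
 assumes "presented M pr sc Dm Z" and "presented N qr tc Y W"
  and B1: "\<And>x x' y. x \<in> Dm ==> x' \<in> Dm ==> y \<in> Y ==> B (x + x') y = B x y + B x' y"
   "\<And>c x y. x \<in> Dm ==> y \<in> Y ==> B (sc c x) y = c * B x y"
  and B2: "\<And>x y y'. x \<in> Dm ==> y \<in> Y ==> y' \<in> Y ==> B x (y + y') = B x y + B x y'"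
   "\<And>c x y. x \<in> Dm ==> y \<in> Y ==> B x (tc c y) = c * B x y"
  and nd1: "\<And>x. x \<in> Dm ==> x \<in> Z \<longleftrightarrow> (\<forall>y\<in>Y. B x y = 0)"
  and nd2: "\<And>y. y \<in> Y ==> y \<in> W \<longleftrightarrow> (\<forall>x\<in>Dm. B x y = 0)"
  and fin: "finite S" "S \<subseteq> Y" "\<And>y. y \<in> Y ==> \<exists>c. y - (\<Sum>s\<in>S. tc (c s) s) \<in> W"
 shows "isomorphic M (dual N)"
proof -
 interpret M: presented M pr sc Dm Z by fact
 interpret N: presented N qr tc Y W by fact
 have Bneg: "B x (- y) = - B x y" if "x \<in> Dm" "y \<in> Y" for x y
  using B2(2)[OF that, of "-1"] N.sc_neg[of 1 y] N.sc_1 by simp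
 have Bdiff: "B x (y - y') = B x y - B x y'" if "x \<in> Dm" "y \<in> Y" "y' \<in> Y" for x y y'
  using B2(1)[OF that(1,2) N.Xneg[OF that(3)]] Bneg[OF that(1,3)] by simp
 have BW: "B x y = B x y'" if "x \<in> Dm" "y \<in> Y" "y' \<in> Y" "qr y = qr y'" for x y y'
 proof -
  have "y - y' \<in> W" using N.ker that by blast
  hence "B x (y - y') = 0" using nd2[OF N.Xdiff[OF that(2,3)]] that(1) by blast
  thus ?thesis using Bdiff that by simp
 qed
 have Bneg1: "B (- x) y = - B x y" if "x \<in> Dm" "y \<in> Y" for x y
  using B1(2)[OF that, of "-1"] M.sc_neg[of 1 x] M.sc_1 by simp
 have BZ: "(\<forall>y\<in>Y. B x y = B x' y) \<longleftrightarrow> pr x = pr x'" if "x \<in> Dm" "x' \<in> Dm" for x x'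
 proof -
  have "B (x - x') y = B x y - B x' y" if "y \<in> Y" for y
   using B1(1)[OF \<open>x \<in> Dm\<close> M.Xneg[OF \<open>x' \<in> Dm\<close>] that] Bneg1[OF \<open>x' \<in> Dm\<close> that] by simp
  hence "(\<forall>y\<in>Y. B x y = B x' y) \<longleftrightarrow> x - x' \<in> Z" using nd1[OF M.Xdiff[OF that]] by simp
  thus ?thesis using M.ker[OF that] by simp
 qed
 define rep where "rep = (%m. SOME x. x \<in> Dm \<and> pr x = m)"
 define qrep where "qrep = (%n. SOME y. y \<in> Y \<and> qr y = n)"
 have rep: "rep m \<in> Dm \<and> pr (rep m) = m" if "m \<in> carrier M" for m
  unfolding rep_def by (rule someI_ex) (use that in \<open>auto simp: M.carrier\<close>)
 have qrep: "qrep n \<in> Y \<and> qr (qrep n) = n" if "n \<in> carrier N" for n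
  unfolding qrep_def by (rule someI_ex) (use that in \<open>auto simp: N.carrier\<close>)
 define \<phi> where "\<phi> = (%m. \<lambda>n\<in>carrier N. B (rep m) (qrep n))"
 have \<phi>: "\<phi> (pr x) (qr y) = B x y" if x: "x \<in> Dm" and y: "y \<in> Y" for x y
 proof -
  have c: "pr x \<in> carrier M" "qr y \<in> carrier N" using x y by (auto simp: M.carrier N.carrier)
  have "\<phi> (pr x) (qr y) = B (rep (pr x)) (qrep (qr y))" using c by (simp add: \<phi>_def)
  also have "\<dots> = B (rep (pr x)) y" by (rule BW) (use rep[OF c(1)] qrep[OF c(2)] y in auto)
  also have "\<dots> = B x y" using BZ[of "rep (pr x)" x] rep[OF c(1)] x y by blast
  finally show ?thesis .
 qed
 have \<phi>_ext: "\<phi> m \<in> extensional (carrier N)" for m by (simp add: \<phi>_def)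
 have \<phi>_hom: "\<phi> m \<in> LinearCombinations.module_hom CC N CC_mod" if "m \<in> carrier M" for m
 proof -
  from that obtain x where x: "x \<in> Dm" "m = pr x" by (auto simp: M.carrier)
  show ?thesis unfolding module_hom_def
   by (auto simp: N.carrier CC_mod_def x N.add N.smult \<phi> N.Xadd N.Xsc B2)
 qed
 have hom: "\<phi> \<in> LinearCombinations.module_hom CC M (dual N)"
  unfolding module_hom_def
 proof (intro CollectI conjI allI impI)
  show "\<phi> \<in> carrier M \<rightarrow> carrier (dual N)" using \<phi>_hom \<phi>_ext by (auto simp: dual_def)
  fix m m' assume "m \<in> carrier M \<and> m' \<in> carrier M"
  then obtain x x' where x: "x \<in> Dm" "m = pr x" "x' \<in> Dm" "m' = pr x'" by (auto simp: M.carrier)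
  have "\<phi> (m \<oplus>\<^bsub>M\<^esub> m') n = \<phi> m n + \<phi> m' n" if "n \<in> carrier N" for n
  proof -
   obtain y where y: "y \<in> Y" "n = qr y" using \<open>n \<in> carrier N\<close> by (auto simp: N.carrier)
   show ?thesis using x y by (simp add: M.add \<phi> M.Xadd B1)
  qed
  thus "\<phi> (m \<oplus>\<^bsub>M\<^esub> m') = \<phi> m \<oplus>\<^bsub>dual N\<^esub> \<phi> m'"
   by (intro extensionalityI[OF \<phi>_ext]) (auto simp: dual_def)
 next
  fix c m assume "c \<in> carrier CC \<and> m \<in> carrier M"
  then obtain x where x: "x \<in> Dm" "m = pr x" by (auto simp: M.carrier)
  have "\<phi> (c \<odot>\<^bsub>M\<^esub> m) n = c * \<phi> m n" if "n \<in> carrier N" for n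
  proof -
   obtain y where y: "y \<in> Y" "n = qr y" using \<open>n \<in> carrier N\<close> by (auto simp: N.carrier)
   show ?thesis using x y by (simp add: M.smult \<phi> M.Xsc B1)
  qed
  thus "\<phi> (c \<odot>\<^bsub>M\<^esub> m) = c \<odot>\<^bsub>dual N\<^esub> \<phi> m"
   by (intro extensionalityI[OF \<phi>_ext]) (auto simp: dual_def)
 qed
 have inj: "inj_on \<phi> (carrier M)"
 proof (rule inj_onI)
  fix m m' assume "m \<in> carrier M" "m' \<in> carrier M" and eq: "\<phi> m = \<phi> m'"
  then obtain x x' where x: "x \<in> Dm" "m = pr x" "x' \<in> Dm" "m' = pr x'" by (auto simp: M.carrier)
  have "B x y = B x' y" if "y \<in> Y" for y using eq x \<phi>[OF _ that] by metis
  thus "m = m'" using BZ[of x x'] x by blast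
 qed
 have "\<psi> \<in> \<phi> ` carrier M" if \<psi>: "\<psi> \<in> carrier (dual N)" for \<psi>
 proof -
  have \<psi>h: "\<psi> \<in> LinearCombinations.module_hom CC N CC_mod" and \<psi>e: "\<psi> \<in> extensional (carrier N)"
   using \<psi> by (auto simp: dual_def)
  define p where "p = (%y. \<psi> (qr y))"
  have p: "p (y + y') = p y + p y'" "p (tc c y) = c * p y" if "y \<in> Y" "y' \<in> Y" for y y' c
   using \<psi>h that unfolding module_hom_def
   by (auto simp: N.carrier p_def CC_mod_def N.add[symmetric] N.smult[symmetric])
  have pW: "p y = 0" if "y \<in> Y" "y \<in> W" for y
  proof -
   have "qr y = qr 0" using N.pr_eq_0[OF that(1)] that(2) by (simp add: N.zero)
   hence "p y = p (tc 0 0)" by (simp add: p_def)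
   also have "\<dots> = 0" using p(2)[OF N.X0 N.X0, of 0] by simp
   finally show ?thesis .
  qed
  have psum: "p (\<Sum>s\<in>A. tc (c s) s) = (\<Sum>s\<in>A. c s * p s)" and Bsum: "x \<in> Dm ==> B x (\<Sum>s\<in>A. tc (c s) s) = (\<Sum>s\<in>A. c s * B x s)"
   if "A \<subseteq> Y" for A c x
  proof -
   have p0: "p 0 = 0" and B0: "x \<in> Dm ==> B x 0 = 0" for x
    using p(2)[OF N.X0 N.X0, of 0] B2(2)[OF _ N.X0, of x 0] by simp_all
   have "(\<Sum>s\<in>A. tc (c s) s) \<in> Y \<and> p (\<Sum>s\<in>A. tc (c s) s) = (\<Sum>s\<in>A. c s * p s) \<and>
    (x \<in> Dm --> B x (\<Sum>s\<in>A. tc (c s) s) = (\<Sum>s\<in>A. c s * B x s))"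
    using that
    by (induction A rule: infinite_finite_induct) (auto simp: p0 B0 N.X0 p B2 N.Xsc N.Xadd)
   thus "p (\<Sum>s\<in>A. tc (c s) s) = (\<Sum>s\<in>A. c s * p s)"
    "x \<in> Dm ==> B x (\<Sum>s\<in>A. tc (c s) s) = (\<Sum>s\<in>A. c s * B x s)" by auto
  qed
  have "\<exists>x\<in>Dm. \<forall>s\<in>S'. B x s = p s" if "finite S'" "S' \<subseteq> Y" for S'
   using that
  proof (induction S' rule: finite_induct)
   case empty thus ?case using M.X0 by auto
  next
   case (insert s S')
   then obtain x0 where x0: "x0 \<in> Dm" "\<And>t. t \<in> S' ==> B x0 t = p t" by auto
   have sY: "s \<in> Y" "S' \<subseteq> Y" using insert.prems by auto
   show ?case
   proof (cases "\<exists>x1\<in>Dm. (\<forall>t\<in>S'. B x1 t = 0) \<and> B x1 s ~= 0")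
    case True
    then obtain x1 where x1: "x1 \<in> Dm" "\<And>t. t \<in> S' ==> B x1 t = 0" "B x1 s ~= 0" by blast
    define x where "x = x0 + sc ((p s - B x0 s) / B x1 s) x1"
    have "x \<in> Dm" using x0 x1 by (simp add: x_def M.Xadd M.Xsc)
    moreover have "B x t = p t" if "t \<in> insert s S'" for t
     using that x0 x1 sY by (auto simp: x_def B1 M.Xsc subset_iff)
    ultimately show ?thesis by blast
   next
    \<comment> \<open>Now \<open>s\<close> is a combination of \<open>S'\<close> modulo
      \<open>W\<close>, so the values of \<open>p\<close> and of \<open>B x0\<close> at
      \<open>s\<close> are both forced by those on \<open>S'\<close>.\<close>
    case False
    have "\<exists>l. \<forall>x\<in>Dm. B x s = (\<Sum>t\<in>S'. l t * B x (if t \<in> S' then t else s))"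
    proof (rule common_kernel[where sc = sc])
     fix x assume x: "x \<in> Dm" "\<forall>t\<in>S'. B x (if t \<in> S' then t else s) = 0"
     thus "B x s = 0" using False by auto
    qed (use insert.hyps sY in \<open>auto simp: B1 M.Xadd M.Xsc subset_iff\<close>)
    then obtain l where l: "\<And>x. x \<in> Dm ==> B x s = (\<Sum>t\<in>S'. l t * B x t)" by auto
    define y where "y = s - (\<Sum>t\<in>S'. tc (l t) t)"
    have sumY: "(\<Sum>t\<in>S'. tc (l t) t) \<in> Y" using sY by (intro N.Xsum N.Xsc) auto
    have yY: "y \<in> Y" unfolding y_def by (rule N.Xdiff[OF sY(1) sumY])
    have "B x y = 0" if "x \<in> Dm" for x
     unfolding y_def using Bdiff[OF that sY(1) sumY] Bsum[OF sY(2) that] l[OF that] by simp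
    hence "y \<in> W" using nd2[OF yY] by blast
    hence "p y = 0" by (rule pW[OF yY])
    moreover have "p s = p y + p (\<Sum>t\<in>S'. tc (l t) t)"
     using p(1)[OF yY sumY] by (simp add: y_def)
    ultimately have "p s = (\<Sum>t\<in>S'. l t * p t)" using psum[OF sY(2)] by simp
    also have "\<dots> = (\<Sum>t\<in>S'. l t * B x0 t)" by (rule sum.cong) (auto simp: x0)
    also have "\<dots> = B x0 s" using l[OF x0(1)] by simp
    finally show ?thesis using x0 by (intro bexI[of _ x0]) auto
   qed
  qed
  from this[OF fin(1,2)] obtain x where x: "x \<in> Dm" "\<And>s. s \<in> S ==> B x s = p s" by blast
  have Bp: "B x y = p y" if y: "y \<in> Y" for y
  proof -
   obtain c where c: "y - (\<Sum>s\<in>S. tc (c s) s) \<in> W" using fin(3)[OF y] by blast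
   have sY: "(\<Sum>s\<in>S. tc (c s) s) \<in> Y" using fin(2) by (intro N.Xsum N.Xsc) auto
   have eq: "qr y = qr (\<Sum>s\<in>S. tc (c s) s)" using N.ker[OF y sY] c by blast
   have "B x y = (\<Sum>s\<in>S. c s * B x s)" using BW[OF x(1) y sY eq] Bsum[OF fin(2) x(1)] by simp
   also have "\<dots> = (\<Sum>s\<in>S. c s * p s)" by (rule sum.cong) (auto simp: x)
   also have "\<dots> = p y" using psum[OF fin(2), of c] eq by (simp add: p_def)
   finally show ?thesis .
  qed
  have "\<psi> = \<phi> (pr x)"
  proof (rule extensionalityI[OF \<psi>e \<phi>_ext])
   fix n assume "n \<in> carrier N"
   then obtain y where y: "y \<in> Y" "n = qr y" by (auto simp: N.carrier)
   thus "\<psi> n = \<phi> (pr x) n" using \<phi>[OF x(1) y(1)] Bp[OF y(1)] by (simp add: p_def)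
  qed
  thus ?thesis using x by (simp add: M.carrier)
 qed
 moreover have "\<phi> ` carrier M \<subseteq> carrier (dual N)" using hom by (auto simp: module_hom_def)
 ultimately have "\<phi> ` carrier M = carrier (dual N)" by blast
 thus ?thesis unfolding isomorphic_def bij_betw_def using hom inj by blast
qed

section \<open>Exterior powers of the normal spaces\<close>

definition fsc :: "complex => ('a => complex) => 'a => complex" where
 "fsc a c = (%s. a * c s)"

definition finsupp :: "'a set => ('a => complex) set" where
 "finsupp S = {c. finite {s. c s ~= 0} \<and> {s. c s ~= 0} \<subseteq> S}"

lemma finsupp_add: "c \<in> finsupp S ==> c' \<in> finsupp S ==> c + c' \<in> finsupp S"
proof -
 assume c: "c \<in> finsupp S" "c' \<in> finsupp S"
 have "{s. (c + c') s ~= 0} \<subseteq> {s. c s ~= 0} \<union> {s. c' s ~= 0}" by auto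
 moreover have "finite ({s. c s ~= 0} \<union> {s. c' s ~= 0})" using c by (auto simp: finsupp_def)
 ultimately have "finite {s. (c + c') s ~= 0}" by (rule finite_subset)
 thus ?thesis using c \<open>{s. (c + c') s ~= 0} \<subseteq> _\<close> by (auto simp: finsupp_def)
qed

lemma finsupp_fsc: "c \<in> finsupp S ==> fsc a c \<in> finsupp S"
proof -
 assume c: "c \<in> finsupp S"
 have "{s. fsc a c s ~= 0} \<subseteq> {s. c s ~= 0}" by (auto simp: fsc_def)
 thus ?thesis using c by (auto simp: finsupp_def intro: finite_subset)
qed

lemma finsupp_gen: "s \<in> S ==> free_gen s \<in> finsupp S"
 by (auto simp: finsupp_def free_gen_def)

lemma presented_free: "presented (free_mod S) (%c. c) fsc (finsupp S) {0}"
 by unfold_locales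
  (auto simp: free_mod_def finsupp_add finsupp_fsc fsc_def algebra_simps fun_eq_iff,
  auto simp: finsupp_def)

text \<open>Linear extension of a map given on the free generators.\<close>

definition lext :: "('a => 'b => complex) => ('a => complex) => 'b => complex" where
 "lext w c = (%t. \<Sum>s\<in>{s. c s ~= 0}. c s * w s t)"

lemma lext_superset: "finite A ==> {s. c s ~= 0} \<subseteq> A ==> lext w c t = (\<Sum>s\<in>A. c s * w s t)"
 unfolding lext_def by (rule sum.mono_neutral_left) auto

lemma lext_add:
 assumes "c \<in> finsupp S" "c' \<in> finsupp S"
 shows "lext w (c + c') = lext w c + lext w c'"
proof
 fix t
 let ?A = "{s. c s ~= 0} \<union> {s. c' s ~= 0}"
 have A: "finite ?A" using assms by (auto simp: finsupp_def)
 have sub: "{s. (c + c') s ~= 0} \<subseteq> ?A" by auto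
 have "lext w c t = (\<Sum>s\<in>?A. c s * w s t)" "lext w c' t = (\<Sum>s\<in>?A. c' s * w s t)"
  by (rule lext_superset[OF A]; blast)+
 thus "lext w (c + c') t = (lext w c + lext w c') t"
  unfolding lext_superset[OF A sub, of w t] by (simp add: distrib_right sum.distrib)
qed

lemma lext_fsc:
 assumes "c \<in> finsupp S"
 shows "lext w (fsc a c) = fsc a (lext w c)"
proof
 fix t
 have A: "finite {s. c s ~= 0}" using assms by (auto simp: finsupp_def)
 have "{s. fsc a c s ~= 0} \<subseteq> {s. c s ~= 0}" by (auto simp: fsc_def)
 from lext_superset[OF A this, of w t] show "lext w (fsc a c) t = fsc a (lext w c) t"
  by (simp add: fsc_def lext_def sum_distrib_left mult.assoc)
qed

lemma lext_gen: "lext w (free_gen s) = w s"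
proof
 fix t
 have "lext w (free_gen s) t = (\<Sum>s'\<in>{s}. free_gen s s' * w s' t)"
  by (rule lext_superset) (auto simp: free_gen_def split: if_splits)
 thus "lext w (free_gen s) t = w s t" by (simp add: free_gen_def)
qed

lemma finsupp_induct:
 assumes c: "c \<in> finsupp S" and 0: "0 \<in> Q" and add: "\<And>x y. x \<in> Q ==> y \<in> Q ==> x + y \<in> Q"
  and gen: "\<And>a s. s \<in> S ==> fsc a (free_gen s) \<in> Q"
 shows "c \<in> Q"
proof -
 have part: "(%t. \<Sum>s\<in>A. fsc (c s) (free_gen s) t) \<in> Q" if "finite A" "A \<subseteq> S" for A
  using that
 proof (induction A rule: finite_induct)
  case empty thus ?case using 0 by (simp add: zero_fun_def)
 next
  case (insert s A)
  have "(%t. \<Sum>s\<in>insert s A. fsc (c s) (free_gen s) t) = fsc (c s) (free_gen s) + (%t. \<Sum>s\<in>A. fsc (c s) (free_gen s) t)"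
   using insert.hyps by (simp add: plus_fun_def)
  thus ?case using add[OF gen] insert by simp
 qed
 have "c = (%t. \<Sum>s\<in>{s. c s ~= 0}. fsc (c s) (free_gen s) t)"
 proof
  fix t
  have "(\<Sum>s\<in>{s. c s ~= 0}. fsc (c s) (free_gen s) t) = (\<Sum>s\<in>{s. c s ~= 0}. if s = t then c t else 0)"
   by (rule sum.cong) (auto simp: fsc_def free_gen_def)
  thus "c t = (\<Sum>s\<in>{s. c s ~= 0}. fsc (c s) (free_gen s) t)" using c by (auto simp: finsupp_def)
 qed
 moreover have "(%t. \<Sum>s\<in>{s. c s ~= 0}. fsc (c s) (free_gen s) t) \<in> Q"
  by (rule part) (use c in \<open>auto simp: finsupp_def\<close>)
 ultimately show ?thesis by simp
qed

context presented
begin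

lemma Madd: "a \<in> carrier M ==> b \<in> carrier M ==> a \<oplus>\<^bsub>M\<^esub> b \<in> carrier M"
 by (auto simp: carrier add Xadd)

lemma Msmult: "a \<in> carrier M ==> c \<odot>\<^bsub>M\<^esub> a \<in> carrier M"
 by (auto simp: carrier smult Xsc)

lemma tuples_slot: "xs @ a # ys \<in> tuples k M ==> b \<in> carrier M ==> xs @ b # ys \<in> tuples k M"
 by (auto simp: tuples_def)

lemma ext_relations_finsupp: "ext_relations k M \<subseteq> finsupp (tuples k M)"
proof
 interpret T: presented "free_mod (tuples k M)" "%c. c" fsc "finsupp (tuples k M)" "{0}" by (rule presented_free)
 fix r assume "r \<in> ext_relations k M"
 then consider (1) xs a b ys where "r = free_gen (xs @ (a \<oplus>\<^bsub>M\<^esub> b) # ys) - free_gen (xs @ a # ys) - free_gen (xs @ b # ys)"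
   "xs @ a # ys \<in> tuples k M" "b \<in> carrier M"
  | (2) xs c a ys where "r = free_gen (xs @ (c \<odot>\<^bsub>M\<^esub> a) # ys) - fsc c (free_gen (xs @ a # ys))" "xs @ a # ys \<in> tuples k M"
  | (3) xs a ys zs where "r = free_gen (xs @ a # ys @ a # zs)" "xs @ a # ys @ a # zs \<in> tuples k M"
  unfolding ext_relations_def by (auto simp: fun_diff_def fsc_def)
 thus "r \<in> finsupp (tuples k M)"
 proof cases
  case 1
  have "a \<in> carrier M" using 1 by (auto simp: tuples_def)
  thus ?thesis unfolding 1(1)
   by (intro T.Xdiff finsupp_gen tuples_slot[OF 1(2)] Madd 1(2,3))
 next
  case 2
  have "a \<in> carrier M" using 2 by (auto simp: tuples_def)
  thus ?thesis unfolding 2(1)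
   by (intro T.Xdiff finsupp_gen finsupp_fsc tuples_slot[OF 2(2)] Msmult 2(2))
 next
  case 3 thus ?thesis by (simp add: finsupp_gen)
 qed
qed

lemma subsp_null: "presented.subsp fsc (finsupp (tuples k M)) (ext_null k M)"
 and null_relations: "ext_relations k M \<subseteq> ext_null k M"
proof -
 interpret T: presented "free_mod (tuples k M)" "%c. c" fsc "finsupp (tuples k M)" "{0}" by (rule presented_free)
 have car: "ext_relations k M \<subseteq> carrier (free_mod (tuples k M))"
  using ext_relations_finsupp by (simp add: T.carrier)
 show "ext_relations k M \<subseteq> ext_null k M" unfolding ext_null_def by (rule T.span_base[OF car])
 have "{x \<in> finsupp (tuples k M). x \<in> ext_null k M} = ext_null k M"
  unfolding ext_null_def using module.span_is_subset2[OF T.module car] by (auto simp: T.carrier)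
 thus "T.subsp (ext_null k M)" using T.subsp_span[OF car] by (simp add: ext_null_def)
qed

lemma presented_ext:
 "presented (ext_power k M) (%c. ext_null k M +>\<^bsub>free_mod (tuples k M)\<^esub> c) fsc (finsupp (tuples k M)) (ext_null k M)"
proof -
 interpret T: presented "free_mod (tuples k M)" "%c. c" fsc "finsupp (tuples k M)" "{0}" by (rule presented_free)
 have "{0} \<subseteq> ext_null k M" using subsp_null[of k] by (simp add: T.subsp_def)
 from T.quotient[OF subsp_null this] show ?thesis by (simp add: ext_power_def)
qed

lemma null_facts:
 shows "0 \<in> ext_null k M" "x \<in> ext_null k M ==> y \<in> ext_null k M ==> x + y \<in> ext_null k M"
  "x \<in> ext_null k M ==> fsc c x \<in> ext_null k M" "x \<in> ext_null k M ==> y \<in> ext_null k M ==> x - y \<in> ext_null k M"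
proof -
 interpret T: presented "free_mod (tuples k M)" "%c. c" fsc "finsupp (tuples k M)" "{0}" by (rule presented_free)
 show "0 \<in> ext_null k M" and a: "x \<in> ext_null k M ==> y \<in> ext_null k M ==> x + y \<in> ext_null k M"
  and s: "x \<in> ext_null k M ==> fsc c x \<in> ext_null k M" for x y c
  using subsp_null[of k] by (auto simp: T.subsp_def)
 show "x \<in> ext_null k M ==> y \<in> ext_null k M ==> x - y \<in> ext_null k M"
  using a[of x "fsc (-1) y"] s[of y "-1"] T.sc_neg[of 1 y] T.sc_1[of y] by simp
qed

lemma null_add:
 "xs @ a # ys \<in> tuples k M ==> b \<in> carrier M ==>
  free_gen (xs @ (a \<oplus>\<^bsub>M\<^esub> b) # ys) - free_gen (xs @ a # ys) - free_gen (xs @ b # ys) \<in> ext_null k M"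
 by (rule subsetD[OF null_relations]) (unfold ext_relations_def fun_diff_def, blast)

lemma null_smult:
 "xs @ a # ys \<in> tuples k M ==> free_gen (xs @ (c \<odot>\<^bsub>M\<^esub> a) # ys) - fsc c (free_gen (xs @ a # ys)) \<in> ext_null k M"
 by (rule subsetD[OF null_relations]) (unfold ext_relations_def fun_diff_def fsc_def, blast)

lemma null_repeat: "xs @ a # ys @ a # zs \<in> tuples k M ==> free_gen (xs @ a # ys @ a # zs) \<in> ext_null k M"
 by (rule subsetD[OF null_relations]) (unfold ext_relations_def, blast)

end

locale two_presented = M: presented M pr sc Dm Z + N: presented N qr tc Y W
 for M pr sc Dm Z and N :: "(complex, 'c) module" and qr :: "'y::ab_group_add => 'c" and tc Y W +
 fixes \<phi>
 assumes \<phi>: "\<And>a. a \<in> carrier M ==> \<phi> a \<in> carrier N"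
  "\<And>a b. a \<in> carrier M ==> b \<in> carrier M ==> \<phi> (a \<oplus>\<^bsub>M\<^esub> b) = \<phi> a \<oplus>\<^bsub>N\<^esub> \<phi> b"
  "\<And>c a. a \<in> carrier M ==> \<phi> (c \<odot>\<^bsub>M\<^esub> a) = c \<odot>\<^bsub>N\<^esub> \<phi> a"
begin

abbreviation push where "push \<equiv> lext (%s. free_gen (map \<phi> s))"

lemma tuples_map: "vs \<in> tuples k M ==> map \<phi> vs \<in> tuples k N"
 using \<phi>(1) by (auto simp: tuples_def)

lemma push_finsupp:
 assumes "c \<in> finsupp (tuples k M)"
 shows "push c \<in> finsupp (tuples k N)"
 using assms
proof (rule finsupp_induct[where Q = "{c \<in> finsupp (tuples k M). push c \<in> finsupp (tuples k N)}", THEN CollectD, THEN conjunct2])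
 interpret T: presented "free_mod (tuples k M)" "%c. c" fsc "finsupp (tuples k M)" "{0}" by (rule presented_free)
 interpret T': presented "free_mod (tuples k N)" "%c. c" fsc "finsupp (tuples k N)" "{0}" by (rule presented_free)
 have "push 0 = 0" by (simp add: lext_def zero_fun_def)
 thus "0 \<in> {c \<in> finsupp (tuples k M). push c \<in> finsupp (tuples k N)}" using T.X0 T'.X0 by simp
 show "fsc a (free_gen s) \<in> {c \<in> finsupp (tuples k M). push c \<in> finsupp (tuples k N)}" if "s \<in> tuples k M" for a s
  using that by (simp add: lext_fsc[OF finsupp_gen[OF that]] lext_gen finsupp_fsc finsupp_gen tuples_map)
qed (auto simp: lext_add finsupp_add)

text \<open>The preimage of \<open>ext_null k N\<close> is a subspace, so it is enough that each
  type of relation goes to a relation of the same type.\<close>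

lemma push_null:
 assumes "c \<in> ext_null k M"
 shows "push c \<in> ext_null k N"
proof -
 interpret T: presented "free_mod (tuples k M)" "%c. c" fsc "finsupp (tuples k M)" "{0}" by (rule presented_free)
 let ?Q = "{c \<in> finsupp (tuples k M). push c \<in> ext_null k N}"
 have sub: "T.subsp ?Q"
  unfolding T.subsp_def
 proof (intro conjI ballI allI)
  have "push 0 = 0" by (simp add: lext_def zero_fun_def)
  thus "0 \<in> ?Q" using T.X0 N.null_facts(1) by simp
 qed (auto simp: finsupp_add finsupp_fsc lext_add lext_fsc N.null_facts)
 have gen: "free_gen s \<in> finsupp (tuples k M)" if "s \<in> tuples k M" for s by (rule finsupp_gen[OF that])
 have diff: "push (x - y) = push x - push y" if "x \<in> finsupp (tuples k M)" "y \<in> finsupp (tuples k M)" for x y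
  using lext_add[OF T.Xdiff[OF that] that(2), of "%s. free_gen (map \<phi> s)"] by simp
 have "ext_relations k M \<subseteq> (%c. c) ` ?Q"
 proof
  fix r assume r: "r \<in> ext_relations k M"
  hence rf: "r \<in> finsupp (tuples k M)" using M.ext_relations_finsupp by blast
  from r consider (1) xs a b ys where "r = free_gen (xs @ (a \<oplus>\<^bsub>M\<^esub> b) # ys) - free_gen (xs @ a # ys) - free_gen (xs @ b # ys)"
    "xs @ a # ys \<in> tuples k M" "b \<in> carrier M"
   | (2) xs c a ys where "r = free_gen (xs @ (c \<odot>\<^bsub>M\<^esub> a) # ys) - fsc c (free_gen (xs @ a # ys))" "xs @ a # ys \<in> tuples k M"
   | (3) xs a ys zs where "r = free_gen (xs @ a # ys @ a # zs)" "xs @ a # ys @ a # zs \<in> tuples k M"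
   unfolding ext_relations_def by (auto simp: fun_diff_def fsc_def)
  hence "push r \<in> ext_null k N"
  proof cases
   case 1
   have a: "a \<in> carrier M" using 1 by (auto simp: tuples_def)
   have t: "xs @ (a \<oplus>\<^bsub>M\<^esub> b) # ys \<in> tuples k M" "xs @ b # ys \<in> tuples k M"
    using M.tuples_slot[OF 1(2)] M.Madd[OF a 1(3)] 1(3) by auto
   have "push r = free_gen (map \<phi> xs @ (\<phi> a \<oplus>\<^bsub>N\<^esub> \<phi> b) # map \<phi> ys) - free_gen (map \<phi> xs @ \<phi> a # map \<phi> ys) -
     free_gen (map \<phi> xs @ \<phi> b # map \<phi> ys)"
    unfolding 1(1) by (simp add: diff T.Xdiff gen t 1(2) lext_gen \<phi>(2)[OF a 1(3)])
   also have "\<dots> \<in> ext_null k N"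
    using tuples_map[OF 1(2)] \<phi>(1)[OF 1(3)] by (intro N.null_add) auto
   finally show ?thesis .
  next
   case 2
   have a: "a \<in> carrier M" using 2 by (auto simp: tuples_def)
   have t: "xs @ (c \<odot>\<^bsub>M\<^esub> a) # ys \<in> tuples k M" using M.tuples_slot[OF 2(2) M.Msmult[OF a]] .
   have "push r = free_gen (map \<phi> xs @ (c \<odot>\<^bsub>N\<^esub> \<phi> a) # map \<phi> ys) - fsc c (free_gen (map \<phi> xs @ \<phi> a # map \<phi> ys))"
    unfolding 2(1) by (simp add: diff gen finsupp_fsc t 2(2) lext_gen lext_fsc[OF gen[OF 2(2)]] \<phi>(3)[OF a])
   also have "\<dots> \<in> ext_null k N" using tuples_map[OF 2(2)] by (intro N.null_smult) auto
   finally show ?thesis .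
  next
   case 3
   have "push r = free_gen (map \<phi> xs @ \<phi> a # map \<phi> ys @ \<phi> a # map \<phi> zs)" by (simp add: 3(1) lext_gen)
   also have "\<dots> \<in> ext_null k N" using tuples_map[OF 3(2)] by (intro N.null_repeat) auto
   finally show ?thesis .
  qed
  thus "r \<in> (%c. c) ` ?Q" using rf by simp
 qed
 from T.span_subset[OF sub this] have "ext_null k M \<subseteq> ?Q" by (simp add: ext_null_def)
 thus ?thesis using assms by blast
qed

abbreviation clsM where "clsM k c \<equiv> ext_null k M +>\<^bsub>free_mod (tuples k M)\<^esub> c"
abbreviation clsN where "clsN k c \<equiv> ext_null k N +>\<^bsub>free_mod (tuples k N)\<^esub> c"

lemma induced_exists: "\<exists>H. induced_ext_map k M N \<phi> H"
proof -
 interpret E: presented "ext_power k M" "clsM k" fsc "finsupp (tuples k M)" "ext_null k M" by (rule M.presented_ext)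
 interpret E': presented "ext_power k N" "clsN k" fsc "finsupp (tuples k N)" "ext_null k N" by (rule N.presented_ext)
 define H where "H = (%A. clsN k (push (SOME c. c \<in> finsupp (tuples k M) \<and> clsM k c = A)))"
 have H: "H (clsM k c) = clsN k (push c)" if c: "c \<in> finsupp (tuples k M)" for c
 proof -
  define c' where "c' = (SOME c'. c' \<in> finsupp (tuples k M) \<and> clsM k c' = clsM k c)"
  have c': "c' \<in> finsupp (tuples k M) \<and> clsM k c' = clsM k c" unfolding c'_def by (rule someI[of _ c]) (use c in simp)
  hence "c' - c \<in> ext_null k M" using E.ker c by blast
  hence "push (c' - c) \<in> ext_null k N" by (rule push_null)
  moreover have "push c' = push (c' - c) + push c"
   using lext_add[OF E.Xdiff[of c' c] c, of "%s. free_gen (map \<phi> s)"] c c' by simp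
  ultimately have "push c' - push c \<in> ext_null k N" by simp
  hence "clsN k (push c') = clsN k (push c)" using E'.ker push_finsupp c c' by blast
  thus ?thesis by (simp add: H_def c'_def)
 qed
 have "H \<in> LinearCombinations.module_hom CC (ext_power k M) (ext_power k N)"
  unfolding module_hom_def
  by (auto simp: E.carrier E'.carrier H E.add E'.add E.smult E'.smult E.Xadd E.Xsc lext_add lext_fsc push_finsupp)
 moreover have "H (wedge k M vs) = wedge k N (map \<phi> vs)" if "vs \<in> tuples k M" for vs
  unfolding wedge_def by (simp add: H[OF finsupp_gen[OF that]] lext_gen)
 ultimately show ?thesis unfolding induced_ext_map_def by blast
qed

text \<open>An induced map is prescribed on pure wedges only; linearity determines it on all
  classes, so different \<open>H\<close> in the definition of \<open>rho\<close> yield the same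
  value.\<close>

lemma induced_value:
 assumes H: "induced_ext_map k M N \<phi> H" and c: "c \<in> finsupp (tuples k M)"
 shows "H (clsM k c) = clsN k (push c)"
proof -
 interpret E: presented "ext_power k M" "clsM k" fsc "finsupp (tuples k M)" "ext_null k M" by (rule M.presented_ext)
 interpret E': presented "ext_power k N" "clsN k" fsc "finsupp (tuples k N)" "ext_null k N" by (rule N.presented_ext)
 have hom: "H (a \<oplus>\<^bsub>ext_power k M\<^esub> b) = H a \<oplus>\<^bsub>ext_power k N\<^esub> H b" "H (z \<odot>\<^bsub>ext_power k M\<^esub> a) = z \<odot>\<^bsub>ext_power k N\<^esub> H a"
  if "a \<in> carrier (ext_power k M)" "b \<in> carrier (ext_power k M)" for a b z
  using H that unfolding induced_ext_map_def module_hom_def by auto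
 have gen: "H (clsM k (fsc a (free_gen s))) = clsN k (push (fsc a (free_gen s)))" if s: "s \<in> tuples k M" for a s
 proof -
  have f: "free_gen s \<in> finsupp (tuples k M)" by (rule finsupp_gen[OF s])
  have w: "H (clsM k (free_gen s)) = clsN k (free_gen (map \<phi> s))"
   using H s unfolding induced_ext_map_def wedge_def by blast
  have "H (clsM k (fsc a (free_gen s))) = a \<odot>\<^bsub>ext_power k N\<^esub> H (clsM k (free_gen s))"
   unfolding E.smult[OF f, symmetric] using f by (intro hom(2)) (auto simp: E.carrier)
  also have "\<dots> = clsN k (fsc a (free_gen (map \<phi> s)))"
   unfolding w by (rule E'.smult[OF finsupp_gen[OF tuples_map[OF s]]])
  finally show ?thesis by (simp add: lext_fsc[OF f] lext_gen)
 qed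
 have "c \<in> {c \<in> finsupp (tuples k M). H (clsM k c) = clsN k (push c)}"
 proof (rule finsupp_induct[OF c])
  have p0: "push 0 = 0" by (simp add: lext_def zero_fun_def)
  have "H (0 \<odot>\<^bsub>ext_power k M\<^esub> clsM k 0) = 0 \<odot>\<^bsub>ext_power k N\<^esub> H (clsM k 0)"
   by (rule hom(2)) (use E.X0 in \<open>auto simp: E.carrier\<close>)
  moreover have "0 \<odot>\<^bsub>ext_power k M\<^esub> clsM k 0 = clsM k 0" using E.smult[OF E.X0, of 0] by simp
  moreover have "0 \<odot>\<^bsub>ext_power k N\<^esub> H (clsM k 0) = clsN k 0"
  proof -
   have "H (clsM k 0) \<in> carrier (ext_power k N)"
    using H E.X0 unfolding induced_ext_map_def module_hom_def by (auto simp: E.carrier)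
   then obtain y where "y \<in> finsupp (tuples k N)" "H (clsM k 0) = clsN k y" by (auto simp: E'.carrier)
   thus ?thesis using E'.smult[of y 0] by simp
  qed
  ultimately show "0 \<in> {c \<in> finsupp (tuples k M). H (clsM k c) = clsN k (push c)}" using E.X0 by (simp add: p0)
 next
  fix x y assume x: "x \<in> {c \<in> finsupp (tuples k M). H (clsM k c) = clsN k (push c)}"
   and y: "y \<in> {c \<in> finsupp (tuples k M). H (clsM k c) = clsN k (push c)}"
  have "H (clsM k (x + y)) = H (clsM k x) \<oplus>\<^bsub>ext_power k N\<^esub> H (clsM k y)"
   using x y hom(1)[of "clsM k x" "clsM k y"] by (auto simp: E.add[symmetric] E.carrier)
  thus "x + y \<in> {c \<in> finsupp (tuples k M). H (clsM k c) = clsN k (push c)}"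
   using x y lext_add[of x "tuples k M" y "%s. free_gen (map \<phi> s)"]
   by (simp add: finsupp_add E'.add push_finsupp del: plus_fun_apply)
 next
  show "fsc a (free_gen s) \<in> {c \<in> finsupp (tuples k M). H (clsM k c) = clsN k (push c)}" if "s \<in> tuples k M" for a s
   using gen[OF that] finsupp_fsc[OF finsupp_gen[OF that]] by simp
 qed
 thus ?thesis by simp
qed

end

section \<open>Normal spaces and conjugation\<close>

lemma presented_Cvec: "presented Cvec (%x. x) (*s) UNIV {0}"
 by unfold_locales (auto simp: Cvec_def vec_eq_iff algebra_simps)

definition ncl :: "complex ^ 'n::finite ^ 'n => complex ^ 'n => (complex ^ 'n) set" where
 "ncl g v = Fix g +>\<^bsub>Cvec\<^esub> v"

lemma ncl_eq: "ncl g v = {x + v | x. x \<in> Fix g}"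
 by (auto simp: ncl_def a_r_coset_def' Cvec_def)

lemma presented_normal: "presented (normal_space g) (ncl g) (*s) UNIV (Fix g)"
proof -
 interpret C: presented Cvec "%x. x" "(*s)" UNIV "{0}" by (rule presented_Cvec)
 have "C.subsp (Fix g)"
  unfolding C.subsp_def by (auto simp: Fix_def matrix_vector_right_distrib vector_scalar_commute)
 moreover have "{0} \<subseteq> Fix g" by (simp add: Fix_def)
 ultimately show ?thesis using C.quotient[of "Fix g"] by (simp add: normal_space_def ncl_def[abs_def])
qed

lemma Fix_conjugate:
 fixes g h :: "complex ^ 'n::finite ^ 'n"
 assumes "invertible h"
 shows "h *v x \<in> Fix (h ** g ** matrix_inv h) \<longleftrightarrow> x \<in> Fix g"
proof -
 have "(h ** g ** matrix_inv h) *v (h *v x) = (h ** g ** (matrix_inv h ** h)) *v x"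
  by (simp add: matrix_vector_mul_assoc matrix_mul_assoc)
 also have "\<dots> = h *v (g *v x)" by (simp add: matrix_inv_cancel[OF assms] matrix_vector_mul_assoc)
 finally have eq: "(h ** g ** matrix_inv h) *v (h *v x) = h *v (g *v x)" .
 have "matrix_inv h *v (h *v y) = y" for y by (simp add: matrix_vector_mul_assoc matrix_inv_cancel[OF assms])
 hence "h *v y = h *v z \<longleftrightarrow> y = z" for y z by metis
 thus ?thesis by (simp add: Fix_def eq)
qed

lemma ncl_image:
 fixes g h :: "complex ^ 'n::finite ^ 'n"
 assumes "invertible h"
 shows "(*v) h ` ncl g v = ncl (h ** g ** matrix_inv h) (h *v v)"
proof (intro equalityI subsetI)
 fix z assume "z \<in> (*v) h ` ncl g v"
 then obtain x where "x \<in> Fix g" "z = h *v (x + v)" by (auto simp: ncl_eq)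
 thus "z \<in> ncl (h ** g ** matrix_inv h) (h *v v)"
  using Fix_conjugate[OF assms, of x g] by (auto simp: ncl_eq matrix_vector_right_distrib)
next
 fix z assume "z \<in> ncl (h ** g ** matrix_inv h) (h *v v)"
 then obtain y where y: "y \<in> Fix (h ** g ** matrix_inv h)" "z = y + h *v v" by (auto simp: ncl_eq)
 have hy: "h *v (matrix_inv h *v y) = y" by (simp add: matrix_vector_mul_assoc matrix_inv_cancel[OF assms])
 hence "matrix_inv h *v y \<in> Fix g" using Fix_conjugate[OF assms, of "matrix_inv h *v y" g] y by simp
 moreover have "z = h *v (matrix_inv h *v y + v)" using y hy by (simp add: matrix_vector_right_distrib)
 ultimately show "z \<in> (*v) h ` ncl g v" unfolding ncl_eq by blast
qed

lemma two_presented_normal: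
 fixes g h :: "complex ^ 'n::finite ^ 'n"
 assumes "invertible h"
 shows "two_presented (normal_space g) (ncl g) (*s) UNIV (Fix g) (normal_space (h ** g ** matrix_inv h))
  (ncl (h ** g ** matrix_inv h)) (*s) UNIV (Fix (h ** g ** matrix_inv h)) (image ((*v) h))"
proof -
 interpret M: presented "normal_space g" "ncl g" "(*s)" UNIV "Fix g" by (rule presented_normal)
 interpret N: presented "normal_space (h ** g ** matrix_inv h)" "ncl (h ** g ** matrix_inv h)" "(*s)" UNIV
  "Fix (h ** g ** matrix_inv h)" by (rule presented_normal)
 show ?thesis
 proof
  show "(*v) h ` A \<in> carrier (normal_space (h ** g ** matrix_inv h))" if "A \<in> carrier (normal_space g)" for A
   using that by (auto simp: M.carrier N.carrier ncl_image[OF assms])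
  show "(*v) h ` (A \<oplus>\<^bsub>normal_space g\<^esub> B) = (*v) h ` A \<oplus>\<^bsub>normal_space (h ** g ** matrix_inv h)\<^esub> (*v) h ` B"
   if AB: "A \<in> carrier (normal_space g)" "B \<in> carrier (normal_space g)" for A B
  proof -
   obtain v w where "A = ncl g v" "B = ncl g w" using AB by (auto simp: M.carrier)
   thus ?thesis by (simp add: M.add N.add ncl_image[OF assms] matrix_vector_right_distrib)
  qed
  show "(*v) h ` (c \<odot>\<^bsub>normal_space g\<^esub> A) = c \<odot>\<^bsub>normal_space (h ** g ** matrix_inv h)\<^esub> (*v) h ` A"
   if "A \<in> carrier (normal_space g)" for c A
  proof -
   from that obtain v where "A = ncl g v" by (auto simp: M.carrier)
   thus ?thesis by (simp add: M.smult N.smult ncl_image[OF assms] vector_scalar_commute)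
  qed
 qed
qed

lemma matrix_inv_unique:
 fixes A B :: "complex ^ 'n::finite ^ 'n"
 assumes "A ** B = mat 1"
 shows "matrix_inv A = B" "matrix_inv B = A"
proof -
 have B: "B ** A = mat 1" using assms by (simp add: matrix_left_right_inverse)
 have i: "invertible A" "invertible B" using assms B by (auto simp: invertible_def)
 have "matrix_inv A = (B ** A) ** matrix_inv A" by (simp add: B)
 also have "\<dots> = B ** (A ** matrix_inv A)" by (simp only: matrix_mul_assoc)
 finally show "matrix_inv A = B" by (simp add: matrix_inv_cancel[OF i(1)])
 have "matrix_inv B = (A ** B) ** matrix_inv B" by (simp add: assms)
 also have "\<dots> = A ** (B ** matrix_inv B)" by (simp only: matrix_mul_assoc)
 finally show "matrix_inv B = A" by (simp add: matrix_inv_cancel[OF i(2)])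
qed

lemma matrix_inv_mult:
 fixes A B :: "complex ^ 'n::finite ^ 'n"
 assumes "invertible A" "invertible B"
 shows "matrix_inv (A ** B) = matrix_inv B ** matrix_inv A"
proof (rule matrix_inv_unique(1))
 have "A ** B ** (matrix_inv B ** matrix_inv A) = A ** (B ** matrix_inv B) ** matrix_inv A"
  by (simp only: matrix_mul_assoc)
 thus "A ** B ** (matrix_inv B ** matrix_inv A) = mat 1" by (simp add: matrix_inv_cancel assms)
qed

lemma matrix_inv_inv: "invertible A ==> matrix_inv (matrix_inv A) = (A :: complex ^ 'n::finite ^ 'n)"
 by (rule matrix_inv_unique(2)) (rule matrix_inv_cancel)

lemma matrix_inv_mat_1: "matrix_inv (mat 1) = (mat 1 :: complex ^ 'n::finite ^ 'n)"
 by (rule matrix_inv_unique(1)) simp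

definition cj :: "complex ^ 'n::finite ^ 'n => complex ^ 'n ^ 'n => complex ^ 'n ^ 'n" where
 "cj h g = h ** g ** matrix_inv h"

lemma cj_mult: "invertible u ==> invertible h ==> cj (u ** h) g = cj u (cj h g)"
 by (simp add: cj_def matrix_inv_mult matrix_mul_assoc)

lemma cj_one [simp]: "cj (mat 1) g = g"
 by (simp add: cj_def matrix_inv_mat_1)

lemma cj_inv_cancel: "invertible h ==> cj h (cj (matrix_inv h) g) = g" "invertible h ==> cj (matrix_inv h) (cj h g) = g"
 using cj_mult[of h "matrix_inv h" g] cj_mult[of "matrix_inv h" h g]
 by (simp_all add: matrix_inv_cancel invertible_matrix_inv)

lemma cj_matrix_inv: "invertible h ==> invertible g ==> cj h (matrix_inv g) = matrix_inv (cj h g)"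
 by (simp add: cj_def matrix_inv_mult invertible_mult invertible_matrix_inv matrix_inv_inv matrix_mul_assoc)

lemma cj_commute: "invertible h ==> h ** g = g ** h ==> cj h g = g"
 by (simp add: cj_def) (metis matrix_inv_cancel(1) matrix_mul_assoc matrix_mul_rid)

lemma Fix_matrix_inv:
 fixes g :: "complex ^ 'n::finite ^ 'n"
 assumes "invertible g"
 shows "Fix (matrix_inv g) = Fix g"
proof -
 have sub: "Fix g \<subseteq> Fix (matrix_inv g)" if "invertible g" for g :: "complex ^ 'n::finite ^ 'n"
 proof
  fix x assume "x \<in> Fix g"
  hence "matrix_inv g *v x = matrix_inv g *v (g *v x)" by (simp add: Fix_def)
  thus "x \<in> Fix (matrix_inv g)"
   by (simp add: Fix_def matrix_vector_mul_assoc matrix_inv_cancel[OF that])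
 qed
 from sub[OF assms] sub[OF invertible_matrix_inv[OF assms]] show ?thesis
  by (simp add: matrix_inv_inv[OF assms])
qed

context presented
begin

lemma null_zero_slot: "xs @ \<zero>\<^bsub>M\<^esub> # ys \<in> tuples k M ==> free_gen (xs @ \<zero>\<^bsub>M\<^esub> # ys) \<in> ext_null k M"
proof -
 assume t: "xs @ \<zero>\<^bsub>M\<^esub> # ys \<in> tuples k M"
 have "0 \<odot>\<^bsub>M\<^esub> \<zero>\<^bsub>M\<^esub> = \<zero>\<^bsub>M\<^esub>" using smult[OF X0, of 0] by (simp add: zero)
 moreover have "fsc 0 (free_gen (xs @ \<zero>\<^bsub>M\<^esub> # ys)) = 0" by (simp add: fsc_def fun_eq_iff)
 ultimately show ?thesis using null_smult[OF t, of 0] by simp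
qed

text \<open>Scalars are pulled out slot by slot; the prefix \<open>xs\<close> holds the slots left
  alone at that stage.\<close>

lemma null_smults:
 assumes "xs @ map e ks \<in> tuples k M" "\<And>i. i \<in> set ks ==> e i \<in> carrier M"
 shows "free_gen (xs @ map (%i. b i \<odot>\<^bsub>M\<^esub> e i) ks) - fsc (prod_list (map b ks)) (free_gen (xs @ map e ks)) \<in> ext_null k M"
 using assms
proof (induction ks arbitrary: xs)
 case Nil
 have "free_gen xs - fsc 1 (free_gen xs) = 0" by (simp add: fsc_def fun_eq_iff)
 hence "free_gen xs - fsc 1 (free_gen xs) \<in> ext_null k M" using null_facts(1)[of k] by metis
 thus ?case by (simp only: list.map append_Nil2 prod_list.Nil)
next
 case (Cons i ks)
 have ei: "b i \<odot>\<^bsub>M\<^esub> e i \<in> carrier M" using Cons.prems(2)[of i] Msmult by simp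
 have t: "xs @ (b i \<odot>\<^bsub>M\<^esub> e i) # map e ks \<in> tuples k M"
  using tuples_slot[of xs "e i" "map e ks" k "b i \<odot>\<^bsub>M\<^esub> e i"] Cons.prems(1) ei by simp
 have "free_gen ((xs @ [b i \<odot>\<^bsub>M\<^esub> e i]) @ map (%i. b i \<odot>\<^bsub>M\<^esub> e i) ks) -
   fsc (prod_list (map b ks)) (free_gen ((xs @ [b i \<odot>\<^bsub>M\<^esub> e i]) @ map e ks)) \<in> ext_null k M"
  by (rule Cons.IH) (use t Cons.prems(2) in auto)
 hence 1: "free_gen (xs @ map (%i. b i \<odot>\<^bsub>M\<^esub> e i) (i # ks)) -
   fsc (prod_list (map b ks)) (free_gen (xs @ (b i \<odot>\<^bsub>M\<^esub> e i) # map e ks)) \<in> ext_null k M"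
  by (simp only: append.assoc append_Cons append_Nil list.map)
 have 2: "fsc (prod_list (map b ks)) (free_gen (xs @ (b i \<odot>\<^bsub>M\<^esub> e i) # map e ks) - fsc (b i) (free_gen (xs @ e i # map e ks)))
   \<in> ext_null k M"
  by (rule null_facts(3), rule null_smult) (use Cons.prems(1) in simp)
 have eq: "free_gen (xs @ map (%i. b i \<odot>\<^bsub>M\<^esub> e i) (i # ks)) - fsc (prod_list (map b (i # ks))) (free_gen (xs @ map e (i # ks))) =
   (free_gen (xs @ map (%i. b i \<odot>\<^bsub>M\<^esub> e i) (i # ks)) - fsc (prod_list (map b ks)) (free_gen (xs @ (b i \<odot>\<^bsub>M\<^esub> e i) # map e ks))) +
   fsc (prod_list (map b ks)) (free_gen (xs @ (b i \<odot>\<^bsub>M\<^esub> e i) # map e ks) - fsc (b i) (free_gen (xs @ e i # map e ks)))"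
  by (simp add: fun_eq_iff fsc_def algebra_simps)
 show ?case unfolding eq by (rule null_facts(2)[OF 1 2])
qed

end

text \<open>Expanding all slots in the eigenvectors \<open>e i\<close> shows that a diagonalisable endomorphism acts on the
 top exterior power by its determinant.\<close>

lemma diagonal_push:
 assumes "two_presented M pr sc Dm Z M pr sc Dm Z \<phi>" and U: "finite U" "card U = k"
  and e: "\<And>i. i \<in> U ==> e i \<in> carrier M" "\<And>i. i \<in> U ==> \<phi> (e i) = b i \<odot>\<^bsub>M\<^esub> e i"
  and span: "\<And>S. \<lbrakk>\<zero>\<^bsub>M\<^esub> \<in> S; \<And>x y. x \<in> S ==> y \<in> S ==> x \<in> carrier M ==> y \<in> carrier M ==> x \<oplus>\<^bsub>M\<^esub> y \<in> S;
   \<And>c x. x \<in> S ==> x \<in> carrier M ==> c \<odot>\<^bsub>M\<^esub> x \<in> S; e ` U \<subseteq> S\<rbrakk> \<Longrightarrow> carrier M \<subseteq> S"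
  and c: "c \<in> finsupp (tuples k M)"
 shows "lext (%s. free_gen (map \<phi> s)) c - fsc (\<Prod>i\<in>U. b i) c \<in> ext_null k M"
proof -
 interpret two_presented M pr sc Dm Z M pr sc Dm Z \<phi> by fact
 interpret T: presented "free_mod (tuples k M)" "%c. c" fsc "finsupp (tuples k M)" "{0}" by (rule presented_free)
 define R where "R = (\<Prod>i\<in>U. b i)"
 define D where "D = (%s. free_gen (map \<phi> s) - fsc R (free_gen s))"
 note nf = M.null_facts
 have D_null: "D s \<in> ext_null k M" if "free_gen (map \<phi> s) \<in> ext_null k M" "free_gen s \<in> ext_null k M" for s
  unfolding D_def by (rule nf(4)[OF that(1) nf(3)[OF that(2)]])
 \<comment> \<open>\<open>ks\<close> lists the slots already expanded in eigenvectors,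
   \<open>ys\<close> the slots that are still arbitrary.\<close>
 have main: "D (map e ks @ ys) \<in> ext_null k M"
  if "set ks \<subseteq> U" "length ks + length ys = k" "set ys \<subseteq> carrier M" for ks ys
  using that
 proof (induction ys arbitrary: ks)
  case Nil
  have t: "map e ks \<in> tuples k M" using Nil e(1) by (auto simp: tuples_def)
  have ph: "map \<phi> (map e ks) = map (%i. b i \<odot>\<^bsub>M\<^esub> e i) ks" using Nil e(2) by auto
  \<comment> \<open>Distinct indices exhaust \<open>U\<close>, whose cardinality is the degree, and
    produce the determinant; a repeated index makes both wedges vanish.\<close>
  show ?case
  proof (cases "distinct ks")
   case True
   hence "card (set ks) = card U" using Nil U by (simp add: distinct_card)
   hence "set ks = U" using Nil(1) U(1) card_subset_eq by blast
   hence "prod_list (map b ks) = R" unfolding R_def using prod.distinct_set_conv_list[OF True, of b] by simp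
   moreover have "free_gen ([] @ map (%i. b i \<odot>\<^bsub>M\<^esub> e i) ks) - fsc (prod_list (map b ks)) (free_gen ([] @ map e ks)) \<in> ext_null k M"
    by (rule M.null_smults) (use t e(1) Nil(1) in auto)
   ultimately show ?thesis unfolding D_def append_Nil append_Nil2 ph by metis
  next
   case False
   then obtain us vs ws i where ks: "ks = us @ [i] @ vs @ [i] @ ws" using not_distinct_decomp by blast
   have 1: "map e us @ e i # map e vs @ e i # map e ws \<in> tuples k M" using t ks by simp
   have 2: "map \<phi> (map e us) @ \<phi> (e i) # map \<phi> (map e vs) @ \<phi> (e i) # map \<phi> (map e ws) \<in> tuples k M"
    using tuples_map[OF 1] by simp
   show ?thesis using D_null[of "map e ks"] M.null_repeat[OF 1] M.null_repeat[OF 2] by (simp add: ks)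
  qed
 next
  case (Cons v ys)
  define xs where "xs = map e ks"
  have xs: "set xs \<subseteq> carrier M" "set ys \<subseteq> carrier M" "length xs + length ys + 1 = k"
   using Cons.prems e(1) by (auto simp: xs_def)
  have tup: "xs @ a # ys \<in> tuples k M" if "a \<in> carrier M" for a using xs that by (auto simp: tuples_def)
  have tup': "map \<phi> xs @ a # map \<phi> ys \<in> tuples k M" if "a \<in> carrier M" for a
   using xs that \<phi>(1) by (auto simp: tuples_def)
  have "carrier M \<subseteq> {a \<in> carrier M. D (xs @ a # ys) \<in> ext_null k M}"
  proof (rule span)
   have z: "\<zero>\<^bsub>M\<^esub> \<in> carrier M" using M.X0 by (simp add: M.zero M.carrier)
   have z0: "0 \<odot>\<^bsub>M\<^esub> \<zero>\<^bsub>M\<^esub> = \<zero>\<^bsub>M\<^esub>" using M.smult[OF M.X0, of 0] by (simp add: M.zero)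
   have "\<phi> \<zero>\<^bsub>M\<^esub> = 0 \<odot>\<^bsub>M\<^esub> \<phi> \<zero>\<^bsub>M\<^esub>" using \<phi>(3)[OF z, of 0] z0 by simp
   moreover have "0 \<odot>\<^bsub>M\<^esub> a = \<zero>\<^bsub>M\<^esub>" if "a \<in> carrier M" for a
    using that M.smult[of _ 0] by (auto simp: M.carrier M.zero)
   ultimately have "\<phi> \<zero>\<^bsub>M\<^esub> = \<zero>\<^bsub>M\<^esub>" using \<phi>(1)[OF z] by metis
   thus "\<zero>\<^bsub>M\<^esub> \<in> {a \<in> carrier M. D (xs @ a # ys) \<in> ext_null k M}"
    using D_null[of "xs @ \<zero>\<^bsub>M\<^esub> # ys"] M.null_zero_slot[OF tup[OF z]] M.null_zero_slot[OF tup'[OF z]] z by simp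
  next
   fix x y assume x: "x \<in> {a \<in> carrier M. D (xs @ a # ys) \<in> ext_null k M}" and y: "y \<in> {a \<in> carrier M. D (xs @ a # ys) \<in> ext_null k M}"
   have xy: "x \<in> carrier M" "y \<in> carrier M" using x y by auto
   define A where "A = free_gen (map \<phi> xs @ (\<phi> x \<oplus>\<^bsub>M\<^esub> \<phi> y) # map \<phi> ys) - free_gen (map \<phi> xs @ \<phi> x # map \<phi> ys)
    - free_gen (map \<phi> xs @ \<phi> y # map \<phi> ys)"
   define B where "B = free_gen (xs @ (x \<oplus>\<^bsub>M\<^esub> y) # ys) - free_gen (xs @ x # ys) - free_gen (xs @ y # ys)"
   have "A \<in> ext_null k M" unfolding A_def by (rule M.null_add[OF tup'[OF \<phi>(1)[OF xy(1)]] \<phi>(1)[OF xy(2)]])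
   moreover have "B \<in> ext_null k M" unfolding B_def by (rule M.null_add[OF tup[OF xy(1)] xy(2)])
   moreover have "D (xs @ (x \<oplus>\<^bsub>M\<^esub> y) # ys) = A - fsc R B + (D (xs @ x # ys) + D (xs @ y # ys))"
    by (simp add: D_def A_def B_def \<phi>(2)[OF xy] fun_eq_iff fsc_def algebra_simps)
   ultimately have "D (xs @ (x \<oplus>\<^bsub>M\<^esub> y) # ys) \<in> ext_null k M"
    using x y nf(2)[OF nf(4)[OF _ nf(3)] nf(2)] by auto
   thus "x \<oplus>\<^bsub>M\<^esub> y \<in> {a \<in> carrier M. D (xs @ a # ys) \<in> ext_null k M}" using M.Madd[OF xy] by simp
  next
   fix z x assume x: "x \<in> {a \<in> carrier M. D (xs @ a # ys) \<in> ext_null k M}"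
   hence xc: "x \<in> carrier M" by simp
   define A where "A = free_gen (map \<phi> xs @ (z \<odot>\<^bsub>M\<^esub> \<phi> x) # map \<phi> ys) - fsc z (free_gen (map \<phi> xs @ \<phi> x # map \<phi> ys))"
   define B where "B = free_gen (xs @ (z \<odot>\<^bsub>M\<^esub> x) # ys) - fsc z (free_gen (xs @ x # ys))"
   have "A \<in> ext_null k M" unfolding A_def by (rule M.null_smult[OF tup'[OF \<phi>(1)[OF xc]]])
   moreover have "B \<in> ext_null k M" unfolding B_def by (rule M.null_smult[OF tup[OF xc]])
   moreover have "D (xs @ (z \<odot>\<^bsub>M\<^esub> x) # ys) = A - fsc R B + fsc z (D (xs @ x # ys))"
    by (simp add: D_def A_def B_def \<phi>(3)[OF xc] fun_eq_iff fsc_def algebra_simps)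
   ultimately have "D (xs @ (z \<odot>\<^bsub>M\<^esub> x) # ys) \<in> ext_null k M"
    using x nf(2)[OF nf(4)[OF _ nf(3)] nf(3)] by auto
   thus "z \<odot>\<^bsub>M\<^esub> x \<in> {a \<in> carrier M. D (xs @ a # ys) \<in> ext_null k M}" using M.Msmult[OF xc] by simp
  next
   show "e ` U \<subseteq> {a \<in> carrier M. D (xs @ a # ys) \<in> ext_null k M}"
   proof
    fix a assume "a \<in> e ` U"
    then obtain i where i: "i \<in> U" "a = e i" by blast
    have "D (map e (ks @ [i]) @ ys) \<in> ext_null k M"
     by (rule Cons.IH) (use Cons.prems i in auto)
    thus "a \<in> {a \<in> carrier M. D (xs @ a # ys) \<in> ext_null k M}" using i e(1) by (simp add: xs_def)
   qed
  qed
  thus ?case using Cons.prems by (auto simp: xs_def)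
 qed
 define \<Psi> where "\<Psi> = (%c. push c - fsc R c)"
 have "c \<in> {c \<in> finsupp (tuples k M). \<Psi> c \<in> ext_null k M}"
 proof (rule finsupp_induct[OF c])
  have "push 0 = 0" "fsc R 0 = 0" by (simp_all add: lext_def fsc_def zero_fun_def)
  thus "0 \<in> {c \<in> finsupp (tuples k M). \<Psi> c \<in> ext_null k M}" using T.X0 nf(1) by (simp add: \<Psi>_def)
 next
  fix x y assume x: "x \<in> {c \<in> finsupp (tuples k M). \<Psi> c \<in> ext_null k M}" and y: "y \<in> {c \<in> finsupp (tuples k M). \<Psi> c \<in> ext_null k M}"
  have p: "push (x + y) = push x + push y" by (rule lext_add[where S = "tuples k M"]) (use x y in auto)
  have "\<Psi> (x + y) = \<Psi> x + \<Psi> y" unfolding \<Psi>_def p T.sc_distrib by simp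
  thus "x + y \<in> {c \<in> finsupp (tuples k M). \<Psi> c \<in> ext_null k M}" using x y nf(2) by (simp add: finsupp_add)
 next
  fix a s assume s: "s \<in> tuples k M"
  have f: "free_gen s \<in> finsupp (tuples k M)" by (rule finsupp_gen[OF s])
  have "D ([] @ s) \<in> ext_null k M" using main[of "[]" s] s by (simp add: tuples_def)
  moreover have "\<Psi> (fsc a (free_gen s)) = fsc a (D s)"
   unfolding \<Psi>_def D_def lext_fsc[OF f] lext_gen by (simp add: fun_eq_iff fsc_def algebra_simps)
  ultimately show "fsc a (free_gen s) \<in> {c \<in> finsupp (tuples k M). \<Psi> c \<in> ext_null k M}"
   using finsupp_fsc[OF f] nf(3) by simp
 qed
 thus ?thesis by (simp add: \<Psi>_def R_def)
qed

section \<open>The cocycle \<open>rho\<close>\<close>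

locale orbifold_gen = orbifold fp d d0 G Ix for fp :: "'n::finite mpoly" and d d0 G Ix +
 fixes \<xi> :: "complex ^ 'n ^ 'n => 'n ext"
 assumes \<xi>: "\<And>g. g \<in> G ==> is_generator g (\<xi> g)"
begin

lemma G_cj: "h \<in> G ==> g \<in> G ==> cj h g \<in> G"
 unfolding cj_def by (intro G_mult G_inv)

lemma G_inv_inv: "g \<in> G ==> matrix_inv (matrix_inv g) = g"
 using matrix_inv_inv G_facts(1) by blast

lemma adapted_codim:
 assumes ad: "adapted d g h P d' a b M"
 shows "codim_Fix g = card {k. a k ~= 1}"
proof -
 have P: "invertible P" using ad by (simp add: adapted_def)
 have "Fix g = {P *v y | y. \<forall>k. k \<notin> {k. a k = 1} --> y $ k = 0}"
 proof (intro equalityI subsetI)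
  fix x assume x: "x \<in> Fix g"
  obtain y where "x = P *v y" by (rule adapted_vec[OF ad])
  thus "x \<in> {P *v y | y. \<forall>k. k \<notin> {k. a k = 1} --> y $ k = 0}" using adapted_Fix[OF ad] x by auto
 next
  fix x assume "x \<in> {P *v y | y. \<forall>k. k \<notin> {k. a k = 1} --> y $ k = 0}"
  thus "x \<in> Fix g" using adapted_Fix[OF ad] by auto
 qed
 hence "vec.dim (Fix g) = card {k. a k = 1}" using dim_coordinate_image[OF P, of "{k. a k = 1}"] by simp
 moreover have "{k. a k ~= 1} = UNIV - {k. a k = 1}" by auto
 ultimately show ?thesis by (simp add: codim_Fix_def card_Diff_subset)
qed

lemma codim_cj:
 assumes "g \<in> G" "h \<in> G"
 shows "codim_Fix (cj h g) = codim_Fix g"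
proof -
 obtain P d' a b M where ad: "adapted d g g P d' a b M" using adapted_exists[OF assms(1,1)] by blast
 show ?thesis unfolding cj_def
  using adapted_codim[OF ad] adapted_codim[OF adapted_conjugate[OF ad assms(2)]] by simp
qed

abbreviation tup where "tup g \<equiv> finsupp (tuples (codim_Fix g) (normal_space g))"
abbreviation nul where "nul g \<equiv> ext_null (codim_Fix g) (normal_space g)"
abbreviation psh where "psh h \<equiv> lext (%s. free_gen (map (image ((*v) h)) s))"

abbreviation lcl where "lcl g c \<equiv> nul g +>\<^bsub>free_mod (tuples (codim_Fix g) (normal_space g))\<^esub> c"

lemma presented_Lambda:
 "presented (Lambda g) (%c. lcl g c) fsc (tup g) (nul g)"
 unfolding Lambda_def by (rule presented.presented_ext[OF presented_normal])

text \<open>A formal combination of tuples representing \<open>\<xi> g\<close>; identities between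
  scalars become congruences modulo \<open>nul g\<close>.\<close>

definition gen where
 "gen g = (SOME c. c \<in> tup g \<and> lcl g c = \<xi> g)"

lemma gen:
 assumes g: "g \<in> G"
 shows "gen g \<in> tup g" "lcl g (gen g) = \<xi> g"
  "gen g \<notin> nul g" "c \<in> tup g ==> \<exists>r. c - fsc r (gen g) \<in> nul g"
proof -
 interpret L: presented "Lambda g" "%c. lcl g c" fsc "tup g" "nul g"
  by (rule presented_Lambda)
 have gn: "\<xi> g \<in> carrier (Lambda g)" "\<xi> g ~= \<zero>\<^bsub>Lambda g\<^esub>" "span_in (Lambda g) {\<xi> g} = carrier (Lambda g)"
  using \<xi>[OF g] by (auto simp: is_generator_def)
 have "\<exists>c. c \<in> tup g \<and> lcl g c = \<xi> g"
  using gn(1) unfolding L.carrier by auto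
 from someI_ex[OF this] show 1: "gen g \<in> tup g"
  and 2: "lcl g (gen g) = \<xi> g" unfolding gen_def by auto
 show "gen g \<notin> nul g" using L.pr_eq_0[OF 1] 2 gn(2) by auto
 assume c: "c \<in> tup g"
 have "lcl g c \<in> span_in (Lambda g) {\<xi> g}"
  unfolding gn(3) using c by (auto simp: L.carrier)
 then obtain r where "lcl g c =
   lcl g (fsc r (gen g))"
  using L.span_singleton[OF 1] unfolding 2 by auto
 hence "c - fsc r (gen g) \<in> nul g" using L.ker[OF c L.Xsc[OF 1]] by blast
 thus "\<exists>r. c - fsc r (gen g) \<in> nul g" by blast
qed

lemma gen_coeff_unique:
 assumes g: "g \<in> G" and "c - fsc r (gen g) \<in> nul g" "c - fsc r' (gen g) \<in> nul g"
 shows "r = r'"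
proof (rule ccontr)
 assume ne: "r ~= r'"
 note nf = presented.null_facts[OF presented_normal]
 have "fsc (inverse (r' - r)) ((c - fsc r (gen g)) - (c - fsc r' (gen g))) \<in> nul g"
  by (intro nf(3) presented.null_facts(4)[OF presented_normal] assms)
 moreover have "fsc (inverse (r' - r)) ((c - fsc r (gen g)) - (c - fsc r' (gen g))) = gen g"
  using ne by (auto simp: fun_eq_iff fsc_def field_simps)
 ultimately show False using gen(3)[OF g] by simp
qed

lemma psh_lin: "x \<in> tup g ==> y \<in> tup g ==> psh h (x + y) = psh h x + psh h y" "x \<in> tup g ==> psh h (fsc c x) = fsc c (psh h x)"
 "x \<in> tup g ==> y \<in> tup g ==> psh h (x - y) = psh h x - psh h y"
proof -
 interpret T: presented "free_mod (tuples (codim_Fix g) (normal_space g))" "%c. c" fsc "tup g" "{0}" by (rule presented_free)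
 show a: "psh h (x + y) = psh h x + psh h y" if "x \<in> tup g" "y \<in> tup g" for x y by (rule lext_add[OF that])
 show "x \<in> tup g ==> psh h (fsc c x) = fsc c (psh h x)" by (rule lext_fsc)
 show "x \<in> tup g ==> y \<in> tup g ==> psh h (x - y) = psh h x - psh h y"
  using a[OF T.Xdiff[of x y], of y] by simp
qed

lemma psh_facts:
 assumes g: "g \<in> G" and h: "h \<in> G"
 shows "c \<in> tup g ==> psh h c \<in> tup (cj h g)" "c \<in> nul g ==> psh h c \<in> nul (cj h g)"
 using two_presented.push_finsupp[OF two_presented_normal[OF G_facts(1)[OF h]], of c "codim_Fix g" g]
  two_presented.push_null[OF two_presented_normal[OF G_facts(1)[OF h]], of c "codim_Fix g" g]
 unfolding cj_def[symmetric] codim_cj[OF g h] by auto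

text \<open>Trades the definite description in \<open>rho\<close> for a congruence of
  representatives. Existence holds because \<open>gen\<close> generates, uniqueness because it is
  not null.\<close>

lemma rho_eq_iff:
 assumes g: "g \<in> G" and h: "h \<in> G"
 shows "rho \<xi> h g = r \<longleftrightarrow> psh h (gen g) - fsc r (gen (cj h g)) \<in> nul (cj h g)"
proof -
 let ?g = "cj h g"
 have g': "?g \<in> G" by (rule G_cj[OF h g])
 interpret L: presented "Lambda ?g" "%c. lcl ?g c" fsc "tup ?g" "nul ?g"
  by (rule presented_Lambda)
 interpret t: two_presented "normal_space g" "ncl g" "(*s)" UNIV "Fix g" "normal_space ?g" "ncl ?g" "(*s)" UNIV "Fix ?g" "image ((*v) h)"
  unfolding cj_def by (rule two_presented_normal[OF G_facts(1)[OF h]])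
 have ps: "psh h (gen g) \<in> tup ?g" by (rule psh_facts(1)[OF g h gen(1)[OF g]])
 define Q where "Q = (%r. \<exists>H. induced_ext_map (codim_Fix g) (normal_space g) (normal_space ?g) (image ((*v) h)) H \<and>
   H (\<xi> g) = r \<odot>\<^bsub>Lambda ?g\<^esub> \<xi> ?g)"
 have Q: "Q r \<longleftrightarrow> psh h (gen g) - fsc r (gen ?g) \<in> nul ?g" for r
 proof -
  have "H (\<xi> g) = r \<odot>\<^bsub>Lambda ?g\<^esub> \<xi> ?g \<longleftrightarrow> psh h (gen g) - fsc r (gen ?g) \<in> nul ?g"
   if "induced_ext_map (codim_Fix g) (normal_space g) (normal_space ?g) (image ((*v) h)) H" for H
  proof -
   have "H (\<xi> g) = lcl ?g (psh h (gen g))"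
    using t.induced_value[OF that gen(1)[OF g]] unfolding gen(2)[OF g] codim_cj[OF g h] .
   moreover have "r \<odot>\<^bsub>Lambda ?g\<^esub> \<xi> ?g = lcl ?g (fsc r (gen ?g))"
    using L.smult[OF gen(1)[OF g'], of r] unfolding gen(2)[OF g'] .
   ultimately show ?thesis using L.ker[OF ps L.Xsc[OF gen(1)[OF g']]] by simp
  qed
  thus ?thesis unfolding Q_def using t.induced_exists[of "codim_Fix g"] by blast
 qed
 have rho: "rho \<xi> h g = (THE r. Q r)" by (simp add: rho_def Q_def cj_def Let_def)
 obtain r0 where r0: "Q r0" using gen(4)[OF g' ps] Q by blast
 have u: "s = r0" if "Q s" for s using gen_coeff_unique[OF g'] that r0 Q by blast
 have "(THE r. Q r) = r0" by (rule the_equality[of Q r0]) (rule r0, rule u)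
 thus ?thesis using rho r0 u[of r] Q[of r] by auto
qed

lemmas rho_spec = rho_eq_iff[THEN iffD1, OF _ _ refl]

text \<open>Induced maps compose, so their scalars multiply.\<close>

lemma rho_cocycle:
 assumes g: "g \<in> G" and h: "h \<in> G" and u: "u \<in> G"
 shows "rho \<xi> (u ** h) g = rho \<xi> u (cj h g) * rho \<xi> h g"
proof -
 let ?g = "cj h g" and ?k = "cj (u ** h) g"
 have g': "?g \<in> G" by (rule G_cj[OF h g])
 have k: "cj u ?g = ?k" by (simp add: cj_mult G_facts(1) h u)
 note nf = presented.null_facts[OF presented_normal]
 interpret L: presented "Lambda ?g" "%c. lcl ?g c" fsc "tup ?g" "nul ?g"
  by (rule presented_Lambda)
 have comp: "psh (u ** h) (gen g) = psh u (psh h (gen g))"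
 proof -
  have im: "(*v) (u ** h) ` A = (*v) u ` (*v) h ` A" for A by (simp add: image_image matrix_vector_mul_assoc)
  have "gen g \<in> {c \<in> tup g. psh (u ** h) c = psh u (psh h c)}"
  proof (rule finsupp_induct[OF gen(1)[OF g]])
   have "psh v 0 = 0" for v :: "complex ^ 'n ^ 'n" by (simp add: lext_def zero_fun_def)
   hence "psh (u ** h) 0 = psh u (psh h 0)" by metis
   thus "0 \<in> {c \<in> tup g. psh (u ** h) c = psh u (psh h c)}" by (simp add: finsupp_def)
  next
   fix x y assume "x \<in> {c \<in> tup g. psh (u ** h) c = psh u (psh h c)}" "y \<in> {c \<in> tup g. psh (u ** h) c = psh u (psh h c)}"
   hence xy: "x \<in> tup g" "y \<in> tup g" "psh (u ** h) x = psh u (psh h x)" "psh (u ** h) y = psh u (psh h y)" by auto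
   have "psh (u ** h) (x + y) = psh u (psh h (x + y))"
    unfolding psh_lin(1)[OF xy(1,2)] psh_lin(1)[OF psh_facts(1)[OF g h xy(1)] psh_facts(1)[OF g h xy(2)]] xy(3,4) ..
   thus "x + y \<in> {c \<in> tup g. psh (u ** h) c = psh u (psh h c)}" using finsupp_add[OF xy(1,2)] by blast
  next
   fix a s assume "s \<in> tuples (codim_Fix g) (normal_space g)"
   hence s: "free_gen s \<in> tup g" by (rule finsupp_gen)
   have "psh (u ** h) (fsc a (free_gen s)) = psh u (psh h (fsc a (free_gen s)))"
    unfolding psh_lin(2)[OF s] psh_lin(2)[OF psh_facts(1)[OF g h s]]
    unfolding lext_gen list.map_comp comp_def im ..
   thus "fsc a (free_gen s) \<in> {c \<in> tup g. psh (u ** h) c = psh u (psh h c)}" using finsupp_fsc[OF s] by blast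
  qed
  thus ?thesis by blast
 qed
 have 1: "psh u (psh h (gen g) - fsc (rho \<xi> h g) (gen ?g)) \<in> nul ?k"
  using psh_facts(2)[OF g' u rho_spec[OF g h]] unfolding k .
 have 2: "fsc (rho \<xi> h g) (psh u (gen ?g) - fsc (rho \<xi> u ?g) (gen ?k)) \<in> nul ?k"
  using nf(3)[OF rho_spec[OF g' u]] unfolding k .
 have m: "psh h (gen g) \<in> tup ?g" "gen ?g \<in> tup ?g" using psh_facts(1)[OF g h gen(1)[OF g]] gen(1)[OF g'] by auto
 have "psh u (psh h (gen g) - fsc (rho \<xi> h g) (gen ?g)) + fsc (rho \<xi> h g) (psh u (gen ?g) - fsc (rho \<xi> u ?g) (gen ?k)) =
   psh (u ** h) (gen g) - fsc (rho \<xi> u ?g * rho \<xi> h g) (gen ?k)"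
  unfolding psh_lin(3)[OF m(1) L.Xsc[OF m(2)]] psh_lin(2)[OF m(2)] comp
  by (simp add: fun_eq_iff fsc_def algebra_simps)
 hence "psh (u ** h) (gen g) - fsc (rho \<xi> u ?g * rho \<xi> h g) (gen ?k) \<in> nul ?k" using nf(2)[OF 1 2] by simp
 thus ?thesis using rho_eq_iff[OF g G_mult[OF u h]] by blast
qed

text \<open>In the normal space the classes of fixed eigenvectors are zero, so those of the moved
  ones span, and \<open>diagonal_push\<close> gives the determinant of \<open>h\<close>
  there.\<close>

lemma rho_value:
 assumes ad: "adapted d g h P d' a b M" and g: "g \<in> G" and h: "h \<in> G" and gh: "g ** h = h ** g"
 shows "rho \<xi> h g = (\<Prod>k | a k ~= 1. b k)"
proof -
 have g': "cj h g = g" by (rule cj_commute[OF G_facts(1)[OF h] gh[symmetric]])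
 have P: "invertible P" "h ** P = P ** dg b" using ad by (auto simp: adapted_def)
 interpret m: presented "normal_space g" "ncl g" "(*s)" UNIV "Fix g" by (rule presented_normal)
 let ?e = "%k. ncl g (P *v axis k 1)"
 have tp: "two_presented (normal_space g) (ncl g) (*s) UNIV (Fix g) (normal_space g) (ncl g) (*s) UNIV (Fix g) (image ((*v) h))"
  using two_presented_normal[OF G_facts(1)[OF h], of g] unfolding cj_def[symmetric] g' .
 have "psh h (gen g) - fsc (\<Prod>k\<in>{k. a k ~= 1}. b k) (gen g) \<in> nul g"
 proof (rule diagonal_push[OF tp, where e = ?e])
  show "card {k. a k ~= 1} = codim_Fix g" by (rule adapted_codim[OF ad, symmetric])
  show "(*v) h ` ?e k = b k \<odot>\<^bsub>normal_space g\<^esub> ?e k" for k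
  proof -
   have "h *v (P *v axis k 1) = b k *s (P *v axis k 1)"
    unfolding diag_power[OF P] by (simp add: vec_eq_iff vector_scalar_commute[symmetric])
     (auto simp: matrix_vector_mult_def axis_def if_distrib[of "%z. _ * z"] cong: if_cong)
   thus ?thesis using ncl_image[OF G_facts(1)[OF h], of g "P *v axis k 1"] unfolding cj_def[symmetric] g'
    by (simp add: m.smult)
  qed
  show "gen g \<in> tup g" by (rule gen(1)[OF g])
  fix S assume S: "\<zero>\<^bsub>normal_space g\<^esub> \<in> S"
   "\<And>x y. x \<in> S ==> y \<in> S ==> x \<in> carrier (normal_space g) ==> y \<in> carrier (normal_space g) ==> x \<oplus>\<^bsub>normal_space g\<^esub> y \<in> S"
   "\<And>c x. x \<in> S ==> x \<in> carrier (normal_space g) ==> c \<odot>\<^bsub>normal_space g\<^esub> x \<in> S" "?e ` {k. a k ~= 1} \<subseteq> S"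
  have car: "ncl g x \<in> carrier (normal_space g)" for x by (simp add: m.carrier)
  have e: "?e k \<in> S" for k
  proof (cases "a k = 1")
   case True
   hence "P *v axis k 1 \<in> Fix g" unfolding adapted_Fix[OF ad] by (auto simp: axis_def)
   hence "?e k = \<zero>\<^bsub>normal_space g\<^esub>" using m.pr_eq_0[of "P *v axis k 1"] by simp
   thus ?thesis using S(1) by simp
  qed (use S(4) in blast)
  have add: "ncl g (x + y) \<in> S" if "ncl g x \<in> S" "ncl g y \<in> S" for x y
   using S(2)[OF that car car] by (simp add: m.add)
  have sc: "ncl g (c *s x) \<in> S" if "ncl g x \<in> S" for c x using S(3)[OF that car] by (simp add: m.smult)
  have sum: "ncl g (\<Sum>k\<in>A. y k *s (P *v axis k 1)) \<in> S" for A and y :: "'n => complex"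
  proof (induction A rule: infinite_finite_induct)
   case empty thus ?case using S(1) by (simp add: m.zero)
  next
   case infinite thus ?case using S(1) by (simp add: m.zero)
  next
   case (insert k A) thus ?case using add[OF sc[OF e]] by simp
  qed
  show "carrier (normal_space g) \<subseteq> S"
  proof
   fix z assume "z \<in> carrier (normal_space g)"
   then obtain x where x: "z = ncl g x" by (auto simp: m.carrier)
   obtain y where y: "x = P *v y" by (rule adapted_vec[OF ad])
   have "x = (\<Sum>k\<in>UNIV. y $ k *s (P *v axis k 1))"
    unfolding y by (simp add: vec_eq_iff mult_axis) (simp add: matrix_vector_mult_def mult.commute)
   thus "z \<in> S" using sum[of "($) y" UNIV] x by simp
  qed
 qed (auto simp: m.carrier)
 thus ?thesis using rho_eq_iff[OF g h] unfolding g' by simp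
qed

lemma rho_one: "g \<in> G ==> rho \<xi> (mat 1) g = 1"
proof -
 assume g: "g \<in> G"
 obtain P d' a b M where ad: "adapted d g (mat 1) P d' a b M" using adapted_exists[OF g G_one] by auto
 have "b k = 1" for k
 proof -
  have P: "invertible P" "mat 1 ** P = P ** dg b" using ad by (auto simp: adapted_def)
  have "matrix_inv P ** P = (matrix_inv P ** P) ** dg b"
   using P(2) by (metis matrix_mul_assoc matrix_mul_lid)
  hence "dg b = mat 1" by (simp add: matrix_inv_cancel[OF P(1)])
  from arg_cong[OF this, of "%A. A $ k $ k"] show ?thesis by (simp add: dg_def mat_def)
 qed
 thus ?thesis using rho_value[OF ad g G_one] by simp
qed

lemma rho_nz:
 assumes g: "g \<in> G" and h: "h \<in> G"
 shows "rho \<xi> h g ~= 0"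
 using rho_cocycle[OF g h G_inv[OF h]] rho_one[OF g] by (auto simp: matrix_inv_cancel[OF G_facts(1)[OF h]])

text \<open>\<open>\<Lambda>\<close> only depends on the fixed locus, so \<open>\<xi>\<close> takes proportional values at \<open>g\<close> and \<open>g\<^sup>-\<^sup>1\<close>.\<close>

lemma rho_inverse:
 "\<exists>c. \<forall>g\<in>G. c g ~= 0 \<and> (\<forall>h\<in>G. rho \<xi> h (matrix_inv g) * c (cj h g) = c g * rho \<xi> h g)"
proof -
 have same: "nul (matrix_inv g) = nul g" "tup (matrix_inv g) = tup g" if "g \<in> G" for g
  unfolding codim_Fix_def normal_space_def by (simp_all add: Fix_matrix_inv[OF G_facts(1)[OF that]])
 define c where "c = (%g. SOME r. gen (matrix_inv g) - fsc r (gen g) \<in> nul g)"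
 note nf = presented.null_facts[OF presented_normal]
 have c: "gen (matrix_inv g) - fsc (c g) (gen g) \<in> nul g" if g: "g \<in> G" for g
  unfolding c_def by (rule someI_ex, rule gen(4)[OF g]) (use gen(1)[OF G_inv[OF g]] same[OF g] in simp)
 have "c g ~= 0" if g: "g \<in> G" for g
 proof
  assume "c g = 0"
  hence "gen (matrix_inv g) \<in> nul (matrix_inv g)"
   using c[OF g] same[OF g] by (simp add: fsc_def fun_diff_def)
  thus False using gen(3)[OF G_inv[OF g]] by simp
 qed
 moreover have "rho \<xi> h (matrix_inv g) * c (cj h g) = c g * rho \<xi> h g" if g: "g \<in> G" and h: "h \<in> G" for g h
 proof -
  let ?k = "cj h g" and ?i = "matrix_inv g"
  have k: "?k \<in> G" by (rule G_cj[OF h g])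
  have ki: "cj h ?i = matrix_inv ?k" by (rule cj_matrix_inv[OF G_facts(1)[OF h] G_facts(1)[OF g]])
  interpret L: presented "Lambda g" "%c. lcl g c" fsc "tup g" "nul g"
   by (rule presented_Lambda)
  have gi: "gen ?i \<in> tup g" using gen(1)[OF G_inv[OF g]] same[OF g] by simp
  have A: "psh h (gen ?i) - fsc (rho \<xi> h ?i) (gen (matrix_inv ?k)) \<in> nul ?k"
   using rho_spec[OF G_inv[OF g] h] unfolding ki same[OF k] .
  have "(psh h (gen ?i) - fsc (rho \<xi> h ?i) (gen (matrix_inv ?k))) + fsc (rho \<xi> h ?i) (gen (matrix_inv ?k) - fsc (c ?k) (gen ?k)) \<in> nul ?k"
   by (rule nf(2)[OF A nf(3)[OF c[OF k]]])
  moreover have "(psh h (gen ?i) - fsc (rho \<xi> h ?i) (gen (matrix_inv ?k))) + fsc (rho \<xi> h ?i) (gen (matrix_inv ?k) - fsc (c ?k) (gen ?k)) =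
    psh h (gen ?i) - fsc (rho \<xi> h ?i * c ?k) (gen ?k)" by (simp add: fun_eq_iff fsc_def algebra_simps)
  ultimately have 1: "psh h (gen ?i) - fsc (rho \<xi> h ?i * c ?k) (gen ?k) \<in> nul ?k" by simp
  have "psh h (gen ?i - fsc (c g) (gen g)) + fsc (c g) (psh h (gen g) - fsc (rho \<xi> h g) (gen ?k)) \<in> nul ?k"
   by (rule nf(2)[OF psh_facts(2)[OF g h c[OF g]] nf(3)[OF rho_spec[OF g h]]])
  moreover have "psh h (gen ?i - fsc (c g) (gen g)) + fsc (c g) (psh h (gen g) - fsc (rho \<xi> h g) (gen ?k)) =
    psh h (gen ?i) - fsc (c g * rho \<xi> h g) (gen ?k)"
   unfolding psh_lin(3)[OF gi L.Xsc[OF gen(1)[OF g]]] psh_lin(2)[OF gen(1)[OF g]]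
   by (simp add: fun_eq_iff fsc_def algebra_simps)
  ultimately have 2: "psh h (gen ?i) - fsc (c g * rho \<xi> h g) (gen ?k) \<in> nul ?k" by simp
  show ?thesis by (rule gen_coeff_unique[OF k 1 2])
 qed
 ultimately show ?thesis by blast
qed

end

section \<open>The state space in terms of polynomials\<close>

lemma presented_poly_ring: "presented (poly_ring V) (rs V) (%c p. cnst c * p) UNIV {p. rs V p = rs V 0}"
proof
 show "cnst (a + b) * x = cnst a * x + cnst b * x" for a b and x :: "'a mpoly"
  by (rule ev_inject) (simp add: distrib_right)
 show "cnst (a * b) * x = cnst a * (cnst b * x)" for a b and x :: "'a mpoly"
  by (rule ev_inject) (simp add: mult.assoc)
 show "cnst 1 * x = x" for x :: "'a mpoly" by (rule ev_inject) simp
qed (auto simp: carrier_poly_ring poly_ring_ops distrib_left rs_eq_iff)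

text \<open>A family \<open>U\<close> of polynomials represents the state with components \<open>(U g) \<xi>\<^sub>g\<close>.\<close>

context orbifold_gen
begin

lemma sector_dual:
 assumes g: "g \<in> G"
 shows "\<exists>\<tau>. dual_generator \<tau> (K g) \<and> top_degree d \<tau> (2 * (\<Sum>k\<in>Ix g. d k)) (d0 * card (Ix g)) \<and>
  (\<forall>h p. h \<in> G --> g ** h = h ** g --> \<tau> (sub h p) = (rho \<xi> h g)\<^sup>2 * \<tau> p)"
proof -
 obtain \<tau> where \<tau>: "dual_generator \<tau> (K g)" "top_degree d \<tau> (2 * (\<Sum>k\<in>Ix g. d k)) (d0 * card (Ix g))"
  "\<And>h P d' a b M p. h \<in> G ==> adapted d g h P d' a b M ==> \<tau> (sub h p) = (\<Prod>k | a k ~= 1. b k)\<^sup>2 * \<tau> p"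
  using sector_duality[OF g] by blast
 have "\<tau> (sub h p) = (rho \<xi> h g)\<^sup>2 * \<tau> p" if h: "h \<in> G" and gh: "g ** h = h ** g" for h p
 proof -
  obtain P d' a b M where ad: "adapted d g h P d' a b M" using adapted_exists[OF g h gh] by blast
  show ?thesis unfolding rho_value[OF ad g h gh] by (rule \<tau>(3)[OF h ad])
 qed
 with \<tau>(1,2) show ?thesis by blast
qed

lemma K_closed:
 assumes g: "g \<in> G"
 shows "0 \<in> K g" "p \<in> K g ==> r \<in> K g ==> p + r \<in> K g" "p \<in> K g ==> p * r \<in> K g" "p \<in> K g ==> r * p \<in> K g"
  "p \<in> K g ==> r \<in> K g ==> p - r \<in> K g" "p \<in> K g ==> wpart d w p \<in> K g"
  "wgraded d w p ==> w + 2 * (\<Sum>k\<in>Ix g. d k) > d0 * card (Ix g) ==> p \<in> K g"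
  "(\<And>a. a \<in> A ==> u a \<in> K g) ==> sum u A \<in> K g"
proof -
 obtain \<tau> where t: "dual_generator \<tau> (K g)" "top_degree d \<tau> (2 * (\<Sum>k\<in>Ix g. d k)) (d0 * card (Ix g))"
  using sector_dual[OF g] by blast
 note D = dual_generator_graded[OF t]
 show 0: "0 \<in> K g" by (rule D(5))
 show add: "p \<in> K g ==> r \<in> K g ==> p + r \<in> K g" for p r by (rule D(3))
 show m: "p \<in> K g ==> p * r \<in> K g" for p r by (rule D(4))
 show "p \<in> K g ==> r * p \<in> K g" using m[of p r] by (simp add: mult.commute)
 show "p \<in> K g ==> r \<in> K g ==> p - r \<in> K g" using add[of p "r * (- 1)"] m[of r "- 1"] by simp
 show "p \<in> K g ==> wpart d w p \<in> K g" by (rule D(1))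
 show "wgraded d w p ==> w + 2 * (\<Sum>k\<in>Ix g. d k) > d0 * card (Ix g) ==> p \<in> K g" by (rule D(2))
 show "(\<And>a. a \<in> A ==> u a \<in> K g) ==> sum u A \<in> K g"
  by (induction A rule: infinite_finite_induct) (auto intro: 0 add)
qed

lemma K_cj: "g \<in> G ==> h \<in> G ==> sub (matrix_inv h) p \<in> K (cj h g) \<longleftrightarrow> p \<in> K g"
 unfolding cj_def by (rule K_conjugate)

abbreviation cls :: "complex ^ 'n ^ 'n => 'n mpoly => (complex ^ 'n => complex) set" where
 "cls g p \<equiv> jac_class (ev fp) g (rs (Fix g) p)"

lemma jac_ideal_K:
 assumes g: "g \<in> G"
 shows "jac_ideal (ev fp) g = rs (Fix g) ` K g"
proof -
 obtain P d' a b M where ad: "adapted d g g P d' a b M" using adapted_exists[OF g g] by blast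
 have "jac_ideal (ev fp) g \<subseteq> range (rs (Fix g))" unfolding jac_ideal_eq[OF ad] by blast
 thus ?thesis by (auto simp: K_def)
qed

lemma presented_Jac:
 assumes g: "g \<in> G"
 shows "presented (Jac (ev fp) g) (cls g) (%c p. cnst c * p) UNIV (K g)"
proof -
 interpret P: presented "poly_ring (Fix g)" "rs (Fix g)" "%c p. cnst c * p" UNIV "{p. rs (Fix g) p = rs (Fix g) 0}"
  by (rule presented_poly_ring)
 have sub: "P.subsp (K g)" unfolding P.subsp_def using K_closed[OF g] by auto
 have "{p. rs (Fix g) p = rs (Fix g) 0} \<subseteq> K g" using K_closed(1)[OF g] by (auto simp: K_def)
 from P.quotient[OF sub this] show ?thesis
  by (simp add: Jac_def jac_class_def jac_ideal_K[OF g])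
qed

abbreviation B :: "(complex, 'n state) module" where "B \<equiv> Btot (ev fp) G"

definition Cls :: "(complex ^ 'n ^ 'n => 'n mpoly) => 'n state" where
 "Cls U = (\<lambda>g\<in>G. cls g (U g))"

definition usc :: "complex => (complex ^ 'n ^ 'n => 'n mpoly) => complex ^ 'n ^ 'n => 'n mpoly" where
 "usc c U = (%g. cnst c * U g)"

definition ZB :: "(complex ^ 'n ^ 'n => 'n mpoly) set" where
 "ZB = {U. \<forall>g\<in>G. U g \<in> K g}"

lemma cls_eq_iff: "g \<in> G ==> cls g p = cls g r \<longleftrightarrow> p - r \<in> K g"
 using presented.ker[OF presented_Jac] by blast

lemma Cls_eq_iff: "Cls U = Cls V \<longleftrightarrow> U - V \<in> ZB"
proof -
 have "Cls U = Cls V \<longleftrightarrow> (\<forall>g\<in>G. cls g (U g) = cls g (V g))"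
 proof
  assume eq: "Cls U = Cls V"
  show "\<forall>g\<in>G. cls g (U g) = cls g (V g)"
  proof
   fix g assume "g \<in> G"
   thus "cls g (U g) = cls g (V g)" using fun_cong[OF eq, of g] by (simp add: Cls_def)
  qed
 next
  assume "\<forall>g\<in>G. cls g (U g) = cls g (V g)"
  thus "Cls U = Cls V" unfolding Cls_def by (intro restrict_ext) simp
 qed
 thus ?thesis by (simp add: cls_eq_iff ZB_def)
qed

lemma presented_Btot: "presented B Cls usc UNIV ZB"
proof
 note J = presented_Jac
 show "carrier B = range Cls"
 proof (intro equalityI subsetI)
  fix u assume u: "u \<in> carrier B"
  have "\<exists>p. u g = cls g p" if "g \<in> G" for g
  proof -
   have "u g \<in> carrier (Jac (ev fp) g)" using u that by (auto simp: Btot_def)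
   thus ?thesis using presented.carrier[OF J[OF that]] by auto
  qed
  then obtain U where U: "\<And>g. g \<in> G ==> u g = cls g (U g)" by metis
  have "u \<in> extensional G" using u by (simp add: Btot_def PiE_def)
  hence "u = Cls U" unfolding Cls_def by (rule extensionalityI) (auto simp: U)
  thus "u \<in> range Cls" by blast
 next
  fix u assume "u \<in> range Cls"
  then obtain U where "u = Cls U" by blast
  thus "u \<in> carrier B" using presented.carrier[OF J] by (auto simp: Btot_def Cls_def)
 qed
 show "Cls x \<oplus>\<^bsub>B\<^esub> Cls y = Cls (x + y)" for x y
  using presented.add[OF J] by (auto simp: Btot_def Cls_def fun_eq_iff)
 show "\<zero>\<^bsub>B\<^esub> = Cls 0" using presented.zero[OF J] by (auto simp: Btot_def Cls_def fun_eq_iff)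
 show "c \<odot>\<^bsub>B\<^esub> Cls x = Cls (usc c x)" for c x
  using presented.smult[OF J] by (auto simp: Btot_def Cls_def usc_def fun_eq_iff)
 show "usc (a + b) x = usc a x + usc b x" "usc (a * b) x = usc a (usc b x)" "usc 1 x = x"
  "usc a (x + y) = usc a x + usc a y" for a b x y
  by (rule ext, rule ev_inject, simp add: usc_def algebra_simps)+
 show "Cls x = Cls y \<longleftrightarrow> x - y \<in> ZB" for x y by (rule Cls_eq_iff)
qed auto

definition single :: "complex ^ 'n ^ 'n => 'n mpoly => complex ^ 'n ^ 'n => 'n mpoly" where
 "single g p = (%g'. if g' = g then p else 0)"

lemma sector_elem_Cls: "sector_elem (ev fp) G (rs (Fix g) p) g = Cls (single g p)"
 using presented.zero[OF presented_Jac] by (auto simp: sector_elem_def Cls_def single_def fun_eq_iff)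

text \<open>The action on families of representatives; it is multiplicative by
  \<open>hact_mult\<close> and matches \<open>act\<close> on classes by
  \<open>act_Cls\<close>.\<close>

definition hact :: "complex ^ 'n ^ 'n => (complex ^ 'n ^ 'n => 'n mpoly) => complex ^ 'n ^ 'n => 'n mpoly" where
 "hact h U = (%g'. cnst (rho \<xi> h (cj (matrix_inv h) g')) * sub (matrix_inv h) (U (cj (matrix_inv h) g')))"

lemma hact_cj: "g \<in> G ==> h \<in> G ==> hact h U (cj h g) = cnst (rho \<xi> h g) * sub (matrix_inv h) (U g)"
 by (simp add: hact_def cj_inv_cancel G_facts(1))

lemma cls_coset:
 assumes g: "g \<in> G"
 shows "cls g p = {rs (Fix g) (n + p) | n. n \<in> K g}"
 by (auto simp: jac_class_def jac_ideal_K[OF g] a_r_coset_def' poly_ring_ops)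

text \<open>Pullback by the inverse of \<open>h\<close> maps \<open>K g\<close> onto
  \<open>K (cj h g)\<close>, so the image of a coset is again a full coset.\<close>

lemma act_Cls:
 assumes h: "h \<in> G"
 shows "act (ev fp) G \<xi> h (Cls U) = Cls (hact h U)"
proof -
 have hi: "matrix_inv h \<in> G" by (rule G_inv[OF h])
 have "rho \<xi> h g \<odot>\<^bsub>Jac (ev fp) g'\<^esub> ((%p. \<lambda>x\<in>Fix g'. p (matrix_inv h *v x)) ` Cls U g) = cls g' (hact h U g')"
  if g': "g' \<in> G" and g_def: "g = cj (matrix_inv h) g'" for g g'
 proof -
  have g: "g \<in> G" unfolding g_def by (rule G_cj[OF hi g'])
  have gg: "g' = cj h g" unfolding g_def by (simp add: cj_inv_cancel G_facts(1)[OF h])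
  have Fx: "matrix_inv h *v x \<in> Fix g" if "x \<in> Fix g'" for x
   using that Fix_conjugate[OF G_facts(1)[OF hi], of x g'] by (simp add: g_def cj_def)
  have im: "(\<lambda>x\<in>Fix g'. rs (Fix g) r (matrix_inv h *v x)) = rs (Fix g') (sub (matrix_inv h) r)" for r
   unfolding rs_def using Fx by (auto simp: fun_eq_iff)
  have K': "\<exists>n\<in>K g. n' = sub (matrix_inv h) n" if "n' \<in> K g'" for n'
  proof -
   have eq: "n' = sub (matrix_inv h) (sub h n')"
    by (simp add: sub_sub matrix_inv_cancel[OF G_facts(1)[OF h]])
   hence "sub h n' \<in> K g" using K_cj[OF g h, of "sub h n'"] that gg by simp
   thus ?thesis using eq by blast
  qed
  have K'': "sub (matrix_inv h) n \<in> K g'" if "n \<in> K g" for n using K_cj[OF g h] that gg by simp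
  have "Cls U g = {rs (Fix g) (n + U g) | n. n \<in> K g}" using g cls_coset[OF g] by (simp add: Cls_def)
  hence "(%p. \<lambda>x\<in>Fix g'. p (matrix_inv h *v x)) ` Cls U g =
    {rs (Fix g') (sub (matrix_inv h) n + sub (matrix_inv h) (U g)) | n. n \<in> K g}"
   by (simp only: setcompr_eq_image image_image im sub_simps(1))
  also have "\<dots> = {rs (Fix g') (n + sub (matrix_inv h) (U g)) | n. n \<in> K g'}"
   using K' K'' by blast
  also have "\<dots> = cls g' (sub (matrix_inv h) (U g))" by (rule cls_coset[OF g', symmetric])
  finally have "(%p. \<lambda>x\<in>Fix g'. p (matrix_inv h *v x)) ` Cls U g = cls g' (sub (matrix_inv h) (U g))" .
  thus ?thesis using presented.smult[OF presented_Jac[OF g']] by (simp add: hact_def g_def)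
 qed
 thus ?thesis
  by (simp add: act_def Cls_def[of "hact h U"] Let_def fun_eq_iff restrict_def cj_def G_inv_inv[OF h])
qed

text \<open>Indexed by the source sector \<open>g\<close>, which spares inverse conjugations;
  \<open>Inv_iff\<close> is the form indexed by targets.\<close>

definition Inv :: "(complex ^ 'n ^ 'n => 'n mpoly) set" where
 "Inv = {U. \<forall>h\<in>G. \<forall>g\<in>G. cnst (rho \<xi> h g) * sub (matrix_inv h) (U g) - U (cj h g) \<in> K (cj h g)}"

lemma Inv_iff: "U \<in> Inv \<longleftrightarrow> (\<forall>h\<in>G. hact h U - U \<in> ZB)"
proof -
 have "(\<forall>g\<in>G. cnst (rho \<xi> h g) * sub (matrix_inv h) (U g) - U (cj h g) \<in> K (cj h g)) \<longleftrightarrow> hact h U - U \<in> ZB"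
  if h: "h \<in> G" for h
 proof
  assume a: "\<forall>g\<in>G. cnst (rho \<xi> h g) * sub (matrix_inv h) (U g) - U (cj h g) \<in> K (cj h g)"
  have "hact h U g' - U g' \<in> K g'" if g': "g' \<in> G" for g'
  proof -
   have g: "cj (matrix_inv h) g' \<in> G" by (rule G_cj[OF G_inv[OF h] g'])
   show ?thesis using bspec[OF a g] by (simp add: cj_inv_cancel G_facts(1)[OF h] hact_def)
  qed
  thus "hact h U - U \<in> ZB" by (simp add: ZB_def)
 next
  assume "hact h U - U \<in> ZB"
  hence "hact h U (cj h g) - U (cj h g) \<in> K (cj h g)" if "g \<in> G" for g
   using G_cj[OF h that] by (simp add: ZB_def)
  thus "\<forall>g\<in>G. cnst (rho \<xi> h g) * sub (matrix_inv h) (U g) - U (cj h g) \<in> K (cj h g)"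
   using hact_cj[OF _ h] by metis
 qed
 thus ?thesis by (simp add: Inv_def)
qed

lemma carrier_B_model: "carrier (B_model (ev fp) G \<xi>) = Cls ` Inv"
proof -
 have "act (ev fp) G \<xi> h (Cls U) = Cls U \<longleftrightarrow> hact h U - U \<in> ZB" if "h \<in> G" for h U
  by (simp add: act_Cls[OF that] Cls_eq_iff)
 thus ?thesis
  by (auto simp: B_model_def presented.carrier[OF presented_Btot] Inv_iff)
qed

lemma hact_lin: "hact h (U + V) = hact h U + hact h V" "hact h (usc c U) = usc c (hact h U)" "hact h 0 = 0"
 by (rule ext, simp add: hact_def usc_def sub_simps algebra_simps)+

lemma ZB_closed: "0 \<in> ZB" "x \<in> ZB ==> y \<in> ZB ==> x + y \<in> ZB" "x \<in> ZB ==> usc c x \<in> ZB" "x \<in> ZB ==> y \<in> ZB ==> x - y \<in> ZB"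
 by (auto simp: ZB_def usc_def K_closed)

lemma ZB_hact: "x \<in> ZB ==> h \<in> G ==> hact h x \<in> ZB"
proof -
 assume x: "x \<in> ZB" and h: "h \<in> G"
 have "hact h x g' \<in> K g'" if g': "g' \<in> G" for g'
 proof -
  let ?g = "cj (matrix_inv h) g'"
  have g: "?g \<in> G" by (rule G_cj[OF G_inv[OF h] g'])
  have "sub (matrix_inv h) (x ?g) \<in> K (cj h ?g)" using K_cj[OF g h] x g by (simp add: ZB_def)
  thus ?thesis using K_closed(4)[OF g'] by (simp add: hact_def cj_inv_cancel G_facts(1)[OF h])
 qed
 thus ?thesis by (simp add: ZB_def)
qed

lemma subsp_Inv: "presented.subsp usc UNIV Inv"
 unfolding presented.subsp_def[OF presented_Btot]
proof (intro conjI ballI allI)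
 fix x y assume "x \<in> Inv" "y \<in> Inv"
 hence x: "\<And>h. h \<in> G ==> hact h x - x \<in> ZB" and y: "\<And>h. h \<in> G ==> hact h y - y \<in> ZB" by (simp_all add: Inv_iff)
 show "x + y \<in> Inv" unfolding Inv_iff
 proof
  fix h assume h: "h \<in> G"
  have "hact h (x + y) - (x + y) = (hact h x - x) + (hact h y - y)" unfolding hact_lin by (simp add: algebra_simps)
  thus "hact h (x + y) - (x + y) \<in> ZB" using ZB_closed(2)[OF x[OF h] y[OF h]] by metis
 qed
 fix c
 show "usc c x \<in> Inv" unfolding Inv_iff
 proof
  fix h assume h: "h \<in> G"
  have "hact h (usc c x) - usc c x = usc c (hact h x - x)"
   unfolding hact_lin by (simp add: usc_def fun_eq_iff right_diff_distrib)
  thus "hact h (usc c x) - usc c x \<in> ZB" using ZB_closed(3)[OF x[OF h], of c] by metis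
 qed
next
 have "hact h 0 - 0 = 0" for h using hact_lin(3)[of h] by simp
 thus "0 \<in> Inv" unfolding Inv_iff using ZB_closed(1) by metis
qed simp

lemma ZB_Inv: "U \<in> Inv ==> V - U \<in> ZB ==> V \<in> Inv"
 unfolding Inv_iff
proof
 fix h assume U: "\<forall>h\<in>G. hact h U - U \<in> ZB" and V: "V - U \<in> ZB" and h: "h \<in> G"
 have "hact h U + hact h (V - U) = hact h V" using hact_lin(1)[of h U "V - U"] by simp
 hence "hact h V - V = (hact h U - U) + hact h (V - U) - (V - U)" by (simp add: algebra_simps)
 thus "hact h V - V \<in> ZB" using U V h ZB_hact[OF V h] ZB_closed(2,4) by metis
qed

section \<open>Homogeneous families and bidegrees\<close>

abbreviation sg :: "complex ^ 'n ^ 'n => real" where "sg g \<equiv> \<Sum>k\<in>- Ix g. q k"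

text \<open>In a fixed sector this is an injective partial correspondence between integral weights
  \<open>w\<close> and bidegrees.\<close>

definition isb :: "complex ^ 'n ^ 'n => real => real => nat => bool" where
 "isb g x y w \<longleftrightarrow> bideg q Ix g (real w / real d0) = (x, y)"

lemma isb_unique: "isb g x y w ==> isb g x y w' ==> w = w'"
 using d0_pos by (auto simp: isb_def bideg_def)

definition Pc :: "real => real => (complex ^ 'n ^ 'n => 'n mpoly) set" where
 "Pc x y = {U. \<forall>g\<in>G. U g = 0 \<or> (\<exists>w. isb g x y w \<and> wgraded d w (U g))}"

lemma PcD: "U \<in> Pc x y ==> g \<in> G ==> isb g x y w ==> wgraded d w (U g)"
 using isb_unique by (fastforce simp: Pc_def)

lemma graded_cnst_mult: "wgraded d w p ==> wgraded d w (cnst c * p)"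
 using graded_wdeg_mult[of d 0 "cnst c" w p] graded_term_of[of "wdeg d" 0 c] by simp

lemma subsp_Pc: "presented.subsp usc UNIV (Pc x y)"
 unfolding presented.subsp_def[OF presented_Btot]
proof (intro conjI ballI allI)
 fix U V assume UV: "U \<in> Pc x y" "V \<in> Pc x y"
 have "(U + V) g = 0 \<or> (\<exists>w. isb g x y w \<and> wgraded d w ((U + V) g))" if g: "g \<in> G" for g
 proof (cases "\<exists>w. isb g x y w")
  case True
  then obtain w where "isb g x y w" by blast
  thus ?thesis using PcD[OF UV(1) g] PcD[OF UV(2) g] by (auto intro: graded_add)
 next
  case False
  hence "U g = 0" "V g = 0" using UV g by (auto simp: Pc_def)
  thus ?thesis by simp
 qed
 thus "U + V \<in> Pc x y" by (simp add: Pc_def)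
 show "usc c U \<in> Pc x y" for c using UV(1) graded_cnst_mult by (fastforce simp: Pc_def usc_def)
qed (auto simp: Pc_def)

lemma homogeneous_rs:
 assumes "wgraded d w r"
 shows "homogeneous q V (real w / real d0) (rs V r)"
proof -
 have var: "homogeneous q V (q k) (rs V (Var k))" for k
 proof -
  have "Vector_Spaces.linear (*s) (*) (%x :: complex ^ 'n. x $ k)"
   by unfold_locales (auto simp: algebra_simps vec_eq_iff)
  moreover have "\<forall>w'. w' ~= q k --> (\<forall>x \<in> V \<inter> weight_space q w'. x $ k = 0)" by (auto simp: weight_space_eq)
  ultimately have "homogeneous q V (q k) (restrict (%x. x $ k) V)" by (rule homogeneous.linear)
  moreover have "restrict (%x. x $ k) V = rs V (Var k)" by (auto simp: rs_def fun_eq_iff)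
  ultimately show ?thesis by simp
 qed
 have mult: "homogeneous q V (w + w') (rs V (p * r))" if "homogeneous q V w (rs V p)" "homogeneous q V w' (rs V r)" for w w' p r
  using homogeneous.mult[OF that] by (simp add: rs_def restrict_def if_distrib cong: if_cong)
 have add: "homogeneous q V w (rs V (p + r))" if "homogeneous q V w (rs V p)" "homogeneous q V w (rs V r)" for w p r
  using homogeneous.add[OF that] by (simp add: rs_def restrict_def if_distrib cong: if_cong)
 have cn: "homogeneous q V 0 (rs V (cnst c))" for c
  using homogeneous.const[of q V c] by (simp add: rs_def restrict_def cong: if_cong)
 have zero: "homogeneous q V w (rs V 0)" for w
  using homogeneous.zero[of q V w] by (simp add: rs_def restrict_def cong: if_cong)
 have pow: "homogeneous q V (real n * q k) (rs V (Var k ^ n))" for k n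
 proof (induction n)
  case 0 show ?case using cn[of 1] by simp
 next
  case (Suc n) show ?case using mult[OF var[of k] Suc] by (simp add: distrib_right add_divide_distrib)
 qed
 have prd: "homogeneous q V (\<Sum>k\<in>A. real (expo m k) * q k) (rs V (\<Prod>k\<in>A. Var k ^ expo m k))" if "finite A" for A m
  using that
 proof (induction A rule: finite_induct)
  case empty show ?case using cn[of 1] by simp
 next
  case (insert k A) thus ?case using mult[OF pow insert.IH] by simp
 qed
 have tm: "homogeneous q V (real (wdeg d m) / real d0) (rs V (term_of m c))" for m c
 proof -
  have eq: "term_of m c = cnst c * (\<Prod>k\<in>UNIV. Var k ^ expo m k)"
   by (rule ev_inject) (simp add: mon_def)
  have "(\<Sum>k\<in>UNIV. real (expo m k) * q k) = real (wdeg d m) / real d0"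
   by (simp add: wdeg_def sum_divide_distrib mult.commute)
  thus ?thesis using mult[OF cn[of c] prd[of UNIV m]] unfolding eq by simp
 qed
 have "homogeneous q V (real w / real d0) (rs V (\<Sum>m\<in>A. term_of m (coef r m)))" if "A \<subseteq> supp r" for A
  using finite_subset[OF that finite_keys] that
 proof (induction A rule: finite_induct)
  case empty show ?case using zero by simp
 next
  case (insert m A)
  have "wdeg d m = w" using assms insert.prems by (auto simp: graded_def)
  hence "homogeneous q V (real w / real d0) (rs V (term_of m (coef r m)))" using tm[of m "coef r m"] by simp
  moreover have "homogeneous q V (real w / real d0) (rs V (\<Sum>m\<in>A. term_of m (coef r m)))" using insert by blast
  ultimately show ?case using add insert.hyps by simp
 qed
 from this[of "supp r"] show ?thesis using mpoly_eq_sum[of r] by simp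
qed

text \<open>A linear function of weight \<open>w\<close> on \<open>Fix g\<close> factors through the projection to the weight space.\<close>

lemma homogeneous_imp_rs:
 assumes g: "g \<in> G" and "homogeneous q (Fix g) w p"
 shows "\<exists>r. p = rs (Fix g) r \<and> (r = 0 \<or> (\<exists>v. w = real v / real d0 \<and> wgraded d v r))"
 using assms(2)
proof (induction rule: homogeneous.induct)
 case (zero w)
 show ?case by (intro exI[of _ 0]) (auto simp: rs_def fun_eq_iff)
next
 case (const c)
 show ?case
  by (intro exI[of _ "cnst c"] conjI disjI2 exI[of _ 0])
   (auto simp: rs_def fun_eq_iff intro: graded_term_of[of "wdeg d" 0, simplified])
next
 case (linear l w)
 interpret L: Vector_Spaces.linear "(*s)" "(*)" l by (rule linear(1))
 define pj where "pj = (%v (x :: complex ^ 'n). \<chi> k. if q k = v then x $ k else 0)"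
 define r where "r = (\<Sum>k | q k = w. cnst (l (axis k 1)) * Var k)"
 have "l x = ev r x" if x: "x \<in> Fix g" for x
 proof -
  have px: "pj v x \<in> Fix g" for v
  proof -
   have "(g *v pj v x) $ i = pj v x $ i" for i
   proof -
    have "g $ i $ k * pj v x $ k = (if q i = v then g $ i $ k * x $ k else 0)" for k
     using G_weights[OF g, of i k] by (cases "g $ i $ k = 0") (auto simp: pj_def)
    hence "(g *v pj v x) $ i = (if q i = v then (g *v x) $ i else 0)"
     by (simp add: matrix_vector_mult_def)
    thus ?thesis using x by (simp add: Fix_def pj_def)
   qed
   thus ?thesis by (simp add: Fix_def vec_eq_iff)
  qed
  have "(\<Sum>v\<in>range q. if q k = v then x $ k else 0) = x $ k" for k
   by (subst sum.delta') auto
  hence "x = (\<Sum>v\<in>range q. pj v x)" by (simp add: vec_eq_iff pj_def)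
  hence "l x = (\<Sum>v\<in>range q. l (pj v x))" using L.sum[of "%v. pj v x" "range q"] by simp
  also have "\<dots> = (\<Sum>v\<in>range q. if v = w then l (pj w x) else 0)"
  proof (rule sum.cong)
   fix v
   show "l (pj v x) = (if v = w then l (pj w x) else 0)"
    using linear(2) px by (auto simp: weight_space_eq pj_def)
  qed simp
  also have "\<dots> = l (pj w x)"
  proof (cases "w \<in> range q")
   case False
   hence "pj w x = 0" by (auto simp: pj_def vec_eq_iff)
   thus ?thesis using False L.zero by simp
  qed simp
  also have "pj w x = (\<Sum>k | q k = w. x $ k *s axis k 1)"
   by (auto simp: vec_eq_iff pj_def axis_def if_distrib[of "%z. _ * z"] cong: if_cong)
  also have "l \<dots> = (\<Sum>k | q k = w. x $ k * l (axis k 1))" by (simp add: L.sum L.scale)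
  finally show ?thesis by (simp add: r_def mult.commute)
 qed
 hence eq: "restrict l (Fix g) = rs (Fix g) r" by (auto simp: rs_def fun_eq_iff)
 have "r = 0 \<or> (\<exists>v. w = real v / real d0 \<and> wgraded d v r)"
 proof (cases "\<exists>k. q k = w")
  case True
  then obtain i where i: "q i = w" by blast
  have "wgraded d (d i) r"
  proof (rule graded_wdegI)
   fix x
   have "2 ^ d k = (2 :: complex) ^ d i" if "q k = w" for k using that i d0_pos by auto
   hence [simp]: "l (axis k 1) * (2 ^ d k * x $ k) = 2 ^ d i * (l (axis k 1) * x $ k)" if "q k = w" for k
    using that by simp
   thus "ev r (\<chi> k. 2 ^ d k * x $ k) = 2 ^ d i * ev r x"
    unfolding r_def ev_sum sum_distrib_left by (intro sum.cong) auto
  qed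
  thus ?thesis using i by blast
 qed (simp add: r_def)
 thus ?case using eq by blast
next
 case (mult w p w' p')
 then obtain r r' where r: "p = rs (Fix g) r" "p' = rs (Fix g) r'"
  "r = 0 \<or> (\<exists>v. w = real v / real d0 \<and> wgraded d v r)" "r' = 0 \<or> (\<exists>v. w' = real v / real d0 \<and> wgraded d v r')"
  by blast
 have "r * r' = 0 \<or> (\<exists>v. w + w' = real v / real d0 \<and> wgraded d v (r * r'))"
 proof (cases "r = 0 \<or> r' = 0")
  case False
  then obtain v v' where v: "w = real v / real d0" "wgraded d v r" "w' = real v' / real d0" "wgraded d v' r'"
   using r by blast
  show ?thesis using graded_wdeg_mult[OF v(2,4)] by (intro disjI2 exI[of _ "v + v'"]) (simp add: v add_divide_distrib)
 qed auto
 moreover have "(\<lambda>x\<in>Fix g. p x * p' x) = rs (Fix g) (r * r')" by (auto simp: rs_def r fun_eq_iff)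
 ultimately show ?case by blast
next
 case (add w p p')
 then obtain r r' where r: "p = rs (Fix g) r" "p' = rs (Fix g) r'"
  "r = 0 \<or> (\<exists>v. w = real v / real d0 \<and> wgraded d v r)" "r' = 0 \<or> (\<exists>v. w = real v / real d0 \<and> wgraded d v r')"
  by blast
 have "r + r' = 0 \<or> (\<exists>v. w = real v / real d0 \<and> wgraded d v (r + r'))"
 proof (cases "r = 0 \<or> r' = 0")
  case True thus ?thesis using r(3,4) by auto
 next
  case False
  then obtain v v' where v: "w = real v / real d0" "wgraded d v r" "w = real v' / real d0" "wgraded d v' r'"
   using r by blast
  have "v = v'" using v(1,3) d0_pos by simp
  hence "wgraded d v (r + r')" using v(4) by (intro graded_add[OF v(2)]) simp
  thus ?thesis by (intro disjI2 exI[of _ v] conjI v(1))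
 qed
 moreover have "(\<lambda>x\<in>Fix g. p x + p' x) = rs (Fix g) (r + r')" by (auto simp: rs_def r fun_eq_iff)
 ultimately show ?case by blast
qed

text \<open>Homogeneous functions on \<open>Fix g\<close> have weighted homogeneous polynomial
  representatives, and conversely a family in \<open>Pc\<close> is the sum of its single-sector
  parts.\<close>

lemma Btot_piece_eq: "Btot_piece (ev fp) q G Ix a b = Cls ` Pc (of_rat a) (of_rat b)"
proof -
 interpret B: presented B Cls usc UNIV ZB by (rule presented_Btot)
 let ?S = "{sector_elem (ev fp) G p g | g w p. g \<in> G \<and> homogeneous q (Fix g) w p \<and> bideg q Ix g w = (of_rat a, of_rat b)}"
 have S: "?S \<subseteq> Cls ` Pc (of_rat a) (of_rat b)"
 proof
  fix u assume "u \<in> ?S"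
  then obtain g w p where u: "u = sector_elem (ev fp) G p g" "g \<in> G" "homogeneous q (Fix g) w p"
   "bideg q Ix g w = (of_rat a, of_rat b)" by blast
  obtain r where r: "p = rs (Fix g) r" "r = 0 \<or> (\<exists>v. w = real v / real d0 \<and> wgraded d v r)"
   using homogeneous_imp_rs[OF u(2,3)] by blast
  have "single g r \<in> Pc (of_rat a) (of_rat b)" using r(2) u(4) by (auto simp: Pc_def single_def isb_def)
  thus "u \<in> Cls ` Pc (of_rat a) (of_rat b)" unfolding u(1) r(1) sector_elem_Cls by blast
 qed
 hence Sc: "?S \<subseteq> carrier B" unfolding B.carrier by blast
 have "Cls ` Pc (of_rat a) (of_rat b) \<subseteq> span_in B ?S"
 proof
  fix u assume "u \<in> Cls ` Pc (of_rat a) (of_rat b)"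
  then obtain U where U: "U \<in> Pc (of_rat a) (of_rat b)" "u = Cls U" by blast
  define T where "T = {x \<in> UNIV. Cls x \<in> span_in B ?S}"
  have T: "B.subsp T" unfolding T_def by (rule B.subsp_span[OF Sc])
  have "single g (U g) \<in> T" if g: "g \<in> G" for g
  proof (cases "U g = 0")
   case True
   hence "single g (U g) = 0" by (auto simp: single_def)
   thus ?thesis using T by (simp add: B.subsp_def)
  next
   case False
   then obtain w where w: "isb g (of_rat a) (of_rat b) w" "wgraded d w (U g)" using U(1) g by (auto simp: Pc_def)
   have "Cls (single g (U g)) \<in> ?S"
    unfolding sector_elem_Cls[symmetric] using homogeneous_rs[OF w(2)] w(1) g unfolding isb_def by blast
   thus ?thesis using B.span_base[OF Sc] by (auto simp: T_def)
  qed
  note single_T = this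
  have "(\<Sum>g\<in>A. single g (U g)) \<in> T" if "A \<subseteq> G" for A
   using finite_subset[OF that finite_G] that
  proof (induction A rule: finite_induct)
   case empty show ?case using T unfolding B.subsp_def sum.empty by blast
  next
   case (insert g A)
   hence "single g (U g) \<in> T" "(\<Sum>g\<in>A. single g (U g)) \<in> T" using single_T by auto
   hence "single g (U g) + (\<Sum>g\<in>A. single g (U g)) \<in> T" using T unfolding B.subsp_def by blast
   thus ?case unfolding sum.insert[OF insert.hyps] .
  qed
  hence "(\<Sum>g\<in>G. single g (U g)) \<in> T" by blast
  moreover have "Cls (\<Sum>g\<in>G. single g (U g)) = Cls U"
  proof -
   have "(\<Sum>g\<in>G. single g (U g)) x = U x" if "x \<in> G" for x
   proof -
    have "(\<Sum>g\<in>A. single g (U g)) x = (\<Sum>g\<in>A. single g (U g) x)" for A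
     by (induction A rule: infinite_finite_induct) auto
    thus ?thesis using finite_G that by (simp add: single_def)
   qed
   thus ?thesis unfolding Cls_def by (intro restrict_ext) simp
  qed
  ultimately show "u \<in> span_in B ?S" by (simp add: U(2) T_def)
 qed
 moreover have "span_in B ?S \<subseteq> Cls ` Pc (of_rat a) (of_rat b)" by (rule B.span_subset[OF subsp_Pc S])
 ultimately show ?thesis unfolding Btot_piece_def by blast
qed

abbreviation Vp :: "real => real => (complex ^ 'n ^ 'n => 'n mpoly) set" where
 "Vp x y \<equiv> Inv \<inter> Pc x y"

text \<open>An invariant class of the given bidegree has a homogeneous representative, and this one
  lies in \<open>Inv\<close> as well because invariance depends on the class only.\<close>

lemma B_piece_eq: "B_piece (ev fp) q G \<xi> Ix a b = Cls ` Vp (of_rat a) (of_rat b)"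
proof (intro equalityI subsetI)
 fix u assume "u \<in> B_piece (ev fp) q G \<xi> Ix a b"
 then obtain U V where "u = Cls U" "U \<in> Inv" "u = Cls V" "V \<in> Pc (of_rat a) (of_rat b)"
  unfolding B_piece_def carrier_B_model Btot_piece_eq by blast
 moreover from this have "V - U \<in> ZB" using Cls_eq_iff by metis
 ultimately show "u \<in> Cls ` Vp (of_rat a) (of_rat b)" using ZB_Inv by blast
qed (auto simp: B_piece_def carrier_B_model Btot_piece_eq)

lemma presented_B_model: "presented (B_model (ev fp) G \<xi>) Cls usc Inv ZB"
proof -
 have eq: "B_model (ev fp) G \<xi> = B\<lparr>carrier := Cls ` Inv\<rparr>"
  using carrier_B_model by (simp add: B_model_def)
 show ?thesis unfolding eq by (rule presented.presented_subsp[OF presented_Btot subsp_Inv])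
qed

lemma subsp_Vp: "presented.subsp usc Inv (Vp x y)"
 using subsp_Inv subsp_Pc[of x y]
 unfolding presented.subsp_def[OF presented_Btot] presented.subsp_def[OF presented_B_model] by auto

lemma presented_piece:
 "presented ((B_model (ev fp) G \<xi>)\<lparr>carrier := B_piece (ev fp) q G \<xi> Ix a b\<rparr>) Cls usc (Vp (of_rat a) (of_rat b)) ZB"
 unfolding B_piece_eq by (rule presented.presented_subsp[OF presented_B_model subsp_Vp])

end

section \<open>Ages and bidegrees\<close>

lemma cis_sum: "cis (\<Sum>k\<in>A. f k) = (\<Prod>k\<in>A. cis (f k))"
 by (induction A rule: infinite_finite_induct) (auto simp: cis_mult[symmetric])

lemma cis_eq_1_imp_Ints: "cis (2 * pi * x) = 1 ==> x \<in> \<int>"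
proof -
 assume "cis (2 * pi * x) = 1"
 hence "cos (2 * pi * x) = 1" by (simp add: complex_eq_iff)
 then obtain n :: int where "2 * pi * x = real_of_int n * 2 * pi" using cos_one_2pi_int by auto
 hence "x = real_of_int n" by simp
 thus ?thesis by simp
qed

lemma wpart_sub:
 fixes A :: "complex ^ 'n::finite ^ 'n"
 assumes "\<And>i k. A $ i $ k ~= 0 ==> d i = d k"
 shows "wpart d w (sub A p) = sub A (wpart d w p)"
proof -
 have sub_sum: "sub A (sum u S) = (\<Sum>s\<in>S. sub A (u s))" for u :: "'a => 'n mpoly" and S
  by (rule ev_inject) simp
 have gr: "wgraded d v (sub A (wpart d v p))" for v by (rule graded_sub[OF assms graded_filt])
 have "wpart d w (sub A p) = wpart d w (\<Sum>v\<in>wdeg d ` supp p. sub A (wpart d v p))"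
  using sum_wpart[of p d] sub_sum by metis
 also have "\<dots> = (\<Sum>v\<in>wdeg d ` supp p. if w = v then sub A (wpart d w p) else 0)"
  unfolding filt_sum by (rule sum.cong) (auto simp: filt_graded[OF gr])
 also have "\<dots> = sub A (wpart d w p)"
 proof (cases "w \<in> wdeg d ` supp p")
  case False
  hence "wpart d w p = 0" by (intro filt_eq_0) blast
  thus ?thesis using False by (simp add: sub_simps)
 qed simp
 finally show ?thesis .
qed

lemma wpart_cnst: "wpart d w (cnst c * p) = cnst c * wpart d w p"
 by (rule filt_mult) (auto simp: wdeg_add split: if_splits)

text \<open>Layer-cake comparison. The largest value \<open>u j0\<close> is matched with some
  \<open>v k0\<close> at least as large. Removing both lowers the counts up to that level by one on
  each side, and above it the left side has nothing to count.\<close>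

lemma counting_sum_le:
 fixes u :: "'a => real" and v :: "'b => real"
 assumes "finite A" "finite P" "\<And>k. k \<in> P ==> v k \<ge> 0" "\<And>j. j \<in> A ==> u j > 0"
  and "\<And>t. t > 0 ==> card {j \<in> A. u j \<ge> t} \<le> card {k \<in> P. v k \<ge> t}"
 shows "sum u A \<le> sum v P"
 using assms
proof (induction "card A" arbitrary: A P)
 case 0
 hence "A = {}" by simp
 thus ?case using 0 by (simp add: sum_nonneg)
next
 case (Suc n)
 hence ne: "A ~= {}" by auto
 define t0 where "t0 = Max (u ` A)"
 have "t0 \<in> u ` A" unfolding t0_def using Suc.prems(1) ne by (intro Max_in) auto
 then obtain j0 where j0: "j0 \<in> A" "u j0 = t0" by auto
 have max: "u j \<le> t0" if "j \<in> A" for j unfolding t0_def using Suc.prems(1) that by (intro Max_ge) auto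
 have t0: "t0 > 0" using Suc.prems(4)[OF j0(1)] j0(2) by simp
 have "j0 \<in> {j \<in> A. u j \<ge> t0}" using j0 by simp
 hence "card {j \<in> A. u j \<ge> t0} > 0" using Suc.prems(1) by (subst card_gt_0_iff) auto
 hence "card {k \<in> P. v k \<ge> t0} > 0" using Suc.prems(5)[OF t0] by linarith
 hence "{k \<in> P. v k \<ge> t0} ~= {}" by (metis card.empty less_irrefl)
 then obtain k0 where k0: "k0 \<in> P" "v k0 \<ge> t0" by blast
 have "sum u (A - {j0}) \<le> sum v (P - {k0})"
 proof (rule Suc.hyps(1))
  show "n = card (A - {j0})" using Suc.hyps(2) Suc.prems(1) j0 by simp
  fix t :: real assume t: "t > 0"
  show "card {j \<in> A - {j0}. u j \<ge> t} \<le> card {k \<in> P - {k0}. v k \<ge> t}"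
  proof (cases "t \<le> t0")
   case True
   have "{j \<in> A - {j0}. u j \<ge> t} = {j \<in> A. u j \<ge> t} - {j0}" "{k \<in> P - {k0}. v k \<ge> t} = {k \<in> P. v k \<ge> t} - {k0}" by auto
   moreover have "j0 \<in> {j \<in> A. u j \<ge> t}" "k0 \<in> {k \<in> P. v k \<ge> t}" using j0 k0 True by auto
   ultimately show ?thesis using Suc.prems(5)[OF t] Suc.prems(1,2) by (simp add: diff_le_mono)
  next
   case False
   have "{j \<in> A - {j0}. u j \<ge> t} = {}" using False max by force
   thus ?thesis by (simp only: card.empty)
  qed
 qed (use Suc.prems in auto)
 thus ?case using j0 k0 Suc.prems(1,2) by (simp add: sum.remove[of A j0] sum.remove[of P k0])
qed

context orbifold
begin

lemma adapted_inverse: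
 assumes ad: "adapted d g h P d' a b M" and g: "g \<in> G"
 shows "adapted d (matrix_inv g) h P d' (%k. inverse (a k)) b M"
proof -
 have P: "g ** P = P ** dg a" using ad by (simp add: adapted_def)
 have "a k ~= 0" for k using adapted_norm(1)[OF ad, of k] by auto
 hence one: "dg a ** dg (%k. inverse (a k)) = mat 1" unfolding dg_mult by (simp add: vec_eq_iff dg_def mat_def)
 have "matrix_inv g ** P = matrix_inv g ** (P ** dg a) ** dg (%k. inverse (a k))"
  by (simp add: matrix_mul_assoc[symmetric] one)
 also have "\<dots> = (matrix_inv g ** g) ** P ** dg (%k. inverse (a k))" by (simp add: P[symmetric] matrix_mul_assoc)
 finally have "matrix_inv g ** P = P ** dg (%k. inverse (a k))" by (simp add: matrix_inv_cancel[OF G_facts(1)[OF g]])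
 thus ?thesis using ad by (auto simp: adapted_def power_inverse)
qed

lemma adapted_self:
 assumes "g \<in> G"
 obtains P d' a M where "adapted d g g P d' a a M"
proof -
 obtain P d' a b M where ad: "adapted d g g P d' a b M" using adapted_exists[OF assms assms] by blast
 hence "adapted d g g P d' a a M" by (simp add: adapted_def)
 thus ?thesis using that by blast
qed

lemma adapted_age:
 assumes "adapted d g h P d' a b M"
 shows "age g = (\<Sum>k\<in>UNIV. frac_arg (a k))"
 by (rule age_diag) (use assms adapted_norm(1)[OF assms] in \<open>auto simp: adapted_def\<close>)

lemma diagonal_one_imp:
 fixes g P :: "complex ^ 'm::finite ^ 'm"
 assumes P: "invertible P" "g ** P = P ** dg a" and "\<And>k. a k = 1"
 shows "g = mat 1"
proof -
 have "a = (%_. 1)" using assms(3) by blast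
 hence "dg a = mat 1" by (simp add: dg_def mat_def)
 hence "g ** (P ** matrix_inv P) = P ** matrix_inv P" using P(2) by (simp add: matrix_mul_assoc)
 thus ?thesis by (simp add: matrix_inv_cancel[OF P(1)])
qed

lemma adapted_one: "adapted d (mat 1) (mat 1) (mat 1) d (%_. 1) (%_. 1) 1"
proof -
 have "dg (%_. 1) = (mat 1 :: complex ^ 'n ^ 'n)" by (simp add: dg_def mat_def)
 moreover have "(mat 1 :: complex ^ 'n ^ 'n) $ i $ k ~= 0 ==> d i = d k" for i k
  by (cases "i = k") (auto simp: mat_def)
 ultimately show ?thesis using invertible_mat_1 by (auto simp: adapted_def)
qed

text \<open>The exponents add up to an integer because \<open>det g = 1\<close>, and to a positive
  one unless all vanish. An eigenvalue other than 1 and its inverse have exponents with sum 1, so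
  the two ages together count the moved directions.\<close>

lemma age_facts:
 assumes g: "g \<in> G"
 shows "age g \<in> \<int>" "age g \<ge> 0" "g ~= mat 1 ==> age g \<ge> 1"
  "age g + age (matrix_inv g) = real CARD('n) - real (card (Ix g))"
proof -
 obtain P d' a M where ad: "adapted d g g P d' a a M" using adapted_self[OF g] .
 have P: "invertible P" "g ** P = P ** dg a" using ad by (auto simp: adapted_def)
 note n = adapted_norm(1)[OF ad]
 note age = adapted_age[OF ad]
 have "cis (2 * pi * age g) = (\<Prod>k\<in>UNIV. a k)"
  unfolding age sum_distrib_left cis_sum by (simp add: cis_frac_arg n)
 also have "\<dots> = 1" using det_diag(2)[OF P] G_facts(3)[OF g] by simp
 finally show int: "age g \<in> \<int>" by (rule cis_eq_1_imp_Ints)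
 show nn: "age g \<ge> 0" unfolding age by (intro sum_nonneg frac_arg_range)
 show "age g \<ge> 1" if "g ~= mat 1"
 proof -
  have "age g ~= 0"
  proof
   assume "age g = 0"
   hence "frac_arg (a k) = 0" for k unfolding age using frac_arg_range(1) by (simp add: sum_nonneg_eq_0_iff)
   hence "a k = 1" for k using frac_arg_eq_0[OF n] by blast
   thus False using diagonal_one_imp[OF P] that by blast
  qed
  with int nn show ?thesis by (auto elim!: Ints_cases)
 qed
 have "frac_arg (a k) + frac_arg (inverse (a k)) = (if a k ~= 1 then 1 else 0)" for k
  using frac_arg_inverse[OF n[of k]] frac_arg_eq_0[OF n[of k]] by auto
 hence "age g + age (matrix_inv g) = (\<Sum>k\<in>UNIV. if a k ~= 1 then 1 else 0)"
  unfolding age adapted_age[OF adapted_inverse[OF ad g]] sum.distrib[symmetric] by simp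
 also have "\<dots> = real (card {k. a k ~= 1})" by (simp add: sum.If_cases)
 also have "card {k. a k ~= 1} = CARD('n) - card {k. a k = 1}"
 proof -
  have "{k. a k ~= 1} = UNIV - {k. a k = 1}" by auto
  thus ?thesis by (simp add: card_Diff_subset)
 qed
 finally show "age g + age (matrix_inv g) = real CARD('n) - real (card (Ix g))"
  using adapted_sums(2)[OF ad g] card_mono[of UNIV "{k. a k = 1}"] by (simp add: of_nat_diff)
qed

lemma sg_eq: "(\<Sum>k\<in>- Ix g. q k) = 1 - real (\<Sum>k\<in>Ix g. d k) / real d0"
proof -
 have "(\<Sum>k\<in>- Ix g. q k) + (\<Sum>k\<in>Ix g. q k) = (\<Sum>k\<in>UNIV. q k)"
  using sum.union_disjoint[of "- Ix g" "Ix g" q] by (simp add: Un_commute)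
 also have "\<dots> = 1" using cy d0_pos by (simp add: sum_div_d0)
 finally show ?thesis by (simp add: sum_div_d0)
qed

lemma sg_bounds: "0 \<le> (\<Sum>k\<in>- Ix g. q k)" "(\<Sum>k\<in>- Ix g. q k) \<le> 1" "(\<Sum>k\<in>- Ix g. q k) = 1 ==> Ix g = {}"
proof -
 show "0 \<le> (\<Sum>k\<in>- Ix g. q k)" by (intro sum_nonneg) simp
 show "(\<Sum>k\<in>- Ix g. q k) \<le> 1" unfolding sg_eq by (simp add: sum_nonneg)
 assume "(\<Sum>k\<in>- Ix g. q k) = 1"
 hence "real (\<Sum>k\<in>Ix g. d k) = 0" unfolding sg_eq using d0_pos by (simp del: of_nat_sum)
 hence "(\<Sum>k\<in>Ix g. d k) = 0" by (simp only: of_nat_eq_0_iff)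
 hence "x \<notin> Ix g" for x using d_pos[of x] by auto
 thus "Ix g = {}" by blast
qed

lemma Ix_one: "Ix (mat 1) = UNIV" "age (mat 1 :: complex ^ 'n ^ 'n) = 0"
proof -
 have "card (Ix (mat 1)) = CARD('n)" using adapted_sums(2)[OF adapted_one G_one] by simp
 thus "Ix (mat 1) = UNIV" by (simp add: card_eq_UNIV_imp_eq_UNIV)
 show "age (mat 1 :: complex ^ 'n ^ 'n) = 0" using adapted_age[OF adapted_one] frac_arg_eq_0[of 1] by simp
qed

lemma sector_conj:
 assumes g: "g \<in> G" and h: "h \<in> G"
 shows "(\<Sum>k\<in>Ix (cj h g). d k) = (\<Sum>k\<in>Ix g. d k)" "age (cj h g) = age g"
proof -
 obtain P d' a M where ad: "adapted d g g P d' a a M" using adapted_self[OF g] .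
 have ad': "adapted d (cj h g) (cj h g) (h ** P) d' a a M" unfolding cj_def by (rule adapted_conjugate[OF ad h])
 have g': "cj h g \<in> G" unfolding cj_def by (intro G_mult G_inv g h)
 show "(\<Sum>k\<in>Ix (cj h g). d k) = (\<Sum>k\<in>Ix g. d k)" using adapted_sums(1)[OF ad g] adapted_sums(1)[OF ad' g'] by simp
 show "age (cj h g) = age g" by (simp add: adapted_age[OF ad] adapted_age[OF ad'])
qed

lemma sector_inv:
 assumes g: "g \<in> G"
 shows "(\<Sum>k\<in>Ix (matrix_inv g). d k) = (\<Sum>k\<in>Ix g. d k)" "card (Ix (matrix_inv g)) = card (Ix g)"
proof -
 obtain P d' a M where ad: "adapted d g g P d' a a M" using adapted_self[OF g] .
 note ad' = adapted_inverse[OF ad g]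
 show "(\<Sum>k\<in>Ix (matrix_inv g). d k) = (\<Sum>k\<in>Ix g. d k)" "card (Ix (matrix_inv g)) = card (Ix g)"
  using adapted_sums(1,2)[OF ad g] adapted_sums(1,2)[OF ad' G_inv[OF g]] by simp_all
qed

section \<open>The generator j of the group J\<close>

abbreviation jm :: "complex ^ 'n ^ 'n" where "jm \<equiv> j_elem q"

lemma jm_eq: "jm = dg (%k. cis (2 * pi * q k))"
 by (auto simp: j_elem_def dg_def vec_eq_iff)

lemma jm_G: "jm \<in> G"
 using J_G generate.incl[of jm "{jm}" GL] by (auto simp: J_group_def)

lemma jm_central: "g \<in> G ==> jm ** g = g ** jm"
 unfolding jm_eq dg_mult mult_dg vec_eq_iff
proof (intro allI)
 fix i k assume "g \<in> G"
 thus "(\<chi> i k. cis (2 * pi * q i) * g $ i $ k) $ i $ k = (\<chi> i k. g $ i $ k * cis (2 * pi * q k)) $ i $ k"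
  using G_weights[of g i k] by (cases "g $ i $ k = 0") auto
qed

lemma adapted_weights_occur:
 assumes "adapted d g h P d' a b M"
 shows "\<exists>i. P $ i $ k ~= 0 \<and> d' k = d i"
proof -
 have P: "invertible P" using assms by (simp add: adapted_def)
 have "\<exists>i. P $ i $ k ~= 0"
 proof (rule ccontr)
  assume "\<nexists>i. P $ i $ k ~= 0"
  hence "P *v axis k 1 = 0" by (simp add: vec_eq_iff mult_axis)
  hence "matrix_inv P *v (P *v axis k 1) = 0" by simp
  hence "axis k 1 = (0 :: complex ^ 'n)" by (simp add: matrix_vector_mul_assoc matrix_inv_cancel[OF P])
  thus False by (simp add: axis_def vec_eq_iff) (metis zero_neq_one)
 qed
 thus ?thesis using assms unfolding adapted_def by metis
qed

lemma adapted_jm: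
 assumes "adapted d g jm P d' a b M"
 shows "b k = cis (2 * pi * (real (d' k) / real d0))"
proof -
 obtain i where i: "P $ i $ k ~= 0" "d' k = d i" using adapted_weights_occur[OF assms] by blast
 have "jm ** P = P ** dg b" using assms by (simp add: adapted_def)
 from arg_cong[OF this, of "%A. A $ i $ k"]
 have "cis (2 * pi * q i) * P $ i $ k = P $ i $ k * b k" unfolding jm_eq dg_mult mult_dg by simp
 thus ?thesis using i by simp
qed

text \<open>The exponents of j are the reduced weights themselves, strictly between 0 and 1 and of
  sum 1.\<close>

lemma jm_sector: "Ix jm = {}" "age jm = 1"
proof -
 obtain P d' a M where ad: "adapted d jm jm P d' a a M" using adapted_self[OF jm_G] .
 have fr: "frac_arg (a k) = real (d' k) / real d0 \<and> d' k > 0" for k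
 proof -
  obtain i where i: "d' k = d i" using adapted_weights_occur[OF ad] by blast
  show ?thesis unfolding adapted_jm[OF ad, of k] i using frac_arg_cis[of "q i"] d_lt[of i] d_pos[of i] by simp
 qed
 have "a k ~= 1" for k
 proof -
  have "frac_arg (a k) ~= 0" using fr[of k] d0_pos by simp
  thus ?thesis using frac_arg_eq_0[OF adapted_norm(1)[OF ad]] by blast
 qed
 hence "card (Ix jm) = 0" using adapted_sums(2)[OF ad jm_G] by simp
 thus "Ix jm = {}" by simp
 have "age jm = (\<Sum>k\<in>UNIV. real (d' k) / real d0)" unfolding adapted_age[OF ad] using fr by simp
 also have "\<dots> = 1" unfolding sum_div_d0 using adapted_sums(3)[OF ad jm_G] d0_pos by simp
 finally show "age jm = 1" .
qed

section \<open>The only sector with \<open>(q\<^sub>l, q\<^sub>r) = (0, D)\<close>\<close>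

lemma graded_fp: "wgraded d d0 fp"
 by (rule graded_wdegI) (rule f_scale, simp)

lemma graded_partial:
 assumes ad: "adapted d g h P d' a b M"
 shows "wgraded d' (d0 - d' k) (pd (sub P fp) k)"
proof (rule graded_wdegI)
 fix x
 have "wgraded d' d0 (sub P fp)" using ad graded_sub[OF _ graded_fp, of P d'] by (simp add: adapted_def)
 hence "2 ^ d' k * ev (pd (sub P fp) k) (\<chi> i. 2 ^ d' i * x $ i) = 2 ^ d0 * ev (pd (sub P fp) k) x"
  by (intro ev_pd_scale ev_scale)
 moreover have "d' k < d0" using adapted_weights_occur[OF ad, of k] d_lt by auto
 hence "(2 :: complex) ^ d0 = 2 ^ d' k * 2 ^ (d0 - d' k)" by (simp add: power_add[symmetric])
 ultimately show "ev (pd (sub P fp) k) (\<chi> i. 2 ^ d' i * x $ i) = 2 ^ (d0 - d' k) * ev (pd (sub P fp) k) x" by simp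
qed

abbreviation live :: "complex ^ 'n ^ 'n => 'n set => 'n set" where
 "live P S \<equiv> {k. \<exists>y. (\<forall>i. i \<notin> S --> y $ i = 0) \<and> ev (pd (sub P fp) k) y ~= 0}"

text \<open>Otherwise the partial derivatives that do not vanish identically on the coordinate subspace \<open>S\<close>,
 being too few, would have a common zero there.\<close>

lemma partials_on_coordinate_subspace:
 assumes ad: "adapted d g g P d' a a M"
 shows "card S \<le> card (live P S)"
proof (rule ccontr)
 define T where "T = (live P S)"
 assume "\<not> card S \<le> card (live P S)"
 hence "\<not> card S \<le> card T" unfolding T_def .
 hence lt: "card T < card S" by simp
 hence "card T \<le> card S" by simp
 from card_le_inj[OF _ _ this] obtain \<iota> where \<iota>: "\<iota> ` T \<subseteq> S" "inj_on \<iota> T" by auto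
 have "card (\<iota> ` T) < card S" using lt card_image[OF \<iota>(2)] by simp
 hence "\<iota> ` T ~= S" by auto
 then obtain i0 where i0: "i0 \<in> S" "i0 \<notin> \<iota> ` T" using \<iota>(1) by blast
 \<comment> \<open>The live derivatives occupy slots of \<open>S\<close>, the coordinates fill those
   outside, and by the count at least the slot \<open>i0\<close> is left for 0.\<close>
 define H where "H = (%i. if i \<notin> S then Var i else if i \<in> \<iota> ` T then pd (sub P fp) (inv_into T \<iota> i) else 0)"
 \<comment> \<open>The zero form is homogeneous of every weight; 1 is an arbitrary positive
   choice.\<close>
 define \<delta> where "\<delta> = (%i. if i \<notin> S then d' i else if i \<in> \<iota> ` T then d0 - d' (inv_into T \<iota> i) else 1)"
 have d': "0 < d' k \<and> d' k < d0" for k using adapted_weights_occur[OF ad, of k] d_lt d_pos by auto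
 have var: "wgraded d' (d' i) (Var i)" for i by (rule graded_wdegI) simp
 have "\<not> only_zero H"
 proof (rule exists_common_zero)
  show "0 < d' k" for k using d' by blast
  show "wgraded d' (\<delta> i) (H i)" for i using graded_partial[OF ad] var by (auto simp: H_def \<delta>_def)
  show "0 < \<delta> i" for i using d' by (auto simp: \<delta>_def)
  show "H i0 = 0" using i0 by (simp add: H_def)
 qed
 moreover have "only_zero H"
  unfolding only_zero_def
 proof (intro allI impI)
  fix y assume y: "\<forall>i. ev (H i) y = 0"
  have yS: "y $ i = 0" if "i \<notin> S" for i using spec[OF y, of i] that by (simp add: H_def)
  have "ev (pd (sub P fp) k) y = 0" for k
  proof (cases "k \<in> T")
   case True
   hence "\<iota> k \<in> \<iota> ` T" "\<iota> k \<in> S" using \<iota>(1) by auto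
   thus ?thesis using spec[OF y, of "\<iota> k"] by (simp add: H_def inv_into_f_f[OF \<iota>(2) True])
  qed (use yS in \<open>auto simp: T_def\<close>)
  moreover have "adapted d (mat 1) g P d' (%_. 1) a M"
  proof -
   have "mat 1 ** P = P ** dg (%_. 1)" by (simp add: mult_dg vec_eq_iff)
   thus ?thesis using ad by (simp add: adapted_def)
  qed
  from only_zero_stuple[OF this G_one] have "only_zero (%k. pd (sub P fp) k)"
   by (simp add: stuple_def[abs_def])
  ultimately show "y = 0" by (simp add: only_zero_def)
 qed
 ultimately show False by blast
qed

text \<open>With \<open>\<beta> = \<alpha> - q\<close> the invariance of \<open>f\<close> gives \<open>\<beta> \<cdot> m \<ge> 0\<close> for all its monomials \<open>m\<close>, while
 \<open>\<Sum>\<beta> = 0\<close>.  Counting the partial derivatives that survive on the subspaces \<open>\<beta> \<le> - t\<close> shows that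
 \<open>\<beta>\<close> takes its maximum \<open>c\<close> where \<open>- c\<close> is the minimum, and then a monomial of the form
 \<open>x\<^sub>k x\<^sub>j\<close> occurs, which the Calabi--Yau condition excludes.\<close>

lemma age_one_unique:
 assumes g: "g \<in> G" and Ix: "Ix g = {}" and age1: "age g = 1"
 shows "g = jm"
proof -
 obtain P d' a M where ad: "adapted d g g P d' a a M" using adapted_self[OF g] .
 have P: "invertible P" "g ** P = P ** dg a" "\<And>i k. P $ i $ k ~= 0 ==> d i = d' k" using ad by (auto simp: adapted_def)
 note n = adapted_norm(1)[OF ad]
 define \<alpha> where "\<alpha> = (%k. frac_arg (a k))"
 define \<beta> where "\<beta> = (%k. \<alpha> k - real (d' k) / real d0)"
 have d': "0 < d' k \<and> d' k < d0" for k using adapted_weights_occur[OF ad, of k] d_lt d_pos by auto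
 have "card {k. a k = 1} = 0" using adapted_sums(2)[OF ad g] Ix by simp
 hence an: "a k ~= 1" for k by (auto simp: card_eq_0_iff)
 have \<alpha>0: "\<alpha> k > 0" for k
  using frac_arg_range(1)[of "a k"] frac_arg_eq_0[OF n[of k]] an[of k] by (simp add: \<alpha>_def less_le)
 have s\<beta>: "(\<Sum>k\<in>UNIV. \<beta> k) = 0"
  unfolding \<beta>_def sum_subtractf sum_div_d0 using age1 adapted_age[OF ad] adapted_sums(3)[OF ad g] d0_pos by (simp add: \<alpha>_def)
 \<comment> \<open>Invariance of f makes \<open>\<alpha> k\<close> plus the sum of the
   \<open>\<alpha>\<close> over the variables of \<open>m\<close> an integer; it is positive, hence
   at least 1. The same expression in the weights is exactly 1.\<close>
 have mono: "\<beta> k + (\<Sum>i\<in>UNIV. real (expo m i) * \<beta> i) \<ge> 0 \<and> (\<Sum>i\<in>UNIV. expo m i) \<ge> 1 \<and> wdeg d' m = d0 - d' k"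
  if m: "m \<in> supp (pd (sub P fp) k)" for k m
 proof -
  have w: "wdeg d' m = d0 - d' k" using graded_partial[OF ad] m by (auto simp: graded_def)
  have "ev (sub P fp) (\<chi> i. a i * x $ i) = 1 * ev (sub P fp) x" for x
   using diag_power[OF P(1,2), of x] G_facts(2)[OF g, of "P *v x"] by simp
  hence semi: "a k * ev (pd (sub P fp) k) (\<chi> i. a i * x $ i) = 1 * ev (pd (sub P fp) k) x" for x by (rule ev_pd_scale)
  have "ev (pd (sub P fp) k) (\<chi> i. a i * x $ i) = inverse (a k) * ev (pd (sub P fp) k) x" for x
  proof -
   have "a k ~= 0" using n[of k] by auto
   hence "ev (pd (sub P fp) k) (\<chi> i. a i * x $ i) =
     inverse (a k) * (a k * ev (pd (sub P fp) k) (\<chi> i. a i * x $ i))" by (simp add: mult.assoc[symmetric])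
   thus ?thesis unfolding semi by simp
  qed
  hence "graded (chr a) (inverse (a k)) (pd (sub P fp) k)" by (rule graded_chrI)
  hence "chr a m = inverse (a k)" using m by (auto simp: graded_def)
  moreover have "a k ~= 0" using n[of k] by auto
  ultimately have "a k * (\<Prod>i\<in>UNIV. a i ^ expo m i) = 1" by (simp add: chr_def)
  moreover have "cis (2 * pi * (\<alpha> k + (\<Sum>i\<in>UNIV. real (expo m i) * \<alpha> i))) = a k * (\<Prod>i\<in>UNIV. a i ^ expo m i)"
  proof -
   have "cis (2 * pi * (real (expo m i) * \<alpha> i)) = a i ^ expo m i" for i
   proof -
    have "cis (2 * pi * (real (expo m i) * \<alpha> i)) = cis (2 * pi * \<alpha> i) ^ expo m i"
     by (rule trans[OF arg_cong[of _ _ cis] Complex.DeMoivre[symmetric]]) (simp only: mult_ac)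
    thus ?thesis by (simp add: \<alpha>_def cis_frac_arg n)
   qed
   moreover have "cis (2 * pi * \<alpha> k) = a k" by (simp add: \<alpha>_def cis_frac_arg n)
   ultimately show ?thesis unfolding distrib_left cis_mult[symmetric] sum_distrib_left cis_sum by simp
  qed
  ultimately have "\<alpha> k + (\<Sum>i\<in>UNIV. real (expo m i) * \<alpha> i) \<in> \<int>" using cis_eq_1_imp_Ints by simp
  moreover have "\<alpha> k + (\<Sum>i\<in>UNIV. real (expo m i) * \<alpha> i) > 0"
   by (intro add_pos_nonneg \<alpha>0 sum_nonneg mult_nonneg_nonneg) (use \<alpha>0 less_imp_le in auto)
  ultimately have A: "\<alpha> k + (\<Sum>i\<in>UNIV. real (expo m i) * \<alpha> i) \<ge> 1" by (auto elim!: Ints_cases)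
  have "(\<Sum>i\<in>UNIV. real (expo m i) * (real (d' i) / real d0)) = real (wdeg d' m) / real d0"
   by (simp add: wdeg_def sum_divide_distrib mult.commute)
  also have "\<dots> = 1 - real (d' k) / real d0" using w d'[of k] by (simp add: of_nat_diff diff_divide_distrib)
  finally have B: "(\<Sum>i\<in>UNIV. real (expo m i) * (real (d' i) / real d0)) = 1 - real (d' k) / real d0" .
  have "(\<Sum>i\<in>UNIV. real (expo m i) * \<beta> i) =
    (\<Sum>i\<in>UNIV. real (expo m i) * \<alpha> i) - (\<Sum>i\<in>UNIV. real (expo m i) * (real (d' i) / real d0))"
   unfolding \<beta>_def right_diff_distrib sum_subtractf ..
  hence 1: "\<beta> k + (\<Sum>i\<in>UNIV. real (expo m i) * \<beta> i) \<ge> 0" using A B by (simp add: \<beta>_def)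
  have "(\<Sum>i\<in>UNIV. expo m i) ~= 0"
  proof
   assume "(\<Sum>i\<in>UNIV. expo m i) = 0"
   hence "wdeg d' m = 0" by (simp add: wdeg_def)
   thus False using w d'[of k] by simp
  qed
  hence "1 \<le> (\<Sum>i\<in>UNIV. expo m i)" by (meson less_one linorder_not_le)
  with 1 w show ?thesis by blast
 qed
 have monomial: "\<exists>m\<in>supp (pd (sub P fp) k). \<forall>i. i \<notin> S --> expo m i = 0"
  if y: "\<forall>i. i \<notin> S --> y $ i = 0" "ev (pd (sub P fp) k) y ~= 0" for k y S
 proof -
  have "\<not> (\<forall>m\<in>supp (pd (sub P fp) k). coef (pd (sub P fp) k) m * mon y m = 0)"
  proof
   assume "\<forall>m\<in>supp (pd (sub P fp) k). coef (pd (sub P fp) k) m * mon y m = 0"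
   hence "ev (pd (sub P fp) k) y = 0" unfolding ev_def by (rule sum.neutral)
   thus False using y(2) by contradiction
  qed
  then obtain m where m: "m \<in> supp (pd (sub P fp) k)" "coef (pd (sub P fp) k) m * mon y m ~= 0" by blast
  have "expo m i = 0" if "i \<notin> S" for i
  proof (rule ccontr)
   assume e: "expo m i ~= 0"
   have "y $ i ^ expo m i = 0" using y(1) that e by simp
   hence "mon y m = 0" unfolding mon_def by (intro prod_zero) auto
   thus False using m(2) by simp
  qed
  thus ?thesis using m(1) by blast
 qed
 have supp_sum: "(\<Sum>i\<in>UNIV. real (expo m i) * \<beta> i) \<le> - t * real (\<Sum>i\<in>UNIV. expo m i)"
  if "\<forall>i. i \<notin> {j. \<beta> j \<le> - t} --> expo m i = 0" for m t
  unfolding of_nat_sum sum_distrib_left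
 proof (rule sum_mono)
  fix i show "real (expo m i) * \<beta> i \<le> - t * real (expo m i)"
  proof (cases "\<beta> i \<le> - t")
   case True
   from mult_left_mono[OF this, of "real (expo m i)"] show ?thesis by (simp add: mult.commute)
  qed (use that in simp)
 qed
 \<comment> \<open>A nonconstant monomial supported where \<open>\<beta> \<le> - t\<close>
   contributes at most \<open>- t\<close>, so a derivative surviving on that subspace has
   \<open>\<beta> k \<ge> t\<close>.\<close>
 have count: "card {j. \<beta> j \<le> - t} \<le> card {k. \<beta> k \<ge> t}" if t: "t > 0" for t
 proof -
  have "(live P {j. \<beta> j \<le> - t}) \<subseteq> {k. \<beta> k \<ge> t}"
  proof
   fix k assume "k \<in> (live P {j. \<beta> j \<le> - t})"
   then obtain m where m: "m \<in> supp (pd (sub P fp) k)" "\<forall>i. i \<notin> {j. \<beta> j \<le> - t} --> expo m i = 0"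
    using monomial[of "{j. \<beta> j \<le> - t}"] by blast
   have "1 \<le> (\<Sum>i\<in>UNIV. expo m i)" using mono[OF m(1)] by blast
   hence "real 1 \<le> real (\<Sum>i\<in>UNIV. expo m i)" by (simp only: of_nat_le_iff)
   hence "- t * real (\<Sum>i\<in>UNIV. expo m i) \<le> - t * 1"
    using t by (intro mult_left_mono_neg) (simp_all del: of_nat_sum)
   moreover have "(\<Sum>i\<in>UNIV. real (expo m i) * \<beta> i) \<le> - t * real (\<Sum>i\<in>UNIV. expo m i)"
    by (rule supp_sum[OF m(2)])
   moreover have "\<beta> k + (\<Sum>i\<in>UNIV. real (expo m i) * \<beta> i) \<ge> 0" using mono[OF m(1)] by blast
   ultimately have "\<beta> k \<ge> t" by linarith
   thus "k \<in> {k. \<beta> k \<ge> t}" by simp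
  qed
  hence "card (live P {j. \<beta> j \<le> - t}) \<le> card {k. \<beta> k \<ge> t}"
   by (intro card_mono) auto
  thus ?thesis using partials_on_coordinate_subspace[OF ad, of "{j. \<beta> j \<le> - t}"] by linarith
 qed
 have "\<beta> k = 0" for k
 proof (rule ccontr)
  assume k: "\<beta> k ~= 0"
  define A where "A = {j. \<beta> j < 0}"
  define Q where "Q = {j. \<beta> j > 0}"
  have sumAQ: "(\<Sum>j\<in>A. - \<beta> j) = (\<Sum>j\<in>Q. \<beta> j)"
  proof -
   have "(\<Sum>k\<in>UNIV. \<beta> k) = (\<Sum>k\<in>A \<union> Q. \<beta> k)" by (rule sum.mono_neutral_right) (auto simp: A_def Q_def)
   also have "\<dots> = (\<Sum>k\<in>A. \<beta> k) + (\<Sum>k\<in>Q. \<beta> k)" by (rule sum.union_disjoint) (auto simp: A_def Q_def)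
   finally show ?thesis using s\<beta> by (simp add: sum_negf)
  qed
  have "A ~= {}"
  proof
   assume "A = {}"
   hence "\<forall>j. \<beta> j \<ge> 0" by (auto simp: A_def not_less)
   hence "\<beta> k = 0" using s\<beta> by (simp add: sum_nonneg_eq_0_iff)
   thus False using k by blast
  qed
  define c where "c = Max ((%j. - \<beta> j) ` A)"
  have "c \<in> (%j. - \<beta> j) ` A" unfolding c_def using \<open>A ~= {}\<close> by (intro Max_in) auto
  then obtain j0 where j0: "\<beta> j0 = - c" "c > 0" by (auto simp: A_def)
  have cmax: "- \<beta> j \<le> c" for j
  proof (cases "j \<in> A")
   case True thus ?thesis unfolding c_def by (intro Max_ge) auto
  qed (use j0 in \<open>auto simp: A_def\<close>)
  \<comment> \<open>If some value exceeded \<open>c\<close>, cutting it down to \<open>c\<close>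
    would preserve the counts at all levels up to \<open>c\<close>, the only ones where the left
    side is nonzero. The comparison of sums would then hold with a strictly smaller right side,
    against \<open>sumAQ\<close>.\<close>
  have upper: "\<beta> k0 \<le> c" for k0
  proof (rule ccontr)
   assume k0: "\<not> \<beta> k0 \<le> c"
   have k0Q: "k0 \<in> Q" using k0 j0(2) by (simp add: Q_def)
   define v where "v = (%k. if k = k0 then c else \<beta> k)"
   have "(\<Sum>j\<in>A. - \<beta> j) \<le> (\<Sum>j\<in>Q. v j)"
   proof (rule counting_sum_le)
    fix t :: real assume t: "t > 0"
    show "card {j \<in> A. - \<beta> j \<ge> t} \<le> card {k \<in> Q. v k \<ge> t}"
    proof (cases "t \<le> c")
     case True
     have "{j \<in> A. - \<beta> j \<ge> t} = {j. \<beta> j \<le> - t}" using t by (auto simp: A_def)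
     moreover have "{k \<in> Q. v k \<ge> t} = {k. \<beta> k \<ge> t}" using t True k0 by (auto simp: Q_def v_def)
     ultimately show ?thesis using count[OF t] by simp
    next
     case False
     have "\<not> t \<le> - \<beta> j" for j using False cmax[of j] by linarith
     hence "{j \<in> A. - \<beta> j \<ge> t} = {}" by blast
     thus ?thesis by (simp only: card.empty)
    qed
   qed (use j0(2) in \<open>auto simp: A_def Q_def v_def\<close>)
   also have "(\<Sum>j\<in>Q. v j) < (\<Sum>j\<in>Q. \<beta> j)"
    by (rule sum_strict_mono_ex1) (use k0 k0Q in \<open>auto simp: v_def\<close>)
   finally show False using sumAQ by linarith
  qed
  have "j0 \<in> {j. \<beta> j \<le> - c}" using j0 by simp
  hence "card {j. \<beta> j \<le> - c} > 0" by (subst card_gt_0_iff) auto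
  hence "card (live P {j. \<beta> j \<le> - c}) > 0"
   using partials_on_coordinate_subspace[OF ad, of "{j. \<beta> j \<le> - c}"] by linarith
  hence "(live P {j. \<beta> j \<le> - c}) ~= {}"
   unfolding card_gt_0_iff by (rule conjunct1)
  then obtain k1 y where y: "\<forall>i. i \<notin> {j. \<beta> j \<le> - c} --> y $ i = 0" "ev (pd (sub P fp) k1) y ~= 0"
   by blast
  from monomial[OF y] obtain m where m: "m \<in> supp (pd (sub P fp) k1)" "\<forall>i. i \<notin> {j. \<beta> j \<le> - c} --> expo m i = 0"
   by blast
  note mm = mono[OF m(1)]
  have "(\<Sum>i\<in>UNIV. real (expo m i) * \<beta> i) \<le> - c * real (\<Sum>i\<in>UNIV. expo m i)"
   by (rule supp_sum[OF m(2)])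
  moreover have mm1: "\<beta> k1 + (\<Sum>i\<in>UNIV. real (expo m i) * \<beta> i) \<ge> 0" using mm by blast
  \<comment> \<open>With \<open>\<beta> k1 \<le> c\<close> the monomial cannot have degree above
    1.\<close>
  ultimately have "c * real (\<Sum>i\<in>UNIV. expo m i) \<le> c * 1" using upper[of k1] by linarith
  hence "(\<Sum>i\<in>UNIV. expo m i) \<le> 1" using j0(2) by (simp del: of_nat_sum)
  moreover have "1 \<le> (\<Sum>i\<in>UNIV. expo m i)" using mm by blast
  ultimately have deg: "(\<Sum>i\<in>UNIV. expo m i) = 1" by (rule antisym)
  have "\<exists>a\<in>UNIV. expo m a = 1 \<and> (\<forall>b\<in>UNIV. a ~= b --> expo m b = 0)"
   using deg sum_eq_1_iff[of UNIV "expo m"] by simp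
  then obtain j1 where j1': "expo m j1 = 1" "\<forall>b\<in>UNIV. j1 ~= b --> expo m b = 0" by (elim bexE conjE) (rule that)
  have j1: "expo m j1 = 1" "i ~= j1 ==> expo m i = 0" for i using j1' by auto
  have \<beta>j1: "\<beta> j1 \<le> - c"
  proof (rule ccontr)
   assume "\<not> \<beta> j1 \<le> - c"
   thus False using spec[OF m(2), of j1] j1(1) by simp
  qed
  have "(\<Sum>i\<in>UNIV. real (expo m i) * \<beta> i) = \<beta> j1"
  proof -
   have "(\<Sum>i\<in>UNIV. real (expo m i) * \<beta> i) = (\<Sum>i\<in>{j1}. real (expo m i) * \<beta> i)"
    by (rule sum.mono_neutral_right) (use j1 in auto)
   thus ?thesis using j1 by simp
  qed
  hence "\<beta> k1 > 0" using mm1 j0(2) \<beta>j1 by linarith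
  hence "j1 ~= k1" using \<beta>j1 j0(2) by auto
  have "wdeg d' m = d' j1"
  proof -
   have "wdeg d' m = (\<Sum>i\<in>{j1}. d' i * expo m i)"
    unfolding wdeg_def by (rule sum.mono_neutral_right) (use j1 in auto)
   thus ?thesis using j1 by simp
  qed
  moreover have "wdeg d' m = d0 - d' k1" using mm by blast
  \<comment> \<open>The weights of two different variables already exhaust \<open>d0\<close>, which
    leaves nothing for a third.\<close>
  ultimately have jk: "d' j1 + d' k1 = d0" using d'[of k1] by linarith
  have "card {j1, k1} < 3" by (simp add: card_insert_if)
  hence "{j1, k1} ~= UNIV" by (rule small_neq_UNIV)
  then obtain l where l: "l ~= j1" "l ~= k1" by blast
  have "(\<Sum>k\<in>{j1, k1, l}. d' k) \<le> (\<Sum>k\<in>UNIV. d' k)" by (rule sum_mono2) auto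
  hence "d' j1 + d' k1 + d' l \<le> d0" using adapted_sums(3)[OF ad g] l \<open>j1 ~= k1\<close> by simp
  thus False using d'[of l] jk by simp
 qed
 hence ak: "a k = cis (2 * pi * (real (d' k) / real d0))" for k
  using cis_frac_arg[OF n[of k]] by (simp add: \<beta>_def \<alpha>_def)
 have "jm ** P = P ** dg a"
  unfolding jm_eq dg_mult mult_dg vec_eq_iff
 proof (intro allI)
  fix i k show "(\<chi> i k. cis (2 * pi * q i) * P $ i $ k) $ i $ k = (\<chi> i k. P $ i $ k * a k) $ i $ k"
   using P(3)[of i k] ak[of k] by (cases "P $ i $ k = 0") auto
 qed
 hence "g ** (P ** matrix_inv P) = jm ** (P ** matrix_inv P)" using P(2) by (simp add: matrix_mul_assoc)
 thus ?thesis by (simp add: matrix_inv_cancel[OF P(1)])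
qed

end

context orbifold_gen
begin

section \<open>Bounds on bidegrees\<close>

lemma isb_iff: "isb g x y w \<longleftrightarrow> real w / real d0 - sg g + age g = x \<and> real w / real d0 - sg g + age (matrix_inv g) = y"
 by (simp add: isb_def bideg_def)

lemma sg_conj: "g \<in> G ==> h \<in> G ==> sg (cj h g) = sg g" and sg_inv: "g \<in> G ==> sg (matrix_inv g) = sg g"
 unfolding sg_eq by (simp_all add: sector_conj sector_inv)

lemma isb_conj:
 assumes g: "g \<in> G" and h: "h \<in> G"
 shows "isb (cj h g) x y w \<longleftrightarrow> isb g x y w"
proof -
 have "age (matrix_inv (cj h g)) = age (matrix_inv g)"
  using sector_conj(2)[OF G_inv[OF g] h] by (simp add: cj_matrix_inv G_facts(1) g h)
 thus ?thesis unfolding isb_iff sg_conj[OF g h] sector_conj(2)[OF g h] by simp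
qed

lemma isb_inv: "g \<in> G ==> isb (matrix_inv g) x y w \<longleftrightarrow> isb g y x w"
 unfolding isb_iff by (auto simp: sg_inv G_inv_inv)

text \<open>The top weight of a sector expressed through \<open>sg\<close>, ready to be combined
  with the sum of the two ages.\<close>

lemma top_ineq:
 assumes "w + 2 * (\<Sum>k\<in>Ix g. d k) \<le> d0 * card (Ix g)"
 shows "real w / real d0 \<le> real (card (Ix g)) - 2 + 2 * sg g"
proof -
 have "real (w + 2 * (\<Sum>k\<in>Ix g. d k)) \<le> real (d0 * card (Ix g))" using assms by (simp only: of_nat_le_iff)
 hence "real w + 2 * real (\<Sum>k\<in>Ix g. d k) \<le> real d0 * real (card (Ix g))" by simp
 thus ?thesis unfolding sg_eq using d0_pos by (simp add: field_simps del: of_nat_sum)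
qed

text \<open>Away from the identity the age is at least 1 while \<open>sg g\<close> is at most
  1.\<close>

lemma age_ge_sg: "g \<in> G ==> sg g \<le> age g"
proof (cases "g = mat 1")
 case True thus ?thesis using Ix_one by simp
qed (use age_facts(3)[of g] sg_bounds(2)[of g] in linarith)

lemma age_eq_sg: "g \<in> G ==> g ~= mat 1 ==> age g = sg g ==> Ix g = {} \<and> age g = 1"
 using age_facts(3)[of g] sg_bounds(2,3)[of g] by linarith

text \<open>The lower bound is \<open>sg g \<le> age g\<close>. The upper bound is the same
  inequality for the inverse of \<open>g\<close>, combined with the top weight and the sum of the
  two ages. Extreme values force equality throughout.\<close>

lemma isb_bounds:
 assumes g: "g \<in> G" and w: "isb g x y w" "w + 2 * (\<Sum>k\<in>Ix g. d k) \<le> d0 * card (Ix g)"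
 shows "0 \<le> x" "x \<le> real CARD('n) - 2" "x = 0 ==> w = 0 \<and> age g = sg g"
  "x = real CARD('n) - 2 ==> age (matrix_inv g) = sg g \<and> w + 2 * (\<Sum>k\<in>Ix g. d k) = d0 * card (Ix g)"
proof -
 have x: "x = real w / real d0 - sg g + age g" using w(1) by (simp add: isb_iff)
 have nn: "real w / real d0 \<ge> 0" by simp
 note a = age_ge_sg[OF g] age_ge_sg[OF G_inv[OF g], unfolded sg_inv[OF g]] age_facts(4)[OF g]
 show "0 \<le> x" using x nn a by linarith
 show "x \<le> real CARD('n) - 2" using x top_ineq[OF w(2)] a by linarith
 show "x = 0 ==> w = 0 \<and> age g = sg g"
 proof -
  assume "x = 0"
  hence "real w / real d0 = 0" "age g = sg g" using x nn a by linarith+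
  thus ?thesis using d0_pos by simp
 qed
 assume "x = real CARD('n) - 2"
 hence e: "real w / real d0 = real (card (Ix g)) - 2 + 2 * sg g" "age (matrix_inv g) = sg g"
  using x top_ineq[OF w(2)] a by linarith+
 hence "real w + 2 * real (\<Sum>k\<in>Ix g. d k) = real d0 * real (card (Ix g))"
  unfolding sg_eq using d0_pos by (simp add: field_simps del: of_nat_sum)
 hence "real (w + 2 * (\<Sum>k\<in>Ix g. d k)) = real (d0 * card (Ix g))" by simp
 hence "w + 2 * (\<Sum>k\<in>Ix g. d k) = d0 * card (Ix g)" by (simp only: of_nat_eq_iff)
 thus "age (matrix_inv g) = sg g \<and> w + 2 * (\<Sum>k\<in>Ix g. d k) = d0 * card (Ix g)" using e by simp
qed

text \<open>Without fixed directions the two ages add up to N, which is at least 3.\<close>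

lemma ages_not_both_one: "g \<in> G ==> Ix g = {} ==> age g = 1 ==> age (matrix_inv g) = 1 ==> False"
 using age_facts(4)[of g] N3 by simp

lemma rho_jm: "g \<in> G ==> rho \<xi> jm g = cis (2 * pi * sg g)"
proof -
 assume g: "g \<in> G"
 obtain P d' a b M where ad: "adapted d g jm P d' a b M"
  using adapted_exists[OF g jm_G jm_central[OF g, symmetric]] by blast
 have "rho \<xi> jm g = (\<Prod>k | a k ~= 1. b k)" by (rule rho_value[OF ad g jm_G jm_central[OF g, symmetric]])
 also have "\<dots> = cis (2 * pi * (\<Sum>k | a k ~= 1. real (d' k) / real d0))"
  unfolding sum_distrib_left cis_sum by (simp add: adapted_jm[OF ad])
 also have "(\<Sum>k | a k ~= 1. real (d' k) / real d0) = sg g"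
 proof -
  have "(\<Sum>k\<in>UNIV. d' k) = (\<Sum>k | a k ~= 1. d' k) + (\<Sum>k | a k = 1. d' k)"
   by (subst sum.union_disjoint[symmetric]) (auto intro: sum.cong)
  hence "real (\<Sum>k | a k ~= 1. d' k) = real d0 - real (\<Sum>k\<in>Ix g. d k)"
   using adapted_sums(1,3)[OF ad g] by linarith
  thus ?thesis unfolding sg_eq unfolding sum_div_d0 using d0_pos by (simp add: diff_divide_distrib del: of_nat_sum)
 qed
 finally show ?thesis .
qed

text \<open>Invariance under \<open>j\<close> forces integral bidegrees.\<close>

lemma Inv_integral:
 assumes U: "U \<in> Inv" and g: "g \<in> G" and w: "wpart d w (U g) \<notin> K g"
 shows "real w / real d0 - sg g \<in> \<int>"
proof -
 define r where "r = wpart d w (U g)"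
 have cjg: "cj jm g = g" by (rule cj_commute[OF G_facts(1)[OF jm_G] jm_central[OF g]])
 have "\<forall>h\<in>G. \<forall>g\<in>G. cnst (rho \<xi> h g) * sub (matrix_inv h) (U g) - U (cj h g) \<in> K (cj h g)"
  using U by (simp add: Inv_def)
 from bspec[OF bspec[OF this jm_G] g] have 0: "cnst (rho \<xi> jm g) * sub (matrix_inv jm) (U g) - U g \<in> K g"
  unfolding cjg .
 have ws: "wpart d w (sub (matrix_inv jm) (U g)) = sub (matrix_inv jm) (wpart d w (U g))"
  by (rule wpart_sub) (rule G_weights[OF G_inv[OF jm_G]])
 from 0 have "wpart d w (cnst (rho \<xi> jm g) * sub (matrix_inv jm) (U g) - U g) \<in> K g" by (rule K_closed(6)[OF g])
 hence 1: "cnst (rho \<xi> jm g) * sub (matrix_inv jm) r - r \<in> K g"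
  unfolding filt_diff wpart_cnst ws r_def .
 \<comment> \<open>The inverse of j multiplies polynomials of weight \<open>w\<close> by
   \<open>t ^ w\<close>.\<close>
 define t where "t = cis (- (2 * pi / real d0))"
 have t: "t ^ v = cis (- (2 * pi * (real v / real d0)))" for v
  unfolding t_def Complex.DeMoivre by (simp add: mult_ac)
 have ji: "matrix_inv jm = dg (%k. t ^ d k)"
  by (rule matrix_inv_unique(1)) (unfold jm_eq dg_mult, simp add: vec_eq_iff dg_def mat_def t cis_mult)
 have "sub (matrix_inv jm) r = cnst (t ^ w) * r"
 proof (rule ev_inject)
  fix x
  have "wgraded d w r" unfolding r_def by (rule graded_filt)
  thus "ev (sub (matrix_inv jm) r) x = ev (cnst (t ^ w) * r) x"
   by (simp add: ji dg_mult_vec ev_scale)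
 qed
 hence "cnst (rho \<xi> jm g) * sub (matrix_inv jm) r - r = cnst (rho \<xi> jm g * t ^ w - 1) * r"
  by (intro ev_inject) (simp add: algebra_simps)
 hence 2: "cnst (rho \<xi> jm g * t ^ w - 1) * r \<in> K g" using 1 by simp
 \<comment> \<open>Otherwise the component \<open>r\<close> would be a constant multiple of an
   element of \<open>K g\<close>.\<close>
 have "rho \<xi> jm g * t ^ w = 1"
 proof (rule ccontr)
  assume ne: "rho \<xi> jm g * t ^ w ~= 1"
  have "cnst (inverse (rho \<xi> jm g * t ^ w - 1)) * (cnst (rho \<xi> jm g * t ^ w - 1) * r) \<in> K g"
   by (rule K_closed(4)[OF g 2])
  moreover have "cnst (inverse (rho \<xi> jm g * t ^ w - 1)) * (cnst (rho \<xi> jm g * t ^ w - 1) * r) = r"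
   by (rule ev_inject) (use ne in simp)
  ultimately show False using w by (simp add: r_def)
 qed
 hence "cis (2 * pi * (sg g - real w / real d0)) = 1"
  unfolding rho_jm[OF g] t cis_mult by (simp add: algebra_simps)
 hence "sg g - real w / real d0 \<in> \<int>" by (rule cis_eq_1_imp_Ints)
 from Ints_minus[OF this] show ?thesis by simp
qed

end

section \<open>The diamond\<close>

lemma sum_fun_apply: "(\<Sum>a\<in>A. u a) g = (\<Sum>a\<in>A. u a g)"
 by (induction A rule: infinite_finite_induct) auto

lemma graded_wdeg_0:
 fixes p :: "'n::finite mpoly"
 assumes d: "\<And>k. d k > 0" and p: "wgraded d 0 p"
 shows "p = cnst (coef p 0)"
proof (rule poly_mapping_eqI)
 fix m
 have "m = 0" if m: "m \<in> supp p"
 proof (rule poly_mapping_eqI)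
  fix k
  have "(\<Sum>k\<in>UNIV. d k * expo m k) = 0" using p m by (simp add: graded_def wdeg_def)
  hence "d k * expo m k = 0" by simp
  thus "expo m k = expo 0 k" using d[of k] by simp
 qed
 thus "coef p m = coef (cnst (coef p 0)) m" by (cases "m = 0") (auto simp: in_keys_iff lookup_single)
qed

context orbifold_gen
begin

lemma Vp_sector:
 assumes "U \<in> Vp x y" "g \<in> G" "U g \<notin> K g"
 shows "\<exists>w. isb g x y w \<and> wgraded d w (U g) \<and> w + 2 * (\<Sum>k\<in>Ix g. d k) \<le> d0 * card (Ix g)"
proof -
 have "U g ~= 0" using K_closed(1)[OF assms(2)] assms(3) by metis
 then obtain w where w: "isb g x y w" "wgraded d w (U g)" using assms(1,2) unfolding Pc_def by blast
 moreover have "w + 2 * (\<Sum>k\<in>Ix g. d k) \<le> d0 * card (Ix g)"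
 proof (rule ccontr)
  assume "\<not> w + 2 * (\<Sum>k\<in>Ix g. d k) \<le> d0 * card (Ix g)"
  hence "U g \<in> K g" by (intro K_closed(7)[OF assms(2) w(2)]) simp
  thus False using assms(3) by contradiction
 qed
 ultimately show ?thesis by blast
qed

text \<open>Passing to the inverse of \<open>g\<close> exchanges the left and right degrees.\<close>

lemma isb_bounds_right:
 assumes g: "g \<in> G" and w: "isb g x y w" "w + 2 * (\<Sum>k\<in>Ix g. d k) \<le> d0 * card (Ix g)"
 shows "0 \<le> y" "y \<le> real CARD('n) - 2" "y = 0 ==> w = 0 \<and> age (matrix_inv g) = sg g"
  "y = real CARD('n) - 2 ==> age g = sg g \<and> w + 2 * (\<Sum>k\<in>Ix g. d k) = d0 * card (Ix g)"
proof -
 have 1: "isb (matrix_inv g) y x w" using w(1) isb_inv[OF g] by simp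
 have 2: "w + 2 * (\<Sum>k\<in>Ix (matrix_inv g). d k) \<le> d0 * card (Ix (matrix_inv g))" using w(2) by (simp only: sector_inv[OF g])
 note b = isb_bounds[OF G_inv[OF g] 1 2, unfolded sector_inv[OF g] sg_inv[OF g] G_inv_inv[OF g]]
 show "0 \<le> y" "y \<le> real CARD('n) - 2" "y = 0 ==> w = 0 \<and> age (matrix_inv g) = sg g"
  "y = real CARD('n) - 2 ==> age g = sg g \<and> w + 2 * (\<Sum>k\<in>Ix g. d k) = d0 * card (Ix g)"
  by (rule b(1), rule b(2), erule b(3), erule b(4))
qed

lemma D_pos: "real CARD('n) - 2 \<ge> 1"
 using N3 by (simp add: le_diff_eq)

lemma Vp_outside:
 assumes "x < 0 \<or> y < 0 \<or> x > (real CARD('n) - 2) \<or> y > (real CARD('n) - 2)"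
 shows "Vp x y \<subseteq> ZB"
proof
 fix U assume U: "U \<in> Vp x y"
 have "U g \<in> K g" if g: "g \<in> G" for g
 proof (rule ccontr)
  assume "U g \<notin> K g"
  then obtain w where w: "isb g x y w" "w + 2 * (\<Sum>k\<in>Ix g. d k) \<le> d0 * card (Ix g)"
   using Vp_sector[OF U g] by blast
  show False using isb_bounds(1,2)[OF g w] isb_bounds_right(1,2)[OF g w] assms by linarith
 qed
 thus "U \<in> ZB" by (simp add: ZB_def)
qed

text \<open>For any other \<open>g\<close> each equality forces age 1 without fixed directions, and
  both ages cannot be 1.\<close>

lemma age_eq_both: "g \<in> G ==> age g = sg g ==> age (matrix_inv g) = sg g ==> g = mat 1"
proof (rule ccontr)
 assume g: "g \<in> G" and a: "age g = sg g" "age (matrix_inv g) = sg g" and ne: "g ~= mat 1"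
 have i: "Ix g = {}" "age g = 1" using age_eq_sg[OF g ne a(1)] by blast+
 have "age (matrix_inv g) = 1" using i(2) a by linarith
 thus False by (rule ages_not_both_one[OF g i])
qed

text \<open>At a corner two of the bounds become equalities. On the diagonal both ages equal
  \<open>sg g\<close>, which leaves the identity; at the other two corners \<open>g\<close> or its
  inverse has age 1 and no fixed vectors, and \<open>age_one_unique\<close> applies.\<close>

lemma isb_corner:
 assumes g: "g \<in> G" and w: "w + 2 * (\<Sum>k\<in>Ix g. d k) \<le> d0 * card (Ix g)"
 shows "isb g 0 0 w ==> g = mat 1 \<and> w = 0"
  "isb g (real CARD('n) - 2) (real CARD('n) - 2) w ==> g = mat 1 \<and> w + 2 * d0 = d0 * CARD('n)"
  "isb g 0 (real CARD('n) - 2) w ==> g = jm \<and> w = 0" "isb g (real CARD('n) - 2) 0 w ==> g = matrix_inv jm \<and> w = 0"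
proof -
 show "isb g 0 0 w ==> g = mat 1 \<and> w = 0"
  using isb_bounds(3)[OF g _ w] isb_bounds_right(3)[OF g _ w] age_eq_both[OF g] by blast
 show "g = mat 1 \<and> w + 2 * d0 = d0 * CARD('n)" if b: "isb g (real CARD('n) - 2) (real CARD('n) - 2) w"
 proof -
  have "g = mat 1" using isb_bounds(4)[OF g b w] isb_bounds_right(4)[OF g b w] age_eq_both[OF g] by blast
  moreover have "w + 2 * (\<Sum>k\<in>Ix g. d k) = d0 * card (Ix g)" using isb_bounds(4)[OF g b w] by blast
  ultimately show ?thesis using cy by (simp add: Ix_one)
 qed
 have left: "g = jm \<and> w = 0" if g: "g \<in> G" and w: "w + 2 * (\<Sum>k\<in>Ix g. d k) \<le> d0 * card (Ix g)" and b: "isb g 0 (real CARD('n) - 2) w" for g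
 proof -
  have 1: "w = 0" "age g = sg g" using isb_bounds(3)[OF g b w] by blast+
  have "g ~= mat 1"
  proof
   assume "g = mat 1"
   hence "0 = (real CARD('n) - 2)" using b 1(1) by (simp add: isb_iff matrix_inv_mat_1 Ix_one)
   thus False using D_pos by linarith
  qed
  with age_eq_sg[OF g _ 1(2)] age_one_unique[OF g] 1(1) show ?thesis by blast
 qed
 show "isb g 0 (real CARD('n) - 2) w ==> g = jm \<and> w = 0" by (rule left[OF g w])
 assume "isb g (real CARD('n) - 2) 0 w"
 hence b: "isb (matrix_inv g) 0 (real CARD('n) - 2) w" using isb_inv[OF g] by simp
 have "w + 2 * (\<Sum>k\<in>Ix (matrix_inv g). d k) \<le> d0 * card (Ix (matrix_inv g))" using w by (simp only: sector_inv[OF g])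
 from left[OF G_inv[OF g] this b] show "g = matrix_inv jm \<and> w = 0" using G_inv_inv[OF g] by metis
qed

section \<open>The four one-dimensional corners\<close>

lemma single_Inv:
 assumes g0: "g0 \<in> G" "\<And>h. h \<in> G ==> cj h g0 = g0" "\<And>h. h \<in> G ==> rho \<xi> h g0 = 1"
  and r: "\<And>h. h \<in> G ==> sub h r - r \<in> K g0"
 shows "single g0 r \<in> Inv"
 unfolding Inv_def
proof (intro CollectI ballI)
 fix h g assume h: "h \<in> G" and g: "g \<in> G"
 show "cnst (rho \<xi> h g) * sub (matrix_inv h) (single g0 r g) - single g0 r (cj h g) \<in> K (cj h g)"
 proof (cases "g = g0")
  case True
  have "cnst 1 * p = p" for p :: "'n mpoly" by (rule ev_inject) simp
  thus ?thesis using r[OF G_inv[OF h]] by (simp add: True g0(2,3)[OF h] single_def)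
 next
  case False
  have "cj h g ~= g0"
  proof
   assume "cj h g = g0"
   hence "g = cj (matrix_inv h) g0" using cj_inv_cancel(2)[OF G_facts(1)[OF h], of g] by simp
   thus False using g0(2)[OF G_inv[OF h]] False by simp
  qed
  thus ?thesis using False K_closed(1)[OF G_cj[OF h g]] by (simp add: single_def sub_simps)
 qed
qed

lemma one_sector_dimension:
 assumes P: "presented M Cls usc (Vp x y) ZB" and g0: "g0 \<in> G" and e: "single g0 r \<in> Inv" "wgraded d w r" "isb g0 x y w" "r \<notin> K g0"
  and only: "\<And>g w. g \<in> G ==> w + 2 * (\<Sum>k\<in>Ix g. d k) \<le> d0 * card (Ix g) ==> isb g x y w ==> g = g0"
  and c: "\<And>p. wgraded d w p ==> \<exists>c. p - cnst c * r \<in> K g0"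
 shows "has_dimension M 1"
proof (rule presented.has_dimension_1[OF P])
 show "single g0 r \<in> Vp x y" using e by (auto simp: Pc_def single_def)
 show "single g0 r \<notin> ZB" using e(4) g0 by (auto simp: ZB_def single_def)
 fix U assume U: "U \<in> Vp x y"
 have "wgraded d w (U g0)" using PcD[OF _ g0 e(3)] U by blast
 then obtain c where c: "U g0 - cnst c * r \<in> K g0" using c by blast
 have "(U - usc c (single g0 r)) g \<in> K g" if g: "g \<in> G" for g
 proof (cases "g = g0")
  case False
  hence "U g \<in> K g" using Vp_sector[OF U g] only[OF g] by blast
  thus ?thesis using False by (simp add: usc_def single_def)
 qed (use c in \<open>simp add: usc_def single_def\<close>)
 thus "\<exists>c. U - usc c (single g0 r) \<in> ZB" unfolding ZB_def by blast
qed

text \<open>The product of the moved eigenvalues is either empty or all of \<open>det h\<close>, and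
  both are 1.\<close>

lemma rho_trivial:
 assumes g: "g \<in> G" and h: "h \<in> G" and comm: "g ** h = h ** g" and Ix: "Ix g = {} \<or> Ix g = UNIV"
 shows "rho \<xi> h g = 1"
proof -
 obtain P d' a b M where ad: "adapted d g h P d' a b M" using adapted_exists[OF g h comm] by blast
 have P: "invertible P" "h ** P = P ** dg b" using ad by (auto simp: adapted_def)
 have c: "card {k. a k = 1} = card (Ix g)" by (rule adapted_sums(2)[OF ad g])
 show ?thesis
 proof (cases "Ix g = UNIV")
  case True
  hence "{k. a k = 1} = UNIV" using c by (intro card_eq_UNIV_imp_eq_UNIV) auto
  hence "{k. a k ~= 1} = {}" by auto
  thus ?thesis unfolding rho_value[OF ad g h comm] by (simp only: prod.empty)
 next
  case False
  hence "{k. a k = 1} = {}" using c Ix by simp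
  hence "{k. a k ~= 1} = UNIV" by auto
  hence "rho \<xi> h g = (\<Prod>k\<in>UNIV. b k)" unfolding rho_value[OF ad g h comm] by simp
  thus ?thesis using det_diag(2)[OF P] G_facts(3)[OF h] by simp
 qed
qed

lemma one_notin_K: "g \<in> G ==> 1 \<notin> K g"
 using K_vanish_0[of g 1] by auto

lemma sub_one: "sub A 1 = 1"
 by (rule ev_inject) simp

text \<open>Only constants have weight 0, and 1 is outside \<open>K g0\<close> because the elements
  of that ideal vanish at 0.\<close>

lemma constants_dimension:
 assumes P: "presented M Cls usc (Vp x y) ZB" and g0: "g0 \<in> G" "\<And>h. h \<in> G ==> g0 ** h = h ** g0" "Ix g0 = {} \<or> Ix g0 = UNIV"
  and b: "isb g0 x y 0"
  and only: "\<And>g w. g \<in> G ==> w + 2 * (\<Sum>k\<in>Ix g. d k) \<le> d0 * card (Ix g) ==> isb g x y w ==> g = g0"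
 shows "has_dimension M 1"
proof (rule one_sector_dimension[OF P g0(1) _ _ b one_notin_K[OF g0(1)] only])
 show "single g0 1 \<in> Inv"
  by (rule single_Inv[OF g0(1)])
   (use cj_commute[OF G_facts(1)] g0 rho_trivial K_closed(1) in \<open>simp_all add: sub_one\<close>)
 show "wgraded d 0 1" using graded_term_of[of "wdeg d" 0 1] by simp
 fix p :: "'n mpoly" assume "wgraded d 0 p"
 hence "p = cnst (coef p 0)" by (rule graded_wdeg_0[OF d_pos])
 hence "p - cnst (coef p 0) * 1 = 0" by simp
 thus "\<exists>c. p - cnst c * 1 \<in> K g0" using K_closed(1)[OF g0(1)] by metis
qed

lemma dimension_00: "presented M Cls usc (Vp 0 0) ZB ==> has_dimension M 1"
 by (rule constants_dimension[OF _ G_one])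
  (use isb_corner(1) in \<open>auto simp: Ix_one isb_iff matrix_inv_mat_1\<close>)

lemma isb_jm: "isb jm 0 (real CARD('n) - 2) 0"
proof -
 have "sg jm = 1" unfolding sg_eq by (simp add: jm_sector)
 thus ?thesis using age_facts(4)[OF jm_G] unfolding isb_iff by (simp only:) (simp add: jm_sector)
qed

lemma dimension_0D: "presented M Cls usc (Vp 0 (real CARD('n) - 2)) ZB ==> has_dimension M 1"
proof (rule constants_dimension[OF _ jm_G jm_central])
 show "isb jm 0 (real CARD('n) - 2) 0" by (rule isb_jm)
qed (use isb_corner(3) in \<open>auto simp: jm_sector\<close>)

lemma dimension_D0: "presented M Cls usc (Vp (real CARD('n) - 2) 0) ZB ==> has_dimension M 1"
proof (rule constants_dimension[OF _ G_inv[OF jm_G]])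
 have "Ix (matrix_inv jm) = {}" using sector_inv(2)[OF jm_G] by (simp add: jm_sector)
 thus "Ix (matrix_inv jm) = {} \<or> Ix (matrix_inv jm) = UNIV" ..
 show "isb (matrix_inv jm) (real CARD('n) - 2) 0 0" using isb_jm isb_inv[OF jm_G] by simp
 fix h assume h: "h \<in> G"
 have "cj (matrix_inv jm) h = h"
 proof -
  have "cj jm h = h" by (rule cj_commute[OF G_facts(1)[OF jm_G] jm_central[OF h]])
  thus ?thesis using cj_inv_cancel(2)[OF G_facts(1)[OF jm_G], of h] by simp
 qed
 hence "matrix_inv jm ** h ** jm = h" by (simp add: cj_def G_inv_inv[OF jm_G])
 hence "matrix_inv jm ** h ** (jm ** matrix_inv jm) = h ** matrix_inv jm" by (metis matrix_mul_assoc)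
 thus "matrix_inv jm ** h = h ** matrix_inv jm" by (simp add: matrix_inv_cancel[OF G_facts(1)[OF jm_G]])
qed (use isb_corner(4) in auto)

text \<open>In the top weight of the untwisted sector a polynomial with \<open>\<tau> p = 0\<close>
  lies in the ideal, so \<open>\<tau>\<close> detects this piece. As \<open>rho\<close> is 1 on the
  identity, \<open>\<tau>\<close> is invariant, and hence so is the class of
  \<open>r\<close>.\<close>

lemma dimension_DD:
 assumes P: "presented M Cls usc (Vp (real CARD('n) - 2) (real CARD('n) - 2)) ZB"
 shows "has_dimension M 1"
proof -
 obtain \<tau> where \<tau>: "dual_generator \<tau> (K (mat 1))"
   "top_degree d \<tau> (2 * (\<Sum>k\<in>Ix (mat 1). d k)) (d0 * card (Ix (mat 1)))"
   "\<And>h p. h \<in> G ==> mat 1 ** h = h ** mat 1 ==> \<tau> (sub h p) = (rho \<xi> h (mat 1))\<^sup>2 * \<tau> p"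
  using sector_dual[OF G_one] by blast
 have lin: "linear_form \<tau>" and K: "\<And>p. p \<in> K (mat 1) \<longleftrightarrow> (\<forall>r. \<tau> (p * r) = 0)"
  using \<tau>(1) by (auto simp: dual_generator_def)
 have sc: "\<tau> (cnst c * p) = c * \<tau> p" and add: "\<tau> (p + r) = \<tau> p + \<tau> r" for c p r using lin by (auto simp: linear_form_def)
 have diff: "\<tau> (p - cnst c * r) = \<tau> p - c * \<tau> r" for p r c
  using add[of "p - cnst c * r" "cnst c * r"] sc[of c r] by simp
 note D6 = dual_generator_graded(6)[OF \<tau>(1,2), unfolded Ix_one cy]
 have "wgraded d 0 (1 :: 'n mpoly)" using graded_term_of[of "wdeg d" 0 1] by simp
 from D6[OF this one_notin_K[OF G_one]] obtain v r where r: "wgraded d v r" "v + 0 + 2 * d0 = d0 * CARD('n)" "\<tau> (1 * r) ~= 0"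
  by blast
 have top: "p \<in> K (mat 1)" if p: "wgraded d v p" "\<tau> p = 0" for p
 proof (rule ccontr)
  assume "p \<notin> K (mat 1)"
  from D6[OF p(1) this] obtain v' r' where r': "wgraded d v' r'" "v' + v + 2 * d0 = d0 * CARD('n)" "\<tau> (p * r') ~= 0" by blast
  have "v' = 0" using r(2) r'(2) by linarith
  hence "r' = cnst (coef r' 0)" using r'(1) graded_wdeg_0[OF d_pos] by simp
  hence "\<tau> (p * r') = coef r' 0 * \<tau> p" using sc[of "coef r' 0" p] by (metis mult.commute)
  thus False using p(2) r'(3) by simp
 qed
 have gc: "wgraded d v (p - cnst c * s)" if "wgraded d v p" "wgraded d v s" for p s c
  using graded_add[OF that(1) graded_cnst_mult[OF that(2), of "- c"]]
  by (simp add: single_uminus)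
 have comm: "cj h (mat 1) = mat 1" if "h \<in> G" for h by (rule cj_commute[OF G_facts(1)[OF that]]) simp
 show ?thesis
 proof (rule one_sector_dimension[OF P G_one _ r(1)])
  show "single (mat 1) r \<in> Inv"
  proof (rule single_Inv[OF G_one comm])
   show rho1: "rho \<xi> h (mat 1) = 1" if "h \<in> G" for h by (rule rho_trivial[OF G_one that]) (simp_all add: Ix_one)
   fix h assume h: "h \<in> G"
   have one: "cnst 1 * r = r" by (rule ev_inject) simp
   have "wgraded d v (sub h r - cnst 1 * r)" by (rule gc[OF graded_sub[OF G_weights[OF h] r(1)] r(1)])
   moreover have "\<tau> (sub h r - cnst 1 * r) = 0" unfolding diff by (simp add: \<tau>(3)[OF h] rho1[OF h])
   ultimately have "sub h r - cnst 1 * r \<in> K (mat 1)" by (rule top)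
   thus "sub h r - r \<in> K (mat 1)" unfolding one .
  qed
  have "real v + 2 * real d0 = real d0 * real CARD('n)" using r(2) by (metis add_0_right of_nat_add of_nat_mult of_nat_numeral)
  thus "isb (mat 1) (real CARD('n) - 2) (real CARD('n) - 2) v" using d0_pos by (simp add: isb_iff matrix_inv_mat_1 Ix_one field_simps)
  show "r \<notin> K (mat 1)" using K[of r] r(3) by (metis mult.commute)
  show "\<exists>c. p - cnst c * r \<in> K (mat 1)" if p: "wgraded d v p" for p
  proof (intro exI[of _ "\<tau> p / \<tau> r"] top)
   show "wgraded d v (p - cnst (\<tau> p / \<tau> r) * r)" by (rule gc[OF p r(1)])
   show "\<tau> (p - cnst (\<tau> p / \<tau> r) * r) = 0" unfolding diff using r(3) by simp
  qed
 qed (use isb_corner(2) in blast)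
qed

section \<open>Exchange of g and its inverse\<close>

lemma K_inv: "g \<in> G ==> K (matrix_inv g) = K g"
 unfolding K_def jac_ideal_def by (simp only: Fix_matrix_inv[OF G_facts(1)])

text \<open>The factors \<open>c g\<close> compensate for the different generators at
  \<open>g\<close> and its inverse; with those of \<open>rho_inverse\<close> the swap respects
  invariance.\<close>

definition swap :: "(complex ^ 'n ^ 'n => complex) => (complex ^ 'n ^ 'n => 'n mpoly) => complex ^ 'n ^ 'n => 'n mpoly" where
 "swap c U = (%g. cnst (c g) * U (matrix_inv g))"

lemma swap_Vp:
 assumes c: "\<And>g h. g \<in> G ==> h \<in> G ==> rho \<xi> h (matrix_inv g) * c (cj h g) = c g * rho \<xi> h g" and U: "U \<in> Vp x y"
 shows "swap c U \<in> Vp y x"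
proof
 show "swap c U \<in> Inv"
  unfolding Inv_def
 proof (intro CollectI ballI)
  fix h g assume h: "h \<in> G" and g: "g \<in> G"
  have g': "cj h g \<in> G" by (rule G_cj[OF h g])
  have gi: "cj h (matrix_inv g) = matrix_inv (cj h g)" by (rule cj_matrix_inv[OF G_facts(1)[OF h] G_facts(1)[OF g]])
  define k where "k = cnst (rho \<xi> h (matrix_inv g)) * sub (matrix_inv h) (U (matrix_inv g)) - U (matrix_inv (cj h g))"
  have "\<forall>h\<in>G. \<forall>g\<in>G. cnst (rho \<xi> h g) * sub (matrix_inv h) (U g) - U (cj h g) \<in> K (cj h g)" using U by (simp add: Inv_def)
  from bspec[OF bspec[OF this h] G_inv[OF g]] have "k \<in> K (cj h g)" unfolding gi k_def K_inv[OF g'] .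
  hence "cnst (c (cj h g)) * k \<in> K (cj h g)" by (rule K_closed(4)[OF g'])
  also have "cnst (c (cj h g)) * k = cnst (rho \<xi> h g) * sub (matrix_inv h) (swap c U g) - swap c U (cj h g)"
  proof (rule ev_inject)
   fix x
   have "c (cj h g) * (rho \<xi> h (matrix_inv g) * z - z') = rho \<xi> h g * (c g * z) - c (cj h g) * z'" for z z' :: complex
    using c[OF g h] by (simp add: right_diff_distrib) (metis mult.assoc mult.commute)
   thus "ev (cnst (c (cj h g)) * k) x = ev (cnst (rho \<xi> h g) * sub (matrix_inv h) (swap c U g) - swap c U (cj h g)) x"
    by (simp add: k_def swap_def)
  qed
  finally show "cnst (rho \<xi> h g) * sub (matrix_inv h) (swap c U g) - swap c U (cj h g) \<in> K (cj h g)" .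
 qed
 show "swap c U \<in> Pc y x"
  unfolding Pc_def
 proof (intro CollectI ballI)
  fix g assume g: "g \<in> G"
  have "U \<in> Pc x y" using U by simp
  hence "U (matrix_inv g) = 0 \<or> (\<exists>w. isb (matrix_inv g) x y w \<and> wgraded d w (U (matrix_inv g)))"
   using G_inv[OF g] by (simp add: Pc_def)
  thus "swap c U g = 0 \<or> (\<exists>w. isb g y x w \<and> wgraded d w (swap c U g))"
   unfolding swap_def isb_inv[OF g] using graded_cnst_mult by force
 qed
qed

lemma pieces_swap:
 assumes M: "presented M Cls usc (Vp x y) ZB" and N: "presented N Cls usc (Vp y x) ZB"
 shows "isomorphic M N"
proof -
 obtain c where c: "\<And>g. g \<in> G ==> c g ~= 0" "\<And>g h. g \<in> G ==> h \<in> G ==> rho \<xi> h (matrix_inv g) * c (cj h g) = c g * rho \<xi> h g"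
  using rho_inverse by blast
 \<comment> \<open>With these factors \<open>swap c'\<close> inverts \<open>swap c\<close>.\<close>
 define c' where "c' = (%g. inverse (c (matrix_inv g)))"
 have c': "rho \<xi> h (matrix_inv g) * c' (cj h g) = c' g * rho \<xi> h g" if g: "g \<in> G" and h: "h \<in> G" for g h
 proof -
  have "rho \<xi> h g * c (matrix_inv (cj h g)) = c (matrix_inv g) * rho \<xi> h (matrix_inv g)"
   using c(2)[OF G_inv[OF g] h] by (simp add: G_inv_inv[OF g] cj_matrix_inv[OF G_facts(1)[OF h] G_facts(1)[OF g]])
  thus ?thesis using c(1)[OF G_inv[OF g]] c(1)[OF G_inv[OF G_cj[OF h g]]] by (simp add: c'_def field_simps)
 qed
 show ?thesis
 proof (rule presented_isomorphic[OF M N, of "swap c"])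
  show "swap c U \<in> Vp y x" if "U \<in> Vp x y" for U by (rule swap_Vp[OF c(2) that])
  show "swap c (U + V) = swap c U + swap c V" for U V by (simp add: swap_def fun_eq_iff distrib_left)
  show "swap c (usc z U) = usc z (swap c U)" for z U by (simp add: swap_def usc_def fun_eq_iff mult.left_commute)
  show "swap c U \<in> ZB \<longleftrightarrow> U \<in> ZB" for U
  proof
   assume a: "swap c U \<in> ZB"
   have "U g \<in> K g" if g: "g \<in> G" for g
   proof -
    have gi: "matrix_inv g \<in> G" by (rule G_inv[OF g])
    have "cnst (c (matrix_inv g)) * U g \<in> K (matrix_inv g)"
     using a gi by (auto simp: ZB_def swap_def G_inv_inv[OF g] dest!: bspec[OF _ gi])
    hence "cnst (inverse (c (matrix_inv g))) * (cnst (c (matrix_inv g)) * U g) \<in> K g"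
     unfolding K_inv[OF g] by (rule K_closed(4)[OF g])
    moreover have "cnst (inverse (c (matrix_inv g))) * (cnst (c (matrix_inv g)) * U g) = U g"
     by (rule ev_inject) (use c(1)[OF gi] in simp)
    ultimately show ?thesis by simp
   qed
   thus "U \<in> ZB" by (simp add: ZB_def)
  next
   assume a: "U \<in> ZB"
   have "cnst (c g) * U (matrix_inv g) \<in> K g" if g: "g \<in> G" for g
    using a G_inv[OF g] K_inv[OF g] K_closed(4)[OF g] by (auto simp: ZB_def)
   thus "swap c U \<in> ZB" by (simp add: ZB_def swap_def)
  qed
  fix Y assume Y: "Y \<in> Vp y x"
  have "(Y - swap c (swap c' Y)) g \<in> K g" if g: "g \<in> G" for g
  proof -
   have "swap c (swap c' Y) g = Y g"
    by (rule ev_inject) (use c(1)[OF g] in \<open>simp add: swap_def c'_def G_inv_inv[OF g]\<close>)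
   thus ?thesis using K_closed(1)[OF g] by simp
  qed
  hence "Y - swap c (swap c' Y) \<in> ZB" unfolding ZB_def by blast
  moreover have "swap c' Y \<in> Vp x y" by (rule swap_Vp[OF c' Y])
  ultimately show "\<exists>U\<in>Vp x y. Y - swap c U \<in> ZB" by blast
 qed
qed

end

section \<open>Averaging over G and the duality pairing\<close>

context orbifold_gen
begin

text \<open>The sum is not normalized; the factor 1 / card G enters in
  \<open>avg_id\<close>.\<close>

definition avg :: "(complex ^ 'n ^ 'n => 'n mpoly) => complex ^ 'n ^ 'n => 'n mpoly" where
 "avg U = (\<Sum>h\<in>G. hact h U)"

lemma hact_mult:
 assumes h: "h \<in> G" and u: "u \<in> G" and g': "g' \<in> G"
 shows "hact u (hact h U) g' = hact (u ** h) U g'"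
proof -
 define g1 where "g1 = cj (matrix_inv u) g'"
 define g where "g = cj (matrix_inv h) g1"
 have g1: "g1 \<in> G" unfolding g1_def by (rule G_cj[OF G_inv[OF u] g'])
 have g: "g \<in> G" unfolding g_def by (rule G_cj[OF G_inv[OF h] g1])
 have hg: "cj h g = g1" unfolding g_def by (rule cj_inv_cancel(1)[OF G_facts(1)[OF h]])
 have inv: "matrix_inv (u ** h) = matrix_inv h ** matrix_inv u"
  by (rule matrix_inv_mult[OF G_facts(1)[OF u] G_facts(1)[OF h]])
 have gg: "cj (matrix_inv (u ** h)) g' = g"
  unfolding inv g_def g1_def by (rule cj_mult) (use G_facts(1)[OF G_inv] h u in blast)+
 have rho: "rho \<xi> (u ** h) g = rho \<xi> u g1 * rho \<xi> h g" using rho_cocycle[OF g h u] unfolding hg .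
 have "hact u (hact h U) g' = cnst (rho \<xi> u g1) * sub (matrix_inv u) (cnst (rho \<xi> h g) * sub (matrix_inv h) (U g))"
  by (simp add: hact_def g1_def g_def)
 also have "\<dots> = cnst (rho \<xi> (u ** h) g) * sub (matrix_inv (u ** h)) (U g)"
  unfolding inv rho by (rule ev_inject) (simp add: matrix_vector_mul_assoc)
 also have "\<dots> = hact (u ** h) U g'" unfolding hact_def[of "u ** h"] gg ..
 finally show ?thesis .
qed

lemma hact_sum: "hact h (sum u A) = (\<Sum>a\<in>A. hact h (u a))"
proof (induction A rule: infinite_finite_induct)
 case (insert a A)
 thus ?case by (simp only: sum.insert[OF insert.hyps] hact_lin)
qed (simp_all only: sum.infinite sum.empty hact_lin simp_thms)

lemma avg_Inv: "avg U \<in> Inv"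
 unfolding Inv_iff
proof
 fix u assume u: "u \<in> G"
 have ui: "matrix_inv u \<in> G" by (rule G_inv[OF u])
 have c: "matrix_inv u ** (u ** h) = h" "u ** (matrix_inv u ** h) = h" for h :: "complex ^ 'n ^ 'n"
  by (simp_all add: matrix_mul_assoc matrix_inv_cancel[OF G_facts(1)[OF u]])
 have "hact u (avg U) g - avg U g \<in> K g" if g: "g \<in> G" for g
 proof -
  have "hact u (avg U) g = (\<Sum>h\<in>G. hact (u ** h) U g)"
   unfolding avg_def hact_sum sum_fun_apply by (rule sum.cong) (simp_all add: hact_mult u g)
  also have "\<dots> = (\<Sum>h\<in>G. hact h U g)"
   by (rule sum.reindex_bij_witness[where i = "%h. matrix_inv u ** h" and j = "%h. u ** h"])
    (simp_all add: c G_mult u ui)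
  finally show ?thesis using K_closed(1)[OF g] by (simp add: avg_def sum_fun_apply)
 qed
 thus "hact u (avg U) - avg U \<in> ZB" by (simp add: ZB_def)
qed

lemma hact_Pc:
 assumes U: "U \<in> Pc x y" and h: "h \<in> G"
 shows "hact h U \<in> Pc x y"
 unfolding Pc_def
proof (intro CollectI ballI)
 fix g' assume g': "g' \<in> G"
 define g where "g = cj (matrix_inv h) g'"
 have g: "g \<in> G" unfolding g_def by (rule G_cj[OF G_inv[OF h] g'])
 have gg: "cj h g = g'" unfolding g_def by (rule cj_inv_cancel(1)[OF G_facts(1)[OF h]])
 have eq: "hact h U g' = cnst (rho \<xi> h g) * sub (matrix_inv h) (U g)" by (simp add: hact_def g_def)
 have "U g = 0 \<or> (\<exists>w. isb g x y w \<and> wgraded d w (U g))" using U g by (simp add: Pc_def)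
 thus "hact h U g' = 0 \<or> (\<exists>w. isb g' x y w \<and> wgraded d w (hact h U g'))"
 proof
  assume "U g = 0" thus ?thesis by (simp add: eq sub_simps)
 next
  assume "\<exists>w. isb g x y w \<and> wgraded d w (U g)"
  then obtain w where w: "isb g x y w" "wgraded d w (U g)" by blast
  have "wgraded d w (hact h U g')"
   unfolding eq by (rule graded_cnst_mult, rule graded_sub[OF G_weights[OF G_inv[OF h]] w(2)])
  moreover have "isb g' x y w" using w(1) isb_conj[OF g h] gg by simp
  ultimately show ?thesis by blast
 qed
qed

lemma avg_Vp: "U \<in> Pc x y ==> avg U \<in> Vp x y"
proof -
 assume U: "U \<in> Pc x y"
 have "(\<Sum>h\<in>A. hact h U) \<in> Pc x y" if "A \<subseteq> G" for A
  using finite_subset[OF that finite_G] that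
 proof (induction A rule: finite_induct)
  case empty show ?case by (simp add: Pc_def)
 next
  case (insert h A)
  hence "hact h U \<in> Pc x y" "(\<Sum>h\<in>A. hact h U) \<in> Pc x y" using hact_Pc[OF U] by auto
  hence "hact h U + (\<Sum>h\<in>A. hact h U) \<in> Pc x y"
   using subsp_Pc[of x y] unfolding presented.subsp_def[OF presented_Btot] by blast
  thus ?case unfolding sum.insert[OF insert.hyps] .
 qed
 thus ?thesis using avg_Inv unfolding avg_def by blast
qed

lemma ev_of_nat: "ev (of_nat n) x = of_nat n"
 by (induction n) simp_all

lemma avg_id:
 assumes U: "U \<in> Inv"
 shows "U - usc (inverse (of_nat (card G))) (avg U) \<in> ZB"
proof -
 have card: "card G > 0" using G_one finite_G by (auto simp: card_gt_0_iff)
 have "(U - usc (inverse (of_nat (card G))) (avg U)) g \<in> K g" if g: "g \<in> G" for g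
 proof -
  have "(\<Sum>h\<in>G. hact h U g - U g) \<in> K g"
   by (rule K_closed(8)[OF g]) (use U g in \<open>auto simp: Inv_iff ZB_def\<close>)
  hence "cnst (- inverse (of_nat (card G))) * (\<Sum>h\<in>G. hact h U g - U g) \<in> K g" by (rule K_closed(4)[OF g])
  also have "cnst (- inverse (of_nat (card G))) * (\<Sum>h\<in>G. hact h U g - U g) = (U - usc (inverse (of_nat (card G))) (avg U)) g"
   by (rule ev_inject) (use card in \<open>simp add: usc_def avg_def sum_fun_apply sum_subtractf field_simps ev_of_nat\<close>)
  finally show ?thesis .
 qed
 thus ?thesis unfolding ZB_def by blast
qed

lemma avg_lin: "avg (U + V) = avg U + avg V" "avg (usc c U) = usc c (avg U)" "avg 0 = 0"
proof -
 show "avg (U + V) = avg U + avg V" unfolding avg_def hact_lin by (rule sum.distrib)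
 show "avg (usc c U) = usc c (avg U)"
  unfolding avg_def hact_lin by (simp add: usc_def fun_eq_iff sum_fun_apply sum_distrib_left)
 show "avg 0 = 0" unfolding avg_def hact_lin by (rule sum.neutral) simp
qed

lemma avg_cong:
 assumes "\<And>g. g \<in> G ==> U g = V g"
 shows "avg U - avg V \<in> ZB"
proof -
 have "avg U g - avg V g \<in> K g" if g: "g \<in> G" for g
 proof -
  have "hact h U g = hact h V g" if "h \<in> G" for h
   using assms[OF G_cj[OF G_inv[OF that] g]] by (simp add: hact_def)
  hence "avg U g = avg V g" unfolding avg_def sum_fun_apply by (intro sum.cong) auto
  thus ?thesis using K_closed(1)[OF g] by simp
 qed
 thus ?thesis by (simp add: ZB_def)
qed

text \<open>Positive weights leave finitely many monomials per sector and bidegree. Their averages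
  span, as averaging multiplies invariants by card G modulo \<open>ZB\<close>. This is the
  finiteness that \<open>presented_dual\<close> asks for.\<close>

lemma Vp_finitely_spanned:
 "\<exists>S. finite S \<and> S \<subseteq> Vp x y \<and> (\<forall>U\<in>Vp x y. \<exists>c. U - (\<Sum>s\<in>S. usc (c s) s) \<in> ZB)"
proof -
 define Mn where "Mn = (%g. {m. isb g x y (wdeg d m)})"
 have fin: "finite (Mn g)" for g
 proof (cases "\<exists>w. isb g x y w")
  case True
  then obtain w where w: "isb g x y w" by blast
  have "Mn g \<subseteq> {m. \<forall>k. expo m k \<le> w}"
  proof (intro subsetI CollectI allI)
   fix m k assume "m \<in> Mn g"
   hence "wdeg d m = w" using isb_unique w by (auto simp: Mn_def)
   moreover have "d k * expo m k \<le> wdeg d m" unfolding wdeg_def by (rule member_le_sum) auto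
   moreover have "expo m k \<le> d k * expo m k" using d_pos[of k] by simp
   ultimately show "expo m k \<le> w" by linarith
  qed
  thus ?thesis by (rule finite_subset) (rule finite_bounded_expo)
 next
  case False
  hence "Mn g = {}" by (auto simp: Mn_def)
  thus ?thesis by simp
 qed
 define S where "S = (%(g, m). avg (single g (term_of m 1))) ` (SIGMA g:G. Mn g)"
 have S: "finite S" unfolding S_def by (intro finite_imageI finite_SigmaI finite_G fin)
 have SV: "S \<subseteq> Vp x y"
 proof
  fix s assume "s \<in> S"
  then obtain g m where gm: "g \<in> G" "m \<in> Mn g" "s = avg (single g (term_of m 1))" by (auto simp: S_def)
  have "single g (term_of m 1) \<in> Pc x y"
   using gm(2) graded_term_of[of "wdeg d" m 1] by (auto simp: Pc_def single_def Mn_def)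
  thus "s \<in> Vp x y" unfolding gm(3) by (rule avg_Vp)
 qed
 define L where "L = {U. \<exists>c. U - (\<Sum>s\<in>S. usc (c s) s) \<in> ZB}"
 have Ladd: "U + V \<in> L" if UV: "U \<in> L" "V \<in> L" for U V
 proof -
  obtain c c' where c: "U - (\<Sum>s\<in>S. usc (c s) s) \<in> ZB" "V - (\<Sum>s\<in>S. usc (c' s) s) \<in> ZB" using UV unfolding L_def by blast
  have "(\<Sum>s\<in>S. usc (c s + c' s) s) = (\<Sum>s\<in>S. usc (c s) s) + (\<Sum>s\<in>S. usc (c' s) s)"
   unfolding sum.distrib[symmetric] by (rule sum.cong) (auto simp: presented.sc_add[OF presented_Btot])
  hence "U + V - (\<Sum>s\<in>S. usc (c s + c' s) s) = (U - (\<Sum>s\<in>S. usc (c s) s)) + (V - (\<Sum>s\<in>S. usc (c' s) s))"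
   by (simp add: algebra_simps)
  hence "U + V - (\<Sum>s\<in>S. usc (c s + c' s) s) \<in> ZB" using ZB_closed(2)[OF c] by metis
  thus ?thesis unfolding L_def by (intro CollectI exI[of _ "%s. c s + c' s"])
 qed
 have Lsc: "usc z U \<in> L" if U: "U \<in> L" for U z
 proof -
  obtain c where c: "U - (\<Sum>s\<in>S. usc (c s) s) \<in> ZB" using U unfolding L_def by blast
  have "usc z (U - (\<Sum>s\<in>S. usc (c s) s)) = usc z U - (\<Sum>s\<in>S. usc (z * c s) s)"
   by (rule ext) (simp add: usc_def sum_fun_apply right_diff_distrib sum_distrib_left, rule sum.cong,
    simp_all add: presented.sc_mult[OF presented_Btot, unfolded usc_def fun_eq_iff, rule_format])
  hence "usc z U - (\<Sum>s\<in>S. usc (z * c s) s) \<in> ZB" using ZB_closed(3)[OF c, of z] by metis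
  thus ?thesis unfolding L_def by (intro CollectI exI[of _ "%s. z * c s"])
 qed
 have LZ: "V \<in> L" if U: "U \<in> L" and V: "V - U \<in> ZB" for U V
 proof -
  obtain c where c: "U - (\<Sum>s\<in>S. usc (c s) s) \<in> ZB" using U unfolding L_def by blast
  have "V - (\<Sum>s\<in>S. usc (c s) s) = (V - U) + (U - (\<Sum>s\<in>S. usc (c s) s))" by simp
  hence "V - (\<Sum>s\<in>S. usc (c s) s) \<in> ZB" using ZB_closed(2)[OF V c] by metis
  thus ?thesis unfolding L_def by (intro CollectI exI[of _ c])
 qed
 have L0: "0 \<in> L"
 proof -
  have "(\<Sum>s\<in>S. usc 0 s) = 0" by (rule sum.neutral) (simp add: presented.sc_0[OF presented_Btot])
  thus ?thesis unfolding L_def using ZB_closed(1) by (intro CollectI exI[of _ "%_. 0"]) simp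
 qed
 have LS: "s \<in> L" if s: "s \<in> S" for s
 proof -
  have "(\<Sum>s'\<in>S. usc (if s' = s then 1 else 0) s') = (\<Sum>s'\<in>S. if s' = s then s else 0)"
   by (rule sum.cong) (auto simp: presented.sc_0[OF presented_Btot] presented.sc_1[OF presented_Btot])
  also have "\<dots> = s" using S s by simp
  finally have "s - (\<Sum>s'\<in>S. usc (if s' = s then 1 else 0) s') \<in> ZB" using ZB_closed(1) by simp
  thus ?thesis unfolding L_def by (intro CollectI exI[of _ "%s'. if s' = s then 1 else 0"])
 qed
 have mono_L: "avg (single g (term_of m c)) \<in> L" if "g \<in> G" "m \<in> Mn g" for g m c
 proof -
  have "single g (term_of m c) = usc c (single g (term_of m 1))"
   using term_of_eq[of m c] by (auto simp: single_def usc_def fun_eq_iff)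
  thus ?thesis using Lsc[OF LS] that by (auto simp: avg_lin S_def)
 qed
 have sing: "avg (single g p) \<in> L" if g: "g \<in> G" and p: "supp p \<subseteq> Mn g" for g p
 proof -
  have "avg (single g (\<Sum>m\<in>A. term_of m (coef p m))) \<in> L" if "A \<subseteq> supp p" for A
   using finite_subset[OF that finite_keys] that
  proof (induction A rule: finite_induct)
   case empty
   have "single g 0 = 0" by (simp add: single_def fun_eq_iff)
   thus ?case using L0 by (simp only: sum.empty avg_lin)
  next
   case (insert m A)
   have eq: "single g (term_of m (coef p m) + (\<Sum>m\<in>A. term_of m (coef p m))) =
     single g (term_of m (coef p m)) + single g (\<Sum>m\<in>A. term_of m (coef p m))"
    by (simp add: single_def fun_eq_iff)
   have 1: "avg (single g (term_of m (coef p m))) \<in> L" by (rule mono_L[OF g]) (use insert.prems p in auto)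
   have 2: "avg (single g (\<Sum>m\<in>A. term_of m (coef p m))) \<in> L" by (rule insert.IH) (use insert.prems in blast)
   show ?case unfolding sum.insert[OF insert.hyps] eq avg_lin(1) by (rule Ladd[OF 1 2])
  qed
  from this[of "supp p"] show ?thesis using mpoly_eq_sum[of p] by simp
 qed
 have "U \<in> L" if U: "U \<in> Vp x y" for U
 proof -
  have sp: "supp (U g) \<subseteq> Mn g" if g: "g \<in> G" for g
  proof -
   have "U g = 0 \<or> (\<exists>w. isb g x y w \<and> wgraded d w (U g))" using U g by (simp add: Pc_def)
   thus ?thesis by (auto simp: Mn_def graded_def)
  qed
  have "avg (\<Sum>g\<in>A. single g (U g)) \<in> L" if "A \<subseteq> G" for A
   using finite_subset[OF that finite_G] that
  proof (induction A rule: finite_induct)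
   case empty show ?case using L0 avg_lin(3) by (simp only: sum.empty)
  next
   case (insert g A)
   hence g: "g \<in> G" and A: "A \<subseteq> G" by auto
   show ?case unfolding sum.insert[OF insert.hyps] avg_lin
    by (rule Ladd[OF sing[OF g sp[OF g]] insert.IH[OF A]])
  qed
  from this[OF subset_refl] have 1: "avg (\<Sum>g\<in>G. single g (U g)) \<in> L" .
  have "avg U - avg (\<Sum>g\<in>G. single g (U g)) \<in> ZB"
   by (rule avg_cong) (use finite_G in \<open>simp add: sum_fun_apply single_def\<close>)
  hence "avg U \<in> L" by (rule LZ[OF 1])
  hence "usc (inverse (of_nat (card G))) (avg U) \<in> L" by (rule Lsc)
  moreover have "U - usc (inverse (of_nat (card G))) (avg U) \<in> ZB" by (rule avg_id) (use U in simp)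
  ultimately show ?thesis by (rule LZ)
 qed
 from this[unfolded L_def mem_Collect_eq] show ?thesis by (intro exI[of _ S] conjI ballI S SV)
qed

text \<open>The predicate in the choice is the same for all members of a conjugacy class, so they
  get the same representative, see \<open>rep_cj\<close>.\<close>

definition rep :: "complex ^ 'n ^ 'n => complex ^ 'n ^ 'n" where
 "rep g = (SOME x. \<exists>h\<in>G. x = cj h g)"

lemma rep_ex: "\<exists>h\<in>G. rep g = cj h g"
 unfolding rep_def by (rule someI_ex) (use G_one in blast)

lemma rep_G: "g \<in> G ==> rep g \<in> G"
 using rep_ex[of g] G_cj by auto

lemma rep_cj:
 assumes h: "h \<in> G"
 shows "rep (cj h g) = rep g"
proof -
 have "(\<exists>u\<in>G. x = cj u (cj h g)) \<longleftrightarrow> (\<exists>u\<in>G. x = cj u g)" for x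
 proof
  assume "\<exists>u\<in>G. x = cj u (cj h g)"
  then obtain u where u: "u \<in> G" "x = cj u (cj h g)" by blast
  have "x = cj (u ** h) g" using u by (simp add: cj_mult G_facts(1) h)
  thus "\<exists>u\<in>G. x = cj u g" using G_mult[OF u(1) h] by blast
 next
  assume "\<exists>u\<in>G. x = cj u g"
  then obtain u where u: "u \<in> G" "x = cj u g" by blast
  have "x = cj (u ** matrix_inv h) (cj h g)"
   using cj_mult[OF G_facts(1)[OF u(1)] G_facts(1)[OF G_inv[OF h]], of "cj h g"] u
   by (simp add: cj_inv_cancel(2)[OF G_facts(1)[OF h]])
  thus "\<exists>u\<in>G. x = cj u (cj h g)" using G_mult[OF u(1) G_inv[OF h]] by blast
 qed
 thus ?thesis by (simp only: rep_def)
qed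

lemma rep_rep: "rep (rep g) = rep g"
proof -
 obtain h where h: "h \<in> G" "rep g = cj h g" using rep_ex by blast
 show ?thesis using rep_cj[OF h(1), of g] unfolding h(2)[symmetric] .
qed

text \<open>One summand per conjugacy class; the other sectors are determined by invariance.\<close>

definition pairing :: "(complex ^ 'n ^ 'n => 'n mpoly => complex) => (complex ^ 'n ^ 'n => 'n mpoly) =>
  (complex ^ 'n ^ 'n => 'n mpoly) => complex" where
 "pairing \<tau> U V = (\<Sum>g\<in>rep ` G. \<tau> g (U g * V g))"

definition sector_functionals :: "(complex ^ 'n ^ 'n => 'n mpoly => complex) => bool" where
 "sector_functionals \<tau> \<longleftrightarrow> (\<forall>g\<in>G. dual_generator (\<tau> g) (K g) \<and> top_degree d (\<tau> g) (2 * (\<Sum>k\<in>Ix g. d k)) (d0 * card (Ix g)) \<and>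
  (\<forall>h p. h \<in> G --> g ** h = h ** g --> \<tau> g (sub h p) = (rho \<xi> h g)\<^sup>2 * \<tau> g p))"

lemma sector_functionalsD:
 assumes "sector_functionals \<tau>" "g \<in> G"
 shows "dual_generator (\<tau> g) (K g)" "top_degree d (\<tau> g) (2 * (\<Sum>k\<in>Ix g. d k)) (d0 * card (Ix g))"
  "h \<in> G ==> g ** h = h ** g ==> \<tau> g (sub h p) = (rho \<xi> h g)\<^sup>2 * \<tau> g p" "linear_form (\<tau> g)"
  "p \<in> K g ==> \<tau> g (p * r) = 0"
 using assms by (simp_all add: sector_functionals_def dual_generator_def)

text \<open>Duality in the sector of a representative \<open>g0\<close> supplies \<open>r\<close>
  with nonzero value, and the average of \<open>single g0 r\<close> is the partner. Only elements of
  the centralizer of \<open>g0\<close> contribute, all with the same value, so nothing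
  cancels.\<close>

lemma pairing_nondegenerate:
 assumes \<tau>: "sector_functionals \<tau>" and U: "U \<in> Vp x y" "U \<notin> ZB"
 shows "\<exists>V\<in>Vp (real CARD('n) - 2 - y) (real CARD('n) - 2 - x). pairing \<tau> U V ~= 0"
proof -
 obtain g where g: "g \<in> G" "U g \<notin> K g" using U(2) by (auto simp: ZB_def)
 obtain h where h: "h \<in> G" "rep g = cj h g" using rep_ex by blast
 define g0 where "g0 = rep g"
 have g0: "g0 \<in> G" "rep g0 = g0" unfolding g0_def using rep_G[OF g(1)] rep_rep by auto
 have inv: "cnst (rho \<xi> h g) * sub (matrix_inv h) (U g) - U (cj h g) \<in> K (cj h g)" if "h \<in> G" "g \<in> G" for h g
  using U(1) that by (simp add: Inv_def)
 have Ug0: "U g0 \<notin> K g0"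
 proof
  assume a: "U g0 \<in> K g0"
  have "cnst (rho \<xi> h g) * sub (matrix_inv h) (U g) - U g0 \<in> K g0" using inv[OF h(1) g(1)] h(2) by (simp add: g0_def)
  from K_closed(2)[OF g0(1) this a] have "cnst (rho \<xi> h g) * sub (matrix_inv h) (U g) \<in> K g0" by simp
  hence "cnst (inverse (rho \<xi> h g)) * (cnst (rho \<xi> h g) * sub (matrix_inv h) (U g)) \<in> K g0" by (rule K_closed(4)[OF g0(1)])
  moreover have "cnst (inverse (rho \<xi> h g)) * (cnst (rho \<xi> h g) * sub (matrix_inv h) (U g)) = sub (matrix_inv h) (U g)"
   by (rule ev_inject) (use rho_nz[OF g(1) h(1)] in simp)
  ultimately have "sub (matrix_inv h) (U g) \<in> K (cj h g)" using h(2) by (simp add: g0_def)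
  thus False using K_cj[OF g(1) h(1)] g(2) by simp
 qed
 obtain w where w: "isb g0 x y w" "wgraded d w (U g0)" using Vp_sector[OF U(1) g0(1) Ug0] by blast
 note t = sector_functionalsD(1,2)[OF \<tau> g0(1)] and th = sector_functionalsD(3)[OF \<tau> g0(1)]
 note lin = sector_functionalsD(4)[OF \<tau> g0(1)] and Kt = sector_functionalsD(5)[OF \<tau> g0(1)]
 from dual_generator_graded(6)[OF t w(2) Ug0] obtain v r where r: "wgraded d v r"
  "v + w + 2 * (\<Sum>k\<in>Ix g0. d k) = d0 * card (Ix g0)" "\<tau> g0 (U g0 * r) ~= 0" by blast
 \<comment> \<open>Complementary weights in the sector become the bidegree (D - y, D - x) through
   the sum of the two ages.\<close>
 have b: "isb g0 (real CARD('n) - 2 - y) (real CARD('n) - 2 - x) v"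
 proof -
  have "real v + real w + 2 * real (\<Sum>k\<in>Ix g0. d k) = real d0 * real (card (Ix g0))"
   using arg_cong[OF r(2), of real] by (simp del: of_nat_sum)
  hence "real v / real d0 + real w / real d0 = real (card (Ix g0)) - 2 + 2 * sg g0"
   unfolding sg_eq using d0_pos by (simp add: field_simps del: of_nat_sum)
  thus ?thesis using w(1) age_facts(4)[OF g0(1)] unfolding isb_iff by linarith
 qed
 have "single g0 r \<in> Pc (real CARD('n) - 2 - y) (real CARD('n) - 2 - x)" using b r(1) by (auto simp: Pc_def single_def)
 hence V: "avg (single g0 r) \<in> Vp (real CARD('n) - 2 - y) (real CARD('n) - 2 - x)" by (rule avg_Vp)
 have other: "avg (single g0 r) g' = 0" if g': "g' \<in> rep ` G" "g' ~= g0" for g'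
 proof -
  have "hact h (single g0 r) g' = 0" if h: "h \<in> G" for h
  proof -
   have "cj (matrix_inv h) g' ~= g0"
   proof
    assume "cj (matrix_inv h) g' = g0"
    hence "rep g0 = rep g'" using rep_cj[OF G_inv[OF h], of g'] by simp
    thus False using g' g0(2) rep_rep by auto
   qed
   thus ?thesis by (simp add: hact_def single_def sub_simps)
  qed
  thus ?thesis unfolding avg_def sum_fun_apply by (intro sum.neutral) blast
 qed
 define C where "C = {h \<in> G. cj (matrix_inv h) g0 = g0}"
 have C1: "mat 1 \<in> C" by (simp add: C_def G_one matrix_inv_mat_1)
 have Cfin: "finite C" using finite_G by (simp add: C_def)
 \<comment> \<open>One factor \<open>rho\<close> comes from the averaged element and one from the
   invariance of \<open>U\<close>; their product is the character of \<open>\<tau> g0\<close> under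
   \<open>h\<close>.\<close>
 have Cterm: "\<tau> g0 (U g0 * hact h (single g0 r) g0) = (if h \<in> C then \<tau> g0 (U g0 * r) else 0)" if h: "h \<in> G" for h
 proof (cases "h \<in> C")
  case False
  hence "hact h (single g0 r) g0 = 0" using h by (simp add: C_def hact_def single_def sub_simps)
  thus ?thesis using False linear_form_0[OF lin] by simp
 next
  case True
  hence hi: "cj (matrix_inv h) g0 = g0" by (simp add: C_def)
  have hc: "cj h g0 = g0" using cj_inv_cancel(1)[OF G_facts(1)[OF h], of g0] unfolding hi .
  have comm: "g0 ** h = h ** g0"
  proof -
   have "h ** g0 ** (matrix_inv h ** h) = g0 ** h" using hc by (simp add: cj_def matrix_mul_assoc)
   thus ?thesis by (simp add: matrix_inv_cancel[OF G_facts(1)[OF h]])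
  qed
  define R where "R = rho \<xi> h g0"
  define s where "s = cnst R * sub (matrix_inv h) r"
  define k where "k = cnst R * sub (matrix_inv h) (U g0) - U g0"
  have k: "k \<in> K g0" using inv[OF h g0(1)] by (simp add: k_def R_def hc)
  have hs: "hact h (single g0 r) g0 = s" by (simp add: hact_def hi single_def s_def R_def)
  have "U g0 * s = cnst R * sub (matrix_inv h) (U g0) * s - k * s" by (simp add: k_def algebra_simps)
  hence "\<tau> g0 (U g0 * s) = \<tau> g0 (cnst R * sub (matrix_inv h) (U g0) * s) - \<tau> g0 (k * s)"
   by (simp only: linear_form_diff[OF lin])
  also have "\<tau> g0 (k * s) = 0" by (rule Kt[OF k])
  also have "cnst R * sub (matrix_inv h) (U g0) * s = cnst (R\<^sup>2) * sub (matrix_inv h) (U g0 * r)"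
   by (rule ev_inject) (simp add: s_def power2_eq_square)
  also have "\<tau> g0 (cnst (R\<^sup>2) * sub (matrix_inv h) (U g0 * r)) = R\<^sup>2 * \<tau> g0 (sub (matrix_inv h) (U g0 * r))"
   using lin unfolding linear_form_def by blast
  also have "\<dots> = \<tau> g0 (sub h (sub (matrix_inv h) (U g0 * r)))" unfolding R_def by (rule th[OF h comm, symmetric])
  also have "sub h (sub (matrix_inv h) (U g0 * r)) = U g0 * r"
   by (simp add: sub_sub matrix_inv_cancel[OF G_facts(1)[OF h]])
  finally show ?thesis using True by (simp add: hs)
 qed
 have "pairing \<tau> U (avg (single g0 r)) = (\<Sum>g\<in>rep ` G. if g = g0 then \<tau> g0 (U g0 * avg (single g0 r) g0) else 0)"
  unfolding pairing_def
 proof (rule sum.cong)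
  fix g' assume g': "g' \<in> rep ` G"
  hence "g' \<in> G" using rep_G by auto
  hence "linear_form (\<tau> g')" by (rule sector_functionalsD(4)[OF \<tau>])
  thus "\<tau> g' (U g' * avg (single g0 r) g') = (if g' = g0 then \<tau> g0 (U g0 * avg (single g0 r) g0) else 0)"
   using other[OF g'] by (auto simp: linear_form_0)
 qed simp
 also have "\<dots> = \<tau> g0 (U g0 * avg (single g0 r) g0)" using finite_G g(1) by (auto simp: g0_def)
 also have "U g0 * avg (single g0 r) g0 = (\<Sum>h\<in>G. U g0 * hact h (single g0 r) g0)"
  unfolding avg_def sum_fun_apply sum_distrib_left ..
 also have "\<tau> g0 \<dots> = (\<Sum>h\<in>G. if h \<in> C then \<tau> g0 (U g0 * r) else 0)"
  unfolding linear_form_sum[OF lin] by (rule sum.cong) (simp_all add: Cterm)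
 also have "\<dots> = of_nat (card C) * \<tau> g0 (U g0 * r)"
 proof -
  have "C \<subseteq> G" by (auto simp: C_def)
  hence "G \<inter> {h. h \<in> C} = C" by auto
  thus ?thesis using finite_G by (simp add: sum.If_cases)
 qed
 finally have "pairing \<tau> U (avg (single g0 r)) ~= 0" using r(3) C1 Cfin by auto
 thus ?thesis using V by blast
qed

lemma pieces_dual:
 assumes M: "presented M Cls usc (Vp x y) ZB" and N: "presented N Cls usc (Vp (real CARD('n) - 2 - y) (real CARD('n) - 2 - x)) ZB"
 shows "isomorphic M (dual N)"
proof -
 have "\<forall>g\<in>G. \<exists>t. dual_generator t (K g) \<and> top_degree d t (2 * (\<Sum>k\<in>Ix g. d k)) (d0 * card (Ix g)) \<and>
  (\<forall>h p. h \<in> G --> g ** h = h ** g --> t (sub h p) = (rho \<xi> h g)\<^sup>2 * t p)"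
  by (intro ballI sector_dual)
 hence "\<exists>\<tau>. sector_functionals \<tau>" unfolding sector_functionals_def by (rule bchoice)
 then obtain \<tau> where \<tau>: "sector_functionals \<tau>" by (rule exE)
 have G: "g \<in> G" if "g \<in> rep ` G" for g using that rep_G by auto
 note lin = sector_functionalsD(4)[OF \<tau> G] and Kt = sector_functionalsD(5)[OF \<tau> G]
 have comm: "pairing \<tau> U V = pairing \<tau> V U" for U V unfolding pairing_def by (simp add: mult.commute)
 have add: "pairing \<tau> (U + U') V = pairing \<tau> U V + pairing \<tau> U' V" for U U' V
  unfolding pairing_def sum.distrib[symmetric]
 proof (rule sum.cong)
  fix g assume "g \<in> rep ` G"
  hence "\<tau> g (U g * V g + U' g * V g) = \<tau> g (U g * V g) + \<tau> g (U' g * V g)" using lin[of g] by (simp only: linear_form_def simp_thms)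
  thus "\<tau> g ((U + U') g * V g) = \<tau> g (U g * V g) + \<tau> g (U' g * V g)" by (simp add: distrib_right)
 qed simp
 have sc: "pairing \<tau> (usc c U) V = c * pairing \<tau> U V" for c U V
  unfolding pairing_def sum_distrib_left
 proof (rule sum.cong)
  fix g assume "g \<in> rep ` G"
  hence "\<tau> g (cnst c * (U g * V g)) = c * \<tau> g (U g * V g)" using lin[of g] by (simp only: linear_form_def simp_thms)
  thus "\<tau> g (usc c U g * V g) = c * \<tau> g (U g * V g)" by (simp add: usc_def mult.assoc)
 qed simp
 have zero: "pairing \<tau> U V = 0" if "U \<in> ZB" for U V
  unfolding pairing_def
 proof (rule sum.neutral, rule ballI)
  fix g assume g: "g \<in> rep ` G"
  hence "U g \<in> K g" using that G by (simp add: ZB_def)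
  thus "\<tau> g (U g * V g) = 0" by (rule Kt[OF g])
 qed
 obtain S where S: "finite S" "S \<subseteq> Vp (real CARD('n) - 2 - y) (real CARD('n) - 2 - x)" "\<And>U. U \<in> Vp (real CARD('n) - 2 - y) (real CARD('n) - 2 - x) ==> \<exists>c. U - (\<Sum>s\<in>S. usc (c s) s) \<in> ZB"
  using Vp_finitely_spanned[of "(real CARD('n) - 2) - y" "(real CARD('n) - 2) - x"] by blast
 have nd: "U \<in> ZB \<longleftrightarrow> (\<forall>V\<in>Vp (real CARD('n) - 2 - y) (real CARD('n) - 2 - x). pairing \<tau> U V = 0)" if U: "U \<in> Vp x y" for U x y
 proof
  show "\<forall>V\<in>Vp (real CARD('n) - 2 - y) (real CARD('n) - 2 - x). pairing \<tau> U V = 0" if "U \<in> ZB"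
   by (rule ballI, rule zero[OF that])
  assume a: "\<forall>V\<in>Vp (real CARD('n) - 2 - y) (real CARD('n) - 2 - x). pairing \<tau> U V = 0"
  show "U \<in> ZB"
  proof (rule ccontr)
   assume "U \<notin> ZB"
   from pairing_nondegenerate[OF \<tau> U this] a show False by blast
  qed
 qed
 show ?thesis
 proof (rule presented_dual[OF M N, where B = "pairing \<tau>" and S = S])
  show "pairing \<tau> U (V + V') = pairing \<tau> U V + pairing \<tau> U V'" for U V V' by (simp only: comm[of U] add)
  show "pairing \<tau> U (usc c V) = c * pairing \<tau> U V" for c U V by (simp only: comm[of U] sc)
  show "U \<in> ZB \<longleftrightarrow> (\<forall>V\<in>Vp (real CARD('n) - 2 - y) (real CARD('n) - 2 - x). pairing \<tau> U V = 0)" if U: "U \<in> Vp x y" for U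
   by (rule nd[OF U])
  show "V \<in> ZB \<longleftrightarrow> (\<forall>U\<in>Vp x y. pairing \<tau> U V = 0)" if V: "V \<in> Vp (real CARD('n) - 2 - y) (real CARD('n) - 2 - x)" for V
  proof -
   \<comment> \<open>The reflection of bidegrees is an involution, so \<open>nd\<close> covers both
     kernels of the pairing.\<close>
   have xy: "(real CARD('n) - 2) - ((real CARD('n) - 2) - x) = x" "(real CARD('n) - 2) - ((real CARD('n) - 2) - y) = y" by simp_all
   have "V \<in> ZB \<longleftrightarrow> (\<forall>U\<in>Vp x y. pairing \<tau> V U = 0)"
    using nd[OF V] unfolding xy .
   thus ?thesis by (simp only: comm[of V])
  qed
  show "pairing \<tau> (U + U') V = pairing \<tau> U V + pairing \<tau> U' V" for U U' V by (rule add)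
  show "pairing \<tau> (usc c U) V = c * pairing \<tau> U V" for c U V by (rule sc)
  show "\<exists>c. U - (\<Sum>s\<in>S. usc (c s) s) \<in> ZB" if "U \<in> Vp (real CARD('n) - 2 - y) (real CARD('n) - 2 - x)" for U
   by (rule S(3)[OF that])
 qed (rule S(1), rule S(2))
qed

section \<open>Decomposition by integral bidegrees\<close>

definition comp :: "int \<times> int => (complex ^ 'n ^ 'n => 'n mpoly) => complex ^ 'n ^ 'n => 'n mpoly" where
 "comp i U = (%g. filt (%m. isb g (of_int (fst i)) (of_int (snd i)) (wdeg d m)) (U g))"

abbreviation isi :: "complex ^ 'n ^ 'n => int \<times> int => nat => bool" where
 "isi g i w \<equiv> isb g (of_int (fst i)) (of_int (snd i)) w"

abbreviation Vi :: "int \<times> int => (complex ^ 'n ^ 'n => 'n mpoly) set" where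
 "Vi i \<equiv> Vp (of_int (fst i)) (of_int (snd i))"

lemma isi_functional: "isi g i w ==> isi g j w ==> i = j"
 by (auto simp: isb_iff prod_eq_iff)

text \<open>A sector has at most one weight of a given bidegree, so the projection is a single
  weight component.\<close>

lemma comp_eq: "comp i U g = (if \<exists>w. isi g i w then wpart d (SOME w. isi g i w) (U g) else 0)"
proof (cases "\<exists>w. isi g i w")
 case True
 define w0 where "w0 = (SOME w. isi g i w)"
 have s: "isi g i w0" unfolding w0_def using True by (rule someI_ex)
 have eq: "isi g i (wdeg d m) \<longleftrightarrow> wdeg d m = w0" for m
 proof
  show "isi g i (wdeg d m) ==> wdeg d m = w0" by (rule isb_unique[OF _ s])
  show "wdeg d m = w0 ==> isi g i (wdeg d m)" using s by simp
 qed
 have "comp i U g = wpart d w0 (U g)" unfolding comp_def eq ..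
 thus ?thesis unfolding w0_def if_P[OF True] .
next
 case False
 hence "comp i U g = 0" unfolding comp_def by (intro filt_eq_0) blast
 thus ?thesis unfolding if_not_P[OF False] .
qed

lemma comp_Vi: "U \<in> Inv ==> comp i U \<in> Vi i"
proof
 assume U: "U \<in> Inv"
 show "comp i U \<in> Pc (of_int (fst i)) (of_int (snd i))"
  unfolding Pc_def
 proof (intro CollectI ballI)
  fix g
  show "comp i U g = 0 \<or> (\<exists>w. isi g i w \<and> wgraded d w (comp i U g))"
  proof (cases "\<exists>w. isi g i w")
   case True
   have "isi g i (SOME w. isi g i w)" using True by (rule someI_ex)
   moreover have "wgraded d (SOME w. isi g i w) (comp i U g)"
    unfolding comp_eq using True by (simp del: graded_filt) (rule graded_filt)
   ultimately show ?thesis by blast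
  qed (simp add: comp_eq)
 qed
 show "comp i U \<in> Inv"
  unfolding Inv_def
 proof (intro CollectI ballI)
  fix h g assume h: "h \<in> G" and g: "g \<in> G"
  define k where "k = cnst (rho \<xi> h g) * sub (matrix_inv h) (U g) - U (cj h g)"
  have k: "k \<in> K (cj h g)" using U h g by (simp add: Inv_def k_def)
  have same: "isb (cj h g) a b = isb g a b" for a b by (rule ext) (rule isb_conj[OF g h])
  show "cnst (rho \<xi> h g) * sub (matrix_inv h) (comp i U g) - comp i U (cj h g) \<in> K (cj h g)"
  proof (cases "\<exists>w. isi g i w")
   case False
   thus ?thesis using K_closed(1)[OF G_cj[OF h g]] by (simp add: comp_eq same sub_simps)
  next
   case True
   define w where "w = (SOME w. isi g i w)"
   have c: "comp i U g = wpart d w (U g)" "comp i U (cj h g) = wpart d w (U (cj h g))"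
    using True by (simp_all add: comp_eq same w_def)
   have ws: "wpart d w (sub (matrix_inv h) (U g)) = sub (matrix_inv h) (wpart d w (U g))"
    by (rule wpart_sub) (rule G_weights[OF G_inv[OF h]])
   have "wpart d w k \<in> K (cj h g)" by (rule K_closed(6)[OF G_cj[OF h g] k])
   thus ?thesis unfolding k_def filt_diff wpart_cnst ws c .
  qed
 qed
qed

lemma comp_ZB: "U \<in> ZB ==> comp i U \<in> ZB"
proof -
 assume U: "U \<in> ZB"
 have "comp i U g \<in> K g" if g: "g \<in> G" for g
  unfolding comp_eq using K_closed(1,6)[OF g] U g by (auto simp: ZB_def)
 thus ?thesis by (simp add: ZB_def)
qed

lemma comp_other:
 assumes U: "U \<in> Vi i" and g: "g \<in> G"
 shows "comp j U g = (if j = i then U g else 0)"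
proof -
 have "U g = 0 \<or> (\<exists>w. isi g i w \<and> wgraded d w (U g))" using U g by (simp add: Pc_def)
 thus ?thesis
 proof
  assume "U g = 0" thus ?thesis by (simp add: comp_def)
 next
  assume "\<exists>w. isi g i w \<and> wgraded d w (U g)"
  then obtain w where w: "isi g i w" "wgraded d w (U g)" by blast
  have m: "wdeg d m = w" if "m \<in> supp (U g)" for m using w(2) that by (simp add: graded_def)
  show ?thesis
  proof (cases "j = i")
   case True
   thus ?thesis unfolding comp_def using w(1) m by (simp add: filt_id)
  next
   case False
   have "\<not> isi g j w" using isi_functional[OF w(1)] False by blast
   hence "comp j U g = 0" unfolding comp_def using m by (intro filt_eq_0) auto
   thus ?thesis using False by simp
  qed
 qed
qed

lemma comp_finite: "finite {i. \<exists>g\<in>G. comp i U g ~= 0}"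
proof (rule finite_imageD)
 let ?\<phi> = "%i :: int \<times> int. (real_of_int (fst i), real_of_int (snd i))"
 show "inj_on ?\<phi> {i. \<exists>g\<in>G. comp i U g ~= 0}" by (auto intro!: inj_onI simp: prod_eq_iff)
 have "?\<phi> ` {i. \<exists>g\<in>G. comp i U g ~= 0} \<subseteq> (%(g, m). bideg q Ix g (real (wdeg d m) / real d0)) ` (SIGMA g:G. supp (U g))"
 proof
  fix z assume "z \<in> ?\<phi> ` {i. \<exists>g\<in>G. comp i U g ~= 0}"
  then obtain i g where i: "z = ?\<phi> i" "g \<in> G" "comp i U g ~= 0" by blast
  have "\<exists>m\<in>supp (U g). isi g i (wdeg d m)"
  proof (rule ccontr)
   assume "\<not> (\<exists>m\<in>supp (U g). isi g i (wdeg d m))"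
   hence "comp i U g = 0" unfolding comp_def by (intro filt_eq_0) blast
   thus False using i(3) by contradiction
  qed
  then obtain m where m: "m \<in> supp (U g)" "isi g i (wdeg d m)" by blast
  hence "z = bideg q Ix g (real (wdeg d m) / real d0)" by (simp add: isb_def i(1))
  thus "z \<in> (%(g, m). bideg q Ix g (real (wdeg d m) / real d0)) ` (SIGMA g:G. supp (U g))"
   using m(1) i(2) by force
 qed
 moreover have "finite (SIGMA g:G. supp (U g))" using finite_G by (intro finite_SigmaI) auto
 ultimately show "finite (?\<phi> ` {i. \<exists>g\<in>G. comp i U g ~= 0})" by (rule finite_subset[OF _ finite_imageI])
qed

lemma wpart_comp: "wpart d w (comp i U g) = (if isi g i w then wpart d w (U g) else 0)"
 by (rule poly_mapping_eqI) (auto simp: comp_def)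

text \<open>By \<open>Inv_integral\<close> and the integrality of ages, a weight component outside
  \<open>K g\<close> has an integral bidegree and so occurs in exactly one \<open>comp i U\<close>;
  the others are in \<open>K g\<close> already.\<close>

lemma comp_sum_eq:
 assumes U: "U \<in> Inv" and A: "finite A" "\<And>i. comp i U \<notin> ZB ==> i \<in> A"
 shows "U - (\<Sum>i\<in>A. comp i U) \<in> ZB"
proof -
 have "U g - (\<Sum>i\<in>A. comp i U g) \<in> K g" if g: "g \<in> G" for g
 proof -
  define P where "P = U g - (\<Sum>i\<in>A. comp i U g)"
  have "wpart d w P \<in> K g" for w
  proof (cases "wpart d w (U g) \<in> K g")
   case True
   have "(\<Sum>i\<in>A. wpart d w (comp i U g)) \<in> K g"
    by (rule K_closed(8)[OF g]) (use True K_closed(1)[OF g] in \<open>auto simp: wpart_comp\<close>)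
   thus ?thesis unfolding P_def filt_diff filt_sum by (rule K_closed(5)[OF g True])
  next
   case False
   have "real w / real d0 - sg g \<in> \<int>" by (rule Inv_integral[OF U g False])
   hence "real w / real d0 - sg g + age g \<in> \<int>" "real w / real d0 - sg g + age (matrix_inv g) \<in> \<int>"
    using age_facts(1)[OF g] age_facts(1)[OF G_inv[OF g]] by auto
   then obtain p r where "real w / real d0 - sg g + age g = of_int p" "real w / real d0 - sg g + age (matrix_inv g) = of_int r"
    by (auto elim!: Ints_cases)
   hence i: "isi g (p, r) w" by (simp add: isb_iff)
   have "comp (p, r) U \<notin> ZB"
   proof
    assume "comp (p, r) U \<in> ZB"
    hence "comp (p, r) U g \<in> K g" using g by (simp add: ZB_def)
    hence "wpart d w (comp (p, r) U g) \<in> K g" by (rule K_closed(6)[OF g])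
    thus False using False i by (simp add: wpart_comp)
   qed
   hence pr: "(p, r) \<in> A" by (rule A(2))
   have "(\<Sum>i\<in>A. wpart d w (comp i U g)) = (\<Sum>i\<in>A. if i = (p, r) then wpart d w (U g) else 0)"
    by (rule sum.cong) (use i isi_functional in \<open>auto simp: wpart_comp\<close>)
   also have "\<dots> = wpart d w (U g)" using A(1) pr by simp
   finally show ?thesis unfolding P_def filt_diff filt_sum using K_closed(1)[OF g] by simp
  qed
  hence "(\<Sum>w\<in>wdeg d ` supp P. wpart d w P) \<in> K g" by (intro K_closed(8)[OF g])
  thus ?thesis using sum_wpart[of P d] by (simp add: P_def)
 qed
 thus ?thesis by (simp add: ZB_def sum_fun_apply)
qed

text \<open>Existence is \<open>comp_sum_eq\<close>. For uniqueness, \<open>comp j\<close> is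
  applied to the difference of two decompositions: it respects \<open>ZB\<close> and picks out the
  j-th summand.\<close>

lemma direct_sum:
 "internal_direct_sum (B_model (ev fp) G \<xi>) (%i. Cls ` Vi i)"
proof -
 let ?B = "B_model (ev fp) G \<xi>"
 interpret P: presented ?B Cls usc Inv ZB by (rule presented_B_model)
 have V0: "0 \<in> Vi i" for i using subsp_Vp by (simp add: P.subsp_def)
 have fs: "finsum ?B v A = Cls (\<Sum>i\<in>A. u i)" if "finite A" "\<And>i. u i \<in> Vi i" "\<And>i. v i = Cls (u i)"
  for A v and u :: "int \<times> int => complex ^ 'n ^ 'n => 'n mpoly"
  by (rule P.finsum_pr) (use that in auto)
 have "\<exists>!v. (\<forall>i. v i \<in> Cls ` Vi i) \<and> finite {i. v i ~= \<zero>\<^bsub>?B\<^esub>} \<and> s = finsum ?B v {i. v i ~= \<zero>\<^bsub>?B\<^esub>}"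
  if s: "s \<in> carrier ?B" for s
 proof -
  obtain U where U: "U \<in> Inv" "s = Cls U" using s by (auto simp: P.carrier)
  define v where "v = (%i. Cls (comp i U))"
  have cV: "comp i U \<in> Vi i" for i by (rule comp_Vi[OF U(1)])
  have v0: "v i ~= \<zero>\<^bsub>?B\<^esub> \<longleftrightarrow> comp i U \<notin> ZB" for i
   unfolding v_def using P.pr_eq_0[of "comp i U"] cV by blast
  have fin: "finite {i. v i ~= \<zero>\<^bsub>?B\<^esub>}"
  proof (rule finite_subset[OF _ comp_finite[of U]], rule subsetI)
   fix i assume "i \<in> {i. v i ~= \<zero>\<^bsub>?B\<^esub>}"
   hence "comp i U \<notin> ZB" using v0 by blast
   then obtain g where g: "g \<in> G" "comp i U g \<notin> K g" by (auto simp: ZB_def)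
   hence "comp i U g ~= 0" using K_closed(1)[OF g(1)] by metis
   thus "i \<in> {i. \<exists>g\<in>G. comp i U g ~= 0}" using g(1) by blast
  qed
  have "U - (\<Sum>i\<in>{i. v i ~= \<zero>\<^bsub>?B\<^esub>}. comp i U) \<in> ZB"
   by (rule comp_sum_eq[OF U(1) fin]) (use v0 in blast)
  hence "Cls U = Cls (\<Sum>i\<in>{i. v i ~= \<zero>\<^bsub>?B\<^esub>}. comp i U)" using Cls_eq_iff by blast
  also have "\<dots> = finsum ?B v {i. v i ~= \<zero>\<^bsub>?B\<^esub>}" by (rule fs[OF fin cV, symmetric]) (simp add: v_def)
  finally have sv: "s = finsum ?B v {i. v i ~= \<zero>\<^bsub>?B\<^esub>}" by (simp add: U(2))
  show ?thesis
  proof (rule ex1I[of _ v], intro conjI allI)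
   show "v i \<in> Cls ` Vi i" for i unfolding v_def using cV by blast
   show "finite {i. v i ~= \<zero>\<^bsub>?B\<^esub>}" by (rule fin)
   show "s = finsum ?B v {i. v i ~= \<zero>\<^bsub>?B\<^esub>}" by (rule sv)
   fix v' assume a: "(\<forall>i. v' i \<in> Cls ` Vi i) \<and> finite {i. v' i ~= \<zero>\<^bsub>?B\<^esub>} \<and> s = finsum ?B v' {i. v' i ~= \<zero>\<^bsub>?B\<^esub>}"
   define A where "A = {i. v' i ~= \<zero>\<^bsub>?B\<^esub>}"
   have A: "finite A" "s = finsum ?B v' A" using a by (auto simp: A_def)
   have "\<forall>i. \<exists>u. u \<in> Vi i \<and> v' i = Cls u" using a by blast
   from choice[OF this] obtain u where u: "\<And>i. u i \<in> Vi i" "\<And>i. v' i = Cls (u i)" by blast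
   have "Cls U = Cls (\<Sum>i\<in>A. u i)" using fs[of A u v', OF A(1) u] A(2) U(2) by simp
   hence Z: "U - (\<Sum>i\<in>A. u i) \<in> ZB" using Cls_eq_iff by blast
   show "v' = v"
   proof
    fix j
    have "(comp j U - (if j \<in> A then u j else 0)) g \<in> K g" if g: "g \<in> G" for g
    proof -
     have "comp j (U - (\<Sum>i\<in>A. u i)) g \<in> K g" using comp_ZB[OF Z, of j] g by (simp add: ZB_def)
     also have "comp j (U - (\<Sum>i\<in>A. u i)) g = comp j U g - (\<Sum>i\<in>A. comp j (u i) g)"
      by (simp add: comp_def sum_fun_apply filt_sum)
     also have "(\<Sum>i\<in>A. comp j (u i) g) = (\<Sum>i\<in>A. if j = i then u i g else 0)"
      by (rule sum.cong) (simp_all add: comp_other[OF u(1) g])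
     also have "\<dots> = (if j \<in> A then u j g else 0)" using A(1) by simp
     finally show ?thesis by (cases "j \<in> A") simp_all
    qed
    hence "comp j U - (if j \<in> A then u j else 0) \<in> ZB" unfolding ZB_def by blast
    hence "Cls (comp j U) = Cls (if j \<in> A then u j else 0)" using Cls_eq_iff by blast
    moreover have "v' j = Cls (if j \<in> A then u j else 0)" using u(2) by (simp add: A_def P.zero)
    ultimately show "v' j = v j" by (simp add: v_def)
   qed
  qed
 qed
 moreover have "VectorSpace.subspace CC (Cls ` Vi i) ?B" for i by (rule P.subspace_subsp[OF subsp_Vp])
 ultimately show ?thesis unfolding internal_direct_sum_def by blast
qed

lemma diamond_B_model: "diamond (int CARD('n) - 2) (B_model (ev fp) G \<xi>) (B_piece (ev fp) q G \<xi> Ix)"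
proof -
 define W where "W = (%p r :: int. (B_model (ev fp) G \<xi>)\<lparr>carrier := B_piece (ev fp) q G \<xi> Ix (of_int p) (of_int r)\<rparr>)"
 have W: "presented (W p r) Cls usc (Vp (of_int p) (of_int r)) ZB" for p r
  using presented_piece[of "of_int p" "of_int r"] by (simp add: W_def)
 have DD: "real_of_int (int CARD('n) - 2) = (real CARD('n) - 2)" by simp
 have DD': "real_of_int (int CARD('n) - 2 - r) = real CARD('n) - 2 - real_of_int r" for r by simp
 have carW: "carrier (W p r) = Cls ` Vi (p, r)" for p r using presented.carrier[OF W] by simp
 have "internal_direct_sum (B_model (ev fp) G \<xi>) (%(p, r). carrier (W p r))"
  using direct_sum by (simp add: carW case_prod_beta')
 moreover have "has_dimension (W p r) 0" if "p < 0 \<or> r < 0 \<or> p > int CARD('n) - 2 \<or> r > int CARD('n) - 2" for p r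
 proof (rule presented.has_dimension_0[OF W], rule Vp_outside)
  show "real_of_int p < 0 \<or> real_of_int r < 0 \<or> (real CARD('n) - 2) < real_of_int p \<or> (real CARD('n) - 2) < real_of_int r"
   using that by linarith
 qed
 moreover have "has_dimension (W 0 0) 1" using dimension_00[of "W 0 0"] W[of 0 0] by simp
 moreover have "has_dimension (W (int CARD('n) - 2) (int CARD('n) - 2)) 1"
  by (rule dimension_DD) (use W[of "int CARD('n) - 2" "int CARD('n) - 2"] in \<open>simp only: DD\<close>)
 moreover have "has_dimension (W (int CARD('n) - 2) 0) 1"
  by (rule dimension_D0) (use W[of "int CARD('n) - 2" 0] in \<open>simp only: DD of_int_0\<close>)
 moreover have "has_dimension (W 0 (int CARD('n) - 2)) 1"
  by (rule dimension_0D) (use W[of 0 "int CARD('n) - 2"] in \<open>simp only: DD of_int_0\<close>)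
 moreover have "isomorphic (W p r) (W r p)" for p r by (rule pieces_swap[OF W W])
 moreover have "isomorphic (W p r) (dual (W (int CARD('n) - 2 - r) (int CARD('n) - 2 - p)))" for p r
  by (rule pieces_dual[OF W]) (use W[of "int CARD('n) - 2 - r" "int CARD('n) - 2 - p"] in \<open>simp only: DD'\<close>)
 ultimately show ?thesis unfolding diamond_def Let_def W_def[symmetric] by blast
qed

end

theorem theorem1p1:
  fixes f :: "complex ^ 'n \<Rightarrow> complex"
    and q :: "'n \<Rightarrow> real"
    and G :: "(complex ^ 'n ^ 'n) set"
    and \<xi> :: "complex ^ 'n ^ 'n \<Rightarrow> 'n ext"
    and I :: "complex ^ 'n ^ 'n \<Rightarrow> 'n set"
  assumes "CARD('n) \<ge> 3"
    and "polynomial_fun f"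
    and "quasihomogeneous_with_weights f q"
    and "isolated_singularity f"
    and "(\<Sum>k\<in>UNIV. q k) = 1"
    and "subgroup G GL" and "finite G"
    and "J_group q \<subseteq> G" and "G \<subseteq> SL_of f"
    and "\<forall>g\<in>G. is_generator g (\<xi> g)"
    and "\<forall>g\<in>G. fixed_indices q g (I g)"
  shows "diamond (int CARD('n) - 2) (B_model f G \<xi>) (B_piece f q G \<xi> I)"
proof -
 obtain fp where f: "f = ev fp" using polynomial_funE[OF assms(2)] by blast
 obtain d0 d where d: "quasihomogeneous f d0 d" "\<And>k. q k = real (d k) / real d0"
  using assms(3) by (auto simp: quasihomogeneous_with_weights_def)
 have q: "q = (%k. real (d k) / real d0)" by (rule ext) (rule d(2))
 have "d0 > 0" using d(1) by (simp add: quasihomogeneous_def)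
 moreover have "(\<Sum>k\<in>UNIV. real (d k)) / real d0 = 1" using assms(5) by (simp add: q sum_divide_distrib)
 ultimately have "real (\<Sum>k\<in>UNIV. d k) = real d0" by simp
 hence cy: "(\<Sum>k\<in>UNIV. d k) = d0" by (simp only: of_nat_eq_iff)
 have "calabi_yau fp d d0" using assms(1,4) d(1) cy by (simp only: calabi_yau_def f simp_thms)
 hence "orbifold fp d d0 G I" using assms(6-9,11) by (simp only: orbifold_def orbifold_axioms_def f q Ball_def simp_thms)
 hence "orbifold_gen fp d d0 G I \<xi>" using assms(10) by (simp only: orbifold_gen_def orbifold_gen_axioms_def Ball_def simp_thms)
 then interpret orbifold_gen fp d d0 G I \<xi> .
 show ?thesis using diamond_B_model by (simp only: f q)
qed

end
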